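(* There exist obstructions to local solvability of the $\bar\partial_w$-equation in the $L^2$-sense for $(0,1)$-forms at singularities of type $D_n$, $n\ge4$, $E_6$, $E_7$ and $E_8$. That is, for each surface $X$ with an isolated singularity at $0$ of one of these types, there is a $(0,1)$-form $\varphi\in\ker\bar\partial_w\subset L^2$ on a neighborhood of $0$ in $X$ such that the equation $\bar\partial_w u=\varphi$ has no solution $u\in L^2$ in any neighborhood of $0$.
   Context: The singularities of type $D_n$ ($n\ge4$), $E_6$, $E_7$, $E_8$ are the du Val (rational double point) surface singularities with these Dynkin diagrams; up to local biholomorphism they are the germs at $0\in\mathbb{C}^3$ of $\{x^2+y^2z+z^{n-1}=0\}$, $\{x^2+y^3+z^4=0\}$, $\{x^2+y^3+yz^3=0\}$, $\{x^2+y^3+z^5=0\}$, respectively. $X_{reg}=X\setminus\{0\}$ carries the Hermitian metric induced from $\mathbb{C}^3$; for $U\subset X$ open, a $(0,r)$-form is in $L^2_{0,r}(U)$ if its restriction to $U\cap X_{reg}$ is $L^2$ with respect to this metric. $\varphi\in L^2_{0,r}(U)$ is in $\mathrm{Dom}\,\bar\partial_w$ iff $\bar\partial\varphi$, in the sense of currents on $U$, is in $L^2_{0,r+1}(U)$; then $\bar\partial_w\varphi=\bar\partial\varphi$. *)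

theory Defs
  imports "HOL-Analysis.Analysis" "HOL-Combinatorics.Permutations"
begin

section \<open>Du Val singularities of type D and E\<close>

datatype du_val = D_type nat | E6_type | E7_type | E8_type

fun du_val_poly :: "du_val \<Rightarrow> complex^3 \<Rightarrow> complex" where
  "du_val_poly (D_type n) v = (v$1)^2 + (v$2)^2 * v$3 + (v$3)^(n - 1)"
| "du_val_poly E6_type v = (v$1)^2 + (v$2)^3 + (v$3)^4"
| "du_val_poly E7_type v = (v$1)^2 + (v$2)^3 + v$2 * (v$3)^3"
| "du_val_poly E8_type v = (v$1)^2 + (v$2)^3 + (v$3)^5"

fun admissible_type :: "du_val \<Rightarrow> bool" where
  "admissible_type (D_type n) \<longleftrightarrow> n \<ge> 4"
| "admissible_type _ \<longleftrightarrow> True"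

definition holomorphic_map :: "(complex^'m \<Rightarrow> complex^'n) \<Rightarrow> (complex^'m) set \<Rightarrow> bool" where
  "holomorphic_map f S \<longleftrightarrow>
    (\<forall>z\<in>S. \<exists>D. (f has_derivative D) (at z) \<and> (\<forall>c v. D (c *s v) = c *s D v))"

text \<open>Isomorphism of the germs at the origin as (reduced) complex spaces: the mutually inverse
  maps between the two sets are restrictions of holomorphic maps of the ambient space, but the
  ambient maps themselves need not be invertible.\<close>

definition germ_biholomorphic :: "(complex^3) set \<Rightarrow> (complex^3) set \<Rightarrow> bool" where
  "germ_biholomorphic A B \<longleftrightarrow>
    (\<exists>U V F G. open U \<and> 0 \<in> U \<and> open V \<and> 0 \<in> V \<and>
       holomorphic_map F U \<and> holomorphic_map G V \<and> F 0 = 0 \<and> G 0 = 0 \<and>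
       F ` (A \<inter> U) = B \<inter> V \<and> G ` (B \<inter> V) = A \<inter> U \<and>
       (\<forall>x\<in>A \<inter> U. G (F x) = x) \<and> (\<forall>y\<in>B \<inter> V. F (G y) = y))"

text \<open>Holomorphic parametrizations (inverse charts) of open pieces of the regular part
  \<open>X - {0}\<close>.\<close>

definition holo_param ::
  "(complex^3) set \<Rightarrow> (complex^2) set \<Rightarrow> (complex^2 \<Rightarrow> complex^3) \<Rightarrow> bool" where
  "holo_param X W p \<longleftrightarrow>
    open W \<and> holomorphic_map p W \<and>
    (\<forall>z\<in>W. inj (frechet_derivative p (at z))) \<and>
    (\<exists>q. homeomorphism W (p ` W) p q) \<and>
    openin (top_of_set (X - {0})) (p ` W)"

text \<open>A surface in \<open>\<complex>\<^sup>3\<close> through the origin that is regular outside the origin. Nothing is demanded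
  at the origin itself; there the structure is prescribed by the type of the singularity.\<close>

definition surface_regular_off_0 :: "(complex^3) set \<Rightarrow> bool" where
  "surface_regular_off_0 X \<longleftrightarrow>
    0 \<in> X \<and> (\<exists>S. open S \<and> closedin (top_of_set S) X) \<and>
    (\<forall>x\<in>X - {0}. \<exists>W p. holo_param X W p \<and> x \<in> p ` W)"

definition has_singularity_of_type :: "(complex^3) set \<Rightarrow> du_val \<Rightarrow> bool" where
  "has_singularity_of_type X T \<longleftrightarrow>
    surface_regular_off_0 X \<and> germ_biholomorphic X {v. du_val_poly T v = 0}"


section \<open>The metric induced on the regular part\<close>

definition tangent :: "(complex^3) set \<Rightarrow> complex^3 \<Rightarrow> (complex^3) set" where
  "tangent X x =
    {v. \<exists>W p z w. holo_param X W p \<and> z \<in> W \<and> p z = x \<and> v = frechet_derivative p (at z) w}"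

definition hprod :: "complex^'n \<Rightarrow> complex^'n \<Rightarrow> complex" where
  "hprod v w = (\<Sum>i\<in>UNIV. v$i * cnj (w$i))"

text \<open>The determinant of the Hermitian Gram matrix is the square root of the determinant of the
  real \<open>4 \<times> 4\<close> Gram matrix, i.e. the Riemannian volume density in the coordinates given by \<open>p\<close>.\<close>

definition volume_density :: "(complex^2 \<Rightarrow> complex^3) \<Rightarrow> complex^2 \<Rightarrow> real" where
  "volume_density p z =
    Re (det ((\<chi> i j. hprod (frechet_derivative p (at z) (axis i 1))
                           (frechet_derivative p (at z) (axis j 1))) :: complex^2^2))"

definition is_volume_measure :: "(complex^3) set \<Rightarrow> (complex^3) measure \<Rightarrow> bool" where
  "is_volume_measure X \<mu> \<longleftrightarrow>
    sets \<mu> = sets borel \<and> emeasure \<mu> (- (X - {0})) = 0 \<and>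
    (\<forall>W p E. holo_param X W p \<longrightarrow> E \<in> sets borel \<longrightarrow> E \<subseteq> W \<longrightarrow>
       emeasure \<mu> (p ` E) = (\<integral>\<^sup>+z\<in>E. ennreal (volume_density p z) \<partial>lborel))"

text \<open>For a surface regular outside the origin there is exactly one such measure.\<close>

definition volume_measure :: "(complex^3) set \<Rightarrow> (complex^3) measure" where
  "volume_measure X = (THE \<mu>. is_volume_measure X \<mu>)"

text \<open>A positively oriented orthonormal real basis \<open>a, ia, b, ib\<close> of the tangent space, where
  \<open>a, b\<close> is a unitary basis. All quantities below are independent of the choice.\<close>

definition unitary_frame :: "(complex^3) set \<Rightarrow> complex^3 \<Rightarrow> (complex^3) list" where
  "unitary_frame X x =
    (SOME e. \<exists>a b. e = [a, \<i> *s a, b, \<i> *s b] \<and> a \<in> tangent X x \<and> b \<in> tangent X x \<and>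
       hprod a a = 1 \<and> hprod b b = 1 \<and> hprod a b = 0)"


section \<open>Differential forms\<close>

text \<open>A \<open>k\<close>-form assigns to a point a complex-valued function on lists of \<open>k\<close> vectors. For a form
  on \<open>X - {0}\<close> only tangent vectors matter, for a form on the ambient space all vectors do.
  Values at lists of any other length are irrelevant.\<close>

type_synonym form = "complex^3 \<Rightarrow> (complex^3) list \<Rightarrow> complex"

text \<open>Alternating real-multilinear functions on the complex subspace \<open>T\<close>, of bidegree \<open>(p,q)\<close>. The
  last clause singles out the \<open>(p,q)\<close>-component among all components of total degree \<open>p + q\<close>, since
  the \<open>(p',q')\<close>-component is multiplied by \<open>c^p' * cnj c^q'\<close>.\<close>

definition form_at :: "(complex^3) set \<Rightarrow> nat \<Rightarrow> nat \<Rightarrow> ((complex^3) list \<Rightarrow> complex) \<Rightarrow> bool" where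
  "form_at T p q \<alpha> \<longleftrightarrow>
    (\<forall>vs. length vs = p + q \<and> set vs \<subseteq> T \<longrightarrow>
       (\<forall>i<p + q. \<forall>v\<in>T. \<forall>w\<in>T. \<alpha> (vs[i := v + w]) = \<alpha> (vs[i := v]) + \<alpha> (vs[i := w])) \<and>
       (\<forall>i<p + q. \<forall>v\<in>T. \<forall>t::real. \<alpha> (vs[i := t *\<^sub>R v]) = t *\<^sub>R \<alpha> (vs[i := v])) \<and>
       (\<forall>i<p + q. \<forall>j<p + q. i \<noteq> j \<and> vs ! i = vs ! j \<longrightarrow> \<alpha> vs = 0) \<and>
       (\<forall>c. \<alpha> (map ((*s) c) vs) = c ^ p * cnj c ^ q * \<alpha> vs))"

definition wedge :: "nat \<Rightarrow> nat \<Rightarrow> form \<Rightarrow> form \<Rightarrow> form" where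
  "wedge k l \<alpha> \<beta> x vs =
    (\<Sum>\<sigma> | \<sigma> permutes {..<k + l}. of_int (sign \<sigma>) *
        \<alpha> x (map (\<lambda>i. vs ! \<sigma> i) [0..<k]) * \<beta> x (map (\<lambda>i. vs ! \<sigma> i) [k..<k + l]))
      / (fact k * fact l)"

text \<open>The conjugate-linear part of the real derivative.\<close>

definition dbar_dir :: "(complex^3 \<Rightarrow> complex) \<Rightarrow> complex^3 \<Rightarrow> complex^3 \<Rightarrow> complex" where
  "dbar_dir f x v =
    (frechet_derivative f (at x) v + \<i> * frechet_derivative f (at x) (\<i> *s v)) / 2"

text \<open>The formula for the exterior derivative of a form with constant vector fields inserted, with
  derivatives replaced by their conjugate-linear parts; this is
  \<open>\<Sum>\<^sub>j d(cnj z\<^sub>j) \<and> \<partial>\<eta>/\<partial>(cnj z\<^sub>j)\<close>.\<close>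

definition dbar :: "form \<Rightarrow> form" where
  "dbar \<eta> x vs =
    (\<Sum>i<length vs. (-1) ^ i *
       dbar_dir (\<lambda>y. \<eta> y (take i vs @ drop (Suc i) vs)) x (vs ! i))"

fun C_k :: "nat \<Rightarrow> (complex^3 \<Rightarrow> complex) \<Rightarrow> bool" where
  "C_k 0 f \<longleftrightarrow> continuous_on UNIV f"
| "C_k (Suc k) f \<longleftrightarrow>
    (\<forall>x. f differentiable (at x)) \<and> (\<forall>v. C_k k (\<lambda>x. frechet_derivative f (at x) v))"

text \<open>Test forms on the open subset \<open>U\<close> of \<open>X\<close>, also across the singular point: restrictions of
  smooth forms on the ambient space whose support on \<open>X\<close> is a compact subset of \<open>U\<close>.\<close>

definition test_form :: "(complex^3) set \<Rightarrow> (complex^3) set \<Rightarrow> nat \<Rightarrow> nat \<Rightarrow> form \<Rightarrow> bool" where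
  "test_form X U p q \<eta> \<longleftrightarrow>
    (\<forall>x. form_at UNIV p q (\<eta> x)) \<and>
    (\<forall>vs. length vs = p + q \<longrightarrow> (\<forall>k. C_k k (\<lambda>x. \<eta> x vs))) \<and>
    (\<exists>K. compact K \<and> K \<subseteq> U \<and> (\<forall>x\<in>X - K. \<forall>vs. length vs = p + q \<longrightarrow> \<eta> x vs = 0))"

definition integral_form :: "(complex^3) set \<Rightarrow> (complex^3) set \<Rightarrow> form \<Rightarrow> complex" where
  "integral_form X U \<omega> =
    set_lebesgue_integral (volume_measure X) (U - {0}) (\<lambda>x. \<omega> x (unitary_frame X x))"


section \<open>The weak \<open>\<partial>\<close>-bar operator in the \<open>L\<^sup>2\<close>-sense\<close>

definition form_norm_sq :: "(complex^3) set \<Rightarrow> nat \<Rightarrow> form \<Rightarrow> complex^3 \<Rightarrow> real" where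
  "form_norm_sq X k \<omega> x =
    (\<Sum>vs | set vs \<subseteq> set (unitary_frame X x) \<and> length vs = k. (cmod (\<omega> x vs))\<^sup>2) / fact k"

text \<open>\<open>L\<^sup>2\<close>-forms of bidegree \<open>(0,r)\<close> on \<open>U\<close>, an open subset of \<open>X\<close>. Coefficients are taken to be Borel
  measurable; every class of forms modulo null sets has such a representative.\<close>

definition L2_form :: "(complex^3) set \<Rightarrow> (complex^3) set \<Rightarrow> nat \<Rightarrow> form \<Rightarrow> bool" where
  "L2_form X U r \<phi> \<longleftrightarrow>
    (\<forall>x\<in>U - {0}. form_at (tangent X x) 0 r (\<phi> x)) \<and>
    (\<forall>W p vs. holo_param X W p \<and> p ` W \<subseteq> U \<and> length vs = r \<longrightarrow>
       (\<lambda>z. \<phi> (p z) (map (frechet_derivative p (at z)) vs))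
         \<in> borel_measurable (restrict_space borel W)) \<and>
    (\<integral>\<^sup>+x\<in>U - {0}. ennreal (form_norm_sq X r \<phi> x) \<partial>volume_measure X) < \<infinity>"

text \<open>\<open>dbar_w X U r \<phi> \<psi>\<close>: the \<open>(0,r)\<close>-form \<open>\<phi>\<close> is in the domain of the weak operator on \<open>U\<close> and is
  mapped to \<open>\<psi>\<close>. The sign is the one given by Stokes' theorem.\<close>

definition dbar_w :: "(complex^3) set \<Rightarrow> (complex^3) set \<Rightarrow> nat \<Rightarrow> form \<Rightarrow> form \<Rightarrow> bool" where
  "dbar_w X U r \<phi> \<psi> \<longleftrightarrow>
    L2_form X U r \<phi> \<and> L2_form X U (r + 1) \<psi> \<and>
    (\<forall>s \<eta>. r + 1 + s = 2 \<and> test_form X U 2 s \<eta> \<longrightarrow>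
       integral_form X U (wedge (r + 1) (2 + s) \<psi> \<eta>) =
         (-1) ^ (r + 1) * integral_form X U (wedge r (2 + s + 1) \<phi> (dbar \<eta>)))"

end

theory Submission
  imports Defs "HOL-Complex_Analysis.Conformal_Mappings"
begin

text \<open>Write the germ as \<open>x\<^sup>2 + g(y, z) = 0\<close> with \<open>g\<close> weighted homogeneous of degree \<open>h\<close> for weights
  \<open>a\<close>, \<open>b\<close> of \<open>y\<close>, \<open>z\<close>; for the types D and E these satisfy \<open>2 a < h\<close> and \<open>2 b < h\<close>. The
  obstruction is \<open>\<phi> = x (a cnj y d(cnj z) - b cnj z d(cnj y)) \<bar>y\<bar>\<^bsup>2(b-1)\<^esup> \<bar>z\<bar>\<^bsup>2(a-1)\<^esup> / (\<bar>y\<bar>\<^bsup>2b\<^esup> + \<bar>z\<bar>\<^bsup>2a\<^esup>)\<^sup>2\<close>,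
  which is \<open>L\<^sup>2\<close> because of these two inequalities. Integrating over the two sheets of the double cover of the \<open>(y, z)\<close>-plane, the
  pairing of \<open>\<phi>\<close> with dbar of a (2,0)-form becomes the integral, against a measure invariant under
  the weighted \<open>\<complex>\<^sup>*\<close>-action, of a derivative along that action; hence it vanishes and \<open>\<phi>\<close> is closed
  also across the singular point.

  If \<open>\<phi> = dbar u\<close>, then \<open>\<phi>\<close> would be orthogonal to every dbar-closed test form of bidegree (2,1).
  Let \<open>S\<close> be the squared norm of the gradient of the equation and \<open>\<Omega>\<close> the holomorphic 2-form given
  by the residue. The form \<open>\<theta>(S) S (dbar S) \<and> \<Omega>\<close> with a bump function \<open>\<theta>\<close> is closed, extends smoothly
  to the ambient space, and its product with \<open>\<phi>\<close> has a density of constant sign, since \<open>S\<close> increases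
  along the weighted action.\<close>

section \<open>Functions of class $C^k$ on open sets\<close>

text \<open>Test forms need not vanish at the singular point, so closedness of \<phi> on the regular
  part does not suffice: a residual contribution at 0 has to be excluded. The measure
  \<open>mw\<close> times Lebesgue measure has critical weighted degree; it diverges at 0, but only
  logarithmically. The factor x of \<phi> clears the denominator 2x that every 2-form acquires on
  the sheets, and what is left of the test form is a smooth function vanishing at 0. One order of
  vanishing makes all integrals converge, and invariance of the measure gives the value 0 without
  any limit at the origin.

  The closed form used for the obstruction must be supported in an arbitrarily small neighbourhood.
  A cutoff in the distance from 0 destroys closedness, a cutoff in \<open>S\<close> does not, since
  dbar S wedged with itself is 0. The two are combined so that the function of \<open>S\<close>
  already vanishes on the part of the surface where the distance cutoff varies.

  Type A germs x^2 + y^2 + z^(n+1) have 2 a = h, and the estimate behind square integrability breaks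
  down there.\<close>

fun Ck_on :: "nat \<Rightarrow> 'a::real_normed_vector set \<Rightarrow> ('a \<Rightarrow> 'b::real_normed_vector) \<Rightarrow> bool" where
  "Ck_on 0 S f \<longleftrightarrow> continuous_on S f"
| "Ck_on (Suc k) S f \<longleftrightarrow>
    (\<forall>x\<in>S. f differentiable (at x)) \<and> (\<forall>v. Ck_on k S (\<lambda>x. frechet_derivative f (at x) v))"

lemma has_derivative_cong_open:
  assumes "open S" "x \<in> S" "\<And>y. y \<in> S \<Longrightarrow> f y = g y"
  shows "(f has_derivative D) (at x) \<longleftrightarrow> (g has_derivative D) (at x)"
  using assms by (metis has_derivative_transform_within_open)

lemma frechet_derivative_cong_open:
  assumes "open S" "x \<in> S" "\<And>y. y \<in> S \<Longrightarrow> f y = g y"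
  shows "frechet_derivative f (at x) = frechet_derivative g (at x)"
  unfolding frechet_derivative_def using has_derivative_cong_open[OF assms] by simp

lemma differentiable_cong_open:
  assumes "open S" "x \<in> S" "\<And>y. y \<in> S \<Longrightarrow> f y = g y"
  shows "f differentiable (at x) \<longleftrightarrow> g differentiable (at x)"
  unfolding differentiable_def using has_derivative_cong_open[OF assms] by simp

lemma frechet_derivative_eqI: "(f has_derivative D) (at x) \<Longrightarrow> frechet_derivative f (at x) = D"
  using frechet_derivative_at by metis

lemma Ck_on_cong:
  assumes "open S" "\<And>y. y \<in> S \<Longrightarrow> f y = g y"
  shows "Ck_on k S f \<longleftrightarrow> Ck_on k S g"
  using assms(2)
proof (induction k arbitrary: f g)
  case 0
  then show ?case by (auto cong: continuous_on_cong)
next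
  case (Suc k)
  have "Ck_on k S (\<lambda>x. frechet_derivative f (at x) v) \<longleftrightarrow> Ck_on k S (\<lambda>x. frechet_derivative g (at x) v)" for v
    using frechet_derivative_cong_open[OF assms(1) _ Suc.prems]
    by (intro Suc.IH) auto
  moreover have "f differentiable (at x) \<longleftrightarrow> g differentiable (at x)" if "x \<in> S" for x
    using differentiable_cong_open[OF assms(1) that Suc.prems] by auto
  ultimately show ?case by auto
qed

lemma Ck_on_SucI:
  assumes "open S" "\<And>x. x \<in> S \<Longrightarrow> (f has_derivative f' x) (at x)" "\<And>v. Ck_on k S (\<lambda>x. f' x v)"
  shows "Ck_on (Suc k) S f"
proof -
  have eq: "frechet_derivative f (at x) v = f' x v" if "x \<in> S" for x v
    using frechet_derivative_eqI[OF assms(2)[OF that]] by simp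
  have "Ck_on k S (\<lambda>x. frechet_derivative f (at x) v)" for v
    using Ck_on_cong[OF assms(1), of "\<lambda>x. frechet_derivative f (at x) v" "\<lambda>x. f' x v"] eq assms(3) by simp
  then show ?thesis using assms(2) by (auto simp: differentiable_def)
qed

lemma Ck_on_has_derivative:
  assumes "Ck_on (Suc k) S f" "x \<in> S"
  shows "(f has_derivative frechet_derivative f (at x)) (at x)"
  using assms by (auto simp: frechet_derivative_works)

lemma Ck_on_Suc_D: "Ck_on (Suc k) S f \<Longrightarrow> Ck_on k S f"
proof (induction k arbitrary: f)
  case 0
  then show ?case
    by (auto intro!: continuous_at_imp_continuous_on differentiable_imp_continuous_within)
next
  case (Suc k)
  then show ?case by auto
qed

lemma Ck_on_le: "Ck_on k S f \<Longrightarrow> j \<le> k \<Longrightarrow> Ck_on j S f"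
  by (induction k) (auto simp del: Ck_on.simps simp: le_Suc_eq dest: Ck_on_Suc_D)

lemma Ck_on_imp_continuous_on: "Ck_on k S f \<Longrightarrow> continuous_on S f"
  using Ck_on_le[of k S f 0] by simp

lemma Ck_on_const: "open S \<Longrightarrow> Ck_on k S (\<lambda>x. c)"
proof (induction k arbitrary: c)
  case (Suc k)
  show ?case
    by (rule Ck_on_SucI[where f'="\<lambda>_ _. 0"]) (auto simp: Suc simp del: Ck_on.simps)
qed auto

lemma Ck_on_bounded_linear_comp:
  assumes "open S" "bounded_linear L" "Ck_on k S f"
  shows "Ck_on k S (\<lambda>x. L (f x))"
  using assms(3)
proof (induction k arbitrary: f)
  case 0
  then show ?case
    using bounded_linear.continuous_on[OF assms(2)] by auto
next
  case (Suc k)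
  show ?case
  proof (rule Ck_on_SucI[OF assms(1), where f'="\<lambda>x v. L (frechet_derivative f (at x) v)"])
    show "((\<lambda>x. L (f x)) has_derivative (\<lambda>v. L (frechet_derivative f (at x) v))) (at x)"
      if "x \<in> S" for x
      using Ck_on_has_derivative[OF Suc.prems that] bounded_linear.has_derivative[OF assms(2)]
      by blast
    show "Ck_on k S (\<lambda>x. L (frechet_derivative f (at x) v))" for v
      using Suc by auto
  qed
qed

lemma Ck_on_id: "open S \<Longrightarrow> Ck_on k S (\<lambda>x. x)"
proof (cases k)
  case (Suc j)
  assume "open S"
  then show ?thesis unfolding Suc
    by (intro Ck_on_SucI[where f'="\<lambda>_ v. v"]) (auto intro: Ck_on_const)
qed auto

lemma Ck_on_add:
  assumes "open S" "Ck_on k S f" "Ck_on k S g"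
  shows "Ck_on k S (\<lambda>x. f x + g x)"
  using assms(2,3)
proof (induction k arbitrary: f g)
  case 0
  then show ?case by (auto intro: continuous_intros)
next
  case (Suc k)
  show ?case
    by (rule Ck_on_SucI[OF assms(1), where f'="\<lambda>x v. frechet_derivative f (at x) v + frechet_derivative g (at x) v"])
       (use Suc in \<open>auto intro!: has_derivative_add simp: frechet_derivative_works\<close>)
qed

lemma Ck_on_bilinear:
  assumes "bounded_bilinear P" "open S" "Ck_on k S f" "Ck_on k S g"
  shows "Ck_on k S (\<lambda>x. P (f x) (g x))"
  using assms(3,4)
proof (induction k arbitrary: f g)
  case 0
  then show ?case using bounded_bilinear.continuous_on[OF assms(1)] by auto
next
  case (Suc k)
  note fg = Ck_on_has_derivative[OF Suc.prems(1)] Ck_on_has_derivative[OF Suc.prems(2)]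
  show ?case
  proof (rule Ck_on_SucI[OF assms(2), where f'="\<lambda>x v. P (f x) (frechet_derivative g (at x) v) + P (frechet_derivative f (at x) v) (g x)"])
    show "((\<lambda>x. P (f x) (g x)) has_derivative (\<lambda>v. P (f x) (frechet_derivative g (at x) v) + P (frechet_derivative f (at x) v) (g x))) (at x)"
      if "x \<in> S" for x
      by (rule bounded_bilinear.FDERIV[OF assms(1) fg(1)[OF that] fg(2)[OF that]])
    show "Ck_on k S (\<lambda>x. P (f x) (frechet_derivative g (at x) v) + P (frechet_derivative f (at x) v) (g x))" for v
      using Suc Ck_on_Suc_D[OF Suc.prems(1)] Ck_on_Suc_D[OF Suc.prems(2)]
      by (intro Ck_on_add assms Suc.IH) auto
  qed
qed

lemmas Ck_on_mult = Ck_on_bilinear[OF bounded_bilinear_mult]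
lemmas Ck_on_scaleR = Ck_on_bilinear[OF bounded_bilinear_scaleR]
lemmas Ck_on_inner = Ck_on_bilinear[OF bounded_bilinear_inner]

lemma Ck_on_sum:
  assumes "open S" "\<And>i. i \<in> I \<Longrightarrow> Ck_on k S (f i)"
  shows "Ck_on k S (\<lambda>x. \<Sum>i\<in>I. f i x)"
  using assms(2) by (induction I rule: infinite_finite_induct) (auto intro!: Ck_on_const Ck_on_add assms(1))

lemma Ck_on_minus: "open S \<Longrightarrow> Ck_on k S f \<Longrightarrow> Ck_on k S (\<lambda>x. - f x)"
  using Ck_on_bounded_linear_comp[OF _ bounded_linear_minus[OF bounded_linear_ident]] by blast

lemma Ck_on_diff: "open S \<Longrightarrow> Ck_on k S f \<Longrightarrow> Ck_on k S g \<Longrightarrow> Ck_on k S (\<lambda>x. f x - g x)"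
  using Ck_on_add[OF _ _ Ck_on_minus, of S k f g] by simp

text \<open>Expanding the derivative of \<open>g\<close> in the basis of the Euclidean space in the
  middle turns the derivative of the composition into a finite sum of products of a coordinate of
  that derivative with a partial derivative of \<open>f\<close> composed with \<open>g\<close>. The
  induction hypothesis applies to the latter factor.\<close>

lemma Ck_on_compose:
  fixes f :: "'b::euclidean_space \<Rightarrow> 'c::real_normed_vector"
  assumes "open S" "Ck_on k T f" "Ck_on k S g" "g ` S \<subseteq> T"
  shows "Ck_on k S (\<lambda>x. f (g x))"
  using assms(2,3)
proof (induction k arbitrary: f)
  case 0
  then show ?case using assms(4) by (auto intro: continuous_on_compose2)
next
  case (Suc k)
  let ?f' = "\<lambda>x v. \<Sum>b\<in>Basis. (frechet_derivative g (at x) v \<bullet> b) *\<^sub>R frechet_derivative f (at (g x)) b"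
  show ?case
  proof (rule Ck_on_SucI[OF assms(1), where f'="?f'"])
    fix x assume x: "x \<in> S"
    then have gx: "g x \<in> T" using assms(4) by auto
    have f: "(f has_derivative frechet_derivative f (at (g x))) (at (g x))"
      using Ck_on_has_derivative[OF Suc.prems(1) gx] .
    have g: "(g has_derivative frechet_derivative g (at x)) (at x)"
      using Ck_on_has_derivative[OF Suc.prems(2) x] .
    have "frechet_derivative f (at (g x)) (frechet_derivative g (at x) v) = ?f' x v" for v
      by (subst euclidean_representation[symmetric, of "frechet_derivative g (at x) v"],
          subst linear_sum[OF has_derivative_linear[OF f]])
         (simp add: linear_cmul[OF has_derivative_linear[OF f]])
    then show "((\<lambda>x. f (g x)) has_derivative ?f' x) (at x)"
      using has_derivative_compose[OF g f] by (simp add: fun_eq_iff)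
  next
    fix v
    show "Ck_on k S (\<lambda>x. ?f' x v)"
      using Suc.prems Ck_on_Suc_D[OF Suc.prems(2)]
      by (intro Ck_on_sum Ck_on_scaleR Suc.IH assms(1) Ck_on_inner Ck_on_const) auto
  qed
qed

lemma Ck_on_inverse_id: "Ck_on k (- {0}) (inverse :: 'a::real_normed_field \<Rightarrow> 'a)"
proof (induction k)
  case 0
  show ?case by (auto intro!: continuous_intros)
next
  case (Suc k)
  show ?case
    by (rule Ck_on_SucI[where f'="\<lambda>x v. - (inverse x * v * inverse x)"])
       (auto intro!: has_derivative_inverse' Ck_on_minus Ck_on_mult Ck_on_const Suc)
qed

lemma Ck_on_inverse:
  fixes f :: "'a::real_normed_vector \<Rightarrow> 'b::{real_normed_field,euclidean_space}"
  assumes "open S" "Ck_on k S f" "\<And>x. x \<in> S \<Longrightarrow> f x \<noteq> 0"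
  shows "Ck_on k S (\<lambda>x. inverse (f x))"
  by (rule Ck_on_compose[OF assms(1) Ck_on_inverse_id assms(2)]) (use assms in auto)

text \<open>Needed to glue a form given by a formula on a neighbourhood of the origin with the zero
  form far away.\<close>

lemma Ck_on_Un:
  assumes "Ck_on k S f" "Ck_on k T f" "open S" "open T"
  shows "Ck_on k (S \<union> T) f"
  using assms(1,2)
  by (induction k arbitrary: f) (auto intro: continuous_on_open_Un assms)

lemma C_k_eq_Ck_on: "C_k k f \<longleftrightarrow> Ck_on k UNIV f"
  by (induction k arbitrary: f) auto

section \<open>A smooth bump function\<close>

text \<open>The powers of 1/t are carried along because the family is then closed under
  differentiation: the derivative is a combination of the members with index m + 1 and m +
  2.\<close>

definition exp_inv :: "nat \<Rightarrow> real \<Rightarrow> real" where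
  "exp_inv m t = (if t > 0 then (1 / t) ^ m * exp (- (1 / t)) else 0)"

text \<open>For t > 0 keep only the term of index m + 2 in the exponential series of 1/t. The
  quadratic bound makes the difference quotient at 0 tend to 0, so that the pieces on both sides of
  0 fit together.\<close>

lemma exp_inv_bound: "\<bar>exp_inv m t\<bar> \<le> fact (m + 2) * t\<^sup>2"
proof (cases "t > 0")
  case True
  have "(1/t) ^ (m+2) /\<^sub>R fact (m+2) \<le> exp (1/t)"
    using sum_le_suminf[OF summable_exp_generic, of "{m+2}" "1/t"] True
    by (simp add: exp_def del: fact_Suc)
  moreover have "c > 0 \<Longrightarrow> x /\<^sub>R c \<le> y \<Longrightarrow> x \<le> c * y" for x y c :: real
    by (simp add: field_simps)
  ultimately have "(1/t) ^ (m+2) \<le> fact (m+2) * exp (1/t)" by (metis fact_gt_zero)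
  then have "(1/t) ^ m * (1/t)\<^sup>2 \<le> fact (m+2) * exp (1/t)"
    by (simp only: power_add)
  moreover have "a * (1/t)\<^sup>2 \<le> b \<Longrightarrow> a \<le> b * t\<^sup>2" for a b :: real
    using True by (simp add: field_simps)
  ultimately have "(1/t) ^ m \<le> fact (m+2) * exp (1/t) * t\<^sup>2" by blast
  then have "(1/t) ^ m * exp (- (1/t)) \<le> fact (m+2) * exp (1/t) * t\<^sup>2 * exp (- (1/t))"
    by (rule mult_right_mono) simp
  also have "\<dots> = fact (m+2) * t\<^sup>2 * (exp (1/t) * exp (- (1/t)))" by (simp only: mult_ac)
  also have "exp (1/t) * exp (- (1/t)) = 1" by (simp flip: exp_add)
  finally have "(1/t) ^ m * exp (- (1/t)) \<le> fact (m+2) * t\<^sup>2" by simp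
  then show ?thesis using True by (simp add: exp_inv_def del: fact_Suc)
qed (auto simp: exp_inv_def)

lemma exp_inv_has_derivative:
  "(exp_inv m has_real_derivative exp_inv (m + 2) t - real m * exp_inv (m + 1) t) (at t)"
proof -
  consider "t > 0" | "t < 0" | "t = 0" by linarith
  then show ?thesis
  proof cases
    case 1
    have inv: "((\<lambda>t. 1 / t) has_real_derivative - ((1 / t)\<^sup>2)) (at t)"
      using 1 by (auto intro!: derivative_eq_intros simp: field_simps power2_eq_square)
    have "((\<lambda>t. exp (- (1 / t))) has_real_derivative exp (- (1 / t)) * (1 / t)\<^sup>2) (at t)"
      using DERIV_fun_exp[OF DERIV_minus[OF inv]] by simp
    note DERIV_mult[OF DERIV_power[OF inv, of m] this]
    moreover have "real m * (- (a\<^sup>2) * a ^ (m - Suc 0)) = - real m * a ^ (m + 1)" for a :: real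
      by (cases m) (auto simp: power2_eq_square algebra_simps)
    ultimately have "((\<lambda>t. (1 / t) ^ m * exp (- (1 / t))) has_real_derivative
        exp_inv (m + 2) t - real m * exp_inv (m + 1) t) (at t)"
      using 1 by (simp only: exp_inv_def if_True power_add) (simp add: algebra_simps)
    then show ?thesis
      by (rule has_field_derivative_transform_within_open[where S="{0<..}"]) (use 1 in \<open>auto simp: exp_inv_def\<close>)
  next
    case 2
    show ?thesis
      by (rule has_field_derivative_transform_within_open[where S="{..<0}" and f="\<lambda>_. 0"])
         (use 2 in \<open>auto simp: exp_inv_def\<close>)
  next
    case 3
    have "((\<lambda>h. fact (m + 2) * \<bar>h\<bar>) \<longlongrightarrow> fact (m + 2) * \<bar>0::real\<bar>) (at 0)"
      by (intro tendsto_intros)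
    then have *: "((\<lambda>h. fact (m + 2) * \<bar>h\<bar>) \<longlongrightarrow> 0) (at (0::real))" by simp
    have "((\<lambda>h. exp_inv m h / h) \<longlongrightarrow> 0) (at 0)"
    proof (rule Lim_null_comparison[OF _ *])
      have "norm (exp_inv m h / h) \<le> fact (m + 2) * \<bar>h\<bar>" if "h \<noteq> 0" for h
        using exp_inv_bound[of m h] that
        by (simp add: abs_divide divide_le_eq power2_eq_square abs_mult[symmetric] mult.assoc del: fact_Suc)
      then show "\<forall>\<^sub>F h in at 0. norm (exp_inv m h / h) \<le> fact (m + 2) * \<bar>h\<bar>"
        by (auto simp: eventually_at_filter)
    qed
    then show ?thesis unfolding 3 by (simp add: DERIV_def exp_inv_def)
  qed
qed

lemma Ck_on_exp_inv: "Ck_on k UNIV (exp_inv m)"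
proof (induction k arbitrary: m)
  case 0
  show ?case
    by (auto intro!: continuous_at_imp_continuous_on DERIV_isCont exp_inv_has_derivative)
next
  case (Suc k)
  show ?case
    by (rule Ck_on_SucI[where f'="\<lambda>t v. (exp_inv (m + 2) t - real m * exp_inv (m + 1) t) * v"])
       (use exp_inv_has_derivative in \<open>auto simp: has_field_derivative_def intro!: Ck_on_mult Ck_on_diff Ck_on_const Suc\<close>)
qed

definition smooth_bump :: "real \<Rightarrow> real \<Rightarrow> real \<Rightarrow> real" where
  "smooth_bump l u t = exp_inv 0 (t - l) * exp_inv 0 (u - t)"

lemma smooth_bump: "smooth_bump l u t \<ge> 0" "l < t \<Longrightarrow> t < u \<Longrightarrow> smooth_bump l u t > 0"
    "t \<notin> {l<..<u} \<Longrightarrow> smooth_bump l u t = 0"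
  by (auto simp: smooth_bump_def exp_inv_def)

lemma Ck_on_smooth_bump: "Ck_on k UNIV (smooth_bump l u)"
  unfolding smooth_bump_def [abs_def]
  by (intro Ck_on_mult Ck_on_compose[OF _ Ck_on_exp_inv] Ck_on_diff Ck_on_const Ck_on_id) auto

text \<open>The denominator is positive since 2 - t and t - 1 are never both nonpositive. The
  argument will be the squared norm over \<rho>^2, so the transition happens for norms between
  \<rho> and 2 \<rho>.\<close>

definition smooth_step :: "real \<Rightarrow> real" where
  "smooth_step t = exp_inv 0 (2 - t) * inverse (exp_inv 0 (2 - t) + exp_inv 0 (t - 1))"

lemma smooth_step: "t \<le> 1 \<Longrightarrow> smooth_step t = 1" "t \<ge> 2 \<Longrightarrow> smooth_step t = 0"
  by (auto simp: smooth_step_def exp_inv_def)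

lemma Ck_on_smooth_step: "Ck_on k UNIV smooth_step"
proof -
  have "exp_inv 0 (2 - t) + exp_inv 0 (t - 1) > 0" for t :: real
    by (cases "t < 2") (auto simp: exp_inv_def add_pos_nonneg)
  then have "exp_inv 0 (2 - t) + exp_inv 0 (t - 1) \<noteq> 0" for t :: real
    by (metis less_irrefl)
  then show ?thesis unfolding smooth_step_def [abs_def]
    by (intro Ck_on_mult Ck_on_inverse Ck_on_add Ck_on_compose[OF _ Ck_on_exp_inv] Ck_on_diff Ck_on_const Ck_on_id) auto
qed

section \<open>Holomorphic maps of several variables\<close>

lemma norm_vector_scalar_mult: "norm (c *s (v :: complex^'n)) = cmod c * norm v"
  by (simp add: norm_vec_def norm_mult L2_set_right_distrib)

lemma vector_scalar_mult_of_real: "complex_of_real t *s (v :: complex^'n) = t *\<^sub>R v"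
  by (auto simp: vec_eq_iff complex_eq_iff)

text \<open>The scalar version of \<open>holomorphic_map\<close>. Components, products and
  directional derivatives are handled in this class and reassembled afterwards.\<close>

definition holo_fun :: "(complex^'m \<Rightarrow> complex) \<Rightarrow> (complex^'m) set \<Rightarrow> bool" where
  "holo_fun f S \<longleftrightarrow> (\<forall>z\<in>S. \<exists>D. (f has_derivative D) (at z) \<and> (\<forall>c v. D (c *s v) = c * D v))"

lemma holo_funD:
  assumes "holo_fun f S" "z \<in> S"
  shows "(f has_derivative frechet_derivative f (at z)) (at z)"
    "frechet_derivative f (at z) (c *s v) = c * frechet_derivative f (at z) v"
  using assms unfolding holo_fun_def by (metis frechet_derivative_eqI)+

lemma holomorphic_mapD:
  assumes "holomorphic_map f S" "z \<in> S"
  shows "(f has_derivative frechet_derivative f (at z)) (at z)"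
    "frechet_derivative f (at z) (c *s v) = c *s frechet_derivative f (at z) v"
  using assms unfolding holomorphic_map_def by (metis frechet_derivative_eqI)+

lemma has_derivative_vec_nth:
  "(f has_derivative D) F \<Longrightarrow> ((\<lambda>z. f z $ i) has_derivative (\<lambda>v. D v $ i)) F"
  by (rule bounded_linear.has_derivative[OF bounded_linear_vec_nth])

lemma has_derivative_vec_iff:
  fixes f :: "'a::real_normed_vector \<Rightarrow> 'b::euclidean_space^'n"
  shows "(f has_derivative D) (at z) \<longleftrightarrow> (\<forall>i. ((\<lambda>z. f z $ i) has_derivative (\<lambda>v. D v $ i)) (at z))"
proof
  assume *: "\<forall>i. ((\<lambda>z. f z $ i) has_derivative (\<lambda>v. D v $ i)) (at z)"
  show "(f has_derivative D) (at z)"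
    unfolding has_derivative_componentwise_within[of f]
  proof
    fix b :: "'b^'n" assume "b \<in> Basis"
    then obtain i u where b: "b = axis i u" by (auto simp: Basis_vec_def)
    show "((\<lambda>x. f x \<bullet> b) has_derivative (\<lambda>x. D x \<bullet> b)) (at z)"
      unfolding b inner_axis using * by (auto intro: has_derivative_inner_left)
  qed
qed (auto intro: has_derivative_vec_nth)

lemma holomorphic_map_nth: "holomorphic_map f S \<Longrightarrow> holo_fun (\<lambda>z. f z $ i) S"
  unfolding holomorphic_map_def holo_fun_def
proof
  fix z assume "\<forall>z\<in>S. \<exists>D. (f has_derivative D) (at z) \<and> (\<forall>c v. D (c *s v) = c *s D v)" "z \<in> S"
  then obtain D where "(f has_derivative D) (at z)" "\<And>c v. D (c *s v) = c *s D v" by blast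
  then show "\<exists>D. ((\<lambda>z. f z $ i) has_derivative D) (at z) \<and> (\<forall>c v. D (c *s v) = c * D v)"
    by (intro exI[of _ "\<lambda>v. D v $ i"]) (simp add: has_derivative_vec_nth)
qed

lemma holomorphic_mapI:
  assumes "\<And>i. holo_fun (\<lambda>z. f z $ i) S"
  shows "holomorphic_map f S"
  unfolding holomorphic_map_def
proof
  fix z assume z: "z \<in> S"
  let ?D = "\<lambda>v. \<chi> i. frechet_derivative (\<lambda>z. f z $ i) (at z) v"
  have "(f has_derivative ?D) (at z)"
    unfolding has_derivative_vec_iff[of f] using holo_funD(1)[OF assms z] by simp
  moreover have "?D (c *s v) = c *s ?D v" for c v
    using holo_funD(2)[OF assms z] by (simp add: vec_eq_iff)
  ultimately show "\<exists>D. (f has_derivative D) (at z) \<and> (\<forall>c v. D (c *s v) = c *s D v)" by blast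
qed

lemma holo_fun_subset: "holo_fun f S \<Longrightarrow> T \<subseteq> S \<Longrightarrow> holo_fun f T"
  by (auto simp: holo_fun_def)

section \<open>Cauchy's formula on complex lines and the regularity of holomorphic functions\<close>

lemma holo_fun_line_has_field_derivative:
  assumes "holo_fun f S" "z + \<zeta> *s v \<in> S"
  shows "((\<lambda>\<zeta>. f (z + \<zeta> *s v)) has_field_derivative frechet_derivative f (at (z + \<zeta> *s v)) v) (at \<zeta>)"
proof -
  have "bounded_linear (\<lambda>\<zeta>. \<zeta> *s v)"
    by (rule bounded_linear_intro[where K="norm v"])
       (auto simp: norm_vector_scalar_mult vec_eq_iff algebra_simps)
  then have "((\<lambda>\<zeta>. z + \<zeta> *s v) has_derivative (\<lambda>\<zeta>. \<zeta> *s v)) (at \<zeta>)"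
    using has_derivative_add[OF has_derivative_const bounded_linear_imp_has_derivative] by fastforce
  from has_derivative_compose[OF this holo_funD(1)[OF assms]]
  have "((\<lambda>\<zeta>. f (z + \<zeta> *s v)) has_derivative (\<lambda>c. c * frechet_derivative f (at (z + \<zeta> *s v)) v)) (at \<zeta>)"
    by (simp only: holo_funD(2)[OF assms])
  moreover have "(\<lambda>c. c * a) = (*) a" for a :: complex by (auto simp: mult.commute)
  ultimately show ?thesis unfolding has_field_derivative_def by simp
qed

text \<open>Cauchy's formula for the first derivative of the one-variable function that maps \<zeta>
  to \<open>f (z + \<zeta> *s v)\<close>. It writes a directional derivative as an average of values
  of \<open>f\<close>, which is the source of all regularity below: differentiability of
  \<open>f\<close> is passed on to its derivative under the integral sign.\<close>

lemma holo_fun_Cauchy: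
  assumes f: "holo_fun f S" and r: "r > 0" and S: "\<And>\<zeta>. cmod \<zeta> \<le> r \<Longrightarrow> z + \<zeta> *s v \<in> S"
  shows "((\<lambda>t. f (z + (r * cis (2 * pi * t)) *s v) * (cis (- (2 * pi * t)) / r)) has_integral
           frechet_derivative f (at z) v) {0..1}"
proof -
  let ?g = "\<lambda>\<zeta>. f (z + \<zeta> *s v)"
  have der: "(?g has_field_derivative frechet_derivative f (at (z + \<zeta> *s v)) v) (at \<zeta>)" if "cmod \<zeta> \<le> r" for \<zeta>
    using holo_fun_line_has_field_derivative[OF f S[OF that]] .
  have "continuous_on (cball 0 r) ?g"
    using der by (auto intro!: continuous_at_imp_continuous_on DERIV_isCont)
  moreover have "?g holomorphic_on ball 0 r"
    using der by (force simp: holomorphic_on_open)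
  ultimately have "((\<lambda>u. ?g u / (u - 0) ^ (Suc 1)) has_contour_integral ((2 * pi * \<i>) / (fact 1) * (deriv ^^ 1) ?g 0))
           (circlepath 0 r)"
    by (intro Cauchy_has_contour_integral_higher_derivative_circlepath) (use r in auto)
  moreover have "deriv ?g 0 = frechet_derivative f (at z) v"
    using DERIV_imp_deriv[OF der[of 0]] r by simp
  ultimately have "((\<lambda>u. ?g u / u\<^sup>2) has_contour_integral (2 * pi * \<i> * frechet_derivative f (at z) v)) (circlepath 0 r)"
    by (simp add: power2_eq_square)
  then have "((\<lambda>t. ?g (r * cis (2*pi*t)) / (r * cis (2*pi*t))\<^sup>2 * (2 * pi * \<i> * r * cis (2*pi*t))) has_integral
      (2 * pi * \<i> * frechet_derivative f (at z) v)) {0..1}"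
    unfolding has_contour_integral vector_derivative_circlepath
    by (rule has_integral_eq[rotated])
       (simp add: circlepath cis_conv_exp mult_ac)
  from has_integral_mult_right[OF this, of "1 / (2 * pi * \<i>)"]
  have "((\<lambda>t. 1 / (2 * pi * \<i>) * (?g (r * cis (2*pi*t)) / (r * cis (2*pi*t))\<^sup>2 * (2 * pi * \<i> * r * cis (2*pi*t)))) has_integral
      frechet_derivative f (at z) v) {0..1}" by simp
  then show ?thesis
    by (rule has_integral_eq[rotated])
       (use r in \<open>auto simp: field_simps power2_eq_square cis_mult\<close>)
qed

lemma holo_fun_deriv_le:
  assumes f: "holo_fun f S" and r: "r > 0" and S: "\<And>\<zeta>. cmod \<zeta> \<le> r \<Longrightarrow> z + \<zeta> *s v \<in> S"
    and M: "\<And>x. x \<in> S \<Longrightarrow> cmod (f x) \<le> M"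
  shows "cmod (frechet_derivative f (at z) v) \<le> M / r"
proof -
  have "norm (frechet_derivative f (at z) v) \<le> M / r * measure lborel (cbox (0::real) 1)"
  proof (rule has_integral_bound)
    show "((\<lambda>t. f (z + (r * cis (2 * pi * t)) *s v) * (cis (- (2 * pi * t)) / r)) has_integral
           frechet_derivative f (at z) v) (cbox 0 1)"
      using holo_fun_Cauchy[OF f r S] by simp
    have "M \<ge> 0" using M[OF S[of 0]] r by (metis less_imp_le norm_ge_zero norm_zero order.trans)
    then show "M / r \<ge> 0" using r by simp
    show "norm (f (z + (r * cis (2 * pi * t)) *s v) * (cis (- (2 * pi * t)) / r)) \<le> M / r" for t
      using M[OF S[of "r * cis (2*pi*t)"]] r by (simp add: norm_mult norm_divide divide_right_mono)
  qed
  then show ?thesis by simp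
qed

lemma linear_bound_of_unit:
  fixes L :: "complex^'m \<Rightarrow> complex"
  assumes "linear L" "r > 0" "\<And>w. norm w = r \<Longrightarrow> cmod (L w) \<le> M"
  shows "cmod (L w) \<le> M / r * norm w"
proof (cases "w = 0")
  case True
  then show ?thesis using linear_0[OF assms(1)] by simp
next
  case False
  have "L w = (norm w / r) *\<^sub>R L ((r / norm w) *\<^sub>R w)"
    using linear_cmul[OF assms(1), of "r / norm w" w] False assms(2) by simp
  then have "cmod (L w) = norm w / r * cmod (L ((r / norm w) *\<^sub>R w))"
    using assms(2) by simp
  also have "\<dots> \<le> norm w / r * M"
    by (intro mult_left_mono assms(3)) (use False assms(2) in auto)
  finally show ?thesis by (simp add: mult.commute)
qed

lemma dist_add_le: "dist z0 (z + u) \<le> dist z0 z + norm (u :: 'a::real_normed_vector)"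
  using dist_triangle[of z0 "z + u" z] by (simp add: dist_norm)

lemma radius_bounds:
  assumes "\<rho> > 0"
  shows "\<rho> / (norm v + 1) > 0" "\<rho> / (norm v + 1) * norm v \<le> \<rho>"
proof -
  have n: "norm v + 1 > 0" by (simp add: add_nonneg_pos)
  then show "\<rho> / (norm v + 1) > 0" using assms by simp
  have "\<rho> / (norm v + 1) * norm v \<le> \<rho> / (norm v + 1) * (norm v + 1)"
    using assms n by (intro mult_left_mono) auto
  then show "\<rho> / (norm v + 1) * norm v \<le> \<rho>" using n by simp
qed

text \<open>If w has norm \<rho>, the unit disc in direction w around a point of the smaller ball
  stays in the ball of radius 2 \<rho>. The Cauchy estimate on it bounds the derivative, and the
  mean value inequality gives the Lipschitz bound.\<close>

lemma holo_fun_local_bounds: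
  assumes f: "holo_fun f S" and S: "open S" "z0 \<in> S"
  obtains \<rho> M where "\<rho> > 0" "M \<ge> 0" "cball z0 (2 * \<rho>) \<subseteq> S"
    "\<And>z w. z \<in> cball z0 \<rho> \<Longrightarrow> cmod (frechet_derivative f (at z) w) \<le> M * norm w"
    "\<And>x y. x \<in> cball z0 \<rho> \<Longrightarrow> y \<in> cball z0 \<rho> \<Longrightarrow> cmod (f x - f y) \<le> M * norm (x - y)"
proof -
  obtain e where e: "e > 0" "cball z0 e \<subseteq> S" using S open_contains_cball by blast
  define \<rho> where "\<rho> = e / 2"
  have \<rho>: "\<rho> > 0" "cball z0 (2 * \<rho>) \<subseteq> S" using e by (auto simp: \<rho>_def)
  have f': "holo_fun f (cball z0 (2 * \<rho>))" using f \<rho>(2) holo_fun_subset by blast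
  have "continuous_on (cball z0 (2 * \<rho>)) f"
    using holo_funD(1)[OF f'] by (auto intro!: continuous_at_imp_continuous_on has_derivative_continuous)
  then have "bounded (f ` cball z0 (2 * \<rho>))"
    by (intro compact_imp_bounded compact_continuous_image) auto
  then obtain B where B: "B > 0" "\<And>x. x \<in> cball z0 (2 * \<rho>) \<Longrightarrow> cmod (f x) \<le> B"
    unfolding bounded_pos by auto
  have D: "cmod (frechet_derivative f (at z) w) \<le> B / \<rho> * norm w" if z: "z \<in> cball z0 \<rho>" for z w
  proof (rule linear_bound_of_unit)
    have zS: "z \<in> S" using z \<rho> by auto
    show "linear (frechet_derivative f (at z))"
      using holo_funD(1)[OF f zS] has_derivative_linear by blast
    fix w :: "complex^'a" assume w: "norm w = \<rho>"
    have "cmod (frechet_derivative f (at z) w) \<le> B / 1"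
    proof (rule holo_fun_deriv_le[OF f'])
      fix \<zeta> :: complex assume "cmod \<zeta> \<le> 1"
      then have "norm (\<zeta> *s w) \<le> \<rho>" using \<rho> w by (simp add: norm_vector_scalar_mult mult_left_le_one_le)
      moreover have "dist z0 (z + \<zeta> *s w) \<le> dist z0 z + norm (\<zeta> *s w)"
        by (rule dist_add_le)
      ultimately show "z + \<zeta> *s w \<in> cball z0 (2 * \<rho>)" using z by auto
    qed (use B in auto)
    then show "cmod (frechet_derivative f (at z) w) \<le> B" by simp
  qed (use \<rho> in auto)
  show ?thesis
  proof (rule that[of \<rho> "B / \<rho>"])
    fix x y assume xy: "x \<in> cball z0 \<rho>" "y \<in> cball z0 \<rho>"
    show "cmod (f x - f y) \<le> B / \<rho> * norm (x - y)"
    proof (rule differentiable_bound[OF convex_cball _ _ xy])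
      fix z assume z: "z \<in> cball z0 \<rho>"
      then have "z \<in> S" using \<rho> by auto
      then show "(f has_derivative frechet_derivative f (at z)) (at z within cball z0 \<rho>)"
        using holo_funD(1)[OF f] has_derivative_at_withinI by blast
      show "onorm (frechet_derivative f (at z)) \<le> B / \<rho>"
        by (rule onorm_le) (use D z in auto)
    qed
  qed (use \<rho> B D in auto)
qed

lemma holo_fun_continuous_on: "holo_fun f S \<Longrightarrow> continuous_on S f"
  by (auto intro!: continuous_at_imp_continuous_on has_derivative_continuous dest: holo_funD(1))

text \<open>The difference of the Cauchy integrals at two nearby points is controlled by the
  Lipschitz bound for \<open>f\<close> itself, so the derivative is locally Lipschitz.\<close>

lemma holo_fun_deriv_continuous_on:
  assumes f: "holo_fun f S" and S: "open S"
  shows "continuous_on S (\<lambda>z. frechet_derivative f (at z) v)"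
proof (rule continuous_at_imp_continuous_on, rule ballI)
  fix z0 assume z0: "z0 \<in> S"
  obtain \<rho> M where \<rho>: "\<rho> > 0" "M \<ge> 0" "cball z0 (2 * \<rho>) \<subseteq> S" and
    lip: "\<And>x y. x \<in> cball z0 \<rho> \<Longrightarrow> y \<in> cball z0 \<rho> \<Longrightarrow> cmod (f x - f y) \<le> M * norm (x - y)"
    using holo_fun_local_bounds[OF f S z0] by metis
  define r where "r = \<rho> / 2 / (norm v + 1)"
  have r: "r > 0" "r * norm v \<le> \<rho> / 2"
    using radius_bounds[of "\<rho> / 2" v] \<rho> unfolding r_def by auto
  have in_ball: "z + \<zeta> *s v \<in> cball z0 \<rho>" if "z \<in> cball z0 (\<rho>/2)" "cmod \<zeta> \<le> r" for z \<zeta>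
  proof -
    have "norm (\<zeta> *s v) \<le> \<rho>/2" using that r mult_right_mono[OF that(2), of "norm v"]
      by (simp add: norm_vector_scalar_mult)
    moreover have "dist z0 (z + \<zeta> *s v) \<le> dist z0 z + norm (\<zeta> *s v)"
      by (rule dist_add_le)
    ultimately show ?thesis using that by auto
  qed
  have inS: "z + \<zeta> *s v \<in> S" if "z \<in> cball z0 (\<rho>/2)" "cmod \<zeta> \<le> r" for z \<zeta>
    using in_ball[OF that] \<rho> by auto
  have bd: "cmod (frechet_derivative f (at z) v - frechet_derivative f (at z') v) \<le> M / r * dist z z'"
    if z: "z \<in> cball z0 (\<rho>/2)" "z' \<in> cball z0 (\<rho>/2)" for z z'
  proof -
    note I = has_integral_diff[OF holo_fun_Cauchy[OF f r(1) inS[OF z(1)]] holo_fun_Cauchy[OF f r(1) inS[OF z(2)]]]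
    have "cmod (frechet_derivative f (at z) v - frechet_derivative f (at z') v) \<le> M / r * dist z z' * measure lborel (cbox (0::real) 1)"
    proof (rule has_integral_bound)
      fix t :: real
      let ?c = "r * cis (2 * pi * t)"
      have "cmod (f (z + ?c *s v) - f (z' + ?c *s v)) \<le> M * norm ((z + ?c *s v) - (z' + ?c *s v))"
        using r by (intro lip in_ball z) (auto simp: norm_mult)
      also have "\<dots> = M * dist z z'" by (simp add: dist_norm)
      finally have "cmod (f (z + ?c *s v) - f (z' + ?c *s v)) / r \<le> M * dist z z' / r"
        using r by (intro divide_right_mono) auto
      then show "norm (f (z + ?c *s v) * (cis (- (2 * pi * t)) / r) - f (z' + ?c *s v) * (cis (- (2 * pi * t)) / r))
          \<le> M / r * dist z z'"
        unfolding left_diff_distrib[symmetric] norm_mult using r by (simp add: norm_divide)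
    qed (use I \<rho> r in auto)
    then show ?thesis by simp
  qed
  have "(M / r)-lipschitz_on (cball z0 (\<rho>/2)) (\<lambda>z. frechet_derivative f (at z) v)"
    by (rule lipschitz_onI) (use bd \<rho> r in \<open>auto simp: dist_norm\<close>)
  then have "continuous_on (cball z0 (\<rho>/2)) (\<lambda>z. frechet_derivative f (at z) v)"
    by (rule lipschitz_on_continuous_on)
  then show "isCont (\<lambda>z. frechet_derivative f (at z) v) z0"
    by (rule continuous_on_interior) (use \<rho> in auto)
qed

text \<open>The Cauchy integral is differentiated under the integral sign; continuity of the first
  derivatives justifies this. The derivative is complex-linear because every integrand is.\<close>

lemma holo_fun_deriv:
  assumes f: "holo_fun f S" and S: "open S"
  shows "holo_fun (\<lambda>z. frechet_derivative f (at z) v) S"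
  unfolding holo_fun_def
proof
  fix z0 assume z0: "z0 \<in> S"
  obtain \<rho> where \<rho>: "\<rho> > 0" "cball z0 (2 * \<rho>) \<subseteq> S"
    using holo_fun_local_bounds[OF f S z0] by metis
  define r where "r = \<rho> / (norm v + 1)"
  have r: "r > 0" "r * norm v \<le> \<rho>"
    using radius_bounds[of "\<rho>" v] \<rho> unfolding r_def by auto
  have inS: "z + \<zeta> *s v \<in> S" if "z \<in> ball z0 \<rho>" "cmod \<zeta> \<le> r" for z \<zeta>
  proof -
    have "norm (\<zeta> *s v) \<le> \<rho>" using that r mult_right_mono[OF that(2), of "norm v"]
      by (simp add: norm_vector_scalar_mult)
    moreover have "dist z0 (z + \<zeta> *s v) \<le> dist z0 z + norm (\<zeta> *s v)"
      by (rule dist_add_le)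
    ultimately have "z + \<zeta> *s v \<in> cball z0 (2 * \<rho>)" using that by auto
    then show ?thesis using \<rho>(2) by blast
  qed
  let ?p = "\<lambda>z (t::real). z + (r * cis (2 * pi * t)) *s v" and ?c = "\<lambda>t::real. cis (- (2 * pi * t)) / r"
  have pS: "?p z t \<in> S" if "z \<in> ball z0 \<rho>" for z t
    using inS[OF that] r by (auto simp: norm_mult)
  let ?F = "\<lambda>z t. f (?p z t) * ?c t"
  let ?f' = "\<lambda>z t w. frechet_derivative f (at (?p z t)) w * ?c t"
  have der: "((\<lambda>z. ?F z t) has_derivative ?f' z t) (at z)" if "z \<in> ball z0 \<rho>" for z t
  proof (rule has_derivative_mult_left)
    have "((\<lambda>z. ?p z t) has_derivative (\<lambda>w. w)) (at z)"
      by (auto intro!: derivative_eq_intros)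
    from has_derivative_compose[OF this holo_funD(1)[OF f pS[OF that]]]
    show "((\<lambda>z. f (?p z t)) has_derivative frechet_derivative f (at (?p z t))) (at z)" by simp
  qed
  have bl: "bounded_linear (?f' z t)" if "z \<in> ball z0 \<rho>" for z t
    using der[OF that] has_derivative_bounded_linear by blast
  have contp: "continuous_on (ball z0 \<rho> \<times> cbox 0 1) (\<lambda>zt. ?p (fst zt) (snd zt))"
  proof -
    have scal: "continuous_on T (\<lambda>x. c x *s v)" if "continuous_on T c" for T and c :: "((complex^'a) \<times> real) \<Rightarrow> complex"
      unfolding vector_scalar_mult_def using that by (intro continuous_intros)
    show ?thesis by (intro continuous_intros scal)
  qed
  \<comment> \<open>The Leibniz rule is applied with derivatives as bounded linear maps; continuity
    of this family is checked on one vector at a time.\<close>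
  have *: "((\<lambda>z. integral (cbox 0 1) (?F z)) has_derivative blinfun_apply (integral (cbox 0 1) (\<lambda>t. Blinfun (?f' z0 t))))
      (at z0 within ball z0 \<rho>)"
  proof (rule leibniz_rule)
    show "((\<lambda>z. ?F z t) has_derivative blinfun_apply (Blinfun (?f' z t))) (at z within ball z0 \<rho>)"
      if "z \<in> ball z0 \<rho>" for z t
      unfolding bounded_linear_Blinfun_apply[OF bl[OF that]]
      by (rule has_derivative_at_withinI[OF der[OF that]])
    show "?F z integrable_on cbox 0 1" if "z \<in> ball z0 \<rho>" for z
      using has_integral_integrable[OF holo_fun_Cauchy[OF f r(1) inS[OF that]]] by simp
    show "continuous_on (ball z0 \<rho> \<times> cbox 0 1) (\<lambda>(z, t). Blinfun (?f' z t))"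
    proof (rule continuous_on_blinfun_componentwise)
      fix w :: "complex^'a"
      have "continuous_on (ball z0 \<rho> \<times> cbox 0 1) (\<lambda>zt. ?f' (fst zt) (snd zt) w)"
        by (intro continuous_intros continuous_on_compose2[OF holo_fun_deriv_continuous_on[OF f S] contp])
           (use pS r in auto)
      then show "continuous_on (ball z0 \<rho> \<times> cbox 0 1) (\<lambda>x. blinfun_apply (case x of (z, t) \<Rightarrow> Blinfun (?f' z t)) w)"
      proof (rule continuous_on_eq)
        fix x :: "(complex^'a) \<times> real" assume "x \<in> ball z0 \<rho> \<times> cbox 0 1"
        then have "fst x \<in> ball z0 \<rho>" by auto
        then show "?f' (fst x) (snd x) w = blinfun_apply (case x of (z, t) \<Rightarrow> Blinfun (?f' z t)) w"
          by (simp only: split_beta bounded_linear_Blinfun_apply[OF bl])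
      qed
    qed
  qed (use \<rho> in auto)
  have z0b: "z0 \<in> ball z0 \<rho>" using \<rho> by simp
  from * have *: "((\<lambda>z. integral (cbox 0 1) (?F z)) has_derivative blinfun_apply (integral (cbox 0 1) (\<lambda>t. Blinfun (?f' z0 t)))) (at z0)"
    by (simp only: at_within_open[OF z0b open_ball])
  let ?D = "blinfun_apply (integral (cbox 0 1) (\<lambda>t. Blinfun (?f' z0 t)))"
  have 1: "((\<lambda>z. frechet_derivative f (at z) v) has_derivative ?D) (at z0)"
    by (rule has_derivative_transform_within_open[OF * open_ball z0b])
       (simp only: integral_unique[OF holo_fun_Cauchy[OF f r(1) inS]] cbox_interval)
  have int: "(\<lambda>t. Blinfun (?f' z0 t)) integrable_on (cbox 0 1)"
  proof (rule integrable_continuous, rule continuous_on_blinfun_componentwise)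
    fix w :: "complex^'a"
    have "continuous_on (cbox 0 1) (\<lambda>t. ?f' z0 t w)"
      by (intro continuous_intros continuous_on_compose2[OF holo_fun_deriv_continuous_on[OF f S]]
            continuous_on_compose2[OF contp, of _ "\<lambda>t. (z0, t)", simplified])
         (use pS r \<rho> in auto)
    then show "continuous_on (cbox 0 1) (\<lambda>x. blinfun_apply (Blinfun (?f' z0 x)) w)"
      by (simp only: bounded_linear_Blinfun_apply[OF bl[OF z0b]])
  qed
  have 2: "?D w = integral (cbox 0 1) (\<lambda>t. ?f' z0 t w)" for w
    unfolding blinfun_apply_integral[OF int] bounded_linear_Blinfun_apply[OF bl[OF z0b]] ..
  have "?D (c *s w) = c * ?D w" for c w
  proof -
    have "?D (c *s w) = integral (cbox 0 1) (\<lambda>t. c * ?f' z0 t w)"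
      by (simp only: 2 holo_funD(2)[OF f pS[OF z0b]] mult.assoc[of c])
    then show ?thesis by (simp only: 2 integral_mult_right)
  qed
  with 1 show "\<exists>D. ((\<lambda>z. frechet_derivative f (at z) v) has_derivative D) (at z0) \<and> (\<forall>c v. D (c *s v) = c * D v)"
    by blast
qed

lemma holo_fun_Ck_on: "open S \<Longrightarrow> holo_fun f S \<Longrightarrow> Ck_on k S f"
proof (induction k arbitrary: f)
  case 0
  then show ?case by (simp add: holo_fun_continuous_on)
next
  case (Suc k)
  then show ?case
    by (auto simp: differentiable_def intro!: Suc.IH holo_fun_deriv dest: holo_funD(1))
qed

lemma holomorphic_map_deriv:
  assumes "holomorphic_map f S" "open S"
  shows "holomorphic_map (\<lambda>z. frechet_derivative f (at z) v) S"
proof (rule holomorphic_mapI)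
  fix i
  have eq: "frechet_derivative f (at z) v $ i = frechet_derivative (\<lambda>z. f z $ i) (at z) v" if "z \<in> S" for z
    using frechet_derivative_eqI[OF has_derivative_vec_nth[OF holomorphic_mapD(1)[OF assms(1) that]], of i] by simp
  show "holo_fun (\<lambda>z. frechet_derivative f (at z) v $ i) S"
    using holo_fun_deriv[OF holomorphic_map_nth[OF assms(1)] assms(2), of i v] has_derivative_cong_open[OF assms(2) _ eq]
    unfolding holo_fun_def by simp
qed

lemma continuous_on_vec_iff:
  "continuous_on S f \<longleftrightarrow> (\<forall>i. continuous_on S (\<lambda>z. f z $ i))"
  using continuous_on_vec_lambda[of S "\<lambda>i z. f z $ i"] by (auto intro: continuous_on_component)

lemma holomorphic_map_continuous_on: "holomorphic_map f S \<Longrightarrow> continuous_on S f"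
  using holomorphic_map_nth holo_fun_continuous_on continuous_on_vec_iff by blast

lemma holo_fun_compose:
  assumes "holo_fun f T" "holomorphic_map g S" "g ` S \<subseteq> T"
  shows "holo_fun (\<lambda>z. f (g z)) S"
  unfolding holo_fun_def
proof
  fix z assume z: "z \<in> S"
  then have "g z \<in> T" using assms by auto
  then show "\<exists>D. ((\<lambda>z. f (g z)) has_derivative D) (at z) \<and> (\<forall>c v. D (c *s v) = c * D v)"
    using has_derivative_compose[OF holomorphic_mapD(1)[OF assms(2) z] holo_funD(1)[OF assms(1)]]
      holo_funD(2)[OF assms(1)] holomorphic_mapD(2)[OF assms(2) z] by metis
qed

lemma holomorphic_map_compose:
  assumes "holomorphic_map f T" "holomorphic_map g S" "g ` S \<subseteq> T"
  shows "holomorphic_map (\<lambda>z. f (g z)) S"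
  using holo_fun_compose[OF holomorphic_map_nth[OF assms(1)] assms(2,3)] by (intro holomorphic_mapI)

lemma holomorphic_map_chain:
  assumes "holomorphic_map f T" "holomorphic_map g S" "z \<in> S" "g z \<in> T"
  shows "frechet_derivative (\<lambda>z. f (g z)) (at z) v = frechet_derivative f (at (g z)) (frechet_derivative g (at z) v)"
  using frechet_derivative_eqI[OF has_derivative_compose[OF holomorphic_mapD(1)[OF assms(2,3)] holomorphic_mapD(1)[OF assms(1,4)]]]
  by simp

lemma holomorphic_map_subset: "holomorphic_map f S \<Longrightarrow> T \<subseteq> S \<Longrightarrow> holomorphic_map f T"
  by (auto simp: holomorphic_map_def)

section \<open>Lebesgue measure on $\mathbb{C}^2$\<close>

lemma prod_Basis_vec:
  "(\<Prod>b\<in>(Basis::('a::euclidean_space^'n) set). F b) = (\<Prod>i\<in>UNIV. \<Prod>u\<in>Basis. F (axis i u))"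
proof -
  have "bij_betw (\<lambda>(i, u). axis i u) (UNIV \<times> Basis) (Basis :: ('a^'n) set)"
    by (auto simp: bij_betw_def inj_on_def Basis_vec_def axis_eq_axis)
  then have "(\<Prod>b\<in>(Basis::('a::euclidean_space^'n) set). F b) = (\<Prod>(i, u)\<in>UNIV \<times> Basis. F (axis i u))"
    by (subst prod.reindex_bij_betw[symmetric]) (auto intro!: prod.cong)
  then show ?thesis by (simp add: prod.cartesian_product)
qed

text \<open>The change of variables formula used below concerns \<open>real^4\<close>; these
  mutually inverse maps carry it to \<open>complex^2\<close>.\<close>

definition of_real4 :: "real^4 \<Rightarrow> complex^2" where
  "of_real4 u = vector [Complex (u$1) (u$2), Complex (u$3) (u$4)]"

definition to_real4 :: "complex^2 \<Rightarrow> real^4" where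
  "to_real4 v = vector [Re (v$1), Im (v$1), Re (v$2), Im (v$2)]"

lemma to_real4_nth [simp]: "to_real4 v $ 1 = Re (v$1)" "to_real4 v $ 2 = Im (v$1)"
  "to_real4 v $ 3 = Re (v$2)" "to_real4 v $ 4 = Im (v$2)"
  by (simp_all add: to_real4_def vector_def)

lemma of_real4_nth [simp]: "of_real4 u $ 1 = Complex (u$1) (u$2)" "of_real4 u $ 2 = Complex (u$3) (u$4)"
  by (simp_all add: of_real4_def)

lemma of_real4_to_real4 [simp]: "of_real4 (to_real4 v) = v" "to_real4 (of_real4 u) = u"
  by (auto simp: vec_eq_iff forall_2 forall_4)

lemma bounded_linear_real4: "bounded_linear of_real4" "bounded_linear to_real4"
  by (auto intro!: linear_linear[THEN iffD2] linearI
      simp: linear_conv_bounded_linear[symmetric] vec_eq_iff forall_2 forall_4 complex_eq_iff)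

lemma measurable_real4 [measurable]: "of_real4 \<in> borel \<rightarrow>\<^sub>M borel" "to_real4 \<in> borel \<rightarrow>\<^sub>M borel"
  using bounded_linear_real4 by (auto intro!: borel_measurable_continuous_onI linear_continuous_on)

lemma mem_box_vec: "v \<in> box l u \<longleftrightarrow> (\<forall>i b. b \<in> Basis \<longrightarrow> l$i \<bullet> b < v$i \<bullet> b \<and> v$i \<bullet> b < u$i \<bullet> b)"
  for v :: "'a::euclidean_space^'n"
  by (auto simp: box_def Basis_vec_def inner_axis)

lemma lborel_of_real4: "distr lborel borel of_real4 = lborel"
proof (rule lborel_eqI[symmetric])
  fix l u :: "complex^2" assume le: "\<And>b. b \<in> Basis \<Longrightarrow> l \<bullet> b \<le> u \<bullet> b"
  have le': "Re (l$i) \<le> Re (u$i)" "Im (l$i) \<le> Im (u$i)" for i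
    using le[of "axis i 1"] le[of "axis i \<i>"] by (auto simp: Basis_vec_def inner_axis Basis_complex_def inner_complex_def)
  have "of_real4 -` box l u = box (to_real4 l) (to_real4 u)"
    by (auto simp: mem_box_vec forall_4 forall_2 Basis_complex_def inner_complex_def)
  then have "emeasure (distr lborel borel of_real4) (box l u) = emeasure lborel (box (to_real4 l) (to_real4 u))"
    by (simp add: emeasure_distr)
  also have "\<dots> = ennreal (\<Prod>b\<in>Basis. (to_real4 u - to_real4 l) \<bullet> b)"
  proof (rule emeasure_lborel_box)
    show "to_real4 l \<bullet> b \<le> to_real4 u \<bullet> b" if "b \<in> Basis" for b
    proof -
    have "\<forall>i. to_real4 l $ i \<le> to_real4 u $ i"
      unfolding forall_4 using le' by simp
    then show ?thesis using that by (auto simp: Basis_vec_def inner_axis)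
  qed
  qed
  also have "(\<Prod>b\<in>Basis. (to_real4 u - to_real4 l) \<bullet> b) = (\<Prod>b\<in>Basis. (u - l) \<bullet> b)"
    unfolding prod_Basis_vec UNIV_4 UNIV_2 Basis_complex_def inner_axis
    by (simp add: inner_complex_def)
  finally show "emeasure (distr lborel borel of_real4) (box l u) = ennreal (\<Prod>b\<in>Basis. (u - l) \<bullet> b)" .
qed auto

definition cdet :: "(complex^2 \<Rightarrow> complex^2) \<Rightarrow> complex" where
  "cdet L = L (axis 1 1) $ 1 * L (axis 2 1) $ 2 - L (axis 1 1) $ 2 * L (axis 2 1) $ 1"

lemma det_4:
  "det (A :: real^4^4) =
    A$1$1 * (A$2$2 * (A$3$3 * A$4$4 - A$3$4 * A$4$3) - A$2$3 * (A$3$2 * A$4$4 - A$3$4 * A$4$2) + A$2$4 * (A$3$2 * A$4$3 - A$3$3 * A$4$2))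
  - A$1$2 * (A$2$1 * (A$3$3 * A$4$4 - A$3$4 * A$4$3) - A$2$3 * (A$3$1 * A$4$4 - A$3$4 * A$4$1) + A$2$4 * (A$3$1 * A$4$3 - A$3$3 * A$4$1))
  + A$1$3 * (A$2$1 * (A$3$2 * A$4$4 - A$3$4 * A$4$2) - A$2$2 * (A$3$1 * A$4$4 - A$3$4 * A$4$1) + A$2$4 * (A$3$1 * A$4$2 - A$3$2 * A$4$1))
  - A$1$4 * (A$2$1 * (A$3$2 * A$4$3 - A$3$3 * A$4$2) - A$2$2 * (A$3$1 * A$4$3 - A$3$3 * A$4$1) + A$2$3 * (A$3$1 * A$4$2 - A$3$2 * A$4$1))"
proof -
  have f1: "finite {2::4, 3, 4}" "1 \<notin> {2::4, 3, 4}"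
    and f2: "finite {3::4, 4}" "2 \<notin> {3::4, 4}"
    and f3: "finite {4::4}" "3 \<notin> {4::4}" by auto
  show ?thesis
    unfolding det_def UNIV_4
    unfolding sum_over_permutations_insert[OF f1] sum_over_permutations_insert[OF f2] sum_over_permutations_insert[OF f3]
    unfolding permutes_sing
    by (simp add: sign_swap_id permutation_swap_id permutation_compose sign_compose sign_id) algebra
qed

text \<open>The real Jacobian of a complex-linear map is the squared modulus of its complex
  determinant: the columns for the imaginary directions are \<i> times the others.\<close>

lemma det_complex_linear:
  assumes "linear L" "\<And>c v. L (c *s v) = c *s L v"
  shows "det (matrix (\<lambda>x. to_real4 (L (of_real4 x)))) = (cmod (cdet L))\<^sup>2"
proof -
  have 1: "of_real4 (axis 1 1) = axis 1 1" "of_real4 (axis 2 1) = \<i> *s axis 1 1"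
    "of_real4 (axis 3 1) = axis 2 1" "of_real4 (axis 4 1) = \<i> *s axis 2 1"
    by (auto simp: vec_eq_iff forall_2 complex_eq_iff axis_def)
  show ?thesis
    unfolding det_4 cdet_def cmod_power2
    by (simp add: matrix_def 1 assms(2)) (simp add: algebra_simps power2_eq_square)
qed

text \<open>\<open>J\<close> has to represent the Jacobian on \<open>E\<close> only. This lets the
  caller prove its measurability in another way than through the derivative of \<tau>.\<close>

theorem emeasure_holomorphic_image:
  fixes \<tau> :: "complex^2 \<Rightarrow> complex^2"
  assumes E [measurable]: "E \<in> sets borel" "\<tau> ` E \<in> sets borel"
    and \<tau>: "\<And>z. z \<in> E \<Longrightarrow> (\<tau> has_derivative D z) (at z)" "inj_on \<tau> E"
    and lin: "\<And>z c v. z \<in> E \<Longrightarrow> D z (c *s v) = c *s D z v"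
    and J: "\<And>z. z \<in> E \<Longrightarrow> J z = (cmod (cdet (D z)))\<^sup>2" "(\<lambda>z. indicator E z * J z) \<in> borel_measurable borel"
  shows "emeasure lborel (\<tau> ` E) = (\<integral>\<^sup>+z\<in>E. ennreal (J z) \<partial>lborel)"
proof -
  define S where "S = of_real4 -` E"
  define g where "g = (\<lambda>x. to_real4 (\<tau> (of_real4 x)))"
  define h where "h = (\<lambda>x. indicator E (of_real4 x) * J (of_real4 x))"
  have [measurable]: "S \<in> sets borel" unfolding S_def using measurable_sets[OF measurable_real4(1) E(1)] by simp
  have h [measurable]: "h \<in> borel_measurable borel"
    unfolding h_def using measurable_compose[OF measurable_real4(1) J(2)] .
  have J0: "J z \<ge> 0" if "z \<in> E" for z using J(1)[OF that] by simp
  have h0: "h x \<ge> 0" for x using J0 by (auto simp: h_def indicator_def)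
  have gS: "g ` S = of_real4 -` (\<tau> ` E)"
  proof (intro equalityI subsetI)
    fix x assume "x \<in> of_real4 -` (\<tau> ` E)"
    then obtain z where z: "z \<in> E" "of_real4 x = \<tau> z" by auto
    then have "x = g (to_real4 z)" by (simp add: g_def) (metis of_real4_to_real4(2))
    then show "x \<in> g ` S" using z by (auto simp: S_def)
  qed (auto simp: g_def S_def)
  have gSm [measurable]: "g ` S \<in> sets borel" unfolding gS using measurable_sets[OF measurable_real4(1) E(2)] by simp
  have img: "emeasure lborel (\<tau> ` E) = emeasure lebesgue (g ` S)"
    using emeasure_distr[of of_real4 lborel borel "\<tau> ` E"] by (simp add: lborel_of_real4 gS[symmetric])
  have int: "(\<integral>\<^sup>+z\<in>E. ennreal (J z) \<partial>lborel) = (\<integral>\<^sup>+x. ennreal (h x) \<partial>lborel)"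
  proof -
    have "(\<integral>\<^sup>+z\<in>E. ennreal (J z) \<partial>lborel) = (\<integral>\<^sup>+z. ennreal (indicator E z * J z) \<partial>distr lborel borel of_real4)"
      unfolding lborel_of_real4 by (intro nn_integral_cong) (auto simp: indicator_def)
    also have "\<dots> = (\<integral>\<^sup>+x. ennreal (h x) \<partial>lborel)"
      unfolding h_def by (rule nn_integral_distr) (use J(2) in auto)
    finally show ?thesis .
  qed
  have der: "(g has_derivative (\<lambda>v. to_real4 (D (of_real4 x) (of_real4 v)))) (at x within S)" if "x \<in> S" for x
  proof -
    have "of_real4 x \<in> E" using that by (simp add: S_def)
    from has_derivative_compose[OF bounded_linear_imp_has_derivative[OF bounded_linear_real4(1)] \<tau>(1)[OF this]]
    show ?thesis unfolding g_def
      using bounded_linear.has_derivative[OF bounded_linear_real4(2)] has_derivative_at_withinI by blast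
  qed
  have inj: "inj_on g S"
    using \<tau>(2) unfolding inj_on_def g_def S_def by (metis of_real4_to_real4 vimageE)
  have det: "\<bar>det (matrix (\<lambda>v. to_real4 (D (of_real4 x) (of_real4 v))))\<bar> = h x" if "x \<in> S" for x
  proof -
    have x: "of_real4 x \<in> E" using that by (simp add: S_def)
    show ?thesis
      using det_complex_linear[of "D (of_real4 x)", OF has_derivative_linear[OF \<tau>(1)[OF x]] lin[OF x]] x
      by (simp add: h_def J(1))
  qed
  \<comment> \<open>This equivalence speaks of finite values only. The case distinction below deals
    with an infinite integral: if the image had finite measure, the equivalence would make the
    integral finite.\<close>
  have key: "g ` S \<in> lmeasurable \<and> measure lebesgue (g ` S) = m \<longleftrightarrow> (h has_integral m) UNIV" for m
  proof -
    have "g ` S \<in> lmeasurable \<and> measure lebesgue (g ` S) = m \<longleftrightarrow>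
      ((\<lambda>x. \<bar>det (matrix (\<lambda>v. to_real4 (D (of_real4 x) (of_real4 v))))\<bar>) has_integral m) S"
      by (rule has_measure_differentiable_image[OF _ der inj]) auto
    also have "\<dots> \<longleftrightarrow> (h has_integral m) S"
      by (rule has_integral_cong) (use det in auto)
    also have "\<dots> \<longleftrightarrow> ((\<lambda>x. if x \<in> S then h x else 0) has_integral m) UNIV"
      by (rule has_integral_restrict_UNIV[symmetric])
    also have "(\<lambda>x. if x \<in> S then h x else 0) = h" by (auto simp: h_def S_def)
    finally show ?thesis .
  qed
  show ?thesis
  proof (cases "(\<integral>\<^sup>+x. ennreal (h x) \<partial>lborel) < \<infinity>")
    case True
    then obtain r where r: "(\<integral>\<^sup>+x. ennreal (h x) \<partial>lborel) = ennreal r" "r \<ge> 0"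
      by (cases "\<integral>\<^sup>+x. ennreal (h x) \<partial>lborel" rule: ennreal_cases) auto
    then have "(h has_integral r) UNIV" by (intro nn_integral_has_integral h h0)
    then have "g ` S \<in> lmeasurable" "measure lebesgue (g ` S) = r" using key by auto
    then show ?thesis unfolding img int r using emeasure_eq_measure2 by blast
  next
    case False
    have "\<not> emeasure lebesgue (g ` S) < \<infinity>"
    proof
      assume fin: "emeasure lebesgue (g ` S) < \<infinity>"
      then have "g ` S \<in> lmeasurable" by (intro fmeasurableI) auto
      then have "(h has_integral measure lebesgue (g ` S)) UNIV" using key by blast
      then have "(\<integral>\<^sup>+x. ennreal (h x) \<partial>lborel) = ennreal (measure lebesgue (g ` S))"
        by (rule nn_integral_has_integral_lborel[OF h h0])
      with False show False by simp
    qed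
    with False show ?thesis unfolding img int by (simp add: not_less top_unique)
  qed
qed

section \<open>Translations and Fubini\<close>

lemma nn_integral_lborel_translation:
  fixes f :: "'a::euclidean_space \<Rightarrow> ennreal"
  assumes "f \<in> borel_measurable borel"
  shows "(\<integral>\<^sup>+w. f (w + c) \<partial>lborel) = (\<integral>\<^sup>+w. f w \<partial>lborel)"
proof -
  have "(\<integral>\<^sup>+w. f w \<partial>lborel) = (\<integral>\<^sup>+w. f w \<partial>distr lborel borel ((+) c))" by (simp only: lborel_distr_plus)
  also have "\<dots> = (\<integral>\<^sup>+w. f (c + w) \<partial>lborel)" using assms by (simp add: nn_integral_distr)
  finally show ?thesis by (simp add: add.commute)
qed

text \<open>Translation invariance lets the integral be averaged over the translates by
  \<open>t *\<^sub>R d\<close> with t in [0, 1]; Fubini then turns it into integrals along segments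
  in direction d.\<close>

lemma nn_integral_lborel_lines:
  fixes f :: "'a::euclidean_space \<Rightarrow> ennreal"
  assumes [measurable]: "f \<in> borel_measurable borel"
  shows "(\<integral>\<^sup>+w. (\<integral>\<^sup>+t. indicator {0..1} t * f (w + t *\<^sub>R d) \<partial>lborel) \<partial>lborel) = (\<integral>\<^sup>+w. f w \<partial>lborel)"
proof -
  have "(\<integral>\<^sup>+w. (\<integral>\<^sup>+t. indicator {0..1} t * f (w + t *\<^sub>R d) \<partial>lborel) \<partial>lborel) =
    (\<integral>\<^sup>+t. (\<integral>\<^sup>+w. indicator {0..1} t * f (w + t *\<^sub>R d) \<partial>lborel) \<partial>lborel)"
    by (rule lborel_pair.Fubini') measurable
  also have "\<dots> = (\<integral>\<^sup>+t. indicator {0..1::real} t * (\<integral>\<^sup>+w. f w \<partial>lborel) \<partial>lborel)"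
    by (simp add: nn_integral_cmult nn_integral_lborel_translation)
  also have "\<dots> = (\<integral>\<^sup>+w. f w \<partial>lborel)"
    by (simp add: nn_integral_multc)
  finally show ?thesis .
qed

text \<open>Every segment in direction d meets \<open>K\<close> in a countable, hence null, set. The
  average along segments vanishes, and it equals the measure of \<open>K\<close>.\<close>

lemma null_set_of_countable_slices:
  fixes K :: "'a::euclidean_space set"
  assumes [measurable]: "K \<in> sets borel" and c: "\<And>w. countable {t. w + t *\<^sub>R d \<in> K}"
  shows "emeasure lborel K = 0"
proof -
  have "(\<integral>\<^sup>+t. indicator {0..1::real} t * indicator K (w + t *\<^sub>R d) \<partial>lborel) = (0 :: ennreal)" for w
  proof -
    have "AE t in lborel. t \<notin> {t. w + t *\<^sub>R d \<in> K}"
      using countable_imp_null_set_lborel[OF c] by (rule AE_not_in)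
    then have "AE t in lborel. indicator {0..1::real} t * indicator K (w + t *\<^sub>R d) = (0 :: ennreal)"
      by eventually_elim (auto simp: indicator_def)
    then show ?thesis by (subst nn_integral_cong_AE) auto
  qed
  then have "(\<integral>\<^sup>+w. indicator K w \<partial>lborel) = (0::ennreal)"
    by (subst nn_integral_lborel_lines[symmetric, of _ d]) auto
  then show ?thesis by simp
qed

text \<open>Each point is the only point of \<open>T\<close> in some interval with rational ends,
  and these ends determine it.\<close>

lemma countable_isolated_points:
  fixes T :: "real set"
  assumes "\<And>t. t \<in> T \<Longrightarrow> \<exists>e>0. \<forall>s\<in>T. \<bar>s - t\<bar> < e \<longrightarrow> s = t"
  shows "countable T"
proof -
  have "\<exists>q r :: rat. {s\<in>T. of_rat q < s \<and> s < of_rat r} = {t}" if "t \<in> T" for t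
  proof -
    obtain e where e: "e > 0" "\<And>s. s \<in> T \<Longrightarrow> \<bar>s - t\<bar> < e \<Longrightarrow> s = t" using assms[OF \<open>t \<in> T\<close>] by blast
    obtain q where q: "t - e < of_rat q" "of_rat q < t" using of_rat_dense[of "t - e" t] e by auto
    obtain r where r: "t < of_rat r" "of_rat r < t + e" using of_rat_dense[of t "t + e"] e by auto
    have "{s\<in>T. of_rat q < s \<and> s < of_rat r} = {t}" using e(2) q r \<open>t \<in> T\<close> by force
    then show ?thesis by blast
  qed
  then obtain q r :: "real \<Rightarrow> rat" where qr: "\<And>t. t \<in> T \<Longrightarrow> {s\<in>T. of_rat (q t) < s \<and> s < of_rat (r t)} = {t}" by metis
  have "inj_on (\<lambda>t. (q t, r t)) T"
  proof (rule inj_onI)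
    fix s t assume st: "s \<in> T" "t \<in> T" "(q s, r s) = (q t, r t)"
    then have q: "q s = q t" "r s = r t" by auto
    have "{s} = {t}" by (rule trans[OF sym[OF qr[OF st(1), unfolded q]] qr[OF st(2)]])
    then show "s = t" by blast
  qed
  moreover have "countable ((\<lambda>t. (q t, r t)) ` T)"
    by (rule countable_subset[OF subset_UNIV]) (rule countableI_type)
  ultimately show ?thesis using countable_image_inj_on by blast
qed

lemma measurable_holo_Collect:
  assumes "open W" "continuous_on W f" "continuous_on W g"
  shows "{w\<in>W. Re (f w) = 0 \<and> Re (g w) \<noteq> 0} \<in> sets borel"
proof -
  have W: "W \<in> sets borel" using assms(1) by simp
  note [measurable] = W borel_measurable_continuous_on_indicator[OF W assms(2)] borel_measurable_continuous_on_indicator[OF W assms(3)]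
  have "{w\<in>W. Re (f w) = 0 \<and> Re (g w) \<noteq> 0} =
    {w\<in>space borel. w \<in> W \<and> Re (indicator W w *\<^sub>R f w) = 0 \<and> Re (indicator W w *\<^sub>R g w) \<noteq> 0}"
    by auto
  also have "\<dots> \<in> sets borel" by measurable
  finally show ?thesis .
qed

lemma complex2_expand: "(v :: complex^2) = v$1 *s axis 1 1 + v$2 *s axis 2 1"
  by (simp add: vec_eq_iff forall_2 axis_def)

text \<open>The real hypersurface is cut into four pieces according to a real direction in which the
  real part of \<open>k\<close> has nonzero derivative. On lines in that direction the zeros of the
  piece are isolated. It is used for the branch cut and for the part of the surface outside the two
  sheets.\<close>

lemma null_level_set:
  fixes k :: "complex^2 \<Rightarrow> complex"
  assumes W: "open W" and k: "holo_fun k W"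
    and nz: "\<And>w. w \<in> W \<Longrightarrow> Re (k w) = 0 \<Longrightarrow> \<exists>v. frechet_derivative k (at w) v \<noteq> 0"
  shows "{w\<in>W. Re (k w) = 0} \<in> sets borel" "emeasure lborel {w\<in>W. Re (k w) = 0} = 0"
proof -
  define K where "K d = {w\<in>W. Re (k w) = 0 \<and> Re (frechet_derivative k (at w) d) \<noteq> 0}" for d
  have Km: "K d \<in> sets borel" for d
    unfolding K_def by (intro measurable_holo_Collect W holo_fun_continuous_on k holo_fun_deriv_continuous_on)
  have K0: "emeasure lborel (K d) = 0" for d
  proof (rule null_set_of_countable_slices[OF Km, of _ d], rule countable_isolated_points)
    fix w t assume "t \<in> {t. w + t *\<^sub>R d \<in> K d}"
    then have t: "w + t *\<^sub>R d \<in> W" "Re (k (w + t *\<^sub>R d)) = 0" "Re (frechet_derivative k (at (w + t *\<^sub>R d)) d) \<noteq> 0"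
      by (auto simp: K_def)
    let ?c = "Re (frechet_derivative k (at (w + t *\<^sub>R d)) d)"
    have lin: "linear (frechet_derivative k (at (w + t *\<^sub>R d)))"
      using holo_funD(1)[OF k t(1)] has_derivative_linear by blast
    have "((\<lambda>s. w + s *\<^sub>R d) has_derivative (\<lambda>s. s *\<^sub>R d)) (at t)"
      by (auto intro!: derivative_eq_intros)
    from has_derivative_compose[OF this holo_funD(1)[OF k t(1)]]
    have "((\<lambda>s. Re (k (w + s *\<^sub>R d))) has_derivative (\<lambda>s. Re (s *\<^sub>R frechet_derivative k (at (w + t *\<^sub>R d)) d))) (at t)"
      unfolding linear_cmul[OF lin] by (rule has_derivative_Re)
    then have "((\<lambda>s. Re (k (w + s *\<^sub>R d))) has_real_derivative ?c) (at t)"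
      unfolding has_field_derivative_def by (rule has_derivative_eq_rhs) auto
    then have "((\<lambda>s. (Re (k (w + s *\<^sub>R d)) - Re (k (w + t *\<^sub>R d))) / (s - t)) \<longlongrightarrow> ?c) (at t)"
      by (simp only: has_field_derivative_iff)
    then have "eventually (\<lambda>s. (Re (k (w + s *\<^sub>R d)) - Re (k (w + t *\<^sub>R d))) / (s - t) \<noteq> 0) (at t)"
      using t(3) by (rule tendsto_imp_eventually_ne)
    then obtain e where "e > 0" "\<And>s. s \<noteq> t \<Longrightarrow> dist s t < e \<Longrightarrow> (Re (k (w + s *\<^sub>R d)) - Re (k (w + t *\<^sub>R d))) / (s - t) \<noteq> 0"
      unfolding eventually_at by auto
    then show "\<exists>e>0. \<forall>s\<in>{t. w + t *\<^sub>R d \<in> K d}. \<bar>s - t\<bar> < e \<longrightarrow> s = t"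
      using t(2) by (intro exI[of _ e]) (force simp: K_def dist_real_def)
  qed
  \<comment> \<open>The directions with \<i> are included because the real part of the derivative
    there is minus the imaginary part of the derivative along the axis; if all four real parts
    vanish, so does the complex derivative.\<close>
  let ?Ds = "{axis 1 1, \<i> *s axis 1 1, axis 2 1, \<i> *s axis 2 1} :: (complex^2) set"
  have eq: "{w\<in>W. Re (k w) = 0} = (\<Union>d\<in>?Ds. K d)"
  proof (intro equalityI subsetI)
    fix w assume "w \<in> {w\<in>W. Re (k w) = 0}"
    then have w: "w \<in> W" "Re (k w) = 0" by auto
    let ?L = "frechet_derivative k (at w)"
    have lin: "linear ?L" using holo_funD(1)[OF k w(1)] has_derivative_linear by blast
    show "w \<in> (\<Union>d\<in>?Ds. K d)"
    proof (rule ccontr)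
      assume "w \<notin> (\<Union>d\<in>?Ds. K d)"
      then have "?L (axis 1 1) = 0" "?L (axis 2 1) = 0"
        using w by (auto simp: K_def holo_funD(2)[OF k w(1)] complex_eq_iff)
      then have "?L v = 0" for v
        using complex2_expand[of v] linear_add[OF lin] holo_funD(2)[OF k w(1)]
        by (metis add.right_neutral mult_zero_right)
      with nz[OF w] show False by blast
    qed
  qed (auto simp: K_def)
  show "{w\<in>W. Re (k w) = 0} \<in> sets borel" unfolding eq by (intro sets.finite_UN Km) auto
  have "(\<Union>d\<in>?Ds. K d) \<in> null_sets lborel"
    by (intro null_sets.finite_UN) (auto intro!: null_setsI simp: K0 Km)
  then show "emeasure lborel {w\<in>W. Re (k w) = 0} = 0" unfolding eq by auto
qed

lemma
  fixes f :: "'a::euclidean_space \<Rightarrow> 'b::{banach, second_countable_topology}"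
  assumes f: "integrable lborel f"
  shows integrable_lborel_translation: "integrable lborel (\<lambda>w. f (w + c))"
    and integral_lborel_translation: "integral\<^sup>L lborel (\<lambda>w. f (w + c)) = integral\<^sup>L lborel f"
proof -
  have f': "integrable (distr lborel borel ((+) c)) f" using f by (simp only: lborel_distr_plus)
  have "integrable lborel (\<lambda>w. f (c + w))"
    using f' by (subst (asm) integrable_distr_eq) (use f in auto)
  then show "integrable lborel (\<lambda>w. f (w + c))" by (simp add: add.commute)
  have "integral\<^sup>L lborel f = integral\<^sup>L (distr lborel borel ((+) c)) f" by (simp only: lborel_distr_plus)
  also have "\<dots> = integral\<^sup>L lborel (\<lambda>w. f (c + w))"
    by (subst integral_distr) (use f in auto)
  finally show "integral\<^sup>L lborel (\<lambda>w. f (w + c)) = integral\<^sup>L lborel f" by (simp add: add.commute)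
qed

section \<open>Integration along an injective parametrization\<close>

text \<open>Nothing about the map enters except the formula for the measure of images. It serves the
  charts, and through \<open>nn_integral_image\<close> also the transition maps and the flow. The
  map \<open>t'\<close> is a Borel map on the whole space that agrees with \<open>t\<close> on
  \<open>E\<close>.\<close>

lemma distr_density_image:
  fixes t :: "'a::topological_space \<Rightarrow> 'b::topological_space"
  assumes sets: "sets \<nu> = sets borel" "sets \<mu> = sets borel"
    and E: "E \<in> sets borel" and t': "t' \<in> borel \<rightarrow>\<^sub>M borel" "\<And>z. z \<in> E \<Longrightarrow> t' z = t z"
    and J: "(\<lambda>z. indicator E z * J z) \<in> borel_measurable borel"
    and img: "\<And>F. F \<in> sets borel \<Longrightarrow> F \<subseteq> E \<Longrightarrow> t ` F \<in> sets borel"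
    and eq: "\<And>F. F \<in> sets borel \<Longrightarrow> F \<subseteq> E \<Longrightarrow> emeasure \<mu> (t ` F) = (\<integral>\<^sup>+z\<in>F. J z \<partial>\<nu>)"
  shows "distr (density \<nu> (\<lambda>z. indicator E z * J z)) borel t' = density \<mu> (indicator (t ` E))"
proof (rule measure_eqI)
  have space: "space \<nu> = UNIV" "space \<mu> = UNIV" using sets_eq_imp_space_eq[OF sets(1)] sets_eq_imp_space_eq[OF sets(2)] by simp_all
  fix A assume "A \<in> sets (distr (density \<nu> (\<lambda>z. indicator E z * J z)) borel t')"
  then have A: "A \<in> sets borel" by simp
  let ?F = "E \<inter> t' -` A"
  have F: "?F \<in> sets borel" using E measurable_sets[OF t'(1) A] by simp
  have t'\<nu>: "t' \<in> \<nu> \<rightarrow>\<^sub>M borel" using t'(1) measurable_cong_sets[OF sets(1)] by auto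
  have J\<nu>: "(\<lambda>z. indicator E z * J z) \<in> borel_measurable \<nu>" using J measurable_cong_sets[OF sets(1)] by auto
  have tE: "t ` ?F = t ` E \<inter> A" using t'(2) by auto
  have "emeasure (distr (density \<nu> (\<lambda>z. indicator E z * J z)) borel t') A =
      emeasure (density \<nu> (\<lambda>z. indicator E z * J z)) (t' -` A)"
    using t'\<nu> A by (subst emeasure_distr) (auto simp: space)
  also have "\<dots> = (\<integral>\<^sup>+z. indicator E z * J z * indicator (t' -` A) z \<partial>\<nu>)"
    using J\<nu> measurable_sets[OF t'\<nu> A] by (subst emeasure_density) (auto simp: space)
  also have "\<dots> = (\<integral>\<^sup>+z\<in>?F. J z \<partial>\<nu>)"
    by (intro nn_integral_cong) (auto simp: indicator_def)
  also have "\<dots> = emeasure \<mu> (t ` E \<inter> A)" using eq[OF F] tE by simp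
  also have "\<dots> = (\<integral>\<^sup>+x. indicator (t ` E) x * indicator A x \<partial>\<mu>)"
    using img[OF E] A sets by (simp add: indicator_inter_arith[symmetric])
  also have "\<dots> = emeasure (density \<mu> (indicator (t ` E))) A"
    using img[OF E] A sets by (subst emeasure_density) auto
  finally show "emeasure (distr (density \<nu> (\<lambda>z. indicator E z * J z)) borel t') A = emeasure (density \<mu> (indicator (t ` E))) A" .
qed (use sets in simp)

lemma nn_integral_image:
  fixes t :: "'a::topological_space \<Rightarrow> 'b::topological_space"
  assumes sets: "sets \<nu> = sets borel" "sets \<mu> = sets borel"
    and E: "E \<in> sets borel" and t': "t' \<in> borel \<rightarrow>\<^sub>M borel" "\<And>z. z \<in> E \<Longrightarrow> t' z = t z"
    and J: "(\<lambda>z. indicator E z * J z) \<in> borel_measurable borel"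
    and img: "\<And>F. F \<in> sets borel \<Longrightarrow> F \<subseteq> E \<Longrightarrow> t ` F \<in> sets borel"
    and eq: "\<And>F. F \<in> sets borel \<Longrightarrow> F \<subseteq> E \<Longrightarrow> emeasure \<mu> (t ` F) = (\<integral>\<^sup>+z\<in>F. J z \<partial>\<nu>)"
    and f: "f \<in> borel_measurable borel"
  shows "(\<integral>\<^sup>+x\<in>t ` E. f x \<partial>\<mu>) = (\<integral>\<^sup>+z\<in>E. f (t z) * J z \<partial>\<nu>)"
proof -
  note M = distr_density_image[OF sets E t' J img eq]
  have m: "(\<lambda>z. indicator E z * J z) \<in> borel_measurable \<nu>" "t' \<in> \<nu> \<rightarrow>\<^sub>M borel"
    "f \<in> borel_measurable \<mu>" "(indicator (t ` E) :: _ \<Rightarrow> ennreal) \<in> borel_measurable \<mu>"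
    using J t'(1) f img[OF E] sets by (auto simp: measurable_cong_sets[OF sets(1)] measurable_cong_sets[OF sets(2)])
  have "(\<integral>\<^sup>+x\<in>t ` E. f x \<partial>\<mu>) = (\<integral>\<^sup>+x. f x \<partial>density \<mu> (indicator (t ` E)))"
    using m by (subst nn_integral_density) (auto simp: mult.commute)
  also have "\<dots> = (\<integral>\<^sup>+x. f x \<partial>distr (density \<nu> (\<lambda>z. indicator E z * J z)) borel t')"
    by (simp only: M)
  also have "\<dots> = (\<integral>\<^sup>+z. f (t' z) \<partial>density \<nu> (\<lambda>z. indicator E z * J z))"
    by (rule nn_integral_distr) (use m f in auto)
  also have "\<dots> = (\<integral>\<^sup>+z. indicator E z * J z * f (t' z) \<partial>\<nu>)"
    using m measurable_compose[OF m(2) f] by (subst nn_integral_density) auto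
  also have "\<dots> = (\<integral>\<^sup>+z\<in>E. f (t z) * J z \<partial>\<nu>)"
    using t'(2) by (intro nn_integral_cong) (auto simp: indicator_def mult_ac)
  finally show ?thesis .
qed

lemma borel_measurable_vanishing_extension:
  fixes f :: "'a::topological_space \<Rightarrow> 'b::real_normed_vector"
  assumes "continuous_on W f" "E \<in> sets borel" "E \<subseteq> W"
  shows "(\<lambda>z. indicator E z *\<^sub>R f z) \<in> borel \<rightarrow>\<^sub>M borel"
  by (rule borel_measurable_continuous_on_indicator) (use assms continuous_on_subset in auto)

section \<open>Charts and the volume measure\<close>

text \<open>\<tau> is known to be continuous only. Since \<psi> is tangent to the identity at
  \<open>\<tau> z0\<close>, the increment of \<tau> is at most twice that of \<open>f\<close>, hence
  of first order, and the error of \<psi> then becomes of smaller order.\<close>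

lemma has_derivative_left_factor:
  fixes \<tau> :: "'a::real_normed_vector \<Rightarrow> 'b::real_normed_vector"
  assumes \<psi>: "(\<psi> has_derivative (\<lambda>v. v)) (at (\<tau> z0))" and \<tau>: "isCont \<tau> z0"
    and f: "(f has_derivative L) (at z0)" and S: "open S" "z0 \<in> S" "\<And>z. z \<in> S \<Longrightarrow> \<psi> (\<tau> z) = f z"
  shows "(\<tau> has_derivative L) (at z0)"
  unfolding has_derivative_at_alt
proof (intro conjI allI impI)
  show L: "bounded_linear L" using f has_derivative_bounded_linear by blast
  obtain K where K: "K > 0" "\<And>v. norm (L v) \<le> norm v * K" using bounded_linear.pos_bounded[OF L] by blast
  fix e :: real assume e: "e > 0"
  \<comment> \<open>The bound 1/2 absorbs the error term into the left side. The resulting increment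
    is at most (2 K + 1) |y - z0|, and the total error is at most c (2 K + 3) |y - z0|.\<close>
  define c where "c = min (1/2) (e / (2 * K + 3))"
  have c': "c \<le> 1/2" "c \<le> e / (2 * K + 3)" unfolding c_def by (rule min.cobounded1 min.cobounded2)+
  have c: "c > 0" "c \<le> 1/2" "c * (2 * K + 3) \<le> e"
    using e K pos_le_divide_eq[of "2 * K + 3" c e] c' by (auto simp: c_def)
  obtain d1 where d1: "d1 > 0" "\<And>w. norm (w - \<tau> z0) < d1 \<Longrightarrow> norm (\<psi> w - \<psi> (\<tau> z0) - (w - \<tau> z0)) \<le> c * norm (w - \<tau> z0)"
    using \<psi> c(1) unfolding has_derivative_at_alt by blast
  obtain d2 where d2: "d2 > 0" "\<And>z. norm (z - z0) < d2 \<Longrightarrow> norm (\<tau> z - \<tau> z0) < d1"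
    using \<tau> d1(1) unfolding continuous_at_eps_delta dist_norm by blast
  obtain d3 where d3: "d3 > 0" "\<And>z. norm (z - z0) < d3 \<Longrightarrow> norm (f z - f z0 - L (z - z0)) \<le> c * norm (z - z0)"
    using f c(1) unfolding has_derivative_at_alt by blast
  obtain d4 where d4: "d4 > 0" "ball z0 d4 \<subseteq> S" using S(1,2) open_contains_ball by blast
  show "\<exists>d>0. \<forall>y. norm (y - z0) < d \<longrightarrow> norm (\<tau> y - \<tau> z0 - L (y - z0)) \<le> e * norm (y - z0)"
  proof (intro exI conjI allI impI)
    show "min d2 (min d3 d4) > 0" using d2 d3 d4 by simp
    fix y assume y: "norm (y - z0) < min d2 (min d3 d4)"
    have yS: "y \<in> S" using y d4(2) by (auto simp: dist_norm norm_minus_commute subset_iff)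
    let ?a = "\<tau> y - \<tau> z0" and ?b = "f y - f z0" and ?n = "norm (y - z0)"
    have 1: "norm (?b - ?a) \<le> c * norm ?a"
      using d1(2)[OF d2(2)[of y]] y unfolding S(3)[OF yS] S(3)[OF S(2)] by auto
    have 2: "norm (?b - L (y - z0)) \<le> c * ?n" using d3(2) y by auto
    have "norm ?a \<le> norm ?b + norm (?b - ?a)"
      by (metis norm_minus_commute norm_triangle_sub)
    moreover have "c * norm ?a \<le> 1/2 * norm ?a" using c by (intro mult_right_mono) auto
    ultimately have "norm ?a \<le> 2 * norm ?b" using 1 by linarith
    also have "norm ?b \<le> norm (L (y - z0)) + norm (?b - L (y - z0))"
      by (metis norm_triangle_sub)
    also have "\<dots> \<le> ?n * K + c * ?n" using K 2 add_mono by blast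
    finally have a: "norm ?a \<le> 2 * (?n * K + c * ?n)" by simp
    have "c * ?n \<le> 1/2 * ?n" using c by (intro mult_right_mono) auto
    with a have a: "norm ?a \<le> (2 * K + 1) * ?n" by (simp add: algebra_simps)
    have "norm (?a - L (y - z0)) \<le> norm (?a - ?b) + norm (?b - L (y - z0))"
      using norm_triangle_ineq[of "?a - ?b" "?b - L (y - z0)"] by simp
    also have "\<dots> \<le> c * ((2 * K + 1) * ?n) + c * ?n"
      using norm_minus_commute[of ?a ?b] 1 2 mult_left_mono[OF a, of c] c by linarith
    also have "\<dots> \<le> (c * (2 * K + 3)) * ?n"
      using c by (simp add: algebra_simps)
    also have "\<dots> \<le> e * ?n" using c by (intro mult_right_mono) auto
    finally show "norm (?a - L (y - z0)) \<le> e * ?n" .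
  qed
qed

lemma holo_paramD:
  assumes "holo_param X W p"
  shows "open W" "holomorphic_map p W" "\<And>z. z \<in> W \<Longrightarrow> inj (frechet_derivative p (at z))"
    "inj_on p W" "continuous_on W p" "openin (top_of_set (X - {0})) (p ` W)" "p ` W \<subseteq> X - {0}"
proof -
  obtain q where "homeomorphism W (p ` W) p q" using assms by (auto simp: holo_param_def)
  then show "inj_on p W" "continuous_on W p"
    by (auto simp: homeomorphism_def inj_on_def) (metis)
  show "p ` W \<subseteq> X - {0}"
    using assms openin_subset[of "top_of_set (X - {0})" "p ` W"] by (auto simp: holo_param_def)
qed (use assms in \<open>auto simp: holo_param_def\<close>)

lemma holo_param_derivative:
  assumes "holo_param X W p" "z \<in> W"
  shows "(p has_derivative frechet_derivative p (at z)) (at z)" "linear (frechet_derivative p (at z))"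
    "frechet_derivative p (at z) (c *s v) = c *s frechet_derivative p (at z) v"
  using holomorphic_mapD[OF holo_paramD(2)[OF assms(1)] assms(2)] has_derivative_linear by blast+

text \<open>Charts are only required to be homeomorphisms with injective differential, so
  differentiability of the transition map has to be extracted from continuity by
  \<open>has_derivative_left_factor\<close>.\<close>

lemma holo_param_transition:
  assumes p: "holo_param X W p" and p': "holo_param X W' p'"
  defines "\<tau> \<equiv> \<lambda>z. inv_into W' p' (p z)"
  assumes z: "z0 \<in> W" "p z0 \<in> p' ` W'"
  obtains L where "(\<tau> has_derivative L) (at z0)"
    "\<And>v. frechet_derivative p' (at (\<tau> z0)) (L v) = frechet_derivative p (at z0) v"
    "\<And>c v. L (c *s v) = c *s L v"
proof -
  obtain q where q: "homeomorphism W' (p' ` W') p' q" using p' by (auto simp: holo_param_def)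
  have \<tau>q: "\<tau> z = q (p z)" if "p z \<in> p' ` W'" for z
    using q that holo_paramD(4)[OF p'] unfolding \<tau>_def homeomorphism_def
    by (auto simp: inv_into_f_f)
  define S where "S = W \<inter> p -` (p' ` W')"
  have "openin (top_of_set W) (W \<inter> p -` (p' ` W'))"
    by (rule continuous_openin_preimage[OF holo_paramD(5)[OF p] _ holo_paramD(6)[OF p']])
       (use holo_paramD(7)[OF p] in auto)
  then have S: "open S" "z0 \<in> S" using holo_paramD(1)[OF p] z openin_open_trans by (auto simp: S_def)
  have w0: "\<tau> z0 \<in> W'" "p' (\<tau> z0) = p z0" using z(2) unfolding \<tau>_def by (auto intro: inv_into_into f_inv_into_f)
  have p\<tau>: "p' (\<tau> z) = p z" if "z \<in> S" for z using that unfolding \<tau>_def S_def by (auto intro: f_inv_into_f)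
  have "continuous_on S (\<lambda>z. q (p z))"
    by (rule continuous_on_compose2[OF homeomorphism_cont2[OF q]])
       (use holo_paramD(5)[OF p] in \<open>auto simp: S_def intro: continuous_on_subset\<close>)
  then have "continuous_on S \<tau>" by (rule continuous_on_eq) (auto simp: S_def \<tau>q)
  then have cont: "isCont \<tau> z0" using S continuous_on_eq_continuous_at by blast
  let ?A = "frechet_derivative p' (at (\<tau> z0))" and ?B = "frechet_derivative p (at z0)"
  note A = holo_param_derivative[OF p' w0(1)] and B = holo_param_derivative[OF p z(1)]
  \<comment> \<open>\<open>A'\<close> composed with \<open>p'\<close> plays the role of the map
    tangent to the identity.\<close>
  obtain A' where A': "linear A'" "A' \<circ> ?A = id"
    using linear_injective_left_inverse[OF A(2) holo_paramD(3)[OF p' w0(1)]] by blast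
  have blA': "bounded_linear A'" using A'(1) linear_conv_bounded_linear by blast
  have "((\<lambda>w. A' (p' w)) has_derivative (\<lambda>v. A' (?A v))) (at (\<tau> z0))"
    by (rule bounded_linear.has_derivative[OF blA' A(1)])
  then have 1: "((\<lambda>w. A' (p' w)) has_derivative (\<lambda>v. v)) (at (\<tau> z0))"
    using A'(2) by (simp add: fun_eq_iff)
  have 2: "((\<lambda>z. A' (p z)) has_derivative (\<lambda>v. A' (?B v))) (at z0)"
    by (rule bounded_linear.has_derivative[OF blA' B(1)])
  have \<tau>': "(\<tau> has_derivative (\<lambda>v. A' (?B v))) (at z0)"
    by (rule has_derivative_left_factor[OF 1 cont 2 S]) (use p\<tau> in auto)
  have "((\<lambda>z. p' (\<tau> z)) has_derivative (\<lambda>v. ?A (A' (?B v)))) (at z0)"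
    by (rule has_derivative_compose[OF \<tau>' A(1)])
  then have "(p has_derivative (\<lambda>v. ?A (A' (?B v)))) (at z0)"
    by (rule has_derivative_transform_within_open[OF _ S]) (use p\<tau> in auto)
  then have AL: "?A (A' (?B v)) = ?B v" for v using has_derivative_unique[OF B(1)] by metis
  \<comment> \<open>\<open>A'\<close> is real-linear only. Complex linearity of the composition is
    read off after applying the injective complex-linear map \<open>?A\<close>.\<close>
  have "A' (?B (c *s v)) = c *s A' (?B v)" for c v
    by (rule injD[OF holo_paramD(3)[OF p' w0(1)]]) (simp only: AL A(3), simp only: B(3))
  with \<tau>' AL show ?thesis using that by blast
qed

text \<open>\<open>tangent\<close> collects vectors from all charts through the point; the
  differential of the transition map shows that each of them arises from the given chart.\<close>

lemma tangent_eq_range: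
  assumes p: "holo_param X W p" and z: "z \<in> W"
  shows "tangent X (p z) = range (frechet_derivative p (at z))"
proof (intro equalityI subsetI)
  fix v assume "v \<in> tangent X (p z)"
  then obtain W' p' z' w where p': "holo_param X W' p'" "z' \<in> W'" "p' z' = p z"
    and v: "v = frechet_derivative p' (at z') w" by (auto simp: tangent_def)
  have *: "inv_into W p (p' z') = z" using p'(3) z holo_paramD(4)[OF p] by simp
  obtain L where "\<And>v. frechet_derivative p (at z) (L v) = frechet_derivative p' (at z') v"
    using holo_param_transition[OF p'(1) p p'(2)] p'(3) z * by (metis imageI)
  then show "v \<in> range (frechet_derivative p (at z))" unfolding v by (metis rangeI)
qed (use p z in \<open>auto simp: tangent_def\<close>)

section \<open>Gram determinants, orthonormal bases and the volume density\<close>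

lemma hprod_add: "hprod (a + b) c = hprod a c + hprod b c" "hprod c (a + b) = hprod c a + hprod c b"
  and hprod_mult: "hprod (k *s a) b = k * hprod a b" "hprod a (k *s b) = cnj k * hprod a b"
  and hprod_cnj: "cnj (hprod a b) = hprod b a"
  by (auto simp: hprod_def algebra_simps sum.distrib sum_distrib_left intro: sum.cong)

lemma hprod_self: "hprod a a = of_real ((norm a)\<^sup>2)"
  by (simp add: hprod_def norm_vec_def L2_set_def sum_nonneg complex_norm_square[symmetric])

definition gram :: "complex^3 \<Rightarrow> complex^3 \<Rightarrow> complex" where
  "gram a b = hprod a a * hprod b b - hprod a b * hprod b a"

lemma volume_density_gram:
  "volume_density p z = Re (gram (frechet_derivative p (at z) (axis 1 1)) (frechet_derivative p (at z) (axis 2 1)))"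
  by (simp add: volume_density_def det_2 gram_def)

text \<open>This one identity governs both the change of charts and the comparison of a chart basis
  with a unitary frame.\<close>

lemma gram_lincomb:
  "gram (\<alpha> *s a + \<beta> *s b) (\<gamma> *s a + \<delta> *s b) = of_real ((cmod (\<alpha> * \<delta> - \<beta> * \<gamma>))\<^sup>2) * gram a b"
  unfolding complex_norm_square gram_def hprod_add hprod_mult complex_cnj_diff complex_cnj_mult
  by algebra

lemma linear2_expand:
  fixes L :: "complex^2 \<Rightarrow> complex^'n"
  assumes "linear L" "\<And>c v. L (c *s v) = c *s L v"
  shows "L v = v$1 *s L (axis 1 1) + v$2 *s L (axis 2 1)"
  using complex2_expand[of v] linear_add[OF assms(1)] assms(2) by metis

lemma volume_density_transition:
  assumes p: "holo_param X W p" "z \<in> W" and p': "holo_param X W' p'" "w \<in> W'"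
    and L: "\<And>v. frechet_derivative p' (at w) (L v) = frechet_derivative p (at z) v"
  shows "volume_density p z = (cmod (cdet L))\<^sup>2 * volume_density p' w"
  unfolding volume_density_gram L[symmetric]
  by (subst (1 2) linear2_expand[OF holo_param_derivative(2,3)[OF p']])
     (simp add: gram_lincomb cdet_def)

lemma orthonormal_basis_exists:
  fixes a b :: "complex^3"
  assumes ind: "\<And>\<alpha> \<beta>. \<alpha> *s a + \<beta> *s b = 0 \<Longrightarrow> \<alpha> = 0 \<and> \<beta> = 0"
  obtains \<alpha> \<beta> \<gamma> \<delta> where
    "hprod (\<alpha> *s a + \<beta> *s b) (\<alpha> *s a + \<beta> *s b) = 1" "hprod (\<gamma> *s a + \<delta> *s b) (\<gamma> *s a + \<delta> *s b) = 1"
    "hprod (\<alpha> *s a + \<beta> *s b) (\<gamma> *s a + \<delta> *s b) = 0"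
proof -
  have a0: "a \<noteq> 0" using ind[of 1 0] by auto
  define u where "u = complex_of_real (1 / norm a) *s a"
  have u: "hprod u u = 1" using a0 by (simp add: u_def hprod_self norm_vector_scalar_mult norm_divide)
  define k where "k = hprod b u"
  define c where "c = b - k *s u"
  have "c \<noteq> 0" using ind[of "- k * complex_of_real (1 / norm a)" 1] by (auto simp: c_def u_def algebra_simps)
  have bc: "b = c + k *s u" by (simp add: c_def)
  have "hprod b u = hprod c u + k" by (subst bc) (simp add: hprod_add hprod_mult u)
  then have cu: "hprod c u = 0" by (simp add: k_def)
  then have uc: "hprod u c = 0" using hprod_cnj[of c u] by simp
  let ?t = "complex_of_real (1 / norm c)"
  have v: "hprod (?t *s c) (?t *s c) = 1" "hprod u (?t *s c) = 0"
    using \<open>c \<noteq> 0\<close> uc by (simp_all add: hprod_mult(2) hprod_self norm_vector_scalar_mult norm_divide)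
  have 1: "u = complex_of_real (1 / norm a) *s a + 0 *s b" by (simp add: u_def)
  have 2: "?t *s c = (- ?t * k * complex_of_real (1 / norm a)) *s a + ?t *s b"
    by (simp add: c_def u_def vec_eq_iff algebra_simps)
  show ?thesis using that[of "complex_of_real (1 / norm a)" 0 "- ?t * k * complex_of_real (1 / norm a)" ?t] u v
    unfolding 1[symmetric] 2[symmetric] by blast
qed

lemma holo_param_basis:
  assumes p: "holo_param X W p" "z \<in> W"
  defines "a \<equiv> frechet_derivative p (at z) (axis 1 1)" and "b \<equiv> frechet_derivative p (at z) (axis 2 1)"
  shows "frechet_derivative p (at z) v = v$1 *s a + v$2 *s b"
    "\<alpha> *s a + \<beta> *s b = 0 \<Longrightarrow> \<alpha> = 0 \<and> \<beta> = 0"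
    "tangent X (p z) = {\<alpha> *s a + \<beta> *s b | \<alpha> \<beta>. True}"
proof -
  show *: "frechet_derivative p (at z) v = v$1 *s a + v$2 *s b" for v
    unfolding a_def b_def by (rule linear2_expand) (rule holo_param_derivative[OF p])+
  have **: "frechet_derivative p (at z) (vector [\<alpha>, \<beta>]) = \<alpha> *s a + \<beta> *s b" for \<alpha> \<beta> by (simp add: *)
  show "\<alpha> = 0 \<and> \<beta> = 0" if "\<alpha> *s a + \<beta> *s b = 0"
  proof -
    have "vector [\<alpha>, \<beta>] = (0 :: complex^2)"
      by (rule injD[OF holo_paramD(3)[OF p]]) (simp add: ** that linear_0[OF holo_param_derivative(2)[OF p]])
    then show ?thesis by (simp add: vec_eq_iff forall_2)
  qed
  show "tangent X (p z) = {\<alpha> *s a + \<beta> *s b | \<alpha> \<beta>. True}"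
  proof (intro equalityI subsetI)
    fix v assume "v \<in> tangent X (p z)"
    then obtain u where "v = frechet_derivative p (at z) u" unfolding tangent_eq_range[OF p] by blast
    then show "v \<in> {\<alpha> *s a + \<beta> *s b | \<alpha> \<beta>. True}" using *[of u] by blast
  next
    fix v assume "v \<in> {\<alpha> *s a + \<beta> *s b | \<alpha> \<beta>. True}"
    then obtain \<alpha> \<beta> where "v = frechet_derivative p (at z) (vector [\<alpha>, \<beta>])" using ** by auto
    then show "v \<in> tangent X (p z)" unfolding tangent_eq_range[OF p] by blast
  qed
qed

lemma volume_density_pos:
  assumes p: "holo_param X W p" "z \<in> W"
  shows "volume_density p z > 0"
proof -
  let ?a = "frechet_derivative p (at z) (axis 1 1)" and ?b = "frechet_derivative p (at z) (axis 2 1)"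
  obtain \<alpha> \<beta> \<gamma> \<delta> where o: "hprod (\<alpha> *s ?a + \<beta> *s ?b) (\<alpha> *s ?a + \<beta> *s ?b) = 1"
    "hprod (\<gamma> *s ?a + \<delta> *s ?b) (\<gamma> *s ?a + \<delta> *s ?b) = 1" "hprod (\<alpha> *s ?a + \<beta> *s ?b) (\<gamma> *s ?a + \<delta> *s ?b) = 0"
    using orthonormal_basis_exists[OF holo_param_basis(2)[OF p]] by blast
  then have "gram (\<alpha> *s ?a + \<beta> *s ?b) (\<gamma> *s ?a + \<delta> *s ?b) = 1" by (simp add: gram_def)
  then have "of_real ((cmod (\<alpha> * \<delta> - \<beta> * \<gamma>))\<^sup>2) * gram ?a ?b = 1" by (simp only: gram_lincomb)
  then have "Re (of_real ((cmod (\<alpha> * \<delta> - \<beta> * \<gamma>))\<^sup>2) * gram ?a ?b) = 1" by simp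
  then have "(cmod (\<alpha> * \<delta> - \<beta> * \<gamma>))\<^sup>2 * volume_density p z = 1" by (simp add: volume_density_gram)
  then have "0 < (cmod (\<alpha> * \<delta> - \<beta> * \<gamma>))\<^sup>2 * volume_density p z" by simp
  then show ?thesis unfolding zero_less_mult_iff using zero_le_power2[of "cmod (\<alpha> * \<delta> - \<beta> * \<gamma>)"] by linarith
qed

section \<open>Gluing the volumes of the charts to a measure on the surface\<close>

lemma holo_param_empty: "holo_param X {} p"
  by (auto simp: holo_param_def holomorphic_map_def homeomorphism_def)

lemma regular_part_borel:
  assumes "surface_regular_off_0 X"
  shows "X - {0} \<in> sets borel"
proof -
  obtain S where "open S" "closedin (top_of_set S) X" using assms by (auto simp: surface_regular_off_0_def)
  then show ?thesis by (auto simp: closedin_closed)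
qed

lemma holo_param_image_borel:
  assumes X: "surface_regular_off_0 X" and p: "holo_param X W p" and E: "E \<in> sets borel" "E \<subseteq> W"
  shows "p ` E \<in> sets borel"
proof -
  obtain T where "open T" "p ` W = (X - {0}) \<inter> T" using holo_paramD(6)[OF p] by (auto simp: openin_open)
  then have pW: "p ` W \<in> sets borel" using regular_part_borel[OF X] by auto
  obtain q where q: "homeomorphism W (p ` W) p q" using p by (auto simp: holo_param_def)
  have "(\<lambda>x. indicator (p ` W) x *\<^sub>R q x) \<in> borel \<rightarrow>\<^sub>M borel"
    by (rule borel_measurable_vanishing_extension[OF homeomorphism_cont2[OF q] pW]) simp
  from measurable_sets[OF this E(1)]
  have "p ` W \<inter> (\<lambda>x. indicator (p ` W) x *\<^sub>R q x) -` E \<in> sets borel" using pW by auto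
  also have "p ` W \<inter> (\<lambda>x. indicator (p ` W) x *\<^sub>R q x) -` E = p ` E"
    using q E(2) by (force simp: homeomorphism_def)
  finally show ?thesis .
qed

lemma holo_param_deriv_continuous_on:
  assumes "holo_param X W p"
  shows "continuous_on W (\<lambda>z. frechet_derivative p (at z) v)"
  using holomorphic_map_deriv[OF holo_paramD(2,1)[OF assms]] holomorphic_map_continuous_on by blast

lemma continuous_on_hprod:
  assumes "continuous_on W a" "continuous_on W b"
  shows "continuous_on W (\<lambda>z. hprod (a z) (b z))"
  unfolding hprod_def using assms by (intro continuous_intros)

lemma volume_density_continuous_on:
  assumes "holo_param X W p"
  shows "continuous_on W (volume_density p)"
  unfolding volume_density_gram [abs_def] gram_def
  by (intro continuous_intros continuous_on_hprod holo_param_deriv_continuous_on[OF assms])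

lemma volume_density_measurable:
  assumes "holo_param X W p" "E \<in> sets borel" "E \<subseteq> W"
  shows "(\<lambda>z. indicator E z * volume_density p z) \<in> borel_measurable borel"
    "(\<lambda>z. indicator E z * ennreal (volume_density p z)) \<in> borel_measurable borel"
proof -
  show *: "(\<lambda>z. indicator E z * volume_density p z) \<in> borel_measurable borel"
    using borel_measurable_vanishing_extension[OF volume_density_continuous_on[OF assms(1)] assms(2,3)] by simp
  have "(\<lambda>z. ennreal (indicator E z * volume_density p z)) \<in> borel_measurable borel" using * by simp
  also have "(\<lambda>z. ennreal (indicator E z * volume_density p z)) = (\<lambda>z. indicator E z * ennreal (volume_density p z))"
    by (auto simp: indicator_def)
  finally show "(\<lambda>z. indicator E z * ennreal (volume_density p z)) \<in> borel_measurable borel" .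
qed

text \<open>The volume of a single chart as a measure on all of \<open>complex^3\<close>. The
  parametrization is extended by 0 outside \<open>W\<close>, where the density vanishes, so the
  extension contributes nothing.\<close>

definition chart_volume :: "(complex^2) set \<Rightarrow> (complex^2 \<Rightarrow> complex^3) \<Rightarrow> (complex^3) measure" where
  "chart_volume W p = distr (density lborel (\<lambda>z. indicator W z * ennreal (volume_density p z))) borel
     (\<lambda>z. indicator W z *\<^sub>R p z)"

lemma emeasure_chart_volume:
  assumes p: "holo_param X W p" and A: "A \<in> sets borel"
  shows "emeasure (chart_volume W p) A = (\<integral>\<^sup>+z\<in>{z\<in>W. p z \<in> A}. ennreal (volume_density p z) \<partial>lborel)"
    "{z\<in>W. p z \<in> A} \<in> sets borel"
proof -
  have W: "W \<in> sets borel" using holo_paramD(1)[OF p] by simp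
  have p': "(\<lambda>z. indicator W z *\<^sub>R p z) \<in> borel \<rightarrow>\<^sub>M borel"
    by (rule borel_measurable_vanishing_extension[OF holo_paramD(5)[OF p] W]) simp
  note m = volume_density_measurable(2)[OF p W order_refl] measurable_sets[OF p' A]
  have "W \<inter> (\<lambda>z. indicator W z *\<^sub>R p z) -` A \<in> sets borel" using W m(2) by auto
  also have "W \<inter> (\<lambda>z. indicator W z *\<^sub>R p z) -` A = {z\<in>W. p z \<in> A}" by auto
  finally show "{z\<in>W. p z \<in> A} \<in> sets borel" .
  have "emeasure (chart_volume W p) A =
     (\<integral>\<^sup>+z. indicator W z * ennreal (volume_density p z) * indicator ((\<lambda>z. indicator W z *\<^sub>R p z) -` A) z \<partial>lborel)"
    unfolding chart_volume_def using p' A m by (simp add: emeasure_distr emeasure_density)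
  also have "\<dots> = (\<integral>\<^sup>+z\<in>{z\<in>W. p z \<in> A}. ennreal (volume_density p z) \<partial>lborel)"
    by (intro nn_integral_cong) (auto simp: indicator_def)
  finally show "emeasure (chart_volume W p) A = (\<integral>\<^sup>+z\<in>{z\<in>W. p z \<in> A}. ennreal (volume_density p z) \<partial>lborel)" .
qed

text \<open>The transition map is a holomorphic change of variables, and its Jacobian is the
  quotient of the two volume densities.\<close>

lemma chart_volume_consistent:
  assumes X: "surface_regular_off_0 X" and p: "holo_param X W p" and p': "holo_param X W' p'"
    and A: "A \<in> sets borel" "A \<subseteq> p ` W" "A \<subseteq> p' ` W'"
  shows "emeasure (chart_volume W p) A = emeasure (chart_volume W' p') A"
proof -
  define \<tau> where "\<tau> = (\<lambda>z. inv_into W' p' (p z))"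
  define E where "E = {z\<in>W. p z \<in> A}"
  define E' where "E' = {z\<in>W'. p' z \<in> A}"
  have EB: "E \<in> sets borel" "E' \<in> sets borel" "E \<subseteq> W" "E' \<subseteq> W'"
    using emeasure_chart_volume(2)[OF p A(1)] emeasure_chart_volume(2)[OF p' A(1)] by (auto simp: E_def E'_def)
  have inv: "inv_into W' p' (p' w) = w" if "w \<in> W'" for w using that holo_paramD(4)[OF p'] by simp
  have p\<tau>: "p' (\<tau> z) = p z" "\<tau> z \<in> W'" if "z \<in> E" for z
    using that A(3) unfolding \<tau>_def E_def by (auto intro: f_inv_into_f inv_into_into)
  have \<tau>F: "\<tau> ` F = {w\<in>W'. p' w \<in> p ` F}" if "F \<subseteq> E" for F
    using that p\<tau> inv by (auto simp: \<tau>_def image_iff) (metis subsetD)+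
  have \<tau>E: "\<tau> ` E = E'" unfolding \<tau>F[OF order_refl] E'_def using A(2) by (auto simp: E_def)
  have "\<forall>z\<in>E. \<exists>L. (\<tau> has_derivative L) (at z) \<and> (\<forall>v. frechet_derivative p' (at (\<tau> z)) (L v) = frechet_derivative p (at z) v)
      \<and> (\<forall>c v. L (c *s v) = c *s L v)"
  proof
    fix z assume "z \<in> E"
    then have "z \<in> W" "p z \<in> p' ` W'" using A(3) by (auto simp: E_def)
    from holo_param_transition[OF p p' this]
    show "\<exists>L. (\<tau> has_derivative L) (at z) \<and> (\<forall>v. frechet_derivative p' (at (\<tau> z)) (L v) = frechet_derivative p (at z) v)
      \<and> (\<forall>c v. L (c *s v) = c *s L v)" unfolding \<tau>_def by metis
  qed
  then obtain L where L: "\<And>z. z \<in> E \<Longrightarrow> (\<tau> has_derivative L z) (at z)"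
    "\<And>z v. z \<in> E \<Longrightarrow> frechet_derivative p' (at (\<tau> z)) (L z v) = frechet_derivative p (at z) v"
    "\<And>z c v. z \<in> E \<Longrightarrow> L z (c *s v) = c *s L z v" by metis
  have inj: "inj_on \<tau> E"
    by (rule inj_onI) (metis EB(3) holo_paramD(4)[OF p] inj_onD p\<tau>(1) subsetD)
  have vol: "volume_density p z = (cmod (cdet (L z)))\<^sup>2 * volume_density p' (\<tau> z)" if "z \<in> E" for z
    using volume_density_transition[OF p _ p' p\<tau>(2)[OF that] L(2)[OF that]] that EB(3) by blast
  define J where "J z = (cmod (cdet (frechet_derivative \<tau> (at z))))\<^sup>2" for z
  have J: "J z = (cmod (cdet (L z)))\<^sup>2" if "z \<in> E" for z
    unfolding J_def frechet_derivative_eqI[OF L(1)[OF that]] ..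
  have \<tau>cont: "continuous_on E \<tau>"
    using L(1) by (auto intro!: continuous_at_imp_continuous_on has_derivative_continuous)
  have \<tau>m: "(\<lambda>z. indicator E z *\<^sub>R \<tau> z) \<in> borel \<rightarrow>\<^sub>M borel"
    by (rule borel_measurable_vanishing_extension[OF \<tau>cont EB(1)]) simp
  have pos: "volume_density p' w > 0" if "w \<in> W'" for w
    using volume_density_pos[OF p' that] .
  \<comment> \<open>Measurability of the Jacobian on Borel subsets of \<open>E\<close> follows from
    its expression as a quotient of the two densities, the second one composed with \<tau>.\<close>
  have Jm: "(\<lambda>z. indicator F z * J z) \<in> borel_measurable borel" if F: "F \<in> sets borel" "F \<subseteq> E" for F
  proof -
    have "(\<lambda>z. indicator W' (indicator E z *\<^sub>R \<tau> z) * volume_density p' (indicator E z *\<^sub>R \<tau> z)) \<in> borel_measurable borel"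
      by (rule measurable_compose[OF \<tau>m volume_density_measurable(1)[OF p']]) (use holo_paramD(1)[OF p'] in auto)
    then have "(\<lambda>z. indicator F z * volume_density p z / (indicator W' (indicator E z *\<^sub>R \<tau> z) * volume_density p' (indicator E z *\<^sub>R \<tau> z)))
        \<in> borel_measurable borel"
      using volume_density_measurable(1)[OF p F(1)] F EB(3) by (intro borel_measurable_divide) auto
    also have "(\<lambda>z. indicator F z * volume_density p z / (indicator W' (indicator E z *\<^sub>R \<tau> z) * volume_density p' (indicator E z *\<^sub>R \<tau> z)))
        = (\<lambda>z. indicator F z * J z)"
    proof
      fix z
      show "indicator F z * volume_density p z / (indicator W' (indicator E z *\<^sub>R \<tau> z) * volume_density p' (indicator E z *\<^sub>R \<tau> z))
        = indicator F z * J z"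
      proof (cases "z \<in> F")
        case True
        then have z: "z \<in> E" using F by auto
        then show ?thesis using True pos[OF p\<tau>(2)[OF z]] p\<tau>(2)[OF z] by (simp add: vol J)
      qed simp
    qed
    finally show ?thesis .
  qed
  have img: "\<tau> ` F \<in> sets borel" if F: "F \<in> sets borel" "F \<subseteq> E" for F
    unfolding \<tau>F[OF F(2)]
    by (rule emeasure_chart_volume(2)[OF p' holo_param_image_borel[OF X p F(1)]]) (use F EB in auto)
  have em: "emeasure lborel (\<tau> ` F) = (\<integral>\<^sup>+z\<in>F. ennreal (J z) \<partial>lborel)" if F: "F \<in> sets borel" "F \<subseteq> E" for F
    by (rule emeasure_holomorphic_image[OF F(1) img[OF F] L(1) inj_on_subset[OF inj F(2)] L(3) J Jm[OF F]])
       (use F in auto)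
  have Jm': "(\<lambda>z. indicator E z * ennreal (J z)) \<in> borel_measurable borel"
  proof -
    have "(\<lambda>z. ennreal (indicator E z * J z)) \<in> borel_measurable borel" using Jm[OF EB(1)] by simp
    also have "(\<lambda>z. ennreal (indicator E z * J z)) = (\<lambda>z. indicator E z * ennreal (J z))"
      by (auto simp: indicator_def)
    finally show ?thesis .
  qed
  have "(\<integral>\<^sup>+w\<in>\<tau> ` E. indicator W' w * ennreal (volume_density p' w) \<partial>lborel) =
      (\<integral>\<^sup>+z\<in>E. (indicator W' (\<tau> z) * ennreal (volume_density p' (\<tau> z))) * ennreal (J z) \<partial>lborel)"
    by (rule nn_integral_image[where t'="\<lambda>z. indicator E z *\<^sub>R \<tau> z"])
       (use EB \<tau>m Jm' img em volume_density_measurable(2)[OF p'] holo_paramD(1)[OF p'] in auto)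
  also have "\<dots> = (\<integral>\<^sup>+z\<in>E. ennreal (volume_density p z) \<partial>lborel)"
    using p\<tau>(2) pos[THEN less_imp_le]
    by (intro nn_integral_cong) (auto simp: indicator_def vol J ennreal_mult[symmetric] mult.commute)
  also have "(\<integral>\<^sup>+w\<in>\<tau> ` E. indicator W' w * ennreal (volume_density p' w) \<partial>lborel) = (\<integral>\<^sup>+w\<in>E'. ennreal (volume_density p' w) \<partial>lborel)"
    unfolding \<tau>E using EB(4) by (intro nn_integral_cong) (auto simp: indicator_def)
  finally show ?thesis
    unfolding emeasure_chart_volume(1)[OF p A(1)] emeasure_chart_volume(1)[OF p' A(1)] E_def E'_def by simp
qed

lemma holo_param_countable_cover:
  assumes "surface_regular_off_0 X"
  obtains W p where "\<And>n::nat. holo_param X (W n) (p n)" "X - {0} = (\<Union>n. p n ` W n)"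
proof -
  let ?F = "{S. \<exists>W p. S = p ` W \<and> holo_param X W p}"
  have op: "openin (top_of_set (X - {0})) S" if "S \<in> ?F" for S using that holo_paramD(6) by auto
  obtain F' where F': "F' \<subseteq> ?F" "countable F'" "\<Union>F' = \<Union>?F"
    by (rule Lindelof_openin[OF op])
  have un: "\<Union>?F = X - {0}"
  proof (intro equalityI subsetI)
    fix x assume "x \<in> \<Union>?F"
    then show "x \<in> X - {0}" using holo_paramD(7) by fastforce
  next
    fix x assume "x \<in> X - {0}"
    then obtain W p where "holo_param X W p" "x \<in> p ` W" using assms unfolding surface_regular_off_0_def by blast
    then show "x \<in> \<Union>?F" by auto
  qed
  \<comment> \<open>The empty set, which is the image of an empty chart, makes the family nonempty,
    so that it can be enumerated even if no chart was selected.\<close>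
  define G where "G = insert {} F'"
  have G: "countable G" "G \<noteq> {}" "\<Union>G = X - {0}" using F' un by (auto simp: G_def)
  have "{} \<in> ?F" using holo_param_empty[of X "\<lambda>_. 0"] by (auto intro!: exI[of _ "{}"])
  then have GF: "G \<subseteq> ?F" using F'(1) by (simp add: G_def)
  have "\<exists>W p. from_nat_into G n = p ` W \<and> holo_param X W p" for n
    using subsetD[OF GF from_nat_into[OF G(2), of n]] by simp
  then obtain W p where Wp: "\<And>n. from_nat_into G n = p n ` W n" "\<And>n. holo_param X (W n) (p n)" by metis
  have "X - {0} = (\<Union>n. from_nat_into G n)"
    unfolding G(3)[symmetric] by (subst range_from_nat_into[OF G(2,1), symmetric]) simp
  also have "\<dots> = (\<Union>n. p n ` W n)" by (simp only: Wp(1))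
  finally show ?thesis using that Wp(2) by blast
qed

lemma suminf_ennreal_swap: "(\<Sum>i. \<Sum>n. f i n) = (\<Sum>n. \<Sum>i. f i n :: ennreal)"
proof -
  have "(\<Sum>n. \<Sum>i. f i n) = (\<integral>\<^sup>+n. (\<Sum>i. f i n) \<partial>count_space UNIV)"
    by (rule nn_integral_count_space_nat[symmetric])
  also have "\<dots> = (\<Sum>i. \<integral>\<^sup>+n. f i n \<partial>count_space UNIV)"
    by (rule nn_integral_suminf) simp
  finally show ?thesis by (simp add: nn_integral_count_space_nat)
qed

text \<open>Existence: the chart volumes are added over a disjoint refinement of a countable cover,
  and consistency on overlaps shows that every other chart gets the right value. Uniqueness makes
  the definite description meaningful: the values on images of charts are prescribed and the rest is
  a null set.\<close>

theorem volume_measure: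
  assumes X: "surface_regular_off_0 X"
  shows "is_volume_measure X (volume_measure X)"
proof -
  obtain W p where Wp: "\<And>n::nat. holo_param X (W n) (p n)" "X - {0} = (\<Union>n. p n ` W n)"
    using holo_param_countable_cover[OF X] by blast
  define D where "D = disjointed (\<lambda>n. p n ` W n)"
  have Wb: "W n \<in> sets borel" for n using holo_paramD(1)[OF Wp(1)] by simp
  have D: "D n \<in> sets borel" "D n \<subseteq> p n ` W n" "disjoint_family D" "(\<Union>n. D n) = X - {0}" for n
    using sets.range_disjointed_sets[of "\<lambda>n. p n ` W n" borel] holo_param_image_borel[OF X Wp(1) Wb]
      disjointed_subset[of "\<lambda>n. p n ` W n" n] disjoint_family_disjointed[of "\<lambda>n. p n ` W n"]
      UN_disjointed_eq[of "\<lambda>n. p n ` W n"] Wp(2)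
    by (auto simp: D_def)
  define m where "m A = (\<Sum>n. emeasure (chart_volume (W n) (p n)) (A \<inter> D n))" for A
  define \<mu> where "\<mu> = measure_of UNIV (sets borel) m"
  have sets_cv [simp]: "sets (chart_volume W' p') = sets borel" for W' p' by (simp add: chart_volume_def)
  have em: "emeasure \<mu> A = m A" if "A \<in> sets borel" for A
    unfolding \<mu>_def
  proof (rule emeasure_measure_of_sigma[OF _ _ _ that])
    show "sigma_algebra UNIV (sets borel)" using sets.sigma_algebra_axioms[of borel] by simp
    show "positive (sets borel) m" by (simp add: positive_def m_def)
    show "countably_additive (sets borel) m"
    proof (rule countably_additiveI)
      fix A :: "nat \<Rightarrow> (complex^3) set" assume A: "range A \<subseteq> sets borel" "disjoint_family A"
      have "(\<Sum>i. m (A i)) = (\<Sum>n. \<Sum>i. emeasure (chart_volume (W n) (p n)) (A i \<inter> D n))"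
        unfolding m_def by (rule suminf_ennreal_swap)
      also have "\<dots> = (\<Sum>n. emeasure (chart_volume (W n) (p n)) (\<Union>i. A i \<inter> D n))"
      proof (rule suminf_cong, rule suminf_emeasure)
        fix n show "range (\<lambda>i. A i \<inter> D n) \<subseteq> sets (chart_volume (W n) (p n))" using A D by auto
        show "disjoint_family (\<lambda>i. A i \<inter> D n)" using A(2) by (auto simp: disjoint_family_on_def)
      qed
      finally show "(\<Sum>i. m (A i)) = m (\<Union>(range A))" by (simp add: m_def)
    qed
  qed
  have sets_\<mu>: "sets \<mu> = sets borel"
    using sets.sigma_sets_eq[of "borel :: (complex^3) measure"] by (simp add: \<mu>_def)
  have vol: "is_volume_measure X \<mu>"
    unfolding is_volume_measure_def
  proof (intro conjI allI impI sets_\<mu>)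
    have "- (X - {0}) \<inter> D n = {}" for n using D(4) by blast
    then show "emeasure \<mu> (- (X - {0})) = 0"
      unfolding em[OF borel_comp[OF regular_part_borel[OF X]]] m_def by (simp only: emeasure_empty suminf_zero)
    fix W' p' E assume p': "holo_param X W' p'" and E: "E \<in> sets borel" "E \<subseteq> W'"
    have pE: "p' ` E \<in> sets borel" by (rule holo_param_image_borel[OF X p' E])
    have "emeasure \<mu> (p' ` E) = (\<Sum>n. emeasure (chart_volume W' p') (p' ` E \<inter> D n))"
      unfolding em[OF pE] m_def
      by (rule suminf_cong, rule chart_volume_consistent[OF X Wp(1) p']) (use pE D E in auto)
    also have "\<dots> = emeasure (chart_volume W' p') (\<Union>n. p' ` E \<inter> D n)"
      by (rule suminf_emeasure) (use pE D in \<open>auto intro: disjoint_family_subset[OF D(3)]\<close>)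
    also have "(\<Union>n. p' ` E \<inter> D n) = p' ` E \<inter> (\<Union>n. D n)" by auto
    also have "\<dots> = p' ` E" unfolding D(4) using holo_paramD(7)[OF p'] E(2) by auto
    also have "emeasure (chart_volume W' p') (p' ` E) = (\<integral>\<^sup>+z\<in>{z\<in>W'. p' z \<in> p' ` E}. ennreal (volume_density p' z) \<partial>lborel)"
      by (rule emeasure_chart_volume(1)[OF p' pE])
    also have "{z\<in>W'. p' z \<in> p' ` E} = E" using holo_paramD(4)[OF p'] E(2) by (auto dest: inj_onD)
    finally show "emeasure \<mu> (p' ` E) = (\<integral>\<^sup>+z\<in>E. ennreal (volume_density p' z) \<partial>lborel)" .
  qed
  moreover have "\<mu>' = \<mu>" if \<mu>': "is_volume_measure X \<mu>'" for \<mu>'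
  proof (rule measure_eqI)
    show sets: "sets \<mu>' = sets \<mu>" using \<mu>' sets_\<mu> by (simp add: is_volume_measure_def)
    fix A assume "A \<in> sets \<mu>'"
    then have A: "A \<in> sets borel" using sets sets_\<mu> by simp
    define R where "R = X - {0}"
    have R: "R \<in> sets \<mu>'" "- R \<in> sets \<mu>'" "A \<in> sets \<mu>'"
      unfolding sets sets_\<mu> R_def using A regular_part_borel[OF X] borel_comp[OF regular_part_borel[OF X]] by blast+
    have "emeasure \<mu>' A = emeasure \<mu>' ((A \<inter> - R) \<union> (A \<inter> R))"
      by (rule arg_cong[where f="emeasure \<mu>'"]) blast
    also have "\<dots> = emeasure \<mu>' (A \<inter> - R) + emeasure \<mu>' (A \<inter> R)"
      by (rule plus_emeasure[symmetric]) (use R in auto)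
    also have "emeasure \<mu>' (A \<inter> - R) \<le> emeasure \<mu>' (- R)"
      by (rule emeasure_mono) (use R in auto)
    then have "emeasure \<mu>' (A \<inter> - R) = 0" using \<mu>' by (simp add: is_volume_measure_def R_def)
    also have "A \<inter> R = (\<Union>n. A \<inter> D n)" unfolding R_def D(4)[symmetric] by auto
    also have "emeasure \<mu>' (\<Union>n. A \<inter> D n) = (\<Sum>n. emeasure \<mu>' (A \<inter> D n))"
      by (rule suminf_emeasure[symmetric]) (use A D sets sets_\<mu> in \<open>auto intro: disjoint_family_subset[OF D(3)]\<close>)
    also have "(\<Sum>n. emeasure \<mu>' (A \<inter> D n)) = (\<Sum>n. emeasure (chart_volume (W n) (p n)) (A \<inter> D n))"
    proof (rule suminf_cong)
      fix n
      let ?E = "{z\<in>W n. p n z \<in> A \<inter> D n}"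
      have AD: "A \<inter> D n \<in> sets borel" using A D by auto
      have "A \<inter> D n = p n ` ?E" using D(2)[of n] by auto
      then have "emeasure \<mu>' (A \<inter> D n) = emeasure \<mu>' (p n ` ?E)" by (rule arg_cong)
      also have "\<dots> = (\<integral>\<^sup>+z\<in>?E. ennreal (volume_density (p n) z) \<partial>lborel)"
        using \<mu>' Wp(1) emeasure_chart_volume(2)[OF Wp(1) AD] unfolding is_volume_measure_def by blast
      finally show "emeasure \<mu>' (A \<inter> D n) = emeasure (chart_volume (W n) (p n)) (A \<inter> D n)"
        using emeasure_chart_volume(1)[OF Wp(1) AD] by simp
    qed
    finally show "emeasure \<mu>' A = emeasure \<mu> A" by (simp add: em[OF A] m_def)
  qed
  ultimately show ?thesis
    unfolding volume_measure_def by (rule theI)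
qed

section \<open>Transport of integrals from the surface to a chart\<close>

lemma holo_param_vanishing_extension:
  assumes p: "holo_param X W p"
  shows "(\<lambda>z. indicator W z *\<^sub>R p z) \<in> borel \<rightarrow>\<^sub>M borel"
  by (rule borel_measurable_vanishing_extension[OF holo_paramD(5)[OF p]]) (use holo_paramD(1)[OF p] in auto)

lemma distr_density_chart:
  assumes X: "surface_regular_off_0 X" and p: "holo_param X W p"
  shows "distr (density lborel (\<lambda>z. indicator W z * ennreal (volume_density p z))) borel (\<lambda>z. indicator W z *\<^sub>R p z)
     = density (volume_measure X) (indicator (p ` W))"
proof (rule distr_density_image)
  note V = volume_measure[OF X, unfolded is_volume_measure_def]
  show "sets (volume_measure X) = sets borel" using V by blast
  show "(\<lambda>z. indicator W z *\<^sub>R p z) \<in> borel \<rightarrow>\<^sub>M borel" by (rule holo_param_vanishing_extension[OF p])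
  show "(\<lambda>z. indicator W z * ennreal (volume_density p z)) \<in> borel_measurable borel"
    by (rule volume_density_measurable(2)[OF p]) (use holo_paramD(1)[OF p] in auto)
  show "p ` F \<in> sets borel" if "F \<in> sets borel" "F \<subseteq> W" for F
    by (rule holo_param_image_borel[OF X p that])
  show "emeasure (volume_measure X) (p ` F) = (\<integral>\<^sup>+z\<in>F. ennreal (volume_density p z) \<partial>lborel)"
    if "F \<in> sets borel" "F \<subseteq> W" for F using V p that by blast
qed (use holo_paramD(1)[OF p] in auto)

lemma chart_borel_extension:
  fixes m :: "complex^2 \<Rightarrow> 'b::real_normed_vector"
  assumes X: "surface_regular_off_0 X" and p: "holo_param X W p" and m: "continuous_on W m"
  shows "\<exists>k. k \<in> borel \<rightarrow>\<^sub>M borel \<and> (\<forall>z\<in>W. k (p z) = m z)"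
proof -
  obtain q where q: "homeomorphism W (p ` W) p q" using p by (auto simp: holo_param_def)
  have "continuous_on (p ` W) (\<lambda>x. m (q x))"
    by (rule continuous_on_compose2[OF m homeomorphism_cont2[OF q]]) (use q in \<open>auto simp: homeomorphism_def\<close>)
  then have "(\<lambda>x. indicator (p ` W) x *\<^sub>R m (q x)) \<in> borel \<rightarrow>\<^sub>M borel"
    by (rule borel_measurable_vanishing_extension)
       (use holo_param_image_borel[OF X p] holo_paramD(1)[OF p] in auto)
  then show ?thesis
    by (intro exI[of _ "\<lambda>x. indicator (p ` W) x *\<^sub>R m (q x)"] conjI ballI) (use q in \<open>auto simp: homeomorphism_def\<close>)
qed

text \<open>The function \<open>k\<close> is not assumed measurable. It will be the pointwise norm
  of a form, defined through frames that are chosen at each point separately, so it is replaced by a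
  Borel majorant.\<close>

lemma chart_measurable_majorant:
  assumes X: "surface_regular_off_0 X" and p: "holo_param X W p" and B: "continuous_on W B"
    and le: "\<And>z. z \<in> W \<Longrightarrow> k (p z) * volume_density p z \<le> B z"
  shows "\<exists>k'. k' \<in> borel_measurable borel \<and> (\<forall>x\<in>p ` W. ennreal (k x) \<le> k' x) \<and>
    (\<integral>\<^sup>+x\<in>p ` W. k' x \<partial>volume_measure X) = (\<integral>\<^sup>+z\<in>W. ennreal (B z) \<partial>lborel)"
proof -
  note V = volume_measure[OF X, unfolded is_volume_measure_def]
  have pos: "volume_density p z > 0" if "z \<in> W" for z by (rule volume_density_pos[OF p that])
  have c: "continuous_on W (\<lambda>z. B z / volume_density p z)"
    by (intro continuous_intros B volume_density_continuous_on[OF p]) (use pos in force)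
  obtain k' :: "complex^3 \<Rightarrow> real" where k': "k' \<in> borel_measurable borel" "\<And>z. z \<in> W \<Longrightarrow> k' (p z) = B z / volume_density p z"
    using chart_borel_extension[OF X p c] by blast
  have kk': "ennreal (k x) \<le> ennreal (k' x)" if "x \<in> p ` W" for x
    using that le pos k'(2) by (auto simp: pos_le_divide_eq intro!: ennreal_leI)
  have "(\<integral>\<^sup>+x\<in>p ` W. ennreal (k' x) \<partial>volume_measure X) = (\<integral>\<^sup>+z\<in>W. ennreal (k' (p z)) * ennreal (volume_density p z) \<partial>lborel)"
  proof (rule nn_integral_image)
    show "(\<lambda>z. indicator W z *\<^sub>R p z) \<in> borel \<rightarrow>\<^sub>M borel" by (rule holo_param_vanishing_extension[OF p])
    show "(\<lambda>z. indicator W z * ennreal (volume_density p z)) \<in> borel_measurable borel"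
      by (rule volume_density_measurable(2)[OF p]) (use holo_paramD(1)[OF p] in auto)
    show "p ` F \<in> sets borel" if "F \<in> sets borel" "F \<subseteq> W" for F
      by (rule holo_param_image_borel[OF X p that])
    show "emeasure (volume_measure X) (p ` F) = (\<integral>\<^sup>+z\<in>F. ennreal (volume_density p z) \<partial>lborel)"
      if "F \<in> sets borel" "F \<subseteq> W" for F using V p that by blast
  qed (use holo_paramD(1)[OF p] V k' in auto)
  also have "\<dots> = (\<integral>\<^sup>+z\<in>W. ennreal (B z) \<partial>lborel)"
  proof (rule nn_integral_cong)
    fix z
    show "ennreal (k' (p z)) * ennreal (volume_density p z) * indicator W z = ennreal (B z) * indicator W z"
    proof (cases "z \<in> W")
      case True
      then show ?thesis using pos[OF True]
        by (simp add: k'(2) ennreal_mult''[symmetric])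
    qed simp
  qed
  finally show ?thesis using kk' k'(1) by (intro exI[of _ "\<lambda>x. ennreal (k' x)"]) auto
qed

lemma holo_param_restrict:
  assumes p: "holo_param X W p" and W': "open W'" "W' \<subseteq> W"
  shows "holo_param X W' p"
proof -
  obtain q where q: "homeomorphism W (p ` W) p q" using p by (auto simp: holo_param_def)
  have "openin (top_of_set (p ` W)) (p ` W')"
    by (rule homeomorphism_imp_open_map[OF q]) (use W' in \<open>auto simp: openin_open\<close>)
  then have "openin (top_of_set (X - {0})) (p ` W')" using holo_paramD(6)[OF p] openin_trans by blast
  moreover have "homeomorphism W' (p ` W') p q"
    using homeomorphism_of_subsets[OF q W'(2)] by blast
  ultimately show ?thesis
    using W' holomorphic_map_subset[OF holo_paramD(2)[OF p] W'(2)] holo_paramD(3)[OF p]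
    unfolding holo_param_def by blast
qed

text \<open>Here \<omega> is known only through its product with the density along \<open>p\<close>,
  which is continuous. A Borel function with the same values on the chart takes its place, so
  measurability of \<omega> itself is never at issue.\<close>

lemma integral_chart:
  fixes \<omega> :: "complex^3 \<Rightarrow> complex"
  assumes X: "surface_regular_off_0 X" and p: "holo_param X W p" and w: "continuous_on W w"
    and eq: "\<And>z. z \<in> W \<Longrightarrow> \<omega> (p z) * of_real (volume_density p z) = w z"
  shows "set_integrable (volume_measure X) (p ` W) \<omega> \<longleftrightarrow> set_integrable lborel W w"
    "(LINT x:p ` W|volume_measure X. \<omega> x) = (LINT z:W|lborel. w z)"
proof -
  note V = volume_measure[OF X, unfolded is_volume_measure_def]
  have pos: "volume_density p z > 0" if "z \<in> W" for z by (rule volume_density_pos[OF p that])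
  have Wb: "W \<in> sets borel" using holo_paramD(1)[OF p] by simp
  have c: "continuous_on W (\<lambda>z. w z / of_real (volume_density p z))"
    by (intro continuous_intros w continuous_on_of_real volume_density_continuous_on[OF p]) (use pos in force)
  obtain k :: "complex^3 \<Rightarrow> complex" where k: "k \<in> borel_measurable borel" "\<And>z. z \<in> W \<Longrightarrow> k (p z) = w z / of_real (volume_density p z)"
    using chart_borel_extension[OF X p c] by blast
  have \<omega>k: "\<omega> (p z) = k (p z)" if "z \<in> W" for z
  proof -
    have "k (p z) * of_real (volume_density p z) = w z" using k(2) that pos[OF that] by simp
    then have "(\<omega> (p z) - k (p z)) * of_real (volume_density p z) = 0"
      by (simp only: left_diff_distrib eq[OF that] diff_self)
    then show ?thesis using pos[OF that] by simp
  qed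
  have pW: "p ` W \<in> sets borel" by (rule holo_param_image_borel[OF X p Wb order_refl])
  let ?p = "\<lambda>z. indicator W z *\<^sub>R p z"
  note p' = holo_param_vanishing_extension[OF p]
  have vm: "(\<lambda>z. indicator W z * volume_density p z) \<in> borel_measurable borel"
    by (rule volume_density_measurable(1)[OF p Wb order_refl])
  have d1: "(\<lambda>z. indicator W z * ennreal (volume_density p z)) = (\<lambda>z. ennreal (indicator W z * volume_density p z))"
    by (auto simp: indicator_def)
  have d2: "(indicator (p ` W) :: _ \<Rightarrow> ennreal) = (\<lambda>x. ennreal (indicator (p ` W) x))" by (auto simp: indicator_def)
  note M = distr_density_chart[OF X p, unfolded d1 d2]
  have sV: "sets (volume_measure X) = sets borel" using V by blast
  have kV: "k \<in> borel_measurable (volume_measure X)" "(indicator (p ` W) :: _ \<Rightarrow> real) \<in> borel_measurable (volume_measure X)"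
    using k(1) pW by (auto simp: measurable_cong_sets[OF sV])
  have nn: "indicator W z * volume_density p z \<ge> 0" for z using pos[of z] by (auto simp: indicator_def less_imp_le)
  have kp: "(\<lambda>z. k (?p z)) \<in> borel_measurable lborel" using measurable_compose[OF p' k(1)] by simp
  have cw: "(\<lambda>z. (indicator W z * volume_density p z) *\<^sub>R k (?p z)) = (\<lambda>z. indicator W z *\<^sub>R w z)"
  proof
    fix z
    show "(indicator W z * volume_density p z) *\<^sub>R k (?p z) = indicator W z *\<^sub>R w z"
      using pos[of z] k(2)[of z] by (cases "z \<in> W") (auto simp: scaleR_conv_of_real)
  qed
  have ck: "(\<lambda>x. indicator (p ` W) x *\<^sub>R \<omega> x) = (\<lambda>x. indicator (p ` W) x *\<^sub>R k x)"
  proof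
    fix x show "indicator (p ` W) x *\<^sub>R \<omega> x = indicator (p ` W) x *\<^sub>R k x"
      using \<omega>k by (cases "x \<in> p ` W") auto
  qed
  have "set_integrable (volume_measure X) (p ` W) \<omega> \<longleftrightarrow> integrable (density (volume_measure X) (\<lambda>x. ennreal (indicator (p ` W) x))) k"
    unfolding set_integrable_def ck by (subst integrable_density) (use kV in auto)
  also have "\<dots> \<longleftrightarrow> integrable (density lborel (\<lambda>z. ennreal (indicator W z * volume_density p z))) (\<lambda>z. k (?p z))"
    unfolding M[symmetric] by (rule integrable_distr_eq) (use p' k in auto)
  also have "\<dots> \<longleftrightarrow> set_integrable lborel W w"
    unfolding set_integrable_def cw[symmetric] by (rule integrable_density) (use kp vm nn in auto)
  finally show "set_integrable (volume_measure X) (p ` W) \<omega> \<longleftrightarrow> set_integrable lborel W w" .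
  have "(LINT x:p ` W|volume_measure X. \<omega> x) = integral\<^sup>L (density (volume_measure X) (\<lambda>x. ennreal (indicator (p ` W) x))) k"
    unfolding set_lebesgue_integral_def ck by (subst integral_density) (use kV in auto)
  also have "\<dots> = integral\<^sup>L (density lborel (\<lambda>z. ennreal (indicator W z * volume_density p z))) (\<lambda>z. k (?p z))"
    unfolding M[symmetric] by (rule integral_distr) (use p' k in auto)
  also have "\<dots> = (LINT z:W|lborel. w z)"
    unfolding set_lebesgue_integral_def cw[symmetric] by (rule integral_density) (use kp vm nn in auto)
  finally show "(LINT x:p ` W|volume_measure X. \<omega> x) = (LINT z:W|lborel. w z)" .
qed

section \<open>Frames and the pointwise algebra of forms\<close>

text \<open>Gram-Schmidt in a chart shows that the frame chosen by \<open>SOME\<close> has the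
  required properties. The last identity says that its Gram determinant is 1, expressed in the basis
  of the chart; it is what makes all later formulas independent of the choice.\<close>

lemma unitary_frame_chart:
  assumes p: "holo_param X W p" "z \<in> W"
  defines "a \<equiv> frechet_derivative p (at z) (axis 1 1)" and "b \<equiv> frechet_derivative p (at z) (axis 2 1)"
  obtains \<alpha> \<beta> \<gamma> \<delta> where
    "unitary_frame X (p z) = [\<alpha> *s a + \<beta> *s b, \<i> *s (\<alpha> *s a + \<beta> *s b), \<gamma> *s a + \<delta> *s b, \<i> *s (\<gamma> *s a + \<delta> *s b)]"
    "hprod (\<alpha> *s a + \<beta> *s b) (\<alpha> *s a + \<beta> *s b) = 1" "hprod (\<gamma> *s a + \<delta> *s b) (\<gamma> *s a + \<delta> *s b) = 1"
    "hprod (\<alpha> *s a + \<beta> *s b) (\<gamma> *s a + \<delta> *s b) = 0"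
    "(cmod (\<alpha> * \<delta> - \<beta> * \<gamma>))\<^sup>2 * volume_density p z = 1"
proof -
  note T = holo_param_basis(3)[OF p, folded a_def b_def]
  let ?P = "\<lambda>e. \<exists>u v. e = [u, \<i> *s u, v, \<i> *s v] \<and> u \<in> tangent X (p z) \<and> v \<in> tangent X (p z) \<and>
       hprod u u = 1 \<and> hprod v v = 1 \<and> hprod u v = 0"
  have "\<exists>e. ?P e"
  proof -
    obtain \<alpha> \<beta> \<gamma> \<delta> where o: "hprod (\<alpha> *s a + \<beta> *s b) (\<alpha> *s a + \<beta> *s b) = 1"
      "hprod (\<gamma> *s a + \<delta> *s b) (\<gamma> *s a + \<delta> *s b) = 1" "hprod (\<alpha> *s a + \<beta> *s b) (\<gamma> *s a + \<delta> *s b) = 0"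
      using orthonormal_basis_exists[OF holo_param_basis(2)[OF p, folded a_def b_def]] by blast
    show ?thesis unfolding T
      by (rule exI, rule exI[of _ "\<alpha> *s a + \<beta> *s b"], rule exI[of _ "\<gamma> *s a + \<delta> *s b"]) (use o in blast)
  qed
  then have "?P (unitary_frame X (p z))" unfolding unitary_frame_def by (rule someI_ex)
  then obtain u v where uv: "unitary_frame X (p z) = [u, \<i> *s u, v, \<i> *s v]" "u \<in> tangent X (p z)" "v \<in> tangent X (p z)"
    and o: "hprod u u = 1" "hprod v v = 1" "hprod u v = 0" by blast
  obtain \<alpha> \<beta> where u: "u = \<alpha> *s a + \<beta> *s b" using uv(2) unfolding T by blast
  obtain \<gamma> \<delta> where v: "v = \<gamma> *s a + \<delta> *s b" using uv(3) unfolding T by blast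
  have "gram u v = 1" by (simp add: gram_def o)
  then have "of_real ((cmod (\<alpha> * \<delta> - \<beta> * \<gamma>))\<^sup>2) * gram a b = 1" unfolding u v by (simp only: gram_lincomb)
  then have "Re (of_real ((cmod (\<alpha> * \<delta> - \<beta> * \<gamma>))\<^sup>2) * gram a b) = 1" by simp
  then have "(cmod (\<alpha> * \<delta> - \<beta> * \<gamma>))\<^sup>2 * volume_density p z = 1" by (simp add: volume_density_gram a_def b_def)
  then show ?thesis using that uv(1) o unfolding u v by blast
qed

lemma wedge_1_3:
  "wedge 1 3 \<phi> \<eta> x [v0, v1, v2, v3] =
    (\<phi> x [v0] * (\<eta> x [v1,v2,v3] - \<eta> x [v1,v3,v2] - \<eta> x [v2,v1,v3] + \<eta> x [v2,v3,v1] + \<eta> x [v3,v1,v2] - \<eta> x [v3,v2,v1])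
   - \<phi> x [v1] * (\<eta> x [v0,v2,v3] - \<eta> x [v0,v3,v2] - \<eta> x [v2,v0,v3] + \<eta> x [v2,v3,v0] + \<eta> x [v3,v0,v2] - \<eta> x [v3,v2,v0])
   + \<phi> x [v2] * (\<eta> x [v0,v1,v3] - \<eta> x [v0,v3,v1] - \<eta> x [v1,v0,v3] + \<eta> x [v1,v3,v0] + \<eta> x [v3,v0,v1] - \<eta> x [v3,v1,v0])
   - \<phi> x [v3] * (\<eta> x [v0,v1,v2] - \<eta> x [v0,v2,v1] - \<eta> x [v1,v0,v2] + \<eta> x [v1,v2,v0] + \<eta> x [v2,v0,v1] - \<eta> x [v2,v1,v0])) / 6"
proof -
  have f0: "finite {1::nat, 2, 3}" "0 \<notin> {1::nat, 2, 3}"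
    and f1: "finite {2::nat, 3}" "1 \<notin> {2::nat, 3}"
    and f2: "finite {3::nat}" "2 \<notin> {3::nat}" by auto
  have S: "{..<1 + 3} = {0::nat, 1, 2, 3}" by auto
  have f3: "fact 1 * fact 3 = (6 :: complex)" by (simp add: fact_numeral)
  have u: "[0..<1] = [0::nat]" "[1..<1 + 3] = [1::nat, 2, 3]" by (simp_all add: upt_rec)
  have n: "[v0, v1, v2, v3] ! 0 = v0" "[v0, v1, v2, v3] ! 1 = v1" "[v0, v1, v2, v3] ! 2 = v2" "[v0, v1, v2, v3] ! 3 = v3"
    by (simp_all add: eval_nat_numeral)
  show ?thesis
    unfolding wedge_def S u
    unfolding sum_over_permutations_insert[OF f0] sum_over_permutations_insert[OF f1] sum_over_permutations_insert[OF f2]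
    unfolding permutes_sing f3
    by (simp add: sign_swap_id permutation_swap_id permutation_compose sign_compose sign_id transpose_def n
        del: nth_Cons_numeral nth_Cons_0 nth_Cons_Suc One_nat_def) (simp add: algebra_simps)
qed

text \<open>In coordinates of the chart the assumption on \<eta> reads \<eta> = l \<and> dz1 \<and>
  dz2 with l conjugate-linear. The squared determinant of the frame cancels against the volume
  density. The constant 4 is the value of d(cnj z1) \<and> d(cnj z2) \<and> dz1 \<and> dz2 on e1,
  \<i> e1, e2, \<i> e2.\<close>

lemma wedge_1_3_frame:
  assumes p: "holo_param X W p" "z \<in> W"
  defines "a \<equiv> frechet_derivative p (at z) (axis 1 1)" and "b \<equiv> frechet_derivative p (at z) (axis 2 1)"
  assumes f: "\<And>\<alpha> \<beta>. \<phi> (p z) [\<alpha> *s a + \<beta> *s b] = cnj \<alpha> * f1 + cnj \<beta> * f2"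
    and \<eta>: "\<And>\<alpha> \<beta> \<gamma> \<delta> \<epsilon> \<zeta>. \<eta> (p z) [\<alpha> *s a + \<beta> *s b, \<gamma> *s a + \<delta> *s b, \<epsilon> *s a + \<zeta> *s b] =
      (cnj \<alpha> * l1 + cnj \<beta> * l2) * (\<gamma> * \<zeta> - \<delta> * \<epsilon>) - (cnj \<gamma> * l1 + cnj \<delta> * l2) * (\<alpha> * \<zeta> - \<beta> * \<epsilon>)
      + (cnj \<epsilon> * l1 + cnj \<zeta> * l2) * (\<alpha> * \<delta> - \<beta> * \<gamma>)"
  shows "wedge 1 3 \<phi> \<eta> (p z) (unitary_frame X (p z)) * of_real (volume_density p z) = 4 * (f1 * l2 - f2 * l1)"
proof -
  obtain \<alpha> \<beta> \<gamma> \<delta> where fr: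
    "unitary_frame X (p z) = [\<alpha> *s a + \<beta> *s b, \<i> *s (\<alpha> *s a + \<beta> *s b), \<gamma> *s a + \<delta> *s b, \<i> *s (\<gamma> *s a + \<delta> *s b)]"
    and D: "(cmod (\<alpha> * \<delta> - \<beta> * \<gamma>))\<^sup>2 * volume_density p z = 1"
    using unitary_frame_chart[OF p] unfolding a_def b_def by metis
  have i: "\<i> *s (\<alpha> *s a + \<beta> *s b) = (\<i> * \<alpha>) *s a + (\<i> * \<beta>) *s b" for \<alpha> \<beta> by (simp add: vec_eq_iff algebra_simps)
  have ii: "\<i> * (\<i> * x) = - x" for x by (simp add: mult.assoc[symmetric])
  have "wedge 1 3 \<phi> \<eta> (p z) (unitary_frame X (p z)) = 4 * (f1 * l2 - f2 * l1) * ((\<alpha> * \<delta> - \<beta> * \<gamma>) * cnj (\<alpha> * \<delta> - \<beta> * \<gamma>))"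
    unfolding fr i wedge_1_3 f \<eta>
    by (simp add: field_simps ii)
  also have "(\<alpha> * \<delta> - \<beta> * \<gamma>) * cnj (\<alpha> * \<delta> - \<beta> * \<gamma>) = of_real ((cmod (\<alpha> * \<delta> - \<beta> * \<gamma>))\<^sup>2)"
    by (simp only: complex_norm_square)
  finally have "wedge 1 3 \<phi> \<eta> (p z) (unitary_frame X (p z)) * of_real (volume_density p z) =
     4 * (f1 * l2 - f2 * l1) * of_real ((cmod (\<alpha> * \<delta> - \<beta> * \<gamma>))\<^sup>2 * volume_density p z)"
    by (simp only: of_real_mult mult.assoc)
  then show ?thesis by (simp only: D of_real_1 mult_1_right)
qed

lemma sum_le_sum_list:
  fixes g :: "'a \<Rightarrow> real"
  assumes "\<And>x. g x \<ge> 0"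
  shows "sum g (set xs) \<le> sum_list (map g xs)"
  by (induction xs) (auto simp: sum.insert_if assms add_increasing)

lemma sum_singletons: "(\<Sum>vs\<in>(\<lambda>w. [w]) ` S. f vs) = (\<Sum>w\<in>S. f [w])"
  by (subst sum.reindex) (auto simp: inj_on_def)

lemma sum_squares_bound': "(x + y)\<^sup>2 \<le> 2 * (x\<^sup>2 + y\<^sup>2)" for x y :: real
  using zero_le_power2[of "x - y"] by (simp add: power2_eq_square algebra_simps)

text \<open>Multiplication by the density turns the norm, which involves the inverse metric, into
  the norm of a combination of the chart vectors themselves. No lower bound for the metric is
  therefore needed near the singular point.\<close>

lemma form_norm_sq_frame:
  assumes p: "holo_param X W p" "z \<in> W"
  defines "a \<equiv> frechet_derivative p (at z) (axis 1 1)" and "b \<equiv> frechet_derivative p (at z) (axis 2 1)"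
  assumes f: "\<And>\<alpha> \<beta>. \<phi> (p z) [\<alpha> *s a + \<beta> *s b] = cnj \<alpha> * f1 + cnj \<beta> * f2"
  shows "form_norm_sq X 1 \<phi> (p z) * volume_density p z \<le> 4 * ((cmod f1)\<^sup>2 * (norm b)\<^sup>2 + (cmod f2)\<^sup>2 * (norm a)\<^sup>2)"
proof -
  obtain \<alpha> \<beta> \<gamma> \<delta> where fr:
    "unitary_frame X (p z) = [\<alpha> *s a + \<beta> *s b, \<i> *s (\<alpha> *s a + \<beta> *s b), \<gamma> *s a + \<delta> *s b, \<i> *s (\<gamma> *s a + \<delta> *s b)]"
    and o: "hprod (\<alpha> *s a + \<beta> *s b) (\<alpha> *s a + \<beta> *s b) = 1" "hprod (\<gamma> *s a + \<delta> *s b) (\<gamma> *s a + \<delta> *s b) = 1"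
    "hprod (\<alpha> *s a + \<beta> *s b) (\<gamma> *s a + \<delta> *s b) = 0"
    and D: "(cmod (\<alpha> * \<delta> - \<beta> * \<gamma>))\<^sup>2 * volume_density p z = 1"
    using unitary_frame_chart[OF p] unfolding a_def b_def by metis
  define u v where "u = \<alpha> *s a + \<beta> *s b" and "v = \<gamma> *s a + \<delta> *s b"
  let ?fu = "cnj \<alpha> * f1 + cnj \<beta> * f2" and ?fv = "cnj \<gamma> * f1 + cnj \<delta> * f2"
  have i: "\<i> *s (\<alpha> *s a + \<beta> *s b) = (\<i> * \<alpha>) *s a + (\<i> * \<beta>) *s b" for \<alpha> \<beta> by (simp add: vec_eq_iff algebra_simps)
  have fs: "\<phi> (p z) [u] = ?fu" "\<phi> (p z) [\<i> *s u] = - \<i> * ?fu" "\<phi> (p z) [v] = ?fv" "\<phi> (p z) [\<i> *s v] = - \<i> * ?fv"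
    unfolding u_def v_def i f by (simp_all add: algebra_simps)
  let ?S = "set [u, \<i> *s u, v, \<i> *s v]"
  have "{vs. set vs \<subseteq> ?S \<and> length vs = 1} = (\<lambda>w. [w]) ` ?S"
    by (auto simp: length_Suc_conv)
  then have "form_norm_sq X 1 \<phi> (p z) = (\<Sum>w\<in>?S. (cmod (\<phi> (p z) [w]))\<^sup>2)"
    unfolding form_norm_sq_def fr u_def[symmetric] v_def[symmetric]
    by (simp only: sum_singletons fact_1 div_by_1)
  \<comment> \<open>The norm sums over the set of frame vectors; the sum over the list bounds it
    whether or not entries coincide.\<close>
  also have "\<dots> \<le> sum_list (map (\<lambda>w. (cmod (\<phi> (p z) [w]))\<^sup>2) [u, \<i> *s u, v, \<i> *s v])"
    by (rule sum_le_sum_list) simp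
  also have "\<dots> = 2 * ((cmod ?fu)\<^sup>2 + (cmod ?fv)\<^sup>2)"
    by (simp only: list.map sum_list.Cons sum_list.Nil fs norm_mult) simp
  finally have 1: "form_norm_sq X 1 \<phi> (p z) \<le> 2 * ((cmod ?fu)\<^sup>2 + (cmod ?fv)\<^sup>2)" .
  have n: "norm u = 1" "norm v = 1" using o(1,2) unfolding u_def[symmetric] v_def[symmetric] hprod_self
    by (simp_all flip: of_real_power add: power2_eq_1_iff) (metis norm_ge_zero not_one_le_zero neg_0_le_iff_le)+
  have ouv: "hprod u v = 0" "hprod v u = 0" using o(3) hprod_cnj[of u v] unfolding u_def v_def by auto
  \<comment> \<open>\<open>?N\<close> is the tangent vector dual to the form up to the determinant
    of the frame. Its norm is computed once in the orthonormal frame and once in the chart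
    basis.\<close>
  let ?N = "cnj f1 *s b - cnj f2 *s a"
  have "cnj ?fu *s v + (- cnj ?fv) *s u = (\<alpha> * \<delta> - \<beta> * \<gamma>) *s ?N"
    unfolding u_def v_def by (simp add: vec_eq_iff algebra_simps)
  then have "hprod ((\<alpha> * \<delta> - \<beta> * \<gamma>) *s ?N) ((\<alpha> * \<delta> - \<beta> * \<gamma>) *s ?N) = hprod (cnj ?fu *s v + (- cnj ?fv) *s u) (cnj ?fu *s v + (- cnj ?fv) *s u)"
    by (simp only:)
  also have "\<dots> = ?fu * cnj ?fu + ?fv * cnj ?fv"
    unfolding hprod_add hprod_mult ouv using n by (simp add: hprod_self algebra_simps)
  also have "\<dots> = of_real ((cmod ?fu)\<^sup>2 + (cmod ?fv)\<^sup>2)"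
    by (simp only: complex_norm_square of_real_add)
  finally have "(cmod ?fu)\<^sup>2 + (cmod ?fv)\<^sup>2 = (cmod (\<alpha> * \<delta> - \<beta> * \<gamma>))\<^sup>2 * (norm ?N)\<^sup>2"
    unfolding hprod_self norm_vector_scalar_mult of_real_eq_iff by (simp add: power_mult_distrib)
  then have "((cmod ?fu)\<^sup>2 + (cmod ?fv)\<^sup>2) * volume_density p z = ((cmod (\<alpha> * \<delta> - \<beta> * \<gamma>))\<^sup>2 * volume_density p z) * (norm ?N)\<^sup>2"
    by (simp only: mult_ac)
  then have 2: "((cmod ?fu)\<^sup>2 + (cmod ?fv)\<^sup>2) * volume_density p z = (norm ?N)\<^sup>2" by (simp only: D mult_1_left)
  have "norm ?N \<le> cmod f1 * norm b + cmod f2 * norm a"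
    using norm_triangle_ineq4[of "cnj f1 *s b" "cnj f2 *s a"] by (simp add: norm_vector_scalar_mult)
  then have "(norm ?N)\<^sup>2 \<le> (cmod f1 * norm b + cmod f2 * norm a)\<^sup>2" by (rule power_mono) simp
  also have "\<dots> \<le> 2 * ((cmod f1 * norm b)\<^sup>2 + (cmod f2 * norm a)\<^sup>2)" by (rule sum_squares_bound')
  finally have 3: "(norm ?N)\<^sup>2 \<le> 2 * ((cmod f1)\<^sup>2 * (norm b)\<^sup>2 + (cmod f2)\<^sup>2 * (norm a)\<^sup>2)" by (simp add: power_mult_distrib)
  have "form_norm_sq X 1 \<phi> (p z) * volume_density p z \<le> 2 * ((cmod ?fu)\<^sup>2 + (cmod ?fv)\<^sup>2) * volume_density p z"
    by (rule mult_right_mono[OF 1]) (use volume_density_pos[OF p] in simp)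
  also have "\<dots> = 2 * (norm ?N)\<^sup>2" using 2 by (simp only: mult.assoc)
  finally show ?thesis using 3 by simp
qed

section \<open>Weighted homogeneous polynomials in two variables\<close>

text \<open>Coefficients and exponents are functions on a common index set, so that partial
  derivatives are again of this shape. Where an exponent 0 is lowered by truncated subtraction, the
  new coefficient is 0.\<close>

definition wpoly :: "'k set \<Rightarrow> ('k \<Rightarrow> complex) \<Rightarrow> ('k \<Rightarrow> nat) \<Rightarrow> ('k \<Rightarrow> nat) \<Rightarrow> complex \<Rightarrow> complex \<Rightarrow> complex" where
  "wpoly K c e d y z = (\<Sum>k\<in>K. c k * y ^ e k * z ^ d k)"

lemma wpoly_has_derivative:
  fixes y z :: "'a::real_normed_vector \<Rightarrow> complex"
  assumes "(y has_derivative y') (at v)" "(z has_derivative z') (at v)"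
  shows "((\<lambda>v. wpoly K c e d (y v) (z v)) has_derivative
    (\<lambda>w. wpoly K (\<lambda>k. c k * of_nat (e k)) (\<lambda>k. e k - 1) d (y v) (z v) * y' w
       + wpoly K (\<lambda>k. c k * of_nat (d k)) e (\<lambda>k. d k - 1) (y v) (z v) * z' w)) (at v)"
proof -
  have "((\<lambda>v. \<Sum>k\<in>K. c k * (y v ^ e k * z v ^ d k)) has_derivative
    (\<lambda>w. \<Sum>k\<in>K. c k * (y v ^ e k * (of_nat (d k) * z' w * z v ^ (d k - 1)) + (of_nat (e k) * y' w * y v ^ (e k - 1)) * z v ^ d k))) (at v)"
    by (intro has_derivative_sum has_derivative_mult_right has_derivative_mult has_derivative_power assms)
  moreover have "(\<Sum>k\<in>K. c k * (y v ^ e k * (of_nat (d k) * z' w * z v ^ (d k - 1)) + (of_nat (e k) * y' w * y v ^ (e k - 1)) * z v ^ d k))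
     = wpoly K (\<lambda>k. c k * of_nat (e k)) (\<lambda>k. e k - 1) d (y v) (z v) * y' w
       + wpoly K (\<lambda>k. c k * of_nat (d k)) e (\<lambda>k. d k - 1) (y v) (z v) * z' w" for w
    unfolding wpoly_def sum_distrib_right sum.distrib[symmetric]
    by (rule sum.cong[OF refl]) (simp add: algebra_simps)
  ultimately show ?thesis by (simp only: wpoly_def mult.assoc)
qed

text \<open>Euler's relation. Homogeneity is asked only for indices with nonzero coefficient, since
  the truncated exponents of the vanishing terms have the wrong weight.\<close>

lemma wpoly_euler:
  assumes "\<And>k. k \<in> K \<Longrightarrow> c k \<noteq> 0 \<Longrightarrow> a * e k + b * d k = m"
  shows "wpoly K (\<lambda>k. c k * of_nat (e k)) (\<lambda>k. e k - 1) d y z * (of_nat a * y)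
       + wpoly K (\<lambda>k. c k * of_nat (d k)) e (\<lambda>k. d k - 1) y z * (of_nat b * z) = of_nat m * wpoly K c e d y z"
  unfolding wpoly_def sum_distrib_right sum_distrib_left sum.distrib[symmetric]
proof (rule sum.cong[OF refl])
  fix k assume "k \<in> K"
  show "c k * of_nat (e k) * y ^ (e k - 1) * z ^ d k * (of_nat a * y) + c k * of_nat (d k) * y ^ e k * z ^ (d k - 1) * (of_nat b * z)
    = of_nat m * (c k * y ^ e k * z ^ d k)"
  proof (cases "c k = 0")
    case False
    then have m: "of_nat m = (of_nat a * of_nat (e k) + of_nat b * of_nat (d k) :: complex)"
      using assms[OF \<open>k \<in> K\<close>] by (metis of_nat_add of_nat_mult)
    have e1: "of_nat (e k) * y ^ (e k - 1) * y = of_nat (e k) * y ^ e k" by (cases "e k") auto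
    have e2: "of_nat (d k) * z ^ (d k - 1) * z = of_nat (d k) * z ^ d k" by (cases "d k") auto
    have e3: "c k * of_nat (e k) * y ^ (e k - 1) * z ^ d k * (of_nat a * y) + c k * of_nat (d k) * y ^ e k * z ^ (d k - 1) * (of_nat b * z)
      = c k * of_nat a * z ^ d k * (of_nat (e k) * y ^ (e k - 1) * y) + c k * of_nat b * y ^ e k * (of_nat (d k) * z ^ (d k - 1) * z)"
      by (simp only: mult_ac)
    show ?thesis unfolding e3 e1 e2 m by (simp add: algebra_simps)
  qed simp
qed

lemma wpoly_bound:
  assumes "\<And>k. k \<in> K \<Longrightarrow> c k \<noteq> 0 \<Longrightarrow> a * e k + b * d k = m"
    and "t \<ge> 0" "cmod y \<le> t ^ a" "cmod z \<le> t ^ b"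
  shows "cmod (wpoly K c e d y z) \<le> (\<Sum>k\<in>K. cmod (c k)) * t ^ m"
  unfolding wpoly_def sum_distrib_right
proof (rule sum_norm_le)
  fix k assume "k \<in> K"
  show "norm (c k * y ^ e k * z ^ d k) \<le> cmod (c k) * t ^ m"
  proof (cases "c k = 0")
    case False
    have "cmod y ^ e k * cmod z ^ d k \<le> (t ^ a) ^ e k * (t ^ b) ^ d k"
      using assms by (intro mult_mono power_mono) auto
    also have "\<dots> = t ^ m" using assms(1)[OF \<open>k \<in> K\<close> False] by (simp add: power_mult[symmetric] power_add[symmetric])
    finally show ?thesis by (simp add: norm_mult norm_power mult.assoc mult_left_mono)
  qed simp
qed

lemma holo_funI:
  assumes "\<And>z. z \<in> S \<Longrightarrow> (f has_derivative D z) (at z)" "\<And>z c v. D z (c *s v) = c * D z v"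
  shows "holo_fun f S"
  using assms unfolding holo_fun_def by blast

lemma insert_null_sets_lborel: "N \<in> null_sets lborel \<Longrightarrow> insert x N \<in> null_sets lborel"
  using null_sets.Un[of "{x}" lborel N] finite_imp_null_set_lborel[of "{x}"] by simp

text \<open>\<open>M\<close> is the set of exponents of a polynomial with all coefficients 1. The
  assumption \<open>isolated\<close> says that its gradient vanishes at the origin only, which makes
  the origin the only singular point of the double cover. The degree h may be odd.\<close>

locale weighted_poly =
  fixes M :: "(nat \<times> nat) set" and a b h :: nat
  assumes finite_M: "finite M"
    and weights: "\<And>i j. (i, j) \<in> M \<Longrightarrow> a * i + b * j = h"
    and a_pos: "a > 0" and b_pos: "b > 0" and ha: "2 * a < h" and hb: "2 * b < h"
    and isolated: "\<And>y z. wpoly M (\<lambda>k. of_nat (fst k)) (\<lambda>k. fst k - 1) snd y z = 0 \<Longrightarrow>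
      wpoly M (\<lambda>k. of_nat (snd k)) fst (\<lambda>k. snd k - 1) y z = 0 \<Longrightarrow> y = 0 \<and> z = 0"
begin

definition g :: "complex \<Rightarrow> complex \<Rightarrow> complex" where "g = wpoly M (\<lambda>_. 1) fst snd"
definition g1 :: "complex \<Rightarrow> complex \<Rightarrow> complex" where "g1 = wpoly M (\<lambda>k. of_nat (fst k)) (\<lambda>k. fst k - 1) snd"
definition g2 :: "complex \<Rightarrow> complex \<Rightarrow> complex" where "g2 = wpoly M (\<lambda>k. of_nat (snd k)) fst (\<lambda>k. snd k - 1)"

lemma isolated': "g1 y z = 0 \<Longrightarrow> g2 y z = 0 \<Longrightarrow> y = 0 \<and> z = 0"
  using isolated unfolding g1_def g2_def by blast

lemma weights_g1: "k \<in> M \<Longrightarrow> of_nat (fst k) \<noteq> (0::complex) \<Longrightarrow> a * (fst k - 1) + b * snd k = h - a"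
  by (cases k; cases "fst k") (use weights in \<open>force+\<close>)

lemma weights_g2: "k \<in> M \<Longrightarrow> of_nat (snd k) \<noteq> (0::complex) \<Longrightarrow> a * fst k + b * (snd k - 1) = h - b"
  by (cases k; cases "snd k") (use weights in \<open>force+\<close>)

lemma g_has_derivative:
  fixes y z :: "'a::real_normed_vector \<Rightarrow> complex"
  assumes "(y has_derivative y') (at v)" "(z has_derivative z') (at v)"
  shows "((\<lambda>v. g (y v) (z v)) has_derivative (\<lambda>w. g1 (y v) (z v) * y' w + g2 (y v) (z v) * z' w)) (at v)"
  using wpoly_has_derivative[OF assms, of M "\<lambda>_. 1" fst snd] by (simp add: g_def g1_def g2_def)

definition g11 :: "complex \<Rightarrow> complex \<Rightarrow> complex" where
  "g11 = wpoly M (\<lambda>k. of_nat (fst k) * of_nat (fst k - 1)) (\<lambda>k. fst k - 1 - 1) snd"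
definition g12 :: "complex \<Rightarrow> complex \<Rightarrow> complex" where
  "g12 = wpoly M (\<lambda>k. of_nat (fst k) * of_nat (snd k)) (\<lambda>k. fst k - 1) (\<lambda>k. snd k - 1)"
definition g22 :: "complex \<Rightarrow> complex \<Rightarrow> complex" where
  "g22 = wpoly M (\<lambda>k. of_nat (snd k) * of_nat (snd k - 1)) fst (\<lambda>k. snd k - 1 - 1)"

lemma g1_has_derivative:
  fixes y z :: "'a::real_normed_vector \<Rightarrow> complex"
  assumes "(y has_derivative y') (at v)" "(z has_derivative z') (at v)"
  shows "((\<lambda>v. g1 (y v) (z v)) has_derivative (\<lambda>w. g11 (y v) (z v) * y' w + g12 (y v) (z v) * z' w)) (at v)"
  using wpoly_has_derivative[OF assms, of M "\<lambda>k. of_nat (fst k)" "\<lambda>k. fst k - 1" snd]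
  by (simp add: g1_def g11_def g12_def)

lemma g2_has_derivative:
  fixes y z :: "'a::real_normed_vector \<Rightarrow> complex"
  assumes "(y has_derivative y') (at v)" "(z has_derivative z') (at v)"
  shows "((\<lambda>v. g2 (y v) (z v)) has_derivative (\<lambda>w. g12 (y v) (z v) * y' w + g22 (y v) (z v) * z' w)) (at v)"
  using wpoly_has_derivative[OF assms, of M "\<lambda>k. of_nat (snd k)" fst "\<lambda>k. snd k - 1"]
  by (simp add: g2_def g22_def g12_def mult.commute)

lemma euler: "g1 y z * (of_nat a * y) + g2 y z * (of_nat b * z) = of_nat h * g y z"
  using wpoly_euler[of M "\<lambda>_. 1" a fst b snd h y z] weights by (force simp: g_def g1_def g2_def)

lemma euler1: "g11 y z * (of_nat a * y) + g12 y z * (of_nat b * z) = of_nat (h - a) * g1 y z"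
  unfolding g1_def g11_def g12_def by (rule wpoly_euler) (rule weights_g1)

lemma euler2: "g12 y z * (of_nat a * y) + g22 y z * (of_nat b * z) = of_nat (h - b) * g2 y z"
  using wpoly_euler[of M "\<lambda>k. of_nat (snd k)" a fst b "\<lambda>k. snd k - 1" "h - b" y z] weights_g2
  by (simp add: g2_def g22_def g12_def mult.commute)

lemma bounds:
  obtains C where "C > 0" "\<And>t y z. t \<ge> 0 \<Longrightarrow> cmod y \<le> t ^ a \<Longrightarrow> cmod z \<le> t ^ b \<Longrightarrow>
    cmod (g y z) \<le> C * t ^ h \<and> cmod (g1 y z) \<le> C * t ^ (h - a) \<and> cmod (g2 y z) \<le> C * t ^ (h - b)"
proof -
  let ?C0 = "\<Sum>k\<in>M. cmod 1" and ?C1 = "\<Sum>k\<in>M. cmod (of_nat (fst k))" and ?C2 = "\<Sum>k\<in>M. cmod (of_nat (snd k))"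
  define C where "C = 1 + ?C0 + ?C1 + ?C2"
  have pos: "?C0 \<ge> 0" "?C1 \<ge> 0" "?C2 \<ge> 0" by (intro sum_nonneg; simp)+
  then have C: "C > 0" "?C0 \<le> C" "?C1 \<le> C" "?C2 \<le> C" by (auto simp: C_def)
  have "cmod (g y z) \<le> C * t ^ h \<and> cmod (g1 y z) \<le> C * t ^ (h - a) \<and> cmod (g2 y z) \<le> C * t ^ (h - b)"
    if t: "t \<ge> 0" "cmod y \<le> t ^ a" "cmod z \<le> t ^ b" for t y z
  proof (intro conjI)
    have "cmod (g y z) \<le> ?C0 * t ^ h" unfolding g_def by (rule wpoly_bound[OF _ t]) (use weights in auto)
    also have "\<dots> \<le> C * t ^ h" using C t by (intro mult_right_mono) auto
    finally show "cmod (g y z) \<le> C * t ^ h" .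
    have "cmod (g1 y z) \<le> ?C1 * t ^ (h - a)" unfolding g1_def by (rule wpoly_bound[OF weights_g1 t])
    also have "\<dots> \<le> C * t ^ (h - a)" using C t by (intro mult_right_mono) auto
    finally show "cmod (g1 y z) \<le> C * t ^ (h - a)" .
    have "cmod (g2 y z) \<le> ?C2 * t ^ (h - b)" unfolding g2_def by (rule wpoly_bound[OF weights_g2 t])
    also have "\<dots> \<le> C * t ^ (h - b)" using C t by (intro mult_right_mono) auto
    finally show "cmod (g2 y z) \<le> C * t ^ (h - b)" .
  qed
  with C(1) show ?thesis using that by blast
qed

lemma gradient_0: "g1 0 0 = 0" "g2 0 0 = 0"
proof -
  obtain C where C: "C > 0" "\<And>t y z. t \<ge> 0 \<Longrightarrow> cmod y \<le> t ^ a \<Longrightarrow> cmod z \<le> t ^ b \<Longrightarrow>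
    cmod (g y z) \<le> C * t ^ h \<and> cmod (g1 y z) \<le> C * t ^ (h - a) \<and> cmod (g2 y z) \<le> C * t ^ (h - b)"
    using bounds by blast
  have "h - a > 0" "h - b > 0" using ha hb by auto
  then have "g1 0 0 = 0" "g2 0 0 = 0" using C(2)[of 0 0 0] a_pos b_pos by (auto simp: zero_power)
  then show "g1 0 0 = 0" "g2 0 0 = 0" by auto
qed

lemma has_derivative_coord: "((\<lambda>v::complex^'n. v $ i) has_derivative (\<lambda>w. w $ i)) (at v)"
  by (rule bounded_linear_imp_has_derivative[OF bounded_linear_vec_nth])

lemma holo_fun_g:
  shows "holo_fun (\<lambda>v. g (v$i) (v$j)) S" "holo_fun (\<lambda>v. g1 (v$i) (v$j)) S" "holo_fun (\<lambda>v. g2 (v$i) (v$j)) S"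
  by (rule holo_funI, rule g_has_derivative[OF has_derivative_coord has_derivative_coord], simp add: algebra_simps)
     (rule holo_funI, rule g1_has_derivative[OF has_derivative_coord has_derivative_coord], simp add: algebra_simps,
      rule holo_funI, rule g2_has_derivative[OF has_derivative_coord has_derivative_coord], simp add: algebra_simps)

section \<open>The branches of the square root over the slit plane\<close>

definition f :: "complex^3 \<Rightarrow> complex" where "f v = (v$1)\<^sup>2 + g (v$2) (v$3)"

text \<open>The complement of the branch cut of \<open>csqrt\<close>. The principal root lies in the
  open right half-plane here, so the two sheets of the double cover can be told apart by the sign of
  the real part of x.\<close>

definition slit :: "(complex^2) set" where "slit = {w. - g (w$1) (w$2) \<notin> \<real>\<^sub>\<le>\<^sub>0}"

definition sqg :: "complex^2 \<Rightarrow> complex" where "sqg w = csqrt (- g (w$1) (w$2))"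

definition vec3 :: "complex \<Rightarrow> complex^2 \<Rightarrow> complex^3" where "vec3 x w = vector [x, w$1, w$2]"

lemma vec3_nth [simp]: "vec3 x w $ 1 = x" "vec3 x w $ 2 = w$1" "vec3 x w $ 3 = w$2"
  by (simp_all add: vec3_def)

lemma norm_vec3: "(norm (vec3 x w))\<^sup>2 = (cmod x)\<^sup>2 + (cmod (w$1))\<^sup>2 + (cmod (w$2))\<^sup>2"
  by (simp add: norm_vec_def L2_set_def sum_3 sum_nonneg)

lemma vec3_has_derivative:
  assumes "(k has_derivative k') (at w)"
  shows "((\<lambda>w. vec3 (k w) w) has_derivative (\<lambda>v. vec3 (k' v) v)) (at w)"
  unfolding has_derivative_vec_iff[where f="\<lambda>w. vec3 (k w) w"]
  using assms by (simp add: forall_3 has_derivative_coord)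

lemma open_slit: "open slit"
proof -
  have "continuous_on UNIV (\<lambda>w::complex^2. - g (w$1) (w$2))"
    by (intro continuous_intros holo_fun_continuous_on[OF holo_fun_g(1)])
  then have "open ((\<lambda>w::complex^2. - g (w$1) (w$2)) -` (- \<real>\<^sub>\<le>\<^sub>0))"
    by (rule open_vimage[rotated]) (simp add: closed_nonpos_Reals_complex open_Compl)
  also have "(\<lambda>w::complex^2. - g (w$1) (w$2)) -` (- \<real>\<^sub>\<le>\<^sub>0) = slit" by (auto simp: slit_def)
  finally show ?thesis .
qed

lemma sqg_square: "(sqg w)\<^sup>2 = - g (w$1) (w$2)" by (simp add: sqg_def)

lemma Re_sqg_pos: "w \<in> slit \<Longrightarrow> Re (sqg w) > 0"
proof (rule ccontr)
  assume w: "w \<in> slit" "\<not> Re (sqg w) > 0"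
  then have "Re (sqg w) = 0" using csqrt_principal[of "- g (w$1) (w$2)"] by (auto simp: sqg_def)
  then have "(sqg w)\<^sup>2 = of_real (- ((Im (sqg w))\<^sup>2))" by (simp add: complex_eq_iff power2_eq_square)
  then have "Re (- g (w$1) (w$2)) \<le> 0 \<and> Im (- g (w$1) (w$2)) = 0" unfolding sqg_square by (simp only: Re_complex_of_real Im_complex_of_real) simp
  then have "- g (w$1) (w$2) \<in> \<real>\<^sub>\<le>\<^sub>0" unfolding complex_nonpos_Reals_iff .
  with w show False by (simp add: slit_def)
qed

lemma sqg_has_derivative:
  assumes "w \<in> slit"
  shows "(sqg has_derivative (\<lambda>v. - (g1 (w$1) (w$2) * v$1 + g2 (w$1) (w$2) * v$2) / (2 * sqg w))) (at w)"
proof -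
  have d1: "((\<lambda>w. - g (w$1) (w$2)) has_derivative (\<lambda>v. - (g1 (w$1) (w$2) * v$1 + g2 (w$1) (w$2) * v$2))) (at w)"
    by (intro has_derivative_minus g_has_derivative has_derivative_coord)
  have d2: "(csqrt has_field_derivative inverse (2 * csqrt (- g (w$1) (w$2)))) (at (- g (w$1) (w$2)))"
    using assms by (intro has_field_derivative_csqrt) (simp add: slit_def)
  have "inverse (2 * csqrt (- g (w$1) (w$2))) * - (g1 (w$1) (w$2) * v$1 + g2 (w$1) (w$2) * v$2)
     = - (g1 (w$1) (w$2) * v$1 + g2 (w$1) (w$2) * v$2) / (2 * sqg w)" for v :: "complex^2"
    unfolding sqg_def by (simp only: divide_inverse mult.commute)
  with has_derivative_compose[OF d1 d2[unfolded has_field_derivative_def]] show ?thesis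
    by (simp only: sqg_def [abs_def])
qed

definition pt :: "complex \<Rightarrow> complex^2 \<Rightarrow> complex^3" where "pt s w = vec3 (s * sqg w) w"

definition dpt :: "complex \<Rightarrow> complex^2 \<Rightarrow> complex^2 \<Rightarrow> complex^3" where
  "dpt s w v = vec3 (s * (- (g1 (w$1) (w$2) * v$1 + g2 (w$1) (w$2) * v$2) / (2 * sqg w))) v"

lemma pt_has_derivative:
  assumes "w \<in> slit"
  shows "(pt s has_derivative dpt s w) (at w)"
proof -
  have "((\<lambda>w. s * sqg w) has_derivative (\<lambda>v. s * (- (g1 (w$1) (w$2) * v$1 + g2 (w$1) (w$2) * v$2) / (2 * sqg w)))) (at w)"
    by (rule has_derivative_mult_right[OF sqg_has_derivative[OF assms]])
  from vec3_has_derivative[OF this] show ?thesis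
    unfolding pt_def [abs_def] dpt_def [abs_def] .
qed

lemma dpt_scale: "dpt s w (c *s v) = c *s dpt s w v"
  by (auto simp: dpt_def vec_eq_iff forall_3 algebra_simps)

lemma holomorphic_map_pt: "holomorphic_map (pt s) slit"
  unfolding holomorphic_map_def using pt_has_derivative dpt_scale by blast

lemma f_pt: "s\<^sup>2 = 1 \<Longrightarrow> f (pt s w) = 0"
  by (simp add: f_def pt_def power_mult_distrib sqg_square)

lemma norm_pt: "cmod s = 1 \<Longrightarrow> norm (pt s w) = norm (pt 1 w)"
  by (rule power2_eq_imp_eq) (simp_all add: pt_def norm_vec3 norm_mult)

lemma g_0_iff_nonslit: "w \<in> slit \<Longrightarrow> g (w$1) (w$2) \<noteq> 0"
  by (auto simp: slit_def)

text \<open>Outside \<open>slit\<close> the imaginary part of g is 0. This is the set where the real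
  part of \<i> g vanishes, and apart from the origin the gradient of g is nonzero there.\<close>

lemma null_slit_complement: "emeasure lborel (- slit) = 0" "- slit \<in> sets borel"
proof -
  let ?k = "\<lambda>w::complex^2. \<i> * g (w$1) (w$2)"
  have d: "(?k has_derivative (\<lambda>v. \<i> * (g1 (w$1) (w$2) * v$1 + g2 (w$1) (w$2) * v$2))) (at w)" for w
    by (intro has_derivative_mult_right g_has_derivative has_derivative_coord)
  have k: "holo_fun ?k (- {0})"
    by (rule holo_funI, rule d) (simp add: algebra_simps)
  note d = frechet_derivative_eqI[OF d]
  have nz: "\<exists>v. frechet_derivative ?k (at w) v \<noteq> 0" if "w \<in> - {0}" for w
  proof (rule ccontr)
    assume *: "\<not> ?thesis"
    have "g1 (w$1) (w$2) = 0" "g2 (w$1) (w$2) = 0"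
      using *[unfolded d not_ex not_not, rule_format, of "axis 1 1"] *[unfolded d not_ex not_not, rule_format, of "axis 2 1"]
      by (auto simp: axis_def)
    from isolated'[OF this] that show False by (auto simp: vec_eq_iff forall_2)
  qed
  let ?N = "{w \<in> - {0}. Re (?k w) = 0}"
  have N: "emeasure lborel ?N = 0" "?N \<in> sets borel"
    using null_level_set[OF _ k nz] by auto
  have "insert 0 ?N \<in> null_sets lborel"
    using N by (intro insert_null_sets_lborel null_setsI) auto
  moreover have "- slit \<subseteq> insert 0 ?N"
    by (auto simp: slit_def complex_nonpos_Reals_iff)
  moreover show "- slit \<in> sets borel" using open_slit by auto
  ultimately have "- slit \<in> null_sets lborel" by (intro null_sets_subset[of "insert 0 ?N" lborel "- slit"]) (simp_all only: sets_lborel)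
  then show "emeasure lborel (- slit) = 0" by auto
qed

end

section \<open>The two sheets over the slit plane\<close>

text \<open>An isomorphism of the surface germ with the model hypersurface. The closed ball of
  radius r inside the domain of \<open>G\<close> supplies a compact set for uniform bounds on
  derivatives.\<close>

locale germ = weighted_poly +
  fixes X U V :: "(complex^3) set" and F G :: "complex^3 \<Rightarrow> complex^3" and r :: real
  assumes X: "surface_regular_off_0 X"
    and U: "open U" "0 \<in> U" and V: "open V" "0 \<in> V"
    and F: "holomorphic_map F U" "F 0 = 0" and G: "holomorphic_map G V" "G 0 = 0"
    and FX: "F ` (X \<inter> U) = {v. f v = 0} \<inter> V" and GY: "G ` ({v. f v = 0} \<inter> V) = X \<inter> U"
    and GF: "\<And>x. x \<in> X \<inter> U \<Longrightarrow> G (F x) = x" and FG: "\<And>v. f v = 0 \<Longrightarrow> v \<in> V \<Longrightarrow> F (G v) = v"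
    and r: "r > 0" "cball 0 r \<subseteq> V"
begin

abbreviation "\<mu> \<equiv> volume_measure X"

text \<open>Both sheets have the same domain because changing the sign of x preserves the norm in
  the model.\<close>

definition Dm :: "(complex^2) set" where "Dm = {w \<in> slit. norm (pt 1 w) < r}"

definition sheet :: "complex \<Rightarrow> complex^2 \<Rightarrow> complex^3" where "sheet s w = G (pt s w)"

text \<open>The neighbourhood of the singular point, including that point, on which \<phi> will be
  shown to be closed: the part of the surface that corresponds to the ball of radius r in the
  model.\<close>

definition Reg :: "(complex^3) set" where "Reg = {x \<in> X \<inter> U. F x \<in> ball 0 r}"

lemma X0: "0 \<in> X" using X by (simp add: surface_regular_off_0_def)

lemma F_in: "x \<in> X \<inter> U \<Longrightarrow> f (F x) = 0 \<and> F x \<in> V"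
  using FX by blast

lemma continuous_on_F: "continuous_on U F" and continuous_on_G: "continuous_on V G"
  using F G holomorphic_map_continuous_on by auto

lemma open_F_vimage: "open S \<Longrightarrow> open {x\<in>U. F x \<in> S}"
  using continuous_open_preimage[OF continuous_on_F U(1), of S] by (simp add: Int_def vimage_def)

lemma Reg_openin: "openin (top_of_set X) Reg" "0 \<in> Reg"
proof -
  have "Reg = X \<inter> {x\<in>U. F x \<in> ball 0 r}" by (auto simp: Reg_def)
  then show "openin (top_of_set X) Reg" using open_F_vimage[of "ball 0 r"] by (simp add: openin_open_Int)
  show "0 \<in> Reg" using X0 U F r by (simp add: Reg_def)
qed

lemma F_eq_0_iff: "x \<in> X \<inter> U \<Longrightarrow> F x = 0 \<longleftrightarrow> x = 0"
  using GF F G by metis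

lemma F_coords_nonzero:
  assumes "x \<in> X \<inter> U" "x \<noteq> 0"
  shows "F x $ 2 \<noteq> 0 \<or> F x $ 3 \<noteq> 0"
proof (rule ccontr)
  assume "\<not> ?thesis"
  then have z: "F x $ 2 = 0" "F x $ 3 = 0" by auto
  have "g 0 0 = 0" using euler[of 0 0] ha by simp
  then have "F x $ 1 = 0" using F_in[OF assms(1)] z by (simp add: f_def)
  then have "F x = 0" using z by (simp add: vec_eq_iff forall_3)
  then show False using F_eq_0_iff[OF assms(1)] assms(2) by simp
qed

lemma open_Dm: "open Dm"
proof -
  have "continuous_on slit (\<lambda>w. norm (pt 1 w))"
    by (intro continuous_intros holomorphic_map_continuous_on[OF holomorphic_map_pt])
  from continuous_open_preimage[OF this open_slit, of "{..<r}"]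
  show ?thesis by (simp add: Dm_def Int_def vimage_def)
qed

lemma sheet_props:
  assumes s: "s = 1 \<or> s = -1" and w: "w \<in> Dm"
  shows "pt s w \<in> ball 0 r" "pt s w \<in> V" "f (pt s w) = 0" "F (sheet s w) = pt s w"
    "sheet s w \<in> Reg" "sheet s w \<noteq> 0" "w \<in> slit" "s * s = 1"
proof -
  show ss: "s * s = 1" using s by auto
  have n: "cmod s = 1" using s by auto
  show w': "w \<in> slit" using w by (simp add: Dm_def)
  show b: "pt s w \<in> ball 0 r" using w norm_pt[OF n] by (simp add: Dm_def)
  then show v: "pt s w \<in> V" using r by auto
  show f: "f (pt s w) = 0" using f_pt ss by (simp add: power2_eq_square)
  show FG': "F (sheet s w) = pt s w" unfolding sheet_def by (rule FG[OF f v])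
  have "sheet s w \<in> X \<inter> U" using GY f v unfolding sheet_def by blast
  then show "sheet s w \<in> Reg" using b FG' by (simp add: Reg_def)
  have "sqg w \<noteq> 0" using Re_sqg_pos[OF w'] by auto
  then have "pt s w $ 1 \<noteq> 0" using s by (auto simp: pt_def)
  then show "sheet s w \<noteq> 0" using FG' F by auto
qed

lemma holomorphic_map_sheet:
  assumes s: "s = 1 \<or> s = -1"
  shows "holomorphic_map (sheet s) Dm"
  unfolding sheet_def [abs_def]
proof (rule holomorphic_map_compose[OF G(1)])
  show "holomorphic_map (pt s) Dm"
    by (rule holomorphic_map_subset[OF holomorphic_map_pt]) (auto simp: Dm_def)
  show "pt s ` Dm \<subseteq> V" using sheet_props(2)[OF s] by blast
qed

text \<open>A complex number with positive real part is the principal root of its square, so the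
  equation of the hypersurface recovers the point from its last two coordinates.\<close>

lemma sheet_image:
  assumes s: "s = 1 \<or> s = -1"
  shows "sheet s ` Dm = {x \<in> Reg. Re (s * F x $ 1) > 0}"
proof (intro equalityI subsetI)
  fix x assume "x \<in> sheet s ` Dm"
  then obtain w where w: "w \<in> Dm" "x = sheet s w" by blast
  have "s * F x $ 1 = sqg w" using sheet_props[OF s w(1)] w(2) by (simp add: pt_def mult.assoc[symmetric])
  then have "Re (s * F x $ 1) > 0"
    using Re_sqg_pos[OF sheet_props(7)[OF s w(1)]] by (simp only: w(2))
  then show "x \<in> {x \<in> Reg. Re (s * F x $ 1) > 0}"
    using sheet_props(5)[OF s w(1)] by (simp only: w(2) mem_Collect_eq simp_thms)
next
  fix x assume "x \<in> {x \<in> Reg. Re (s * F x $ 1) > 0}"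
  then have x: "x \<in> X \<inter> U" "F x \<in> ball 0 r" "Re (s * F x $ 1) > 0" by (auto simp: Reg_def)
  define w :: "complex^2" where "w = vector [F x $ 2, F x $ 3]"
  have ss: "s * s = 1" using s by auto
  have "f (F x) = 0" using F_in[OF x(1)] by blast
  then have gw: "- g (w$1) (w$2) = (s * F x $ 1)\<^sup>2"
  proof -
    have "(F x $ 1)\<^sup>2 = - g (F x $ 2) (F x $ 3)" using \<open>f (F x) = 0\<close> by (simp add: f_def eq_neg_iff_add_eq_0)
    moreover have "(s * F x $ 1)\<^sup>2 = (F x $ 1)\<^sup>2" using ss by (simp add: power_mult_distrib power2_eq_square[of s])
    ultimately show ?thesis by (simp add: w_def)
  qed
  have sq: "sqg w = s * F x $ 1"
    unfolding sqg_def gw by (rule csqrt_square) (use x(3) in simp)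
  have "w \<in> slit"
  proof (rule ccontr)
    assume "w \<notin> slit"
    then have "(s * F x $ 1)\<^sup>2 \<in> \<real>\<^sub>\<le>\<^sub>0" unfolding slit_def mem_Collect_eq gw by blast
    then have "Re ((s * F x $ 1)\<^sup>2) \<le> 0" "Im ((s * F x $ 1)\<^sup>2) = 0" unfolding complex_nonpos_Reals_iff by auto
    then show False using x(3) unfolding Re_power2 Im_power2
      by (auto simp del: times_complex.simps)
  qed
  moreover have Fx: "F x = pt s w"
  proof -
    have "s * sqg w = F x $ 1" unfolding sq using ss by (simp add: mult.assoc[symmetric])
    then show ?thesis by (simp add: vec_eq_iff forall_3 pt_def) (simp add: w_def)
  qed
  moreover have "norm (pt 1 w) = norm (pt s w)" using norm_pt[of s w] s by auto
  ultimately have "w \<in> Dm" using x(2) by (simp add: Dm_def)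
  moreover have "x = sheet s w" using GF[OF x(1)] Fx by (simp add: sheet_def)
  ultimately show "x \<in> sheet s ` Dm" by blast
qed

lemma Dpt_sheet:
  assumes s: "s = 1 \<or> s = -1" and w: "w \<in> Dm"
  shows "frechet_derivative F (at (sheet s w)) (frechet_derivative (sheet s) (at w) v) = dpt s w v"
proof -
  have "sheet s w \<in> U" using sheet_props(5)[OF s w] by (simp add: Reg_def)
  from holomorphic_map_chain[OF F(1) holomorphic_map_sheet[OF s] w this]
  have "frechet_derivative F (at (sheet s w)) (frechet_derivative (sheet s) (at w) v) = frechet_derivative (\<lambda>w. F (sheet s w)) (at w) v" by simp
  also have "frechet_derivative (\<lambda>w. F (sheet s w)) (at w) = frechet_derivative (pt s) (at w)"
    by (rule frechet_derivative_cong_open[OF open_Dm w sheet_props(4)[OF s]])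
  also have "\<dots> = dpt s w" by (rule frechet_derivative_eqI[OF pt_has_derivative[OF sheet_props(7)[OF s w]]])
  finally show ?thesis .
qed

lemma holo_param_sheet:
  assumes s: "s = 1 \<or> s = -1"
  shows "holo_param X Dm (sheet s)"
  unfolding holo_param_def
proof (intro conjI ballI open_Dm holomorphic_map_sheet[OF s])
  fix w assume w: "w \<in> Dm"
  show "inj (frechet_derivative (sheet s) (at w))"
  proof (rule injI)
    fix v v' assume "frechet_derivative (sheet s) (at w) v = frechet_derivative (sheet s) (at w) v'"
    then have "dpt s w v = dpt s w v'" using Dpt_sheet[OF s w] by metis
    then have "dpt s w v $ 2 = dpt s w v' $ 2" "dpt s w v $ 3 = dpt s w v' $ 3" by auto
    then show "v = v'" by (simp add: dpt_def vec_eq_iff forall_2)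
  qed
next
  let ?q = "\<lambda>x. vector [F x $ 2, F x $ 3] :: complex^2"
  have "homeomorphism Dm (sheet s ` Dm) (sheet s) ?q"
  proof (rule homeomorphismI)
    show "continuous_on Dm (sheet s)" by (rule holomorphic_map_continuous_on[OF holomorphic_map_sheet[OF s]])
    have *: "continuous_on (sheet s ` Dm) F"
      by (rule continuous_on_subset[OF continuous_on_F]) (use sheet_props(5)[OF s] in \<open>auto simp: Reg_def\<close>)
    show "continuous_on (sheet s ` Dm) ?q"
      unfolding continuous_on_vec_iff[of _ ?q] forall_2 using continuous_on_component[OF *] by simp
    show q: "?q (sheet s w) = w" if "w \<in> Dm" for w
      using sheet_props(4)[OF s that] by (simp add: pt_def vec_eq_iff forall_2)
    show "?q ` (sheet s ` Dm) \<subseteq> Dm" using q by auto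
    show "sheet s (?q x) = x" if "x \<in> sheet s ` Dm" for x using that q by auto
  qed auto
  then show "\<exists>q. homeomorphism Dm (sheet s ` Dm) (sheet s) q" by blast
  have "open (ball 0 r \<inter> {v::complex^3. 0 < Re (s * v $ 1)})"
    by (intro open_Int open_ball open_Collect_less continuous_intros)
  then have "open {v::complex^3. v \<in> ball 0 r \<and> Re (s * v $ 1) > 0}" by (simp only: Int_def mem_Collect_eq)
  from open_F_vimage[OF this]
  have "openin (top_of_set (X - {0})) ((X - {0}) \<inter> {x\<in>U. F x \<in> {v. v \<in> ball 0 r \<and> Re (s * v $ 1) > 0}})"
    by (rule openin_open_Int)
  also have "(X - {0}) \<inter> {x\<in>U. F x \<in> {v. v \<in> ball 0 r \<and> Re (s * v $ 1) > 0}} = sheet s ` Dm"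
    unfolding sheet_image[OF s] using F by (auto simp: Reg_def)
  finally show "openin (top_of_set (X - {0})) (sheet s ` Dm)" .
qed

text \<open>An arbitrary chart of the surface, composed with \<open>F\<close>, becomes an immersion
  into the model whose differential satisfies the linearized equation.\<close>

lemma chart_F:
  assumes p: "holo_param X W p" "p ` W \<subseteq> Reg"
  shows "holomorphic_map (\<lambda>z. F (p z)) W"
    "\<And>z v. z \<in> W \<Longrightarrow> frechet_derivative F (at (p z)) (frechet_derivative p (at z) v) = frechet_derivative (\<lambda>z. F (p z)) (at z) v"
    "\<And>z. z \<in> W \<Longrightarrow> inj (frechet_derivative (\<lambda>z. F (p z)) (at z))"
    "\<And>z u v. z \<in> W \<Longrightarrow> u = frechet_derivative (\<lambda>z. F (p z)) (at z) v \<Longrightarrow>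
      2 * F (p z) $ 1 * u $ 1 + g1 (F (p z) $ 2) (F (p z) $ 3) * u $ 2 + g2 (F (p z) $ 2) (F (p z) $ 3) * u $ 3 = 0"
proof -
  have pU: "p ` W \<subseteq> U" using p(2) by (auto simp: Reg_def)
  have pXU: "p z \<in> X \<inter> U" if "z \<in> W" for z using p(2) that by (auto simp: Reg_def)
  note hp = holo_paramD(2)[OF p(1)]
  show hF: "holomorphic_map (\<lambda>z. F (p z)) W" by (rule holomorphic_map_compose[OF F(1) hp pU])
  show ch: "frechet_derivative F (at (p z)) (frechet_derivative p (at z) v) = frechet_derivative (\<lambda>z. F (p z)) (at z) v"
    if "z \<in> W" for z v using holomorphic_map_chain[OF F(1) hp that] pXU[OF that] by simp
  show "inj (frechet_derivative (\<lambda>z. F (p z)) (at z))" if z: "z \<in> W" for z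
  proof (rule injI)
    fix v v' assume e: "frechet_derivative (\<lambda>z. F (p z)) (at z) v = frechet_derivative (\<lambda>z. F (p z)) (at z) v'"
    have FpV: "F (p z) \<in> V" if "z \<in> W" for z using F_in[OF pXU[OF that]] by blast
    \<comment> \<open>Injectivity comes from \<open>G\<close> composed with \<open>F\<close> being
      the identity on the surface: the differential of p factors through that of the composition
      with \<open>F\<close>.\<close>
    have "frechet_derivative p (at z) = frechet_derivative (\<lambda>z. G (F (p z))) (at z)"
      by (rule frechet_derivative_cong_open[OF holo_paramD(1)[OF p(1)] z]) (use GF pXU in auto)
    also have "\<dots> = (\<lambda>v. frechet_derivative G (at (F (p z))) (frechet_derivative (\<lambda>z. F (p z)) (at z) v))"
      using holomorphic_map_chain[OF G(1) hF z FpV[OF z]] by auto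
    finally have "frechet_derivative p (at z) v = frechet_derivative p (at z) v'" using e by simp
    then show "v = v'" using holo_paramD(3)[OF p(1) z] by (auto dest: injD)
  qed
  show "2 * F (p z) $ 1 * u $ 1 + g1 (F (p z) $ 2) (F (p z) $ 3) * u $ 2 + g2 (F (p z) $ 2) (F (p z) $ 3) * u $ 3 = 0"
    if z: "z \<in> W" and u: "u = frechet_derivative (\<lambda>z. F (p z)) (at z) v" for z u v
  proof -
    let ?A = "frechet_derivative (\<lambda>z. F (p z)) (at z)"
    note A = has_derivative_vec_nth[OF holomorphic_mapD(1)[OF hF z]]
    have "((\<lambda>z. (F (p z) $ 1)\<^sup>2 + g (F (p z) $ 2) (F (p z) $ 3)) has_derivative
      (\<lambda>v. (of_nat 2 * (?A v $ 1) * F (p z) $ 1 ^ (2 - 1)) + (g1 (F (p z) $ 2) (F (p z) $ 3) * ?A v $ 2 + g2 (F (p z) $ 2) (F (p z) $ 3) * ?A v $ 3))) (at z)"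
      by (intro has_derivative_add has_derivative_power g_has_derivative A)
    moreover have "((\<lambda>z. (F (p z) $ 1)\<^sup>2 + g (F (p z) $ 2) (F (p z) $ 3)) has_derivative (\<lambda>v. 0)) (at z)"
      by (rule has_derivative_transform_within_open[OF has_derivative_const[of 0] holo_paramD(1)[OF p(1)] z])
         (use F_in[OF pXU] in \<open>simp add: f_def\<close>)
    ultimately have "(\<lambda>v. (of_nat 2 * (?A v $ 1) * F (p z) $ 1 ^ (2 - 1)) + (g1 (F (p z) $ 2) (F (p z) $ 3) * ?A v $ 2 + g2 (F (p z) $ 2) (F (p z) $ 3) * ?A v $ 3)) = (\<lambda>v. 0)"
      by (rule has_derivative_unique)
    from fun_cong[OF this, of v] show ?thesis by (simp add: u algebra_simps)
  qed
qed

text \<open>If dx vanished on the tangent plane, the linearized equation would leave one nontrivial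
  condition g1 dy + g2 dz = 0 on dy and dz. The image would have dimension at most 1, which
  contradicts injectivity of the differential.\<close>

lemma chart_first_coordinate_submersive:
  assumes p: "holo_param X W p" "p ` W \<subseteq> Reg" and z: "z \<in> W"
  shows "\<exists>v. frechet_derivative (\<lambda>z. F (p z)) (at z) v $ 1 \<noteq> 0"
proof (rule ccontr)
  assume *: "\<not> ?thesis"
  let ?A = "frechet_derivative (\<lambda>z. F (p z)) (at z)"
  note hF = chart_F(1)[OF p]
  have lin: "linear ?A" using holomorphic_mapD(1)[OF hF z] has_derivative_linear by blast
  note sc = holomorphic_mapD(2)[OF hF z]
  have inj: "?A v = 0 \<Longrightarrow> v = 0" for v
    using chart_F(3)[OF p z] linear_0[OF lin] by (metis injD)
  have pz: "p z \<in> X \<inter> U" "p z \<noteq> 0" using p z holo_paramD(7)[OF p(1)] by (auto simp: Reg_def)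
  let ?g1 = "g1 (F (p z) $ 2) (F (p z) $ 3)" and ?g2 = "g2 (F (p z) $ 2) (F (p z) $ 3)"
  have g0: "?g1 \<noteq> 0 \<or> ?g2 \<noteq> 0" using isolated' F_coords_nonzero[OF pz] by blast
  define u u' where "u = ?A (axis 1 1)" and "u' = ?A (axis 2 1)"
  have u1: "u $ 1 = 0" "u' $ 1 = 0" using * by (auto simp: u_def u'_def)
  have k: "?g1 * u $ 2 + ?g2 * u $ 3 = 0" "?g1 * u' $ 2 + ?g2 * u' $ 3 = 0"
    using chart_F(4)[OF p z u_def] chart_F(4)[OF p z u'_def] u1 by auto
  have "?g1 * (u $ 2 * u' $ 3 - u $ 3 * u' $ 2) = 0" "?g2 * (u $ 2 * u' $ 3 - u $ 3 * u' $ 2) = 0"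
    using k by algebra+
  then have det: "u $ 2 * u' $ 3 = u $ 3 * u' $ 2" using g0 by auto
  have comb: "?A (vector [\<alpha>, \<beta>]) = \<alpha> *s u + \<beta> *s u'" for \<alpha> \<beta>
    using linear2_expand[OF lin sc, of "vector [\<alpha>, \<beta>]"] by (simp add: u_def u'_def)
  have "?A (vector [u' $ 2, - u $ 2]) = 0" "?A (vector [u' $ 3, - u $ 3]) = 0"
    unfolding comb using det u1 by (auto simp: vec_eq_iff forall_3 algebra_simps)
  from inj[OF this(1)] inj[OF this(2)] have "u = 0"
    using u1 by (auto simp: vec_eq_iff forall_2 forall_3)
  then have "axis 1 1 = (0 :: complex^2)" using inj unfolding u_def by blast
  then show False by (simp add: axis_eq_0_iff)
qed

section \<open>Integration over the surface through the two sheets\<close>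

definition Nul :: "(complex^3) set" where "Nul = {x \<in> Reg - {0}. Re (F x $ 1) = 0}"

lemma Reg_decomp: "Reg - {0} = sheet 1 ` Dm \<union> sheet (-1) ` Dm \<union> Nul"
  using F by (auto simp: sheet_image Nul_def)

lemma \<mu>: "sets \<mu> = sets borel" "\<And>W p E. holo_param X W p \<Longrightarrow> E \<in> sets borel \<Longrightarrow> E \<subseteq> W \<Longrightarrow>
       emeasure \<mu> (p ` E) = (\<integral>\<^sup>+z\<in>E. ennreal (volume_density p z) \<partial>lborel)"
  using volume_measure[OF X] unfolding is_volume_measure_def by blast+

lemma Reg_cover:
  obtains W p where "\<And>n::nat. holo_param X (W n) (p n)" "\<And>n. p n ` W n \<subseteq> Reg" "Reg - {0} = (\<Union>n. p n ` W n)"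
proof -
  obtain W p where Wp: "\<And>n::nat. holo_param X (W n) (p n)" "X - {0} = (\<Union>n. p n ` W n)"
    using holo_param_countable_cover[OF X] by blast
  define W' where "W' n = {z \<in> W n. p n z \<in> {x\<in>U. F x \<in> ball 0 r}}" for n
  have "open (W' n)" for n
  proof -
    have "W' n = W n \<inter> p n -` {x\<in>U. F x \<in> ball 0 r}" by (auto simp: W'_def)
    also have "open \<dots>" by (rule continuous_open_preimage[OF holo_paramD(5,1)[OF Wp(1)[of n]] open_F_vimage[OF open_ball]])
    finally show ?thesis .
  qed
  then have "holo_param X (W' n) (p n)" for n by (rule holo_param_restrict[OF Wp(1)]) (auto simp: W'_def)
  moreover have "p n ` W' n \<subseteq> Reg" for n using holo_paramD(7)[OF Wp(1)[of n]] by (auto simp: W'_def Reg_def)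
  moreover have "Reg - {0} = (\<Union>n. p n ` W' n)"
  proof (intro equalityI subsetI)
    fix x assume x: "x \<in> Reg - {0}"
    then have "x \<in> X - {0}" by (auto simp: Reg_def)
    then obtain n z where "z \<in> W n" "x = p n z" unfolding Wp(2) by blast
    then have "z \<in> W' n" "x = p n z" using x by (auto simp: W'_def Reg_def)
    then show "x \<in> (\<Union>n. p n ` W' n)" by blast
  next
    fix x assume "x \<in> (\<Union>n. p n ` W' n)"
    then obtain n z where "z \<in> W' n" "x = p n z" by blast
    then show "x \<in> Reg - {0}" using holo_paramD(7)[OF Wp(1)[of n]] by (auto simp: W'_def Reg_def)
  qed
  ultimately show ?thesis using that by blast
qed

lemma Reg_borel: "Reg - {0} \<in> sets borel"
proof -
  have "Reg - {0} = (X - {0}) \<inter> {x\<in>U. F x \<in> ball 0 r}" by (auto simp: Reg_def)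
  then show ?thesis using regular_part_borel[OF X] open_F_vimage[OF open_ball, of 0 r] by auto
qed

text \<open>In every chart the points missed by both sheets form the zero set of the real part of a
  holomorphic function without critical points.\<close>

lemma Nul_null: "Nul \<in> null_sets \<mu>"
proof -
  obtain W p where Wp: "\<And>n::nat. holo_param X (W n) (p n)" "\<And>n. p n ` W n \<subseteq> Reg" "Reg - {0} = (\<Union>n. p n ` W n)"
    using Reg_cover by blast
  define E where "E n = {z \<in> W n. Re (F (p n z) $ 1) = 0}" for n
  have "p n ` E n \<in> null_sets \<mu>" for n
  proof -
    note hF = chart_F(1)[OF Wp(1,2)]
    have k: "holo_fun (\<lambda>z. F (p n z) $ 1) (W n)" by (rule holomorphic_map_nth[OF hF])
    have nz: "\<exists>v. frechet_derivative (\<lambda>z. F (p n z) $ 1) (at z) v \<noteq> 0" if z: "z \<in> W n" for z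
      using chart_first_coordinate_submersive[OF Wp(1,2) z]
      unfolding frechet_derivative_eqI[OF has_derivative_vec_nth[OF holomorphic_mapD(1)[OF hF z]]] .
    note E = null_level_set[OF holo_paramD(1)[OF Wp(1)] k nz, folded E_def]
    have "E n \<subseteq> W n" by (auto simp: E_def)
    have "emeasure \<mu> (p n ` E n) = (\<integral>\<^sup>+z\<in>E n. ennreal (volume_density (p n) z) \<partial>lborel)"
      by (rule \<mu>(2)[OF Wp(1)]) (use E \<open>E n \<subseteq> W n\<close> in auto)
    also have "\<dots> = 0" by (rule nn_integral_null_set) (use E in \<open>auto intro: null_setsI\<close>)
    finally show ?thesis
      using holo_param_image_borel[OF X Wp(1) _ \<open>E n \<subseteq> W n\<close>] E by (intro null_setsI) (auto simp: \<mu>(1))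
  qed
  then have "(\<Union>n. p n ` E n) \<in> null_sets \<mu>" by (rule null_sets_UN)
  also have "(\<Union>n. p n ` E n) = Nul"
  proof (intro equalityI subsetI)
    fix x assume x: "x \<in> Nul"
    then have "x \<in> Reg - {0}" by (simp add: Nul_def)
    then obtain n z where "z \<in> W n" "x = p n z" unfolding Wp(3) by blast
    then show "x \<in> (\<Union>n. p n ` E n)" using x by (auto simp: Nul_def E_def)
  next
    fix x assume "x \<in> (\<Union>n. p n ` E n)"
    then obtain n z where "z \<in> W n" "x = p n z" "Re (F x $ 1) = 0" by (auto simp: E_def)
    moreover from this have "x \<in> Reg - {0}" unfolding Wp(3) by blast
    ultimately show "x \<in> Nul" by (simp add: Nul_def)
  qed
  finally show ?thesis .
qed

lemma sheet_image_borel: "s = 1 \<or> s = -1 \<Longrightarrow> sheet s ` Dm \<in> sets \<mu>"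
  using holo_param_image_borel[OF X holo_param_sheet, of s Dm] open_Dm by (auto simp: \<mu>(1))

text \<open>The two sheets cover the region up to a null set. Equality of the integrals still
  requires measurability on the whole region, which is not evident for expressions in pointwise
  chosen frames; this is why continuity is asked in every chart and not only on the sheets.\<close>

lemma region_integral:
  fixes \<omega> :: "complex^3 \<Rightarrow> complex"
  assumes meas: "\<And>W p. holo_param X W p \<Longrightarrow> p ` W \<subseteq> Reg \<Longrightarrow>
      \<exists>w. continuous_on W w \<and> (\<forall>z\<in>W. \<omega> (p z) * of_real (volume_density p z) = w z)"
    and eq: "\<And>s z. s = 1 \<or> s = -1 \<Longrightarrow> z \<in> Dm \<Longrightarrow> \<omega> (sheet s z) * of_real (volume_density (sheet s) z) = w s z"
    and int: "\<And>s. s = 1 \<or> s = -1 \<Longrightarrow> set_integrable lborel Dm (w s)"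
  shows "(LINT x:Reg - {0}|\<mu>. \<omega> x) = (LINT z:Dm|lborel. w 1 z) + (LINT z:Dm|lborel. w (-1) z)"
proof -
  obtain W p where Wp: "\<And>n::nat. holo_param X (W n) (p n)" "\<And>n. p n ` W n \<subseteq> Reg" "Reg - {0} = (\<Union>n. p n ` W n)"
    using Reg_cover by blast
  have "\<exists>k. k \<in> borel \<rightarrow>\<^sub>M borel \<and> (\<forall>z\<in>W n. k (p n z) = \<omega> (p n z))" for n
  proof -
    obtain w where w: "continuous_on (W n) w" "\<And>z. z \<in> W n \<Longrightarrow> \<omega> (p n z) * of_real (volume_density (p n) z) = w z"
      using meas[OF Wp(1,2)] by blast
    have pos: "volume_density (p n) z > 0" if "z \<in> W n" for z by (rule volume_density_pos[OF Wp(1) that])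
    have "continuous_on (W n) (\<lambda>z. w z / of_real (volume_density (p n) z))"
      by (intro continuous_intros w continuous_on_of_real volume_density_continuous_on[OF Wp(1)]) (use pos in force)
    from chart_borel_extension[OF X Wp(1) this]
    obtain k :: "complex^3 \<Rightarrow> complex" where k: "k \<in> borel \<rightarrow>\<^sub>M borel" "\<And>z. z \<in> W n \<Longrightarrow> k (p n z) = w z / of_real (volume_density (p n) z)" by blast
    have "k (p n z) = \<omega> (p n z)" if "z \<in> W n" for z
      unfolding k(2)[OF that] w(2)[OF that, symmetric] using pos[OF that] by simp
    with k(1) show ?thesis by blast
  qed
  then obtain k where k: "\<And>n. k n \<in> borel \<rightarrow>\<^sub>M borel" "\<And>n z. z \<in> W n \<Longrightarrow> k n (p n z) = \<omega> (p n z)" by metis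
  have pW: "p n ` W n \<in> sets borel" for n
    by (rule holo_param_image_borel[OF X Wp(1) _ order_refl]) (use holo_paramD(1)[OF Wp(1)] in auto)
  let ?\<omega> = "\<lambda>x. indicator (Reg - {0}) x *\<^sub>R \<omega> x"
  \<comment> \<open>On each chart of a countable cover the integrand agrees with a Borel function,
    so preimages are countable unions of Borel sets.\<close>
  have m: "?\<omega> \<in> borel_measurable borel"
  proof (rule borel_measurableI)
    fix S :: "complex set" assume S: "open S"
    have "?\<omega> -` S = (\<Union>n. p n ` W n \<inter> k n -` S) \<union> (if 0 \<in> S then - (Reg - {0}) else {})"
    proof (intro set_eqI iffI)
      fix x assume x: "x \<in> ?\<omega> -` S"
      show "x \<in> (\<Union>n. p n ` W n \<inter> k n -` S) \<union> (if 0 \<in> S then - (Reg - {0}) else {})"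
      proof (cases "x \<in> Reg - {0}")
        case True
        then obtain n z where z: "z \<in> W n" "x = p n z" unfolding Wp(3) by blast
        then have "k n x \<in> S" using x True k(2)[OF z(1)] by simp
        then show ?thesis using z by blast
      next
        case False
        then have "0 \<in> S" using x by simp
        then show ?thesis using False by auto
      qed
    next
      fix x assume "x \<in> (\<Union>n. p n ` W n \<inter> k n -` S) \<union> (if 0 \<in> S then - (Reg - {0}) else {})"
      then have "(\<exists>n. x \<in> p n ` W n \<inter> k n -` S) \<or> (0 \<in> S \<and> x \<notin> Reg - {0})"
        by (cases "0 \<in> S") auto
      then consider n z where "z \<in> W n" "x = p n z" "k n x \<in> S" | "0 \<in> S" "x \<notin> Reg - {0}"
        by blast
      then show "x \<in> ?\<omega> -` S"
      proof cases
        case 1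
        then have "x \<in> Reg - {0}" unfolding Wp(3) by blast
        then show ?thesis using 1 k(2)[OF 1(1)] by simp
      next
        case 2
        then show ?thesis by simp
      qed
    qed
    moreover have "(\<Union>n. p n ` W n \<inter> k n -` S) \<in> sets borel"
      using pW measurable_sets[OF k(1) borel_open[OF S]] by auto
    moreover have "(if 0 \<in> S then - (Reg - {0}) else {}) \<in> sets borel"
      using borel_comp[OF Reg_borel] by simp
    ultimately show "?\<omega> -` S \<inter> space borel \<in> sets borel" by simp
  qed
  let ?A = "sheet 1 ` Dm" and ?B = "sheet (-1) ` Dm"
  have chart: "set_integrable \<mu> (sheet s ` Dm) \<omega>" "(LINT x:sheet s ` Dm|\<mu>. \<omega> x) = (LINT z:Dm|lborel. w s z)" if s: "s = 1 \<or> s = -1" for s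
  proof -
    have "sheet s ` Dm \<subseteq> Reg" using sheet_props(5)[OF s] by blast
    from meas[OF holo_param_sheet[OF s] this] obtain w' where w': "continuous_on Dm w'"
      "\<And>z. z \<in> Dm \<Longrightarrow> \<omega> (sheet s z) * of_real (volume_density (sheet s) z) = w' z" by blast
    have "continuous_on Dm (w s)" by (rule continuous_on_eq[OF w'(1)]) (use w'(2) eq[OF s] in simp)
    from integral_chart[OF X holo_param_sheet[OF s] this eq[OF s]] int[OF s]
    show "set_integrable \<mu> (sheet s ` Dm) \<omega>" "(LINT x:sheet s ` Dm|\<mu>. \<omega> x) = (LINT z:Dm|lborel. w s z)" by auto
  qed
  have AB: "?A \<inter> ?B = {}" by (auto simp: sheet_image)
  have "(LINT x:Reg - {0}|\<mu>. \<omega> x) = (LINT x:?A \<union> ?B|\<mu>. \<omega> x)"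
    unfolding set_lebesgue_integral_def
  proof (rule integral_cong_AE)
    show "?\<omega> \<in> borel_measurable \<mu>" using m by (simp add: measurable_cong_sets[OF \<mu>(1)])
    have "set_integrable \<mu> (?A \<union> ?B) \<omega>" by (rule set_integrable_Un) (use chart sheet_image_borel in auto)
    then show "(\<lambda>x. indicator (?A \<union> ?B) x *\<^sub>R \<omega> x) \<in> borel_measurable \<mu>"
      unfolding set_integrable_def by (rule borel_measurable_integrable)
    show "AE x in \<mu>. indicator (Reg - {0}) x *\<^sub>R \<omega> x = indicator (?A \<union> ?B) x *\<^sub>R \<omega> x"
      using AE_not_in[OF Nul_null] by eventually_elim (auto simp: Reg_decomp indicator_def)
  qed
  also have "\<dots> = (LINT x:?A|\<mu>. \<omega> x) + (LINT x:?B|\<mu>. \<omega> x)"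
    by (rule set_integral_Un[OF AB]) (use chart in auto)
  finally show ?thesis using chart(2)[of 1] chart(2)[of "-1"] by simp
qed

text \<open>For a finiteness claim it is enough to dominate the integrand on the sheets, hence no
  measurability of \<open>k\<close> appears.\<close>

lemma region_nn_integral_finite:
  fixes k :: "complex^3 \<Rightarrow> real"
  assumes B: "\<And>s. s = 1 \<or> s = -1 \<Longrightarrow> continuous_on Dm (B s)"
    and le: "\<And>s z. s = 1 \<or> s = -1 \<Longrightarrow> z \<in> Dm \<Longrightarrow> k (sheet s z) * volume_density (sheet s) z \<le> B s z"
    and fin: "\<And>s. s = 1 \<or> s = -1 \<Longrightarrow> (\<integral>\<^sup>+z\<in>Dm. ennreal (B s z) \<partial>lborel) < \<infinity>"
  shows "(\<integral>\<^sup>+x\<in>Reg - {0}. ennreal (k x) \<partial>\<mu>) < \<infinity>"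
proof -
  let ?A = "sheet 1 ` Dm" and ?B = "sheet (-1) ` Dm"
  have maj: "\<exists>k'. k' \<in> borel_measurable borel \<and> (\<forall>x\<in>sheet s ` Dm. ennreal (k x) \<le> k' x) \<and>
    (\<integral>\<^sup>+x\<in>sheet s ` Dm. k' x \<partial>\<mu>) = (\<integral>\<^sup>+z\<in>Dm. ennreal (B s z) \<partial>lborel)" if s: "s = 1 \<or> s = -1" for s
    by (rule chart_measurable_majorant[OF X holo_param_sheet[OF s] B[OF s] le[OF s]])
  obtain k1 where k1: "k1 \<in> borel_measurable borel" "\<forall>x\<in>?A. ennreal (k x) \<le> k1 x"
    "(\<integral>\<^sup>+x\<in>?A. k1 x \<partial>\<mu>) = (\<integral>\<^sup>+z\<in>Dm. ennreal (B 1 z) \<partial>lborel)"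
    using maj[OF disjI1[OF refl]] by (elim exE conjE) (rule that, assumption+)
  obtain k2 where k2: "k2 \<in> borel_measurable borel" "\<forall>x\<in>?B. ennreal (k x) \<le> k2 x"
    "(\<integral>\<^sup>+x\<in>?B. k2 x \<partial>\<mu>) = (\<integral>\<^sup>+z\<in>Dm. ennreal (B (-1) z) \<partial>lborel)"
    using maj[OF disjI2[OF refl]] by (elim exE conjE) (rule that, assumption+)
  have [measurable]: "?A \<in> sets \<mu>" "?B \<in> sets \<mu>" "k1 \<in> borel_measurable \<mu>" "k2 \<in> borel_measurable \<mu>" "Nul \<in> sets \<mu>"
    using sheet_image_borel k1(1) k2(1) Nul_null by (auto simp: measurable_cong_sets[OF \<mu>(1)])
  \<comment> \<open>Nothing bounds the integrand on \<open>Nul\<close>. The majorant takes the value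
    infinity there, which costs nothing on a null set.\<close>
  have "(\<integral>\<^sup>+x\<in>Reg - {0}. ennreal (k x) \<partial>\<mu>) \<le> (\<integral>\<^sup>+x. (k1 x * indicator ?A x + k2 x * indicator ?B x) + \<infinity> * indicator Nul x \<partial>\<mu>)"
  proof (rule nn_integral_mono)
    fix x
    show "ennreal (k x) * indicator (Reg - {0}) x \<le> (k1 x * indicator ?A x + k2 x * indicator ?B x) + \<infinity> * indicator Nul x"
    proof (cases "x \<in> Reg - {0}")
      case True
      then consider "x \<in> ?A" | "x \<in> ?B" | "x \<in> Nul" using Reg_decomp by blast
      then show ?thesis
        by cases (use True k1(2)[rule_format, of x] k2(2)[rule_format, of x] in \<open>auto simp: add_increasing2 add_increasing\<close>)
    qed simp
  qed
  also have "\<dots> = (\<integral>\<^sup>+x\<in>?A. k1 x \<partial>\<mu>) + (\<integral>\<^sup>+x\<in>?B. k2 x \<partial>\<mu>) + (\<integral>\<^sup>+x. \<infinity> * indicator Nul x \<partial>\<mu>)"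
    by (subst nn_integral_add; (subst nn_integral_add)?) auto
  also have "(\<integral>\<^sup>+x. \<infinity> * indicator Nul x \<partial>\<mu>) = 0" by (rule nn_integral_null_set[OF Nul_null])
  also have "(\<integral>\<^sup>+x\<in>?A. k1 x \<partial>\<mu>) + (\<integral>\<^sup>+x\<in>?B. k2 x \<partial>\<mu>) + 0 < \<infinity>"
    unfolding k1(3) k2(3) using fin by simp
  finally show ?thesis .
qed

end

section \<open>The conjugate-linear part of the derivative\<close>

definition dbv :: "(complex^'n \<Rightarrow> complex) \<Rightarrow> complex^'n \<Rightarrow> complex^'n \<Rightarrow> complex" where
  "dbv f x v = (frechet_derivative f (at x) v + \<i> * frechet_derivative f (at x) (\<i> *s v)) / 2"

lemma dbar_dir_eq_dbv: "dbar_dir f x v = dbv f x v"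
  by (simp add: dbar_dir_def dbv_def)

lemma dbv_eqI: "(f has_derivative D) (at x) \<Longrightarrow> dbv f x v = (D v + \<i> * D (\<i> *s v)) / 2"
  by (simp only: dbv_def frechet_derivative_eqI)

lemma linear_complex_scale:
  fixes D :: "complex^'n \<Rightarrow> complex"
  assumes "linear D"
  shows "D (c *s v) = of_real (Re c) * D v + of_real (Im c) * D (\<i> *s v)"
proof -
  have "c *s v = Re c *\<^sub>R v + Im c *\<^sub>R (\<i> *s v)"
    by (auto simp: vec_eq_iff complex_eq_iff)
  then have "D (c *s v) = Re c *\<^sub>R D v + Im c *\<^sub>R D (\<i> *s v)"
    by (simp only: linear_add[OF assms] linear_cmul[OF assms])
  then show ?thesis by (simp add: scaleR_conv_of_real)
qed

lemma dbv_linear: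
  assumes "f differentiable (at x)"
  shows "dbv f x (u + v) = dbv f x u + dbv f x v" "dbv f x (c *s v) = cnj c * dbv f x v"
proof -
  let ?D = "frechet_derivative f (at x)"
  have lin: "linear ?D" using assms linear_frechet_derivative by blast
  show "dbv f x (u + v) = dbv f x u + dbv f x v"
    by (simp add: dbv_def vector_add_ldistrib linear_add[OF lin] field_simps)
  have i: "\<i> *s (c *s v) = (\<i> * c) *s v" by (simp add: vec_eq_iff)
  have ii: "\<i> * (\<i> * x) = - x" for x by (simp add: mult.assoc[symmetric])
  have "dbv f x (c *s v) = (of_real (Re c) - \<i> * of_real (Im c)) * dbv f x v"
    unfolding dbv_def i linear_complex_scale[OF lin, of c] linear_complex_scale[OF lin, of "\<i> * c"]
    by (simp add: field_simps ii)
  also have "of_real (Re c) - \<i> * of_real (Im c) = cnj c" by (simp add: complex_eq_iff)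
  finally show "dbv f x (c *s v) = cnj c * dbv f x v" .
qed

text \<open>Holomorphic coefficients are constants for dbar, and composition with a holomorphic map
  commutes with taking the conjugate-linear part.\<close>

lemma dbv_sum_holo:
  fixes c :: "'k \<Rightarrow> complex^'n \<Rightarrow> complex" and H :: "'k \<Rightarrow> complex^'m \<Rightarrow> complex"
  assumes c: "\<And>k. k \<in> K \<Longrightarrow> holo_fun (c k) S" and G: "holomorphic_map G S" and x: "x \<in> S"
    and H: "\<And>k. k \<in> K \<Longrightarrow> H k differentiable (at (G x))"
  shows "((\<lambda>x. \<Sum>k\<in>K. c k x * H k (G x)) has_derivative
      (\<lambda>v. \<Sum>k\<in>K. c k x * frechet_derivative (H k) (at (G x)) (frechet_derivative G (at x) v) + frechet_derivative (c k) (at x) v * H k (G x))) (at x)"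
    "dbv (\<lambda>x. \<Sum>k\<in>K. c k x * H k (G x)) x v = (\<Sum>k\<in>K. c k x * dbv (H k) (G x) (frechet_derivative G (at x) v))"
proof -
  note G' = holomorphic_mapD[OF G x]
  show *: "((\<lambda>x. \<Sum>k\<in>K. c k x * H k (G x)) has_derivative
      (\<lambda>v. \<Sum>k\<in>K. c k x * frechet_derivative (H k) (at (G x)) (frechet_derivative G (at x) v) + frechet_derivative (c k) (at x) v * H k (G x))) (at x)"
    by (intro has_derivative_sum has_derivative_mult holo_funD(1)[OF c x] has_derivative_compose[OF G'(1)])
       (use H in \<open>auto simp: frechet_derivative_works\<close>)
  have ii: "\<i> * (\<i> * x) = - x" for x by (simp add: mult.assoc[symmetric])
  have "dbv (\<lambda>x. \<Sum>k\<in>K. c k x * H k (G x)) x v =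
    (\<Sum>k\<in>K. ((c k x * frechet_derivative (H k) (at (G x)) (frechet_derivative G (at x) v) + frechet_derivative (c k) (at x) v * H k (G x))
      + \<i> * (c k x * frechet_derivative (H k) (at (G x)) (frechet_derivative G (at x) (\<i> *s v)) + frechet_derivative (c k) (at x) (\<i> *s v) * H k (G x))) / 2)"
    unfolding dbv_eqI[OF *] by (simp only: sum_distrib_left sum.distrib[symmetric] sum_divide_distrib)
  also have "\<dots> = (\<Sum>k\<in>K. c k x * dbv (H k) (G x) (frechet_derivative G (at x) v))"
    by (rule sum.cong[OF refl])
       (simp add: dbv_def G'(2) holo_funD(2)[OF c x] field_simps ii)
  finally show "dbv (\<lambda>x. \<Sum>k\<in>K. c k x * H k (G x)) x v = (\<Sum>k\<in>K. c k x * dbv (H k) (G x) (frechet_derivative G (at x) v))" .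
qed

section \<open>The form in the square-integrable class\<close>

context weighted_poly
begin

definition Nw :: "complex^2 \<Rightarrow> real" where "Nw w = cmod (w$1) ^ (2 * b) + cmod (w$2) ^ (2 * a)"

text \<open>Up to the factor a^2 b^2 this is the density of the pull-back, under the map (y, z) to
  (y^b, z^a), of the dilation-invariant density that is the inverse fourth power of the norm. The
  numerator is the Jacobian of that map.\<close>

definition mw :: "complex^2 \<Rightarrow> real" where
  "mw w = cmod (w$1) ^ (2 * (b - 1)) * cmod (w$2) ^ (2 * (a - 1)) / (Nw w)\<^sup>2"

text \<open>The weighted polydisc; t measures the weighted distance from the origin.\<close>

definition Box :: "real \<Rightarrow> (complex^2) set" where "Box t = {w. cmod (w$1) \<le> t ^ a \<and> cmod (w$2) \<le> t ^ b}"

lemma Nw_pos: "w \<noteq> 0 \<Longrightarrow> Nw w > 0"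
  by (auto simp: Nw_def vec_eq_iff forall_2 add_pos_nonneg add_nonneg_pos)

lemma Box_measure:
  assumes "t \<ge> 0"
  shows "emeasure lborel (Box t) \<le> ennreal (16 * t ^ (2 * a + 2 * b))" "Box t \<in> sets borel"
proof -
  define u :: "complex^2" where "u = vector [Complex (t^a) (t^a), Complex (t^b) (t^b)]"
  have u: "u $ 1 = Complex (t^a) (t^a)" "u $ 2 = Complex (t^b) (t^b)" by (simp_all add: u_def)
  have sub: "Box t \<subseteq> cbox (- u) u"
  proof
    fix w assume w: "w \<in> Box t"
    have "\<bar>Re (w$1)\<bar> \<le> t^a" "\<bar>Im (w$1)\<bar> \<le> t^a" "\<bar>Re (w$2)\<bar> \<le> t^b" "\<bar>Im (w$2)\<bar> \<le> t^b"
      using w abs_Re_le_cmod[of "w$1"] abs_Im_le_cmod[of "w$1"] abs_Re_le_cmod[of "w$2"] abs_Im_le_cmod[of "w$2"]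
      by (auto simp: Box_def)
    then have "\<forall>i c. c \<in> Basis \<longrightarrow> (- u)$i \<bullet> c \<le> w$i \<bullet> c \<and> w$i \<bullet> c \<le> u$i \<bullet> c"
      unfolding forall_2 by (auto simp: u Basis_complex_def inner_complex_def)
    then show "w \<in> cbox (- u) u" by (auto simp: cbox_def Basis_vec_def inner_axis)
  qed
  have le: "(- u) \<bullet> c \<le> u \<bullet> c" if "c \<in> Basis" for c
  proof -
    have "\<forall>i c. c \<in> Basis \<longrightarrow> (- u)$i \<bullet> c \<le> u$i \<bullet> c"
      unfolding forall_2 using assms by (auto simp: u Basis_complex_def inner_complex_def)
    then show ?thesis using that by (auto simp: Basis_vec_def inner_axis)
  qed
  have "emeasure lborel (cbox (- u) u) = ennreal (\<Prod>c\<in>Basis. (u - (- u)) \<bullet> c)"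
    by (rule emeasure_lborel_cbox[OF le])
  also have "(\<Prod>c\<in>Basis. (u - (- u)) \<bullet> c) = 16 * t ^ (2 * a + 2 * b)"
    unfolding prod_Basis_vec UNIV_2 Basis_complex_def inner_axis
    by (simp add: u inner_complex_def power_add power_mult power2_eq_square power_mult_distrib)
  finally show "emeasure lborel (Box t) \<le> ennreal (16 * t ^ (2 * a + 2 * b))"
    using emeasure_mono[OF sub, of lborel] by simp
  have "closed (Box t)"
    unfolding Box_def by (intro closed_Collect_conj closed_Collect_le continuous_intros)
  then show "Box t \<in> sets borel" by auto
qed

text \<open>On the dyadic shell between \<open>Box (t / 2)\<close> and \<open>Box t\<close> the
  integrand is of order t^(m-n) and the volume is of order t^(2a+2b), so the shells contribute a
  convergent geometric series. The bound is stated as a product to keep all exponents natural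
  numbers.\<close>

lemma shell_integral_finite:
  fixes k :: "complex^2 \<Rightarrow> real"
  assumes R: "R > 0" and k: "k \<in> borel_measurable borel" and C: "C \<ge> 0"
    and bound: "\<And>t w. 0 < t \<Longrightarrow> t \<le> R \<Longrightarrow> w \<in> Box t \<Longrightarrow> (t / 2) ^ (2 * a * b) \<le> Nw w \<Longrightarrow> k w * t ^ n \<le> C * t ^ m"
    and nm: "n + 1 \<le> m + 2 * a + 2 * b"
  shows "(\<integral>\<^sup>+w\<in>Box R. ennreal (k w) \<partial>lborel) < \<infinity>"
proof -
  define t where "t j = R / 2 ^ j" for j :: nat
  have t: "t j > 0" "t j \<le> R" "t (Suc j) = t j / 2" for j
  proof -
    have "R / 2 ^ j \<le> R / 1" using R by (intro divide_left_mono) auto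
    then show "t j \<le> R" by (simp add: t_def)
  qed (use R in \<open>auto simp: t_def\<close>)
  define S where "S j = Box (t j) - Box (t (Suc j))" for j
  have S: "S j \<in> sets borel" for j using Box_measure(2) t(1) by (auto simp: S_def less_imp_le)
  obtain q where q: "m + 2 * a + 2 * b = n + 1 + q" using nm le_Suc_ex by blast
  have int: "(\<integral>\<^sup>+w\<in>S j. ennreal (k w) \<partial>lborel) \<le> ennreal (16 * C * R ^ q * R * (1/2) ^ j)" for j
  proof -
    have le: "k w \<le> C * t j ^ m / t j ^ n" if "w \<in> S j" for w
    proof -
      have w: "w \<in> Box (t j)" "w \<notin> Box (t j / 2)" using that t(3) by (auto simp: S_def)
      have h: "t j / 2 \<ge> 0" using t(1)[of j] by simp
      have "(t j / 2) ^ (2 * a * b) \<le> Nw w"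
      proof (cases "cmod (w$1) \<le> (t j / 2) ^ a")
        case False
        then have "((t j / 2) ^ a) ^ (2 * b) \<le> cmod (w$1) ^ (2 * b)" using h by (intro power_mono) auto
        then show ?thesis by (simp add: Nw_def power_mult[symmetric] mult_ac add_increasing2)
      next
        case True
        then have "cmod (w$2) > (t j / 2) ^ b" using w(2) by (auto simp: Box_def)
        then have "((t j / 2) ^ b) ^ (2 * a) \<le> cmod (w$2) ^ (2 * a)" using h by (intro power_mono) auto
        then show ?thesis by (simp add: Nw_def power_mult[symmetric] mult_ac add_increasing)
      qed
      from bound[OF t(1,2) w(1) this] show ?thesis using t(1)[of j] by (simp add: pos_le_divide_eq)
    qed
    let ?c = "C * t j ^ m / t j ^ n"
    have c0: "?c \<ge> 0" using C t(1)[of j] by simp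
    have "(\<integral>\<^sup>+w\<in>S j. ennreal (k w) \<partial>lborel) \<le> (\<integral>\<^sup>+w. ennreal ?c * indicator (Box (t j)) w \<partial>lborel)"
      by (rule nn_integral_mono) (use le in \<open>auto simp: indicator_def S_def intro!: ennreal_leI\<close>)
    also have "\<dots> = ennreal ?c * emeasure lborel (Box (t j))"
      by (rule nn_integral_cmult_indicator) (use Box_measure(2) t(1)[of j] in auto)
    also have "\<dots> \<le> ennreal ?c * ennreal (16 * t j ^ (2 * a + 2 * b))"
      by (rule mult_left_mono[OF Box_measure(1)]) (use t(1)[of j] in auto)
    also have "\<dots> = ennreal (?c * (16 * t j ^ (2 * a + 2 * b)))"
      by (rule ennreal_mult[symmetric, OF c0]) (use t(1)[of j] in simp)
    also have "?c * (16 * t j ^ (2 * a + 2 * b)) = 16 * C * (t j ^ (m + 2 * a + 2 * b) / t j ^ n)"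
      by (simp add: power_add)
    also have "t j ^ (m + 2 * a + 2 * b) / t j ^ n = t j ^ q * t j"
      unfolding q using t(1)[of j] by (simp add: power_add)
    also have "ennreal (16 * C * (t j ^ q * t j)) \<le> ennreal (16 * C * (R ^ q * t j))"
      by (intro ennreal_leI mult_left_mono mult_right_mono power_mono) (use t[of j] C in auto)
    also have "16 * C * (R ^ q * t j) = 16 * C * R ^ q * R * (1/2) ^ j"
      by (simp add: t_def power_divide)
    finally show ?thesis .
  qed
  \<comment> \<open>The shells exhaust the box except for the origin, which lies in every smaller
    box.\<close>
  have AEw: "AE w in lborel. ennreal (k w) * indicator (Box R) w \<le> (\<Sum>j. ennreal (k w) * indicator (S j) w)"
    using AE_lborel_singleton[of "0 :: complex^2"]
  proof eventually_elim
    case (elim w)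
    show ?case
    proof (cases "w \<in> Box R")
      case True
      have lim: "(\<lambda>j. t j ^ p) \<longlonglongrightarrow> 0" if "p > 0" for p
      proof -
        have "(\<lambda>j. R * (1/2) ^ j) \<longlonglongrightarrow> R * 0" by (intro tendsto_intros LIMSEQ_realpow_zero) auto
        then have "t \<longlonglongrightarrow> 0" by (simp add: t_def [abs_def] power_divide)
        from tendsto_power[OF this, of p] show ?thesis by (simp only: zero_power[OF that])
      qed
      have "\<exists>j. w \<notin> Box (t j)"
      proof (rule ccontr)
        assume "\<not> ?thesis"
        then have "cmod (w$1) \<le> t j ^ a" "cmod (w$2) \<le> t j ^ b" for j by (auto simp: Box_def)
        then have "cmod (w$1) \<le> 0" "cmod (w$2) \<le> 0"
          using LIMSEQ_le_const[OF lim[OF a_pos]] LIMSEQ_le_const[OF lim[OF b_pos]] by blast+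
        then have "w = 0" by (simp add: vec_eq_iff forall_2)
        with elim show False by simp
      qed
      moreover have "w \<in> Box (t 0)" using True by (simp add: t_def)
      moreover have "w \<in> Box (t j)" if "w \<in> Box (t 0)" "\<And>j. w \<in> Box (t j) \<Longrightarrow> w \<in> Box (t (Suc j))" for j
        using that by (induction j) auto
      ultimately obtain j where "w \<in> Box (t j)" "w \<notin> Box (t (Suc j))" by blast
      then have "ennreal (k w) * indicator (Box R) w = ennreal (k w) * indicator (S j) w" using True by (simp add: S_def)
      also have "\<dots> \<le> (\<Sum>i. ennreal (k w) * indicator (S i) w)"
        using sum_le_suminf[of "\<lambda>i. ennreal (k w) * indicator (S i) w" "{j}"] by (simp only: sum.insert sum.empty finite.intros summableI empty_iff not_False_eq_True add_0_right zero_le UNIV_I simp_thms)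
      finally show ?thesis .
    qed simp
  qed
  have "(\<integral>\<^sup>+w\<in>Box R. ennreal (k w) \<partial>lborel) \<le> (\<integral>\<^sup>+w. (\<Sum>j. ennreal (k w) * indicator (S j) w) \<partial>lborel)"
    by (rule nn_integral_mono_AE[OF AEw])
  also have "\<dots> = (\<Sum>j. \<integral>\<^sup>+w\<in>S j. ennreal (k w) \<partial>lborel)"
    by (rule nn_integral_suminf) (use S k in measurable)
  also have "\<dots> \<le> (\<Sum>j. ennreal (16 * C * R ^ q * R * (1/2) ^ j))"
    by (rule suminf_le) (use int in auto)
  also have "\<dots> = ennreal (\<Sum>j. 16 * C * R ^ q * R * (1/2) ^ j)"
    by (rule suminf_ennreal2) (use C R in \<open>auto intro!: summable_mult summable_geometric\<close>)
  also have "\<dots> < \<infinity>" by simp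
  finally show ?thesis .
qed

definition \<beta>1 :: "complex^2 \<Rightarrow> complex" where "\<beta>1 w = - (of_nat b * cnj (w$2) * of_real (mw w))"
definition \<beta>2 :: "complex^2 \<Rightarrow> complex" where "\<beta>2 w = of_nat a * cnj (w$1) * of_real (mw w)"

text \<open>\<open>\<beta>1 d(cnj y) + \<beta>2 d(cnj z)\<close> is, for \<open>w = (y, z)\<close>, the pull-back of the Bochner--Martinelli form under \<open>(y, z) \<mapsto> (y ^ b, z ^ a)\<close>, multiplied by \<open>y ^ (b - 1) * z ^ (a - 1)\<close>.\<close>

lemma mw_nonneg: "mw w \<ge> 0" by (simp add: mw_def Nw_def)

text \<open>The numerator has weighted degree 4ab - 2a - 2b and the denominator 4ab, so
  \<open>mw\<close> has degree -(2a+2b), the critical one. The constant stems from the lower bound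
  with t/2 in place of t.\<close>

lemma mw_bound:
  assumes t: "t > 0" "w \<in> Box t" "(t / 2) ^ (2 * a * b) \<le> Nw w"
  shows "mw w * t ^ (2 * a + 2 * b) \<le> 2 ^ (4 * a * b)"
proof -
  have p: "0 < (t / 2) ^ (2 * a * b)" using t(1) by simp
  have "cmod (w$1) ^ (2 * (b - 1)) * cmod (w$2) ^ (2 * (a - 1)) \<le> (t ^ a) ^ (2 * (b - 1)) * (t ^ b) ^ (2 * (a - 1))"
    using t by (intro mult_mono power_mono) (auto simp: Box_def)
  also have "\<dots> = t ^ (a * (2 * (b - 1)) + b * (2 * (a - 1)))"
    by (simp add: power_mult[symmetric] power_add[symmetric])
  finally have num: "cmod (w$1) ^ (2 * (b - 1)) * cmod (w$2) ^ (2 * (a - 1)) \<le> t ^ (a * (2 * (b - 1)) + b * (2 * (a - 1)))" .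
  have e: "a * (2 * (b - 1)) + b * (2 * (a - 1)) + (2 * a + 2 * b) = 2 * a * b * 2"
    using a_pos b_pos by (cases a; cases b) (auto simp: algebra_simps)
  have den: "((t / 2) ^ (2 * a * b))\<^sup>2 \<le> (Nw w)\<^sup>2" using t(3) p by (intro power_mono) auto
  have "mw w \<le> t ^ (a * (2 * (b - 1)) + b * (2 * (a - 1))) / ((t / 2) ^ (2 * a * b))\<^sup>2"
    unfolding mw_def by (rule frac_le) (use num den p t(1) in auto)
  then have "mw w * t ^ (2 * a + 2 * b) \<le> t ^ (a * (2 * (b - 1)) + b * (2 * (a - 1))) / ((t / 2) ^ (2 * a * b))\<^sup>2 * t ^ (2 * a + 2 * b)"
    using t(1) by (intro mult_right_mono) auto
  also have "\<dots> = t ^ (2 * a * b * 2) / ((t / 2) ^ (2 * a * b))\<^sup>2"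
    unfolding e[symmetric] by (simp add: power_add)
  also have "\<dots> = 2 ^ (2 * a * b * 2)" using t(1) by (simp add: power_mult[symmetric] power_divide)
  finally show ?thesis by (simp add: mult_ac)
qed

lemma mw_measurable [measurable]: "mw \<in> borel_measurable borel"
proof -
  have [measurable]: "(\<lambda>w::complex^2. w $ i) \<in> borel_measurable borel" for i
    by (intro borel_measurable_continuous_onI continuous_intros)
  show ?thesis unfolding mw_def [abs_def] Nw_def by measurable
qed

lemma mw_continuous_on: "continuous_on (- {0}) mw"
  unfolding mw_def [abs_def]
  by (intro continuous_intros) (use Nw_pos in \<open>force simp: Nw_def intro!: continuous_intros\<close>)+

text \<open>The number l counts the factors \<open>mw\<close>: it is 1 for pairings, where one order
  of vanishing of c suffices, and 2 for the squared norm of the form.\<close>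

lemma weighted_integral_finite:
  fixes c :: "complex^2 \<Rightarrow> real"
  assumes R: "R > 0" and c: "c \<in> borel_measurable borel" and C: "C \<ge> 0"
    and bound: "\<And>t w. 0 < t \<Longrightarrow> t \<le> R \<Longrightarrow> w \<in> Box t \<Longrightarrow> 0 \<le> c w \<and> c w \<le> C * t ^ m"
    and m: "l * (2 * a + 2 * b) + 1 \<le> m + 2 * a + 2 * b"
  shows "(\<integral>\<^sup>+w\<in>Box R. ennreal (mw w ^ l * c w) \<partial>lborel) < \<infinity>"
proof (rule shell_integral_finite[OF R _ _ _ m])
  show "(\<lambda>w. mw w ^ l * c w) \<in> borel_measurable borel" using c by measurable
  show "2 ^ (4 * a * b * l) * C \<ge> 0" using C by simp
  fix t w assume t: "0 < t" "t \<le> R" "w \<in> Box t" "(t / 2) ^ (2 * a * b) \<le> Nw w"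
  have "(mw w * t ^ (2 * a + 2 * b)) ^ l * c w \<le> (2 ^ (4 * a * b)) ^ l * (C * t ^ m)"
    by (intro mult_mono power_mono mw_bound) (use t bound[of t w] mw_nonneg[of w] C in auto)
  then show "mw w ^ l * c w * t ^ (l * (2 * a + 2 * b)) \<le> 2 ^ (4 * a * b * l) * C * t ^ m"
    by (simp add: power_mult_distrib power_mult[symmetric] mult_ac)
qed

end

section \<open>Integrals along the weighted flow\<close>

context weighted_poly
begin

text \<open>The weighted action with complex time. Real and imaginary time directions together will
  produce the conjugate-linear derivative along the action.\<close>

definition fl :: "complex \<Rightarrow> complex^2 \<Rightarrow> complex^2" where
  "fl c w = vector [exp (of_nat a * c) * w$1, exp (of_nat b * c) * w$2]"

text \<open>The coordinate x has weight h / 2. Writing the action with exponentials makes this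
  meaningful also for odd h.\<close>

definition Fl :: "complex \<Rightarrow> complex^3 \<Rightarrow> complex^3" where
  "Fl c v = vector [exp (of_nat h / 2 * c) * v$1, exp (of_nat a * c) * v$2, exp (of_nat b * c) * v$3]"

definition Rt :: "complex^3 \<Rightarrow> complex^3" where
  "Rt v = vector [of_nat h / 2 * v$1, of_nat a * v$2, of_nat b * v$3]"

lemma fl_nth [simp]: "fl c w $ 1 = exp (of_nat a * c) * w$1" "fl c w $ 2 = exp (of_nat b * c) * w$2"
  by (simp_all add: fl_def)

lemma Fl_nth [simp]: "Fl c v $ 1 = exp (of_nat h / 2 * c) * v$1" "Fl c v $ 2 = exp (of_nat a * c) * v$2"
   "Fl c v $ 3 = exp (of_nat b * c) * v$3"
  by (simp_all add: Fl_def)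

lemma Rt_nth [simp]: "Rt v $ 1 = of_nat h / 2 * v$1" "Rt v $ 2 = of_nat a * v$2" "Rt v $ 3 = of_nat b * v$3"
  by (simp_all add: Rt_def)

lemma fl_0 [simp]: "fl 0 w = w" "Fl 0 v = v"
  by (simp_all add: vec_eq_iff forall_2 forall_3)

lemma exp_half: "(exp (x / 2 * c))\<^sup>2 = exp (x * c)" for x c :: complex
proof -
  have "x * c = x / 2 * c + x / 2 * c" by (simp add: field_simps)
  then show ?thesis by (metis exp_add power2_eq_square)
qed

lemma g_fl: "g (fl c w $ 1) (fl c w $ 2) = exp (of_nat h * c) * g (w$1) (w$2)"
proof -
  have "(exp (of_nat a * c) * w$1) ^ fst k * (exp (of_nat b * c) * w$2) ^ snd k = exp (of_nat h * c) * (w$1 ^ fst k * w$2 ^ snd k)"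
    if "k \<in> M" for k
  proof -
    have "of_nat h = (of_nat a * of_nat (fst k) + of_nat b * of_nat (snd k) :: complex)"
      using weights[of "fst k" "snd k"] that by (metis of_nat_add of_nat_mult prod.collapse)
    then have "of_nat h * c = of_nat (fst k) * (of_nat a * c) + of_nat (snd k) * (of_nat b * c)"
      by (simp add: algebra_simps)
    then have "exp (of_nat h * c) = exp (of_nat a * c) ^ fst k * exp (of_nat b * c) ^ snd k"
      by (simp only: exp_add exp_of_nat_mult[of "fst k" "of_nat a * c"] exp_of_nat_mult[of "snd k" "of_nat b * c"])
    then show ?thesis by (simp only: power_mult_distrib mult_ac)
  qed
  then show ?thesis by (simp add: g_def wpoly_def sum_distrib_left mult.assoc)
qed

lemma f_Fl: "f (Fl c v) = exp (of_nat h * c) * f v"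
proof -
  have "g (Fl c v $ 2) (Fl c v $ 3) = exp (of_nat h * c) * g (v$2) (v$3)"
    using g_fl[of c "vector [v$2, v$3]"] by simp
  then show ?thesis by (simp only: f_def Fl_nth power_mult_distrib exp_half distrib_left)
qed

text \<open>The flow may carry a point across the branch cut, where the principal root changes its
  sign. So the two sheets may be exchanged, and only sums over both sheets behave well under the
  flow.\<close>

lemma pt_fl: "{pt 1 (fl c w), pt (-1) (fl c w)} = {Fl c (pt 1 w), Fl c (pt (-1) w)}"
  "pt 1 (fl c w) = Fl c (pt 1 w) \<and> pt (-1) (fl c w) = Fl c (pt (-1) w) \<or>
   pt 1 (fl c w) = Fl c (pt (-1) w) \<and> pt (-1) (fl c w) = Fl c (pt 1 w)"
proof -
  have "(sqg (fl c w))\<^sup>2 = (exp (of_nat h / 2 * c) * sqg w)\<^sup>2"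
    unfolding sqg_square g_fl power_mult_distrib exp_half by simp
  then have "sqg (fl c w) = exp (of_nat h / 2 * c) * sqg w \<or> sqg (fl c w) = - (exp (of_nat h / 2 * c) * sqg w)"
    by (simp only: power2_eq_iff)
  then show *: "pt 1 (fl c w) = Fl c (pt 1 w) \<and> pt (-1) (fl c w) = Fl c (pt (-1) w) \<or>
   pt 1 (fl c w) = Fl c (pt (-1) w) \<and> pt (-1) (fl c w) = Fl c (pt 1 w)"
    by (auto simp: vec_eq_iff forall_3 pt_def)
  then show "{pt 1 (fl c w), pt (-1) (fl c w)} = {Fl c (pt 1 w), Fl c (pt (-1) w)}" by auto
qed

lemma Fl_has_vector_derivative:
  "((\<lambda>t. Fl (c * of_real t) v) has_vector_derivative c *s Rt (Fl (c * of_real t) v)) (at t)"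
  unfolding has_vector_derivative_def has_derivative_vec_iff[where f="\<lambda>t. Fl (c * of_real t) v"] forall_3
proof -
  have L: "((\<lambda>t. exp (k * (c * of_real t)) * x) has_derivative (\<lambda>u. u *\<^sub>R (c * (k * (exp (k * (c * of_real t)) * x))))) (at t)" for k x
  proof -
    have "((\<lambda>z. exp (k * (c * z)) * x) has_field_derivative c * (k * (exp (k * (c * of_real t)) * x))) (at (of_real t))"
      by (auto intro!: derivative_eq_intros)
    from has_vector_derivative_real_field[OF this] show ?thesis by (simp only: has_vector_derivative_def)
  qed
  show "((\<lambda>t. Fl (c * of_real t) v $ 1) has_derivative (\<lambda>x. (x *\<^sub>R (c *s Rt (Fl (c * of_real t) v))) $ 1)) (at t) \<and>
    ((\<lambda>t. Fl (c * of_real t) v $ 2) has_derivative (\<lambda>x. (x *\<^sub>R (c *s Rt (Fl (c * of_real t) v))) $ 2)) (at t) \<and>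
    ((\<lambda>t. Fl (c * of_real t) v $ 3) has_derivative (\<lambda>x. (x *\<^sub>R (c *s Rt (Fl (c * of_real t) v))) $ 3)) (at t)"
    unfolding vector_scaleR_component vector_smult_component Fl_nth Rt_nth by (intro conjI L)
qed

lemma fl_continuous: "continuous_on UNIV (\<lambda>x::(complex^2) \<times> real. fl (c * of_real (snd x)) (fst x))"
  unfolding continuous_on_vec_iff[where f="\<lambda>x::(complex^2) \<times> real. fl (c * of_real (snd x)) (fst x)"] forall_2
  by (auto intro!: continuous_intros)

lemma fl_measurable: "(\<lambda>x::(complex^2) \<times> real. fl (c * of_real (snd x)) (fst x)) \<in> borel \<rightarrow>\<^sub>M borel" "fl c \<in> borel \<rightarrow>\<^sub>M borel"
proof -
  show "(\<lambda>x::(complex^2) \<times> real. fl (c * of_real (snd x)) (fst x)) \<in> borel \<rightarrow>\<^sub>M borel"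
    by (rule borel_measurable_continuous_onI[OF fl_continuous])
  show "fl c \<in> borel \<rightarrow>\<^sub>M borel"
    by (rule borel_measurable_continuous_onI)
       (auto simp: continuous_on_vec_iff[where f="fl c"] forall_2 intro!: continuous_intros)
qed

text \<open>The determinant of the flow has modulus of degree a + b in the modulus of exp c, which
  matches the degree of \<open>mw\<close>. This is the invariance of the weighted measure.\<close>

lemma mw_fl: "mw (fl c w) * (cmod (exp (of_nat (a + b) * c)))\<^sup>2 = mw w"
proof -
  define e where "e = cmod (exp c)"
  have e: "e > 0" by (simp add: e_def)
  have n: "cmod (exp (of_nat k * c)) = e ^ k" for k by (simp add: e_def exp_of_nat_mult norm_power)
  have "Nw (fl c w) = e ^ (2 * a * b) * Nw w"
    unfolding Nw_def fl_nth norm_mult n by (simp add: power_mult_distrib algebra_simps flip: power_mult)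
  moreover have "e ^ (2 * a * b) * e ^ (2 * a * b) = e ^ (a * (2 * (b - 1)) + b * (2 * (a - 1)) + (2 * a + 2 * b))"
    using a_pos b_pos by (cases a; cases b) (auto simp: power_add[symmetric] algebra_simps)
  moreover have "cmod (fl c w $ 1) ^ (2 * (b - 1)) * cmod (fl c w $ 2) ^ (2 * (a - 1)) =
     e ^ (a * (2 * (b - 1)) + b * (2 * (a - 1))) * (cmod (w$1) ^ (2 * (b - 1)) * cmod (w$2) ^ (2 * (a - 1)))"
    unfolding fl_nth norm_mult n by (simp add: power_mult_distrib power_add flip: power_mult)
  moreover have "(cmod (exp (of_nat (a + b) * c)))\<^sup>2 = e ^ (2 * a + 2 * b)"
    unfolding n by (simp add: power_mult[symmetric] algebra_simps)
  ultimately show ?thesis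
    using e by (simp add: mw_def power2_eq_square power_add field_simps)
qed

section \<open>Invariance of weighted integrals under the flow\<close>

lemma nn_integral_fl:
  assumes \<Psi>: "\<Psi> \<in> borel_measurable borel"
  shows "(\<integral>\<^sup>+w. ennreal (mw w) * \<Psi> (fl c w) \<partial>lborel) = (\<integral>\<^sup>+w. ennreal (mw w) * \<Psi> w \<partial>lborel)"
proof -
  let ?J = "(cmod (exp (of_nat (a + b) * c)))\<^sup>2"
  have lin: "linear (fl c)" "\<And>k v. fl c (k *s v) = k *s fl c v"
    by (auto intro!: linearI simp: vec_eq_iff forall_2 algebra_simps)
  have der: "(fl c has_derivative fl c) (at z)" for z
    using bounded_linear_imp_has_derivative lin(1) linear_conv_bounded_linear by blast
  have cd: "cdet (fl c) = exp (of_nat (a + b) * c)"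
    by (simp add: cdet_def axis_def algebra_simps flip: exp_add)
  have inv: "fl (- c) (fl c w) = w" "fl c (fl (- c) w) = w" for w
    by (simp_all add: vec_eq_iff forall_2 mult.assoc[symmetric] flip: exp_add)
  have inj: "inj_on (fl c) A" for A using inv(1) by (metis inj_onI)
  have img_eq: "fl c ` A = fl (- c) -` A" for A
    using inv by (auto simp: image_iff) metis
  have img: "fl c ` A \<in> sets borel" if "A \<in> sets borel" for A
    unfolding img_eq using measurable_sets[OF fl_measurable(2)[of "- c"] that] by simp
  have U: "fl c ` UNIV = UNIV" using inv(2) by (metis surjI)
  have "(\<integral>\<^sup>+w\<in>fl c ` UNIV. ennreal (mw w) * \<Psi> w \<partial>lborel) = (\<integral>\<^sup>+w\<in>UNIV. (ennreal (mw (fl c w)) * \<Psi> (fl c w)) * ennreal ?J \<partial>lborel)"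
  proof (rule nn_integral_image)
    show "emeasure lborel (fl c ` A) = (\<integral>\<^sup>+z\<in>A. ennreal ?J \<partial>lborel)" if A: "A \<in> sets borel" "A \<subseteq> UNIV" for A
      by (rule emeasure_holomorphic_image[OF A(1) img[OF A(1)] der inj])
         (use lin cd A in auto)
    show "(\<lambda>w. ennreal (mw w) * \<Psi> w) \<in> borel_measurable borel" using \<Psi> by measurable
  qed (use img fl_measurable in auto)
  also have "\<dots> = (\<integral>\<^sup>+w. ennreal (mw w) * \<Psi> (fl c w) \<partial>lborel)"
  proof (rule nn_integral_cong)
    fix w
    have "ennreal (mw (fl c w)) * \<Psi> (fl c w) * ennreal ?J = (ennreal (mw (fl c w)) * ennreal ?J) * \<Psi> (fl c w)"
      by (simp only: mult_ac)
    also have "ennreal (mw (fl c w)) * ennreal ?J = ennreal (mw w)"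
      unfolding mw_fl[of c w, symmetric] by (rule ennreal_mult[symmetric]) (auto simp: mw_nonneg)
    finally show "ennreal (mw (fl c w)) * \<Psi> (fl c w) * ennreal ?J * indicator UNIV w = ennreal (mw w) * \<Psi> (fl c w)" by simp
  qed
  finally show ?thesis unfolding U by simp
qed

lemma distr_fl: "distr (density lborel mw) borel (fl c) = density lborel mw"
proof (rule measure_eqI)
  fix A assume "A \<in> sets (distr (density lborel mw) borel (fl c))"
  then have A: "A \<in> sets borel" by simp
  have "emeasure (distr (density lborel mw) borel (fl c)) A = (\<integral>\<^sup>+w. ennreal (mw w) * indicator (fl c -` A) w \<partial>lborel)"
    using A fl_measurable(2)[of c] measurable_sets[OF fl_measurable(2)[of c] A]
    by (simp add: emeasure_distr emeasure_density)
  also have "\<dots> = (\<integral>\<^sup>+w. ennreal (mw w) * indicator A (fl c w) \<partial>lborel)"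
    by (intro nn_integral_cong) (auto simp: indicator_def)
  also have "\<dots> = (\<integral>\<^sup>+w. ennreal (mw w) * indicator A w \<partial>lborel)"
    by (rule nn_integral_fl) (use A in auto)
  finally show "emeasure (distr (density lborel mw) borel (fl c)) A = emeasure (density lborel mw) A"
    using A by (simp add: emeasure_density)
qed simp

lemma integral_fl:
  fixes \<Psi> :: "complex^2 \<Rightarrow> complex"
  assumes \<Psi>: "\<Psi> \<in> borel_measurable borel" and int: "integrable lborel (\<lambda>w. mw w *\<^sub>R \<Psi> w)"
  shows "integrable lborel (\<lambda>w. mw w *\<^sub>R \<Psi> (fl c w))" "(\<integral>w. mw w *\<^sub>R \<Psi> (fl c w) \<partial>lborel) = (\<integral>w. mw w *\<^sub>R \<Psi> w \<partial>lborel)"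
proof -
  have \<Psi>': "(\<lambda>w. \<Psi> (fl c w)) \<in> borel_measurable borel" using measurable_compose[OF fl_measurable(2) \<Psi>] .
  have 1: "integrable (density lborel mw) \<Psi>"
    using int \<Psi> by (subst integrable_density) (auto simp: mw_nonneg)
  then have 2: "integrable (distr (density lborel mw) borel (fl c)) \<Psi>" by (simp only: distr_fl)
  then have 3: "integrable (density lborel mw) (\<lambda>w. \<Psi> (fl c w))"
    by (subst (asm) integrable_distr_eq) (use \<Psi> fl_measurable(2)[of c] in auto)
  then show "integrable lborel (\<lambda>w. mw w *\<^sub>R \<Psi> (fl c w))"
    by (subst (asm) integrable_density) (use \<Psi>' in \<open>auto simp: mw_nonneg\<close>)
  have "(\<integral>w. mw w *\<^sub>R \<Psi> w \<partial>lborel) = integral\<^sup>L (density lborel mw) \<Psi>"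
    using \<Psi> by (subst integral_density) (auto simp: mw_nonneg)
  also have "\<dots> = integral\<^sup>L (distr (density lborel mw) borel (fl c)) \<Psi>" by (simp only: distr_fl)
  also have "\<dots> = integral\<^sup>L (density lborel mw) (\<lambda>w. \<Psi> (fl c w))"
    by (rule integral_distr) (use \<Psi> fl_measurable(2)[of c] in auto)
  also have "\<dots> = (\<integral>w. mw w *\<^sub>R \<Psi> (fl c w) \<partial>lborel)"
    using \<Psi>' by (subst integral_density) (auto simp: mw_nonneg)
  finally show "(\<integral>w. mw w *\<^sub>R \<Psi> (fl c w) \<partial>lborel) = (\<integral>w. mw w *\<^sub>R \<Psi> w \<partial>lborel)" ..
qed

text \<open>The root is discontinuous on the cut, but the flow does not respect the slit plane, so
  Borel measurability on all of the plane is needed. The explicit real and imaginary parts show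
  it.\<close>

lemma csqrt_measurable: "csqrt \<in> borel_measurable borel"
proof -
  have "csqrt = (\<lambda>z. Complex (sqrt ((cmod z + Re z) / 2)) ((if Im z = 0 then 1 else sgn (Im z)) * sqrt ((cmod z - Re z) / 2)))"
    by (rule ext) (simp add: complex_eq_iff)
  then have "csqrt = (\<lambda>z. of_real (sqrt ((cmod z + Re z) / 2)) + \<i> * of_real ((if Im z = 0 then 1 else sgn (Im z)) * sqrt ((cmod z - Re z) / 2)))"
    by (simp add: Complex_eq)
  moreover have "(\<lambda>z. of_real (sqrt ((cmod z + Re z) / 2)) + \<i> * of_real ((if Im z = 0 then 1 else sgn (Im z)) * sqrt ((cmod z - Re z) / 2))) \<in> borel_measurable borel"
    by measurable
  ultimately show ?thesis by simp
qed

lemma sqg_measurable: "sqg \<in> borel_measurable borel"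
proof -
  have "(\<lambda>w::complex^2. - g (w$1) (w$2)) \<in> borel_measurable borel"
    by (intro borel_measurable_continuous_onI continuous_intros holo_fun_continuous_on[OF holo_fun_g(1)])
  from measurable_compose[OF this csqrt_measurable] show ?thesis unfolding sqg_def [abs_def] .
qed

lemma vec3_eq: "vec3 x w = x *s axis 1 1 + (w$1 *s axis 2 1 + w$2 *s axis 3 1)"
  by (simp add: vec_eq_iff forall_3 axis_def)

lemma pt_measurable: "pt s \<in> borel \<rightarrow>\<^sub>M borel"
proof -
  have scal: "(\<lambda>w. k w *s u) \<in> borel \<rightarrow>\<^sub>M borel" if "k \<in> borel_measurable borel" for k :: "complex^2 \<Rightarrow> complex" and u :: "complex^3"
  proof -
    have "continuous_on UNIV (\<lambda>c::complex. c *s u)"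
      unfolding vector_scalar_mult_def by (intro continuous_intros)
    from measurable_compose[OF that borel_measurable_continuous_onI[OF this]] show ?thesis .
  qed
  have [measurable]: "(\<lambda>w::complex^2. w $ i) \<in> borel_measurable borel" for i
    by (intro borel_measurable_continuous_onI continuous_intros)
  show ?thesis
    unfolding pt_def [abs_def] vec3_eq
    by (intro borel_measurable_add scal) (use sqg_measurable in measurable)
qed

lemma norm_pt_le: "cmod s = 1 \<Longrightarrow> norm (pt s w) \<le> cmod (sqg w) + cmod (w$1) + cmod (w$2)"
  unfolding pt_def vec3_eq
  using norm_triangle_ineq[of "(s * sqg w) *s axis 1 1" "w$1 *s axis 2 1 + w$2 *s axis 3 1 :: complex^3"]
    norm_triangle_ineq[of "w$1 *s axis 2 1" "w$2 *s axis 3 1 :: complex^3"]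
  by (simp add: norm_vector_scalar_mult norm_mult norm_axis_1)

text \<open>A function bounded by the norm is of order t on \<open>Box t\<close> along the sheets,
  which is the one power missing from the critical density.\<close>

lemma integrable_linear_bound:
  fixes \<kappa> :: "complex^3 \<Rightarrow> complex"
  assumes \<kappa>: "\<kappa> \<in> borel_measurable borel" and C: "C \<ge> 0" and r: "r > 0" and s: "cmod s = 1"
    and bound: "\<And>w. cmod (\<kappa> (pt s w)) \<le> C * norm (pt s w)" and supp: "\<And>w. norm (pt s w) \<ge> r \<Longrightarrow> \<kappa> (pt s w) = 0"
  shows "integrable lborel (\<lambda>w. mw w *\<^sub>R \<kappa> (pt s w))"
proof (rule integrableI_bounded)
  have k: "(\<lambda>w. \<kappa> (pt s w)) \<in> borel_measurable borel" using measurable_compose[OF pt_measurable \<kappa>] .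
  then show "(\<lambda>w. mw w *\<^sub>R \<kappa> (pt s w)) \<in> borel_measurable lborel" by measurable
  obtain C1 where C1: "C1 > 0" "\<And>t y z. t \<ge> 0 \<Longrightarrow> cmod y \<le> t ^ a \<Longrightarrow> cmod z \<le> t ^ b \<Longrightarrow> cmod (g y z) \<le> C1 * t ^ h"
    using bounds by metis
  \<comment> \<open>With R at least 1 the radius r lies below R, R^a and R^b, so the support is
    contained in \<open>Box R\<close>.\<close>
  define R where "R = max 1 r"
  have R: "R \<ge> 1" "R \<ge> r" "R > 0" by (auto simp: R_def)
  define B where "B = sqrt (C1 * R ^ (h - 2)) + R ^ (a - 1) + R ^ (b - 1)"
  have h2: "h \<ge> 2" using ha a_pos by linarith
  \<comment> \<open>The three coordinates are of order t^(h/2), t^a and t^b. All exponents are at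
    least 1, and the surplus powers are absorbed into the constant \<open>B\<close>.\<close>
  have key: "cmod (sqg w) + cmod (w$1) + cmod (w$2) \<le> B * t ^ 1" if t: "0 < t" "t \<le> R" "w \<in> Box t" for t w
  proof -
    have pw: "t ^ n \<le> R ^ (n - 1) * t" if "n > 0" for n
    proof -
      have "t ^ n = t ^ (n - 1) * t" using that by (cases n) auto
      also have "\<dots> \<le> R ^ (n - 1) * t" using t by (intro mult_right_mono power_mono) auto
      finally show ?thesis .
    qed
    have wb: "cmod (w$1) \<le> t ^ a" "cmod (w$2) \<le> t ^ b" using t(3) by (auto simp: Box_def)
    have "(cmod (sqg w))\<^sup>2 = cmod (g (w$1) (w$2))" using sqg_square[of w] by (metis norm_minus_cancel norm_power)
    also have "\<dots> \<le> C1 * t ^ h" using C1(2)[OF _ wb] t by simp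
    also have "t ^ h = t ^ (h - 2) * t\<^sup>2" by (simp only: power_add[symmetric] le_add_diff_inverse2[OF h2])
    also have "C1 * (t ^ (h - 2) * t\<^sup>2) \<le> C1 * (R ^ (h - 2) * t\<^sup>2)"
      using C1 t by (intro mult_left_mono mult_right_mono power_mono) auto
    finally have "cmod (sqg w) \<le> sqrt (C1 * (R ^ (h - 2) * t\<^sup>2))" by (rule real_le_rsqrt)
    also have "\<dots> = sqrt (C1 * R ^ (h - 2)) * t" using t by (simp add: real_sqrt_mult mult.assoc)
    finally show ?thesis
      using wb pw[OF a_pos] pw[OF b_pos] by (simp add: B_def algebra_simps)
  qed
  have B0: "B \<ge> 0" using C1 R by (auto simp: B_def)
  define c where "c w = C * (cmod (sqg w) + cmod (w$1) + cmod (w$2))" for w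
  have cm: "c \<in> borel_measurable borel"
  proof -
    have [measurable]: "(\<lambda>w::complex^2. w $ i) \<in> borel_measurable borel" for i
      by (intro borel_measurable_continuous_onI continuous_intros)
    show ?thesis unfolding c_def [abs_def] using sqg_measurable by measurable
  qed
  have "(\<integral>\<^sup>+w\<in>Box R. ennreal (mw w ^ 1 * c w) \<partial>lborel) < \<infinity>"
  proof (rule weighted_integral_finite[OF R(3) cm, where C="C * B" and m=1])
    show "C * B \<ge> 0" using C B0 by simp
    fix t w assume t: "0 < t" "t \<le> R" "w \<in> Box t"
    show "0 \<le> c w \<and> c w \<le> C * B * t ^ 1"
      using mult_left_mono[OF key[OF t] C] C by (simp add: c_def mult.assoc)
  qed simp
  moreover have "(\<integral>\<^sup>+w. ennreal (norm (mw w *\<^sub>R \<kappa> (pt s w))) \<partial>lborel) \<le> (\<integral>\<^sup>+w\<in>Box R. ennreal (mw w ^ 1 * c w) \<partial>lborel)"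
  proof (rule nn_integral_mono)
    fix w
    show "ennreal (norm (mw w *\<^sub>R \<kappa> (pt s w))) \<le> ennreal (mw w ^ 1 * c w) * indicator (Box R) w"
    proof (cases "norm (pt s w) < r")
      case True
      have "cmod (w$1) \<le> norm (pt s w)" "cmod (w$2) \<le> norm (pt s w)"
        using Finite_Cartesian_Product.norm_nth_le[of "pt s w" 2] Finite_Cartesian_Product.norm_nth_le[of "pt s w" 3] by (simp_all add: pt_def)
      then have "cmod (w$1) \<le> R" "cmod (w$2) \<le> R" using True R by auto
      moreover have "R \<le> R ^ a" "R \<le> R ^ b" using R a_pos b_pos by (auto intro: self_le_power)
      ultimately have "w \<in> Box R" by (auto simp: Box_def)
      moreover have "norm (mw w *\<^sub>R \<kappa> (pt s w)) \<le> mw w * c w"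
      proof -
        have "cmod (\<kappa> (pt s w)) \<le> c w"
          using bound[of w] mult_left_mono[OF norm_pt_le[OF s, of w] C] by (simp add: c_def)
        then show ?thesis using mw_nonneg[of w] by (simp add: mult_left_mono)
      qed
      ultimately show ?thesis by (simp add: ennreal_leI)
    next
      case False
      then show ?thesis using supp[of w] by simp
    qed
  qed
  ultimately show "(\<integral>\<^sup>+w. ennreal (norm (mw w *\<^sub>R \<kappa> (pt s w))) \<partial>lborel) < \<infinity>" by (rule le_less_trans[rotated])
qed

text \<open>The integral of E over the flowed plane does not depend on time, while its change
  between times 0 and 1 is the time integral of the derivative E'. By invariance each time
  contributes the same amount, so the integral of E' itself is 0.\<close>

theorem flow_derivative_integral:
  fixes k \<kappa> :: "complex^3 \<Rightarrow> complex"
  assumes k: "k \<in> borel_measurable borel" "\<And>v. f v = 0 \<Longrightarrow> cmod (k v) \<le> C * norm v" "\<And>v. norm v \<ge> r \<Longrightarrow> k v = 0"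
    and \<kappa>: "\<kappa> \<in> borel_measurable borel" "\<And>v. f v = 0 \<Longrightarrow> cmod (\<kappa> v) \<le> C * norm v" "\<And>v. norm v \<ge> r \<Longrightarrow> \<kappa> v = 0"
    and C: "C \<ge> 0" and r: "r > 0"
    and der: "\<And>v t. f v = 0 \<Longrightarrow> ((\<lambda>t. k (Fl (c * of_real t) v)) has_vector_derivative \<kappa> (Fl (c * of_real t) v)) (at t)"
  shows "s = 1 \<or> s = -1 \<Longrightarrow> integrable lborel (\<lambda>w. mw w *\<^sub>R \<kappa> (pt s w))"
    "(\<integral>w. mw w *\<^sub>R \<kappa> (pt 1 w) \<partial>lborel) + (\<integral>w. mw w *\<^sub>R \<kappa> (pt (-1) w) \<partial>lborel) = 0"
proof -
  have fp: "f (pt s w) = 0" if "s = 1 \<or> s = -1" for s w using f_pt that by auto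
  have ik: "integrable lborel (\<lambda>w. mw w *\<^sub>R k (pt s w))" if "s = 1 \<or> s = -1" for s
    by (rule integrable_linear_bound[OF k(1) C r]) (use that k fp in auto)
  show i\<kappa>: "integrable lborel (\<lambda>w. mw w *\<^sub>R \<kappa> (pt s w))" if "s = 1 \<or> s = -1" for s
    by (rule integrable_linear_bound[OF \<kappa>(1) C r]) (use that \<kappa> fp in auto)
  \<comment> \<open>The sum over both sheets is insensitive to an exchange of the sheets by the
    flow.\<close>
  define E where "E w = k (pt 1 w) + k (pt (-1) w)" for w
  define E' where "E' w = \<kappa> (pt 1 w) + \<kappa> (pt (-1) w)" for w
  have Em: "E \<in> borel_measurable borel" "E' \<in> borel_measurable borel"
    unfolding E_def [abs_def] E'_def [abs_def]
    using measurable_compose[OF pt_measurable k(1)] measurable_compose[OF pt_measurable \<kappa>(1)]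
    by (auto intro: borel_measurable_add)
  have iE: "integrable lborel (\<lambda>w. mw w *\<^sub>R E w)" and iE': "integrable lborel (\<lambda>w. mw w *\<^sub>R E' w)"
    unfolding E_def E'_def scaleR_add_right using ik i\<kappa> by (auto intro: Bochner_Integration.integrable_add)
  have Efl: "E (fl d w) = k (Fl d (pt 1 w)) + k (Fl d (pt (-1) w))"
    "E' (fl d w) = \<kappa> (Fl d (pt 1 w)) + \<kappa> (Fl d (pt (-1) w))" for d w
    using pt_fl(2)[of d w] by (auto simp: E_def E'_def add.commute)
  have ftc: "((\<lambda>t. E' (fl (c * of_real t) w)) has_integral E (fl c w) - E w) {0..1}" for w
  proof -
    have "((\<lambda>t. E' (fl (c * of_real t) w)) has_integral E (fl (c * of_real 1) w) - E (fl (c * of_real 0) w)) {0..1}"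
      unfolding Efl
      by (rule fundamental_theorem_of_calculus)
         (auto intro!: has_vector_derivative_add has_vector_derivative_at_within[OF der] fp)
    then show ?thesis by simp
  qed
  let ?H = "\<lambda>w (t::real). indicator {0..1} t *\<^sub>R (mw w *\<^sub>R E' (fl (c * of_real t) w))"
  have Em2: "(\<lambda>x. E' (fl (c * of_real (snd x)) (fst x))) \<in> borel_measurable borel"
    using measurable_compose[OF fl_measurable(1) Em(2)] .
  have Hm: "case_prod ?H \<in> borel_measurable (lborel \<Otimes>\<^sub>M lborel)"
  proof -
    have f1: "(fst :: (complex^2) \<times> real \<Rightarrow> complex^2) \<in> borel \<rightarrow>\<^sub>M borel"
      and f2: "(snd :: (complex^2) \<times> real \<Rightarrow> real) \<in> borel \<rightarrow>\<^sub>M borel"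
      by (intro borel_measurable_continuous_onI continuous_intros)+
    have ind: "(indicator {0..1} :: real \<Rightarrow> real) \<in> borel_measurable borel" by simp
    have "(\<lambda>x. indicator {0..1} (snd x) *\<^sub>R (mw (fst x) *\<^sub>R E' (fl (c * of_real (snd x)) (fst x)))) \<in> borel_measurable (borel :: ((complex^2) \<times> real) measure)"
      by (rule borel_measurable_scaleR[OF measurable_compose[OF f2 ind] borel_measurable_scaleR[OF measurable_compose[OF f1 mw_measurable] Em2]])
    then show ?thesis by (simp add: lborel_prod case_prod_beta')
  qed
  have nE: "(\<integral>\<^sup>+w. ennreal (norm (mw w *\<^sub>R E' w)) \<partial>lborel) < \<infinity>" using iE' by (simp add: integrable_iff_bounded)
  have "(\<integral>\<^sup>+x. ennreal (norm (case_prod ?H x)) \<partial>(lborel \<Otimes>\<^sub>M lborel)) =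
     (\<integral>\<^sup>+t. (\<integral>\<^sup>+w. ennreal (norm (?H w t)) \<partial>lborel) \<partial>lborel)"
    by (subst lborel_pair.nn_integral_snd[symmetric]) (use Hm in auto)
  also have "\<dots> = (\<integral>\<^sup>+t. indicator {0..1::real} t * (\<integral>\<^sup>+w. ennreal (norm (mw w *\<^sub>R E' w)) \<partial>lborel) \<partial>lborel)"
  proof (rule nn_integral_cong)
    fix t :: real
    have gen: "(\<lambda>w. ennreal (mw w) * ennreal (norm (F w))) \<in> borel_measurable lborel"
      if [measurable]: "F \<in> borel_measurable borel" for F :: "complex^2 \<Rightarrow> complex" by measurable
    have "(\<integral>\<^sup>+w. ennreal (norm (?H w t)) \<partial>lborel) = (\<integral>\<^sup>+w. indicator {0..1} t * (ennreal (mw w) * ennreal (norm (E' (fl (c * of_real t) w)))) \<partial>lborel)"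
      using mw_nonneg by (intro nn_integral_cong) (auto simp: indicator_def ennreal_mult)
    also have "\<dots> = indicator {0..1} t * (\<integral>\<^sup>+w. ennreal (mw w) * ennreal (norm (E' (fl (c * of_real t) w))) \<partial>lborel)"
      by (intro nn_integral_cmult gen measurable_compose[OF fl_measurable(2) Em(2)])
    also have "(\<integral>\<^sup>+w. ennreal (mw w) * ennreal (norm (E' (fl (c * of_real t) w))) \<partial>lborel) = (\<integral>\<^sup>+w. ennreal (mw w) * ennreal (norm (E' w)) \<partial>lborel)"
      by (rule nn_integral_fl) (use Em in measurable)
    also have "\<dots> = (\<integral>\<^sup>+w. ennreal (norm (mw w *\<^sub>R E' w)) \<partial>lborel)"
      using mw_nonneg by (intro nn_integral_cong) (auto simp: ennreal_mult)
    finally show "(\<integral>\<^sup>+w. ennreal (norm (?H w t)) \<partial>lborel) = indicator {0..1::real} t * (\<integral>\<^sup>+w. ennreal (norm (mw w *\<^sub>R E' w)) \<partial>lborel)" .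
  qed
  also have "\<dots> < \<infinity>" using nE by (simp add: nn_integral_multc)
  finally have int: "integrable (lborel \<Otimes>\<^sub>M lborel) (case_prod ?H)"
    using Hm by (intro integrableI_bounded)
  \<comment> \<open>Invariance inserts the flow at time t, Fubini exchanges the integrals, and the
    inner time integral is evaluated by the fundamental theorem of calculus on almost every
    orbit.\<close>
  have "(\<integral>w. mw w *\<^sub>R E' w \<partial>lborel) = (\<integral>t. indicator {0..1::real} t *\<^sub>R (\<integral>w. mw w *\<^sub>R E' w \<partial>lborel) \<partial>lborel)" by simp
  also have "\<dots> = (\<integral>t. (\<integral>w. ?H w t \<partial>lborel) \<partial>lborel)"
    by (simp only: integral_scaleR_right integral_fl[OF Em(2) iE'])
  also have "\<dots> = (\<integral>w. (\<integral>t. ?H w t \<partial>lborel) \<partial>lborel)"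
    by (rule lborel_pair.Fubini_integral[OF int])
  also have "\<dots> = (\<integral>w. mw w *\<^sub>R E (fl c w) - mw w *\<^sub>R E w \<partial>lborel)"
  proof (rule integral_cong_AE)
    have "AE w in lborel. integrable lborel (?H w)"
      using lborel_pair.AE_integrable_fst'[OF int] by simp
    then show "AE w in lborel. (\<integral>t. ?H w t \<partial>lborel) = mw w *\<^sub>R E (fl c w) - mw w *\<^sub>R E w"
    proof eventually_elim
      case (elim w)
      then have "set_integrable lborel {0..1} (\<lambda>t. mw w *\<^sub>R E' (fl (c * of_real t) w))" by (simp add: set_integrable_def)
      from set_borel_integral_eq_integral(2)[OF this]
      have "(\<integral>t. ?H w t \<partial>lborel) = integral {0..1} (\<lambda>t. mw w *\<^sub>R E' (fl (c * of_real t) w))"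
        by (simp only: set_lebesgue_integral_def)
      also have "\<dots> = mw w *\<^sub>R (E (fl c w) - E w)"
        by (rule integral_unique[OF has_integral_cmul[OF ftc]])
      finally show ?case by (simp add: scaleR_diff_right)
    qed
    show "(\<lambda>w. \<integral>t. ?H w t \<partial>lborel) \<in> borel_measurable lborel"
      using lborel.borel_measurable_lebesgue_integral[OF Hm] by simp
    show "(\<lambda>w. mw w *\<^sub>R E (fl c w) - mw w *\<^sub>R E w) \<in> borel_measurable lborel"
      using measurable_compose[OF fl_measurable(2)[of c] Em(1)] Em(1) by measurable
  qed
  also have "\<dots> = 0"
    using integral_fl[OF Em(1) iE, of c] iE by simp
  finally have "(\<integral>w. mw w *\<^sub>R E' w \<partial>lborel) = 0" .
  then show "(\<integral>w. mw w *\<^sub>R \<kappa> (pt 1 w) \<partial>lborel) + (\<integral>w. mw w *\<^sub>R \<kappa> (pt (-1) w) \<partial>lborel) = 0"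
    unfolding E'_def scaleR_add_right using i\<kappa>[of 1] i\<kappa>[of "-1"] by simp
qed

end

section \<open>A closed square-integrable form\<close>

lemma linear_euclidean_sum:
  fixes L :: "'a::euclidean_space \<Rightarrow> 'b::real_vector"
  assumes "linear L"
  shows "L u = (\<Sum>b\<in>Basis. (u \<bullet> b) *\<^sub>R L b)"
  by (subst euclidean_representation[symmetric, of u]) (simp only: linear_sum[OF assms] linear_cmul[OF assms])

lemma continuous_on_linear_apply:
  fixes L :: "'c::topological_space \<Rightarrow> 'a::euclidean_space \<Rightarrow> 'b::real_normed_vector"
  assumes "\<And>v. v \<in> S \<Longrightarrow> linear (L v)" "\<And>e. continuous_on S (\<lambda>v. L v e)" "continuous_on S u"
  shows "continuous_on S (\<lambda>v. L v (u v))"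
proof -
  have "continuous_on S (\<lambda>v. \<Sum>b\<in>Basis. (u v \<bullet> b) *\<^sub>R L v b)"
    by (intro continuous_intros assms(2,3))
  then show ?thesis
    by (rule continuous_on_eq) (use linear_euclidean_sum[OF assms(1)] in simp)
qed

lemma linear_family_bound:
  fixes L :: "'c::topological_space \<Rightarrow> 'a::euclidean_space \<Rightarrow> 'b::real_normed_vector"
  assumes "compact S" "\<And>v. v \<in> S \<Longrightarrow> linear (L v)" "\<And>e. continuous_on S (\<lambda>v. L v e)"
  obtains M where "M > 0" "\<And>v u. v \<in> S \<Longrightarrow> norm (L v u) \<le> M * norm u"
proof -
  have "\<exists>B. \<forall>v\<in>S. norm (L v e) \<le> B" for e
    using compact_imp_bounded[OF compact_continuous_image[OF assms(3) assms(1)], of e] by (auto simp: bounded_iff)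
  then obtain B where B: "\<And>e v. v \<in> S \<Longrightarrow> norm (L v e) \<le> B e" by metis
  define M where "M = 1 + (\<Sum>b\<in>(Basis :: 'a set). \<bar>B b\<bar>)"
  have M: "M > 0" by (simp add: M_def add_pos_nonneg sum_nonneg)
  moreover have "norm (L v u) \<le> M * norm u" if v: "v \<in> S" for v u
  proof -
    have "norm (L v u) \<le> (\<Sum>b\<in>Basis. norm ((u \<bullet> b) *\<^sub>R L v b))"
      unfolding linear_euclidean_sum[OF assms(2)[OF v], of u] by (rule norm_sum)
    also have "\<dots> \<le> (\<Sum>b\<in>Basis. norm u * \<bar>B b\<bar>)"
    proof (rule sum_mono)
      fix b :: 'a assume "b \<in> Basis"
      then have "\<bar>u \<bullet> b\<bar> \<le> norm u" by (rule Basis_le_norm)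
      moreover have "norm (L v b) \<le> \<bar>B b\<bar>" using B[OF v, of b] by linarith
      ultimately show "norm ((u \<bullet> b) *\<^sub>R L v b) \<le> norm u * \<bar>B b\<bar>" by (simp add: mult_mono)
    qed
    also have "\<dots> \<le> M * norm u" by (simp add: M_def sum_distrib_left[symmetric] algebra_simps)
    finally show ?thesis .
  qed
  ultimately show ?thesis using that by blast
qed

lemma Ck_on_vec:
  fixes f :: "'a::real_normed_vector \<Rightarrow> complex^'n"
  assumes "open S" "\<And>i. Ck_on k S (\<lambda>x. f x $ i)"
  shows "Ck_on k S f"
proof -
  have bl: "bounded_linear (\<lambda>c. c *s (v :: complex^'n))" for v
    by (rule bounded_linear_intro[where K="norm v"])
       (auto simp: norm_vector_scalar_mult vec_eq_iff algebra_simps)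
  have "Ck_on k S (\<lambda>x. \<Sum>i\<in>UNIV. f x $ i *s axis i 1)"
    by (intro Ck_on_sum assms Ck_on_bounded_linear_comp[OF _ bl])
  also have "(\<lambda>x. \<Sum>i\<in>UNIV. f x $ i *s axis i 1) = f"
    by (simp add: fun_eq_iff vec_eq_iff axis_def if_distrib cong: if_cong)
  finally show ?thesis .
qed

lemma holomorphic_map_Ck_on: "open S \<Longrightarrow> holomorphic_map f S \<Longrightarrow> Ck_on k S f"
  by (intro Ck_on_vec holo_fun_Ck_on holomorphic_map_nth)

definition crs :: "complex^3 \<Rightarrow> complex^3 \<Rightarrow> complex^3" where
  "crs u v = vector [u$2 * v$3 - u$3 * v$2, u$3 * v$1 - u$1 * v$3, u$1 * v$2 - u$2 * v$1]"

lemma crs_nth [simp]: "crs u v $ 1 = u$2 * v$3 - u$3 * v$2" "crs u v $ 2 = u$3 * v$1 - u$1 * v$3"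
  "crs u v $ 3 = u$1 * v$2 - u$2 * v$1"
  by (simp_all add: crs_def)

lemma crs_lincomb: "crs (\<gamma> *s a + \<delta> *s b) (\<epsilon> *s a + \<zeta> *s b) = (\<gamma> * \<zeta> - \<delta> * \<epsilon>) *s crs a b"
  by (simp add: vec_eq_iff forall_3 algebra_simps)

text \<open>The cyclic order of the pairs makes the coefficients of a 2-form match the components of
  \<open>crs\<close>.\<close>

definition pair_of :: "3 \<Rightarrow> (complex^3) list" where
  "pair_of i = (if i = 1 then [axis 2 1, axis 3 1] else if i = 2 then [axis 3 1, axis 1 1] else [axis 1 1, axis 2 1])"

text \<open>\<open>form_at\<close> demands real bilinearity and a behaviour under simultaneous
  scaling only. Complex bilinearity has to be derived before the form can be expanded in the
  standard basis.\<close>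

lemma form_20_expand:
  assumes "form_at UNIV 2 0 \<alpha>"
  shows "\<alpha> [u, v] = (\<Sum>i\<in>UNIV. crs u v $ i * \<alpha> (pair_of i))"
proof -
  define B where "B x y = \<alpha> [x, y]" for x y
  have S: "(\<forall>i<2. \<forall>v w. \<alpha> (vs[i := v + w]) = \<alpha> (vs[i := v]) + \<alpha> (vs[i := w])) \<and>
    (\<forall>i<2. \<forall>v. \<forall>t::real. \<alpha> (vs[i := t *\<^sub>R v]) = t *\<^sub>R \<alpha> (vs[i := v])) \<and>
    (\<forall>i<2. \<forall>j<2. i \<noteq> j \<and> vs ! i = vs ! j \<longrightarrow> \<alpha> vs = 0) \<and> (\<forall>c. \<alpha> (map ((*s) c) vs) = c ^ 2 * \<alpha> vs)"
    if "length vs = 2" for vs using assms that by (simp add: form_at_def)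
  note S1 = conjunct1[OF S] and S2 = conjunct1[OF conjunct2[OF S]]
    and S3 = conjunct1[OF conjunct2[OF conjunct2[OF S]]] and S4 = conjunct2[OF conjunct2[OF conjunct2[OF S]]]
  have add: "B (x + x') y = B x y + B x' y" "B y (x + x') = B y x + B y x'" for x x' y
    using S1[of "[x, y]", rule_format, of 0 x x'] S1[of "[y, x]", rule_format, of 1 x x'] by (simp_all add: B_def)
  have scl: "B (t *\<^sub>R x) y = t *\<^sub>R B x y" for t x y
    using S2[of "[x, y]", rule_format, of 0 t x] by (simp_all add: B_def)
  have alt: "B x x = 0" for x
    using S3[of "[x, x]", rule_format, of 0 1] by (simp add: B_def)
  have sq: "B (c *s x) (c *s y) = c ^ 2 * B x y" for c x y
    using S4[of "[x, y]", rule_format, of c] by (simp add: B_def)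
  have anti: "B y x = - B x y" for x y
  proof -
    have "0 = B (x + y) (x + y)" by (simp only: alt)
    also have "\<dots> = B x y + B y x" by (simp only: add) (simp add: alt)
    finally have "B x y + B y x = 0" by simp
    then show ?thesis by (simp add: eq_neg_iff_add_eq_0 add.commute)
  qed
  have ii: "\<i> *s (\<i> *s x) = - x" for x :: "complex^3" by (simp add: vec_eq_iff)
  have neg: "B (- x) y = - B x y" for x y using scl[of "-1" x y] by simp
  \<comment> \<open>Polarization: scaling both arguments by 1 + \<i> relates the mixed terms to B.
    Replacing x by \<i> x then isolates the action of \<i> on the first argument.\<close>
  have mix: "B (\<i> *s x) y + B x (\<i> *s y) = 2 * \<i> * B x y" for x y
  proof -
    have e: "(1 + \<i>) *s x = x + \<i> *s x" for x :: "complex^3" by (simp add: vec_eq_iff algebra_simps)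
    have "B ((1 + \<i>) *s x) ((1 + \<i>) *s y) = 2 * \<i> * B x y"
      unfolding sq by (simp add: power2_eq_square algebra_simps)
    moreover have "B (\<i> *s x) (\<i> *s y) = - B x y" unfolding sq by simp
    ultimately show ?thesis unfolding e add by (simp add: algebra_simps)
  qed
  have i_left: "B (\<i> *s x) y = \<i> * B x y" for x y
  proof -
    have "- B x y + B (\<i> *s x) (\<i> *s y) = 2 * \<i> * B (\<i> *s x) y" using mix[of "\<i> *s x" y] by (simp add: ii neg)
    moreover have "B (\<i> *s x) (\<i> *s y) = - B x y" unfolding sq by simp
    ultimately have e: "\<i> * B (\<i> *s x) y = - B x y" by simp
    have "B (\<i> *s x) y = - (\<i> * (\<i> * B (\<i> *s x) y))" by (simp add: mult.assoc[symmetric])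
    also have "\<dots> = \<i> * B x y" unfolding e by simp
    finally show ?thesis .
  qed
  have left: "B (c *s x) y = c * B x y" for c x y
  proof -
    have "c *s x = Re c *\<^sub>R x + Im c *\<^sub>R (\<i> *s x)"
      by (auto simp: vec_eq_iff complex_eq_iff)
    then have "B (c *s x) y = of_real (Re c) * B x y + of_real (Im c) * (\<i> * B x y)"
      by (simp only: add scl i_left scaleR_conv_of_real[where 'a=complex])
    also have "\<dots> = (of_real (Re c) + \<i> * of_real (Im c)) * B x y" by (simp add: algebra_simps)
    also have "of_real (Re c) + \<i> * of_real (Im c) = c" by (simp add: complex_eq_iff)
    finally show ?thesis .
  qed
  have right: "B x (c *s y) = c * B x y" for c x y using left[of c y x] anti[of x "c *s y"] anti[of x y] by simp
  have ex: "w = w$1 *s axis 1 1 + (w$2 *s axis 2 1 + w$3 *s axis 3 1)" for w :: "complex^3"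
    by (simp add: vec_eq_iff forall_3 axis_def)
  let ?e1 = "axis 1 1 :: complex^3" and ?e2 = "axis 2 1 :: complex^3" and ?e3 = "axis 3 1 :: complex^3"
  have "B u v = B (u$1 *s ?e1 + (u$2 *s ?e2 + u$3 *s ?e3)) (v$1 *s ?e1 + (v$2 *s ?e2 + v$3 *s ?e3))"
    using ex[of u] ex[of v] by simp
  also have "\<dots> = (u$2 * v$3 - u$3 * v$2) * B ?e2 ?e3 + (u$3 * v$1 - u$1 * v$3) * B ?e3 ?e1 + (u$1 * v$2 - u$2 * v$1) * B ?e1 ?e2"
    unfolding add left right using anti[of ?e2 ?e1] anti[of ?e1 ?e3] anti[of ?e3 ?e2]
    by (simp add: alt algebra_simps)
  finally show ?thesis by (simp add: sum_3 pair_of_def B_def)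
qed

lemma dbar_list3:
  "dbar \<eta> x [v1, v2, v3] = dbar_dir (\<lambda>y. \<eta> y [v2, v3]) x v1 - dbar_dir (\<lambda>y. \<eta> y [v1, v3]) x v2 + dbar_dir (\<lambda>y. \<eta> y [v1, v2]) x v3"
proof -
  have "{..<length [v1, v2, v3]} = {0, 1, 2}" by auto
  then show ?thesis unfolding dbar_def by (simp add: numeral_2_eq_2)
qed

context germ
begin

section \<open>The obstruction form and its square integrability\<close>

definition prj :: "complex^3 \<Rightarrow> complex^2" where "prj v = vector [v$2, v$3]"

lemma prj_nth [simp]: "prj v $ 1 = v$2" "prj v $ 2 = v$3" by (simp_all add: prj_def)

lemma prj_pt [simp]: "prj (pt s w) = w" by (simp add: vec_eq_iff forall_2 pt_def)

definition \<phi> :: form where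
  "\<phi> x vs = F x $ 1 * (\<beta>1 (prj (F x)) * cnj (frechet_derivative F (at x) (hd vs) $ 2)
     + \<beta>2 (prj (F x)) * cnj (frechet_derivative F (at x) (hd vs) $ 3))"

lemma F_deriv:
  assumes "x \<in> U"
  shows "linear (frechet_derivative F (at x))" "frechet_derivative F (at x) (c *s v) = c *s frechet_derivative F (at x) v"
  using holomorphic_mapD[OF F(1) assms] has_derivative_linear by blast+

lemma \<phi>_conj_linear:
  assumes "x \<in> U"
  shows "\<phi> x [\<alpha> *s u + \<beta> *s v] = cnj \<alpha> * \<phi> x [u] + cnj \<beta> * \<phi> x [v]"
  by (simp add: \<phi>_def linear_add[OF F_deriv(1)[OF assms]] F_deriv(2)[OF assms] algebra_simps)

lemma Reg_U: "x \<in> Reg \<Longrightarrow> x \<in> U" "x \<in> Reg \<Longrightarrow> x \<in> X \<inter> U" by (auto simp: Reg_def)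

lemma \<phi>_chart_continuous_on:
  assumes p: "holo_param X W p" "p ` W \<subseteq> Reg"
  shows "continuous_on W (\<lambda>z. \<phi> (p z) [frechet_derivative p (at z) v])"
proof -
  note hF = chart_F(1)[OF p]
  have cF: "continuous_on W (\<lambda>z. F (p z))" by (rule holomorphic_map_continuous_on[OF hF])
  have cD: "continuous_on W (\<lambda>z. frechet_derivative (\<lambda>z. F (p z)) (at z) v)"
    using holomorphic_map_deriv[OF hF holo_paramD(1)[OF p(1)]] holomorphic_map_continuous_on by blast
  have cp: "continuous_on W (\<lambda>z. prj (F (p z)))"
    unfolding continuous_on_vec_iff[where f="\<lambda>z. prj (F (p z))"] forall_2
    using cF by (auto intro!: continuous_intros)
  have p0: "prj (F (p z)) \<noteq> 0" if "z \<in> W" for z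
  proof -
    have "p z \<in> Reg" "p z \<noteq> 0" using p(2) holo_paramD(7)[OF p(1)] that by auto
    then show ?thesis using F_coords_nonzero[of "p z"] by (auto simp: Reg_def vec_eq_iff forall_2)
  qed
  have cm: "continuous_on W (\<lambda>z. mw (prj (F (p z))))"
    by (rule continuous_on_compose2[OF mw_continuous_on cp]) (use p0 in auto)
  have "continuous_on W (\<lambda>z. F (p z) $ 1 * (\<beta>1 (prj (F (p z))) * cnj (frechet_derivative (\<lambda>z. F (p z)) (at z) v $ 2)
     + \<beta>2 (prj (F (p z))) * cnj (frechet_derivative (\<lambda>z. F (p z)) (at z) v $ 3)))"
    unfolding \<beta>1_def \<beta>2_def by (intro continuous_intros cF cD cp cm)
  then show ?thesis
    by (rule continuous_on_eq) (simp add: \<phi>_def chart_F(2)[OF p])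
qed

lemma G_bound:
  obtains K where "K > 0" "\<And>v u. v \<in> cball 0 r \<Longrightarrow> norm (frechet_derivative G (at v) u) \<le> K * norm u"
proof (rule linear_family_bound[of "cball 0 r" "\<lambda>v. frechet_derivative G (at v)"])
  show "linear (frechet_derivative G (at v))" if "v \<in> cball 0 r" for v
    using holomorphic_mapD(1)[OF G(1), of v] that r has_derivative_linear by blast
  show "continuous_on (cball 0 r) (\<lambda>v. frechet_derivative G (at v) e)" for e
    by (rule continuous_on_subset[OF holomorphic_map_continuous_on[OF holomorphic_map_deriv[OF G(1) V(1)]] r(2)])
qed auto

lemma D_sheet:
  assumes s: "s = 1 \<or> s = -1" and w: "w \<in> Dm"
  shows "frechet_derivative (sheet s) (at w) v = frechet_derivative G (at (pt s w)) (dpt s w v)"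
proof -
  have hpt: "holomorphic_map (pt s) Dm"
    by (rule holomorphic_map_subset[OF holomorphic_map_pt]) (auto simp: Dm_def)
  show ?thesis
    using holomorphic_map_chain[OF G(1) hpt w sheet_props(2)[OF s w]]
      frechet_derivative_eqI[OF pt_has_derivative[OF sheet_props(7)[OF s w]]]
    by (simp add: sheet_def [abs_def])
qed

lemma \<phi>_sheet:
  assumes s: "s = 1 \<or> s = -1" and w: "w \<in> Dm"
  shows "\<phi> (sheet s w) [frechet_derivative (sheet s) (at w) (axis 1 1)] = s * sqg w * \<beta>1 w"
    "\<phi> (sheet s w) [frechet_derivative (sheet s) (at w) (axis 2 1)] = s * sqg w * \<beta>2 w"
  unfolding \<phi>_def using Dpt_sheet[OF s w] sheet_props(4)[OF s w]
  by (simp_all add: dpt_def axis_def) (simp_all add: pt_def)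

text \<open>The factor x of \<phi> compensates the pole of the differential of the square root, so
  the weighted norm is bounded by four continuous functions times \<open>mw\<close> squared. Two of
  them are of the borderline kind for which 2 a < h and 2 b < h are exactly the conditions of the
  degree count.\<close>

lemma \<phi>_L2: "L2_form X Reg 1 \<phi>"
  unfolding L2_form_def
proof (intro conjI ballI allI impI)
  fix x assume x: "x \<in> Reg - {0}"
  then have xU: "x \<in> U" using Reg_U by auto
  have add: "\<phi> x [v + w] = \<phi> x [v] + \<phi> x [w]" for v w using \<phi>_conj_linear[OF xU, of 1 v 1 w] by simp
  have sc: "\<phi> x [c *s v] = cnj c * \<phi> x [v]" for c v using \<phi>_conj_linear[OF xU, of c v 0 v] by simp
  have scr: "\<phi> x [t *\<^sub>R v] = t *\<^sub>R \<phi> x [v]" for t v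
    using sc[of "of_real t" v] by (simp add: vector_scalar_mult_of_real scaleR_conv_of_real[of t "\<phi> x [v]"])
  show "form_at (tangent X x) 0 1 (\<phi> x)"
    unfolding form_at_def by (auto simp: length_Suc_conv add sc scr)
next
  fix W p and vs :: "(complex^2) list" assume "holo_param X W p \<and> p ` W \<subseteq> Reg \<and> length vs = (1::nat)"
  then obtain v where p: "holo_param X W p" "p ` W \<subseteq> Reg" and vs: "vs = [v]" by (auto simp: length_Suc_conv)
  show "(\<lambda>z. \<phi> (p z) (map (frechet_derivative p (at z)) vs)) \<in> borel_measurable (restrict_space borel W)"
    unfolding vs using \<phi>_chart_continuous_on[OF p]
    by (simp add: borel_measurable_continuous_on_restrict)
next
  obtain K where K: "K > 0" "\<And>v u. v \<in> cball 0 r \<Longrightarrow> norm (frechet_derivative G (at v) u) \<le> K * norm u"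
    using G_bound by blast
  \<comment> \<open>The four terms come from multiplying the squares of z and y by the two parts |g|
    and |g2|^2, respectively |g| and |g1|^2, that bound the squared length of x times a chart
    vector.\<close>
  define c1 where "c1 w = (cmod (w$2))\<^sup>2 * cmod (g (w$1) (w$2))" for w :: "complex^2"
  define c2 where "c2 w = (cmod (w$2))\<^sup>2 * (cmod (g2 (w$1) (w$2)))\<^sup>2" for w :: "complex^2"
  define c3 where "c3 w = (cmod (w$1))\<^sup>2 * cmod (g (w$1) (w$2))" for w :: "complex^2"
  define c4 where "c4 w = (cmod (w$1))\<^sup>2 * (cmod (g1 (w$1) (w$2)))\<^sup>2" for w :: "complex^2"
  define B where "B w = 4 * K\<^sup>2 * (real b)\<^sup>2 * (mw w ^ 2 * c1 w) + 4 * K\<^sup>2 * (real b)\<^sup>2 * (mw w ^ 2 * c2 w)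
     + (4 * K\<^sup>2 * (real a)\<^sup>2 * (mw w ^ 2 * c3 w) + 4 * K\<^sup>2 * (real a)\<^sup>2 * (mw w ^ 2 * c4 w))" for w
  have cc: "continuous_on UNIV c1" "continuous_on UNIV c2" "continuous_on UNIV c3" "continuous_on UNIV c4"
    unfolding c1_def [abs_def] c2_def [abs_def] c3_def [abs_def] c4_def [abs_def]
    by (intro continuous_intros holo_fun_continuous_on[OF holo_fun_g(1)] holo_fun_continuous_on[OF holo_fun_g(2)] holo_fun_continuous_on[OF holo_fun_g(3)])+
  have cm: "c1 \<in> borel_measurable borel" "c2 \<in> borel_measurable borel" "c3 \<in> borel_measurable borel" "c4 \<in> borel_measurable borel"
    using cc by (auto intro: borel_measurable_continuous_onI)
  define R where "R = max 1 r"
  have R: "R \<ge> 1" "R \<ge> r" "R > 0" by (auto simp: R_def)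
  obtain C where C: "C > 0" "\<And>t y z. t \<ge> 0 \<Longrightarrow> cmod y \<le> t ^ a \<Longrightarrow> cmod z \<le> t ^ b \<Longrightarrow>
    cmod (g y z) \<le> C * t ^ h \<and> cmod (g1 y z) \<le> C * t ^ (h - a) \<and> cmod (g2 y z) \<le> C * t ^ (h - b)"
    using bounds by blast
  have fin: "(\<integral>\<^sup>+w\<in>Box R. ennreal (mw w ^ 2 * c1 w) \<partial>lborel) < \<infinity>" "(\<integral>\<^sup>+w\<in>Box R. ennreal (mw w ^ 2 * c2 w) \<partial>lborel) < \<infinity>"
    "(\<integral>\<^sup>+w\<in>Box R. ennreal (mw w ^ 2 * c3 w) \<partial>lborel) < \<infinity>" "(\<integral>\<^sup>+w\<in>Box R. ennreal (mw w ^ 2 * c4 w) \<partial>lborel) < \<infinity>"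
  proof -
    have bd: "(cmod (w$1))\<^sup>2 \<le> t ^ (2 * a)" "(cmod (w$2))\<^sup>2 \<le> t ^ (2 * b)" "cmod (g (w$1) (w$2)) \<le> C * t ^ h"
      "(cmod (g1 (w$1) (w$2)))\<^sup>2 \<le> C\<^sup>2 * t ^ (2 * (h - a))" "(cmod (g2 (w$1) (w$2)))\<^sup>2 \<le> C\<^sup>2 * t ^ (2 * (h - b))"
      if t: "0 < t" "w \<in> Box t" for t w
    proof -
      have w: "cmod (w$1) \<le> t ^ a" "cmod (w$2) \<le> t ^ b" using t(2) by (auto simp: Box_def)
      note Cw = C(2)[OF less_imp_le[OF t(1)] w]
      show "(cmod (w$1))\<^sup>2 \<le> t ^ (2 * a)" "(cmod (w$2))\<^sup>2 \<le> t ^ (2 * b)"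
        using power_mono[OF w(1), of 2] power_mono[OF w(2), of 2] by (simp_all add: power_mult[symmetric] mult.commute)
      show "cmod (g (w$1) (w$2)) \<le> C * t ^ h" using Cw by blast
      show "(cmod (g1 (w$1) (w$2)))\<^sup>2 \<le> C\<^sup>2 * t ^ (2 * (h - a))" "(cmod (g2 (w$1) (w$2)))\<^sup>2 \<le> C\<^sup>2 * t ^ (2 * (h - b))"
        using power_mono[OF Cw[THEN conjunct2, THEN conjunct1], of 2] power_mono[OF Cw[THEN conjunct2, THEN conjunct2], of 2]
        by (simp_all add: power_mult_distrib power_mult[symmetric] mult.commute)
    qed
    have e: "2 * (h - a) = 2 * h - 2 * a" "2 * (h - b) = 2 * h - 2 * b" by simp_all
    show "(\<integral>\<^sup>+w\<in>Box R. ennreal (mw w ^ 2 * c1 w) \<partial>lborel) < \<infinity>"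
    proof (rule weighted_integral_finite[OF R(3) cm(1), where C=C and m="2 * b + h"])
      show "0 \<le> c1 w \<and> c1 w \<le> C * t ^ (2 * b + h)" if "0 < t" "t \<le> R" "w \<in> Box t" for t w
        using mult_mono[OF bd(2)[OF that(1,3)] bd(3)[OF that(1,3)]] that by (simp add: c1_def power_add mult_ac)
    qed (use C ha in auto)
    show "(\<integral>\<^sup>+w\<in>Box R. ennreal (mw w ^ 2 * c2 w) \<partial>lborel) < \<infinity>"
    proof (rule weighted_integral_finite[OF R(3) cm(2), where C="C\<^sup>2" and m="2 * b + 2 * (h - b)"])
      show "0 \<le> c2 w \<and> c2 w \<le> C\<^sup>2 * t ^ (2 * b + 2 * (h - b))" if "0 < t" "t \<le> R" "w \<in> Box t" for t w
        using mult_mono[OF bd(2)[OF that(1,3)] bd(5)[OF that(1,3)]] that by (simp add: c2_def power_add mult_ac)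
    qed (use C ha hb in auto)
    show "(\<integral>\<^sup>+w\<in>Box R. ennreal (mw w ^ 2 * c3 w) \<partial>lborel) < \<infinity>"
    proof (rule weighted_integral_finite[OF R(3) cm(3), where C=C and m="2 * a + h"])
      show "0 \<le> c3 w \<and> c3 w \<le> C * t ^ (2 * a + h)" if "0 < t" "t \<le> R" "w \<in> Box t" for t w
        using mult_mono[OF bd(1)[OF that(1,3)] bd(3)[OF that(1,3)]] that by (simp add: c3_def power_add mult_ac)
    qed (use C hb in auto)
    show "(\<integral>\<^sup>+w\<in>Box R. ennreal (mw w ^ 2 * c4 w) \<partial>lborel) < \<infinity>"
    proof (rule weighted_integral_finite[OF R(3) cm(4), where C="C\<^sup>2" and m="2 * a + 2 * (h - a)"])
      show "0 \<le> c4 w \<and> c4 w \<le> C\<^sup>2 * t ^ (2 * a + 2 * (h - a))" if "0 < t" "t \<le> R" "w \<in> Box t" for t w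
        using mult_mono[OF bd(1)[OF that(1,3)] bd(4)[OF that(1,3)]] that by (simp add: c4_def power_add mult_ac)
    qed (use C ha hb in auto)
  qed
  have Dm0: "Dm \<subseteq> - {0}"
  proof
    fix w assume "w \<in> Dm"
    then have "g (w$1) (w$2) \<noteq> 0" using g_0_iff_nonslit by (auto simp: Dm_def)
    moreover have "g 0 0 = 0" using euler[of 0 0] ha by simp
    ultimately show "w \<in> - {0}" by auto
  qed
  have DmR: "Dm \<subseteq> Box R"
  proof
    fix w assume "w \<in> Dm"
    then have "norm (pt 1 w) < r" by (simp add: Dm_def)
    moreover have "cmod (w$1) \<le> norm (pt 1 w)" "cmod (w$2) \<le> norm (pt 1 w)"
      using Finite_Cartesian_Product.norm_nth_le[of "pt 1 w" 2] Finite_Cartesian_Product.norm_nth_le[of "pt 1 w" 3] by (simp_all add: pt_def)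
    moreover have "R \<le> R ^ a" "R \<le> R ^ b" using R a_pos b_pos by (auto intro: self_le_power)
    ultimately show "w \<in> Box R" using R by (auto simp: Box_def)
  qed
  show "(\<integral>\<^sup>+x\<in>Reg - {0}. ennreal (form_norm_sq X 1 \<phi> x) \<partial>\<mu>) < \<infinity>"
  proof (rule region_nn_integral_finite)
    fix s :: complex assume s: "s = 1 \<or> s = -1"
    show "continuous_on Dm B"
      unfolding B_def [abs_def]
      by (intro continuous_intros continuous_on_subset[OF mw_continuous_on Dm0] continuous_on_subset[OF cc(1) subset_UNIV]
        continuous_on_subset[OF cc(2) subset_UNIV] continuous_on_subset[OF cc(3) subset_UNIV] continuous_on_subset[OF cc(4) subset_UNIV])
    show "(\<integral>\<^sup>+z\<in>Dm. ennreal (B z) \<partial>lborel) < \<infinity>"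
    proof -
      have Bm: "Box R \<in> sets lborel" using Box_measure(2)[of R] R by simp
      have nn: "c1 w \<ge> 0" "c2 w \<ge> 0" "c3 w \<ge> 0" "c4 w \<ge> 0" for w by (auto simp: c1_def c2_def c3_def c4_def)
      have fk: "(\<integral>\<^sup>+w\<in>Box R. ennreal (q * (mw w ^ 2 * c w)) \<partial>lborel) < \<infinity>"
        if "(\<integral>\<^sup>+w\<in>Box R. ennreal (mw w ^ 2 * c w) \<partial>lborel) < \<infinity>" "q \<ge> 0" and [measurable]: "c \<in> borel_measurable borel" for q c
      proof -
        have "(\<integral>\<^sup>+w\<in>Box R. ennreal (q * (mw w ^ 2 * c w)) \<partial>lborel) = ennreal q * (\<integral>\<^sup>+w\<in>Box R. ennreal (mw w ^ 2 * c w) \<partial>lborel)"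
          using that(2) Bm by (subst nn_integral_cmult[symmetric]) (auto simp: ennreal_mult' mult.assoc)
        then show ?thesis using that(1) by (simp add: ennreal_mult_less_top)
      qed
      have fa: "(\<integral>\<^sup>+w\<in>Box R. ennreal (u w + v w) \<partial>lborel) < \<infinity>"
        if "(\<integral>\<^sup>+w\<in>Box R. ennreal (u w) \<partial>lborel) < \<infinity>" "(\<integral>\<^sup>+w\<in>Box R. ennreal (v w) \<partial>lborel) < \<infinity>"
          and [measurable]: "u \<in> borel_measurable borel" "v \<in> borel_measurable borel" and "\<And>w. u w \<ge> 0" "\<And>w. v w \<ge> 0" for u v
      proof -
        have "(\<integral>\<^sup>+w\<in>Box R. ennreal (u w + v w) \<partial>lborel) = (\<integral>\<^sup>+w\<in>Box R. ennreal (u w) \<partial>lborel) + (\<integral>\<^sup>+w\<in>Box R. ennreal (v w) \<partial>lborel)"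
          using that(5,6) Bm by (subst nn_integral_add[symmetric]) (auto simp: distrib_right)
        then show ?thesis using that(1,2) by simp
      qed
      note [measurable] = cm
      have "(\<integral>\<^sup>+z\<in>Dm. ennreal (B z) \<partial>lborel) \<le> (\<integral>\<^sup>+z\<in>Box R. ennreal (B z) \<partial>lborel)"
        using DmR by (intro nn_integral_mono) (auto simp: indicator_def)
      also have "\<dots> < \<infinity>"
        unfolding B_def
        by (intro fa fk fin cm) (use nn mw_nonneg K in \<open>auto intro!: add_nonneg_nonneg mult_nonneg_nonneg\<close>)
      finally show ?thesis .
    qed
    fix z assume z: "z \<in> Dm"
    note p = holo_param_sheet[OF s] z
    let ?A = "frechet_derivative (sheet s) (at z) (axis 1 1)" and ?B = "frechet_derivative (sheet s) (at z) (axis 2 1)"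
    have xU: "sheet s z \<in> U" using sheet_props(5)[OF s z] Reg_U by blast
    have 1: "form_norm_sq X 1 \<phi> (sheet s z) * volume_density (sheet s) z
       \<le> 4 * ((cmod (s * sqg z * \<beta>1 z))\<^sup>2 * (norm ?B)\<^sup>2 + (cmod (s * sqg z * \<beta>2 z))\<^sup>2 * (norm ?A)\<^sup>2)"
      by (rule form_norm_sq_frame[OF p]) (simp add: \<phi>_conj_linear[OF xU] \<phi>_sheet[OF s z])
    have n: "cmod s = 1" using s by auto
    have vb: "pt s z \<in> cball 0 r" using sheet_props(1)[OF s z] by auto
    have sq0: "cmod (sqg z) > 0" using Re_sqg_pos[OF sheet_props(7)[OF s z]] by auto
    have sq2: "(cmod (sqg z))\<^sup>2 = cmod (g (z$1) (z$2))" using sqg_square[of z] by (metis norm_minus_cancel norm_power)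
    \<comment> \<open>The isomorphism changes lengths of tangent vectors at most by the factor
      \<open>K\<close>, the bound of the derivative of \<open>G\<close> on the closed ball.\<close>
    have nA: "(norm ?A)\<^sup>2 \<le> K\<^sup>2 * (norm (dpt s z (axis 1 1)))\<^sup>2" and nB: "(norm ?B)\<^sup>2 \<le> K\<^sup>2 * (norm (dpt s z (axis 2 1)))\<^sup>2"
      unfolding D_sheet[OF s z] power_mult_distrib[symmetric] by (intro power_mono K(2) vb norm_ge_zero)+
    have dA: "(cmod (sqg z))\<^sup>2 * (norm (dpt s z (axis 1 1)))\<^sup>2 \<le> cmod (g (z$1) (z$2)) + (cmod (g1 (z$1) (z$2)))\<^sup>2"
      unfolding dpt_def norm_vec3 using sq0 n
      by (simp add: axis_def norm_mult norm_divide power_mult_distrib power_divide sq2[symmetric] field_simps)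
    have dB: "(cmod (sqg z))\<^sup>2 * (norm (dpt s z (axis 2 1)))\<^sup>2 \<le> cmod (g (z$1) (z$2)) + (cmod (g2 (z$1) (z$2)))\<^sup>2"
      unfolding dpt_def norm_vec3 using sq0 n
      by (simp add: axis_def norm_mult norm_divide power_mult_distrib power_divide sq2[symmetric] field_simps)
    have b1: "(cmod (\<beta>1 z))\<^sup>2 = (real b)\<^sup>2 * (cmod (z$2))\<^sup>2 * (mw z)\<^sup>2" and b2: "(cmod (\<beta>2 z))\<^sup>2 = (real a)\<^sup>2 * (cmod (z$1))\<^sup>2 * (mw z)\<^sup>2"
      by (simp_all add: \<beta>1_def \<beta>2_def norm_mult power_mult_distrib)
    have "(cmod (s * sqg z * \<beta>1 z))\<^sup>2 * (norm ?B)\<^sup>2 \<le> (cmod (\<beta>1 z))\<^sup>2 * K\<^sup>2 * (cmod (g (z$1) (z$2)) + (cmod (g2 (z$1) (z$2)))\<^sup>2)"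
    proof -
      have "(cmod (s * sqg z * \<beta>1 z))\<^sup>2 * (norm ?B)\<^sup>2 \<le> (cmod (s * sqg z * \<beta>1 z))\<^sup>2 * (K\<^sup>2 * (norm (dpt s z (axis 2 1)))\<^sup>2)"
        by (rule mult_left_mono[OF nB]) simp
      also have "\<dots> = (cmod (\<beta>1 z))\<^sup>2 * K\<^sup>2 * ((cmod (sqg z))\<^sup>2 * (norm (dpt s z (axis 2 1)))\<^sup>2)"
        by (simp add: norm_mult n power_mult_distrib)
      also have "\<dots> \<le> (cmod (\<beta>1 z))\<^sup>2 * K\<^sup>2 * (cmod (g (z$1) (z$2)) + (cmod (g2 (z$1) (z$2)))\<^sup>2)"
        by (rule mult_left_mono[OF dB]) simp
      finally show ?thesis .
    qed
    moreover have "(cmod (s * sqg z * \<beta>2 z))\<^sup>2 * (norm ?A)\<^sup>2 \<le> (cmod (\<beta>2 z))\<^sup>2 * K\<^sup>2 * (cmod (g (z$1) (z$2)) + (cmod (g1 (z$1) (z$2)))\<^sup>2)"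
    proof -
      have "(cmod (s * sqg z * \<beta>2 z))\<^sup>2 * (norm ?A)\<^sup>2 \<le> (cmod (s * sqg z * \<beta>2 z))\<^sup>2 * (K\<^sup>2 * (norm (dpt s z (axis 1 1)))\<^sup>2)"
        by (rule mult_left_mono[OF nA]) simp
      also have "\<dots> = (cmod (\<beta>2 z))\<^sup>2 * K\<^sup>2 * ((cmod (sqg z))\<^sup>2 * (norm (dpt s z (axis 1 1)))\<^sup>2)"
        by (simp add: norm_mult n power_mult_distrib)
      also have "\<dots> \<le> (cmod (\<beta>2 z))\<^sup>2 * K\<^sup>2 * (cmod (g (z$1) (z$2)) + (cmod (g1 (z$1) (z$2)))\<^sup>2)"
        by (rule mult_left_mono[OF dA]) simp
      finally show ?thesis .
    qed
    ultimately show "form_norm_sq X 1 \<phi> (sheet s z) * volume_density (sheet s) z \<le> B z"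
      using 1 unfolding b1 b2 B_def c1_def c2_def c3_def c4_def by (simp add: algebra_simps)
  qed
qed

section \<open>Closedness of the form across the singular point\<close>

definition cvec :: "complex^3 \<Rightarrow> complex^3" where
  "cvec v = (let E1 = frechet_derivative G (at v) (axis 1 1); E2 = frechet_derivative G (at v) (axis 2 1);
      E3 = frechet_derivative G (at v) (axis 3 1)
    in v$1 *s crs E2 E3 - (g1 (v$2) (v$3) / 2) *s crs E1 E3 + (g2 (v$2) (v$3) / 2) *s crs E1 E2)"

lemma holo_fun_add: "holo_fun p S \<Longrightarrow> holo_fun q S \<Longrightarrow> holo_fun (\<lambda>v. p v + q v) S"
  and holo_fun_diff: "holo_fun p S \<Longrightarrow> holo_fun q S \<Longrightarrow> holo_fun (\<lambda>v. p v - q v) S"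
  and holo_fun_mult: "holo_fun p S \<Longrightarrow> holo_fun q S \<Longrightarrow> holo_fun (\<lambda>v. p v * q v) S"
  and holo_fun_const: "holo_fun (\<lambda>v. k) S"
  and holo_fun_coord: "holo_fun (\<lambda>v. v $ i) S"
proof -
  assume p: "holo_fun p S" and q: "holo_fun q S"
  note d = holo_funD(1)[OF p] holo_funD(1)[OF q]
  show "holo_fun (\<lambda>v. p v + q v) S"
    unfolding holo_fun_def
    by (intro ballI exI conjI, rule has_derivative_add[OF d], assumption+) (simp add: holo_funD(2)[OF p] holo_funD(2)[OF q] algebra_simps)
  show "holo_fun (\<lambda>v. p v - q v) S"
    unfolding holo_fun_def
    by (intro ballI exI conjI, rule has_derivative_diff[OF d], assumption+) (simp add: holo_funD(2)[OF p] holo_funD(2)[OF q] algebra_simps)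
  show "holo_fun (\<lambda>v. p v * q v) S"
    unfolding holo_fun_def
    by (intro ballI exI conjI, rule has_derivative_mult[OF d], assumption+) (simp add: holo_funD(2)[OF p] holo_funD(2)[OF q] algebra_simps)
next
  show "holo_fun (\<lambda>v. k) S" by (rule holo_funI[where D="\<lambda>_ _. 0"]) auto
  show "holo_fun (\<lambda>v. v $ i) S" by (rule holo_funI, rule has_derivative_coord) simp
qed

lemma holo_fun_cvec: "holo_fun (\<lambda>v. cvec v $ i) V"
proof -
  have E: "holo_fun (\<lambda>v. frechet_derivative G (at v) e $ j) V" for e j
    by (rule holomorphic_map_nth[OF holomorphic_map_deriv[OF G(1) V(1)]])
  have "\<forall>i. holo_fun (\<lambda>v. cvec v $ i) V"
    unfolding forall_3 cvec_def Let_def vector_add_component vector_minus_component vector_smult_component crs_nth divide_inverse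
    by (intro conjI holo_fun_add holo_fun_diff holo_fun_mult holo_fun_const holo_fun_coord holo_fun_g E)
  then show ?thesis by blast
qed

lemma cvec_0: "cvec 0 = 0"
  by (simp add: cvec_def Let_def vec_eq_iff gradient_0)

text \<open>On a sheet 2x dx = -(g1 dy + g2 dz), so x times the pull-back of a coordinate 2-form has
  coefficients without denominator with respect to dy \<and> dz. They extend holomorphically over
  the branch locus, and they vanish at 0 together with x and the gradient of g.\<close>

lemma cvec_sheet:
  assumes s: "s = 1 \<or> s = -1" and w: "w \<in> Dm"
  shows "(s * sqg w) *s crs (frechet_derivative (sheet s) (at w) (axis 1 1)) (frechet_derivative (sheet s) (at w) (axis 2 1)) = cvec (pt s w)"
proof -
  let ?DG = "frechet_derivative G (at (pt s w))"
  note G' = holomorphic_mapD[OF G(1) sheet_props(2)[OF s w]]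
  have lin: "linear ?DG" using G'(1) has_derivative_linear by blast
  define x1 x2 where "x1 = s * (- g1 (w$1) (w$2) / (2 * sqg w))" and "x2 = s * (- g2 (w$1) (w$2) / (2 * sqg w))"
  have q0: "sqg w \<noteq> 0" using Re_sqg_pos[OF sheet_props(7)[OF s w]] by auto
  have d: "dpt s w (axis 1 1) = x1 *s axis 1 1 + axis 2 1" "dpt s w (axis 2 1) = x2 *s axis 1 1 + axis 3 1"
    by (simp_all add: dpt_def x1_def x2_def vec_eq_iff forall_3 axis_def)
  have D: "?DG (x *s u + v) = x *s ?DG u + ?DG v" for x u v by (simp add: linear_add[OF lin] G'(2))
  have x: "s * sqg w * x1 = - g1 (w$1) (w$2) / 2" "s * sqg w * x2 = - g2 (w$1) (w$2) / 2"
    using q0 s by (auto simp: x1_def x2_def)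
  let ?E1 = "?DG (axis 1 1)" and ?E2 = "?DG (axis 2 1)" and ?E3 = "?DG (axis 3 1)"
  have "(s * sqg w) *s crs (x1 *s ?E1 + ?E2) (x2 *s ?E1 + ?E3)
     = (s * sqg w) *s crs ?E2 ?E3 + (s * sqg w * x1) *s crs ?E1 ?E3 - (s * sqg w * x2) *s crs ?E1 ?E2"
    by (simp add: vec_eq_iff forall_3 algebra_simps)
  also have "\<dots> = cvec (pt s w)"
    unfolding x by (simp add: cvec_def Let_def pt_def vec_eq_iff forall_3 algebra_simps)
  finally show ?thesis unfolding D_sheet[OF s w] d D .
qed

text \<open>By Euler's relation the Euler field of the model is tangent to the sheets and is the
  lift of (a y, b z).\<close>

lemma dpt_Rt:
  assumes s: "s = 1 \<or> s = -1" and w: "w \<in> Dm"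
  shows "dpt s w (vector [of_nat a * w$1, of_nat b * w$2]) = Rt (pt s w)"
proof -
  have q0: "sqg w \<noteq> 0" using Re_sqg_pos[OF sheet_props(7)[OF s w]] by auto
  have "g1 (w$1) (w$2) * (of_nat a * w$1) + g2 (w$1) (w$2) * (of_nat b * w$2) = - (of_nat h * (sqg w)\<^sup>2)"
    unfolding euler sqg_square by simp
  then have q: "- (g1 (w$1) (w$2) * (of_nat a * w$1) + g2 (w$1) (w$2) * (of_nat b * w$2)) / (2 * sqg w) = of_nat h / 2 * sqg w"
    using q0 by (simp only:) (simp add: power2_eq_square)
  show ?thesis unfolding dpt_def vector_2 q by (simp add: vec_eq_iff forall_3 pt_def)
qed

lemma sheet_Rt:
  assumes s: "s = 1 \<or> s = -1" and w: "w \<in> Dm"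
  shows "(of_nat a * w$1) *s frechet_derivative (sheet s) (at w) (axis 1 1) + (of_nat b * w$2) *s frechet_derivative (sheet s) (at w) (axis 2 1)
     = frechet_derivative G (at (pt s w)) (Rt (pt s w))"
  unfolding dpt_Rt[OF s w, symmetric] D_sheet[OF s w, symmetric]
  using holo_param_basis(1)[OF holo_param_sheet[OF s] w, of "vector [of_nat a * w$1, of_nat b * w$2]"] by simp

text \<open>On the sheets, wedging with \<open>\<phi>\<close> amounts to contracting with the Euler field \<open>Rt\<close>.\<close>

lemma \<phi>_wedge_sheet:
  assumes s: "s = 1 \<or> s = -1" and w: "w \<in> Dm"
    and l: "\<And>c d. l (c *s frechet_derivative (sheet s) (at w) (axis 1 1) + d *s frechet_derivative (sheet s) (at w) (axis 2 1))
      = cnj c * l (frechet_derivative (sheet s) (at w) (axis 1 1)) + cnj d * l (frechet_derivative (sheet s) (at w) (axis 2 1))"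
  shows "\<phi> (sheet s w) [frechet_derivative (sheet s) (at w) (axis 1 1)] * l (frechet_derivative (sheet s) (at w) (axis 2 1))
     - \<phi> (sheet s w) [frechet_derivative (sheet s) (at w) (axis 2 1)] * l (frechet_derivative (sheet s) (at w) (axis 1 1))
     = - (s * sqg w * of_real (mw w) * l (frechet_derivative G (at (pt s w)) (Rt (pt s w))))"
  unfolding \<phi>_sheet[OF s w] sheet_Rt[OF s w, symmetric] l \<beta>1_def \<beta>2_def by (simp add: algebra_simps)

text \<open>Contraction with the Euler field turns the integrand into -4 \<open>mw\<close> times the
  conjugate-linear derivative along that field of one smooth function on the model. Its real and
  imaginary parts in time are derivatives along the flow, whose integrals vanish.\<close>

theorem \<phi>_closed:
  assumes \<eta>: "test_form X Reg 2 0 \<eta>"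
  shows "integral_form X Reg (wedge 1 3 \<phi> (dbar \<eta>)) = 0"
proof -
  define H where "H i y = \<eta> y (pair_of i)" for i y
  have len: "length (pair_of i) = 2" for i by (simp add: pair_of_def)
  have form: "form_at UNIV 2 0 (\<eta> y)" for y using \<eta> by (simp add: test_form_def)
  have ex: "\<eta> y [u, v] = (\<Sum>i\<in>UNIV. crs u v $ i * H i y)" for y u v
    unfolding H_def by (rule form_20_expand[OF form])
  have Ck: "Ck_on k UNIV (H i)" for k i
    using \<eta> len unfolding test_form_def H_def [abs_def] C_k_eq_Ck_on by simp
  have Hd: "H i differentiable (at y)" for i y using Ck[of 1 i] by simp
  have Hc: "continuous_on UNIV (\<lambda>y. frechet_derivative (H i) (at y) v)" for i v using Ck[of 1 i] by simp
  have dd: "dbar_dir (\<lambda>y. \<eta> y [u, v]) x e = (\<Sum>i\<in>UNIV. crs u v $ i * dbv (H i) x e)" for u v x e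
  proof -
    have "((\<lambda>y. \<Sum>i\<in>UNIV. crs u v $ i * H i y) has_derivative (\<lambda>e. \<Sum>i\<in>UNIV. crs u v $ i * frechet_derivative (H i) (at x) e)) (at x)"
      using Hd by (intro has_derivative_sum has_derivative_mult_right) (simp add: frechet_derivative_works)
    from dbv_eqI[OF this, of e]
    have "dbv (\<lambda>y. \<Sum>i\<in>UNIV. crs u v $ i * H i y) x e = (\<Sum>i\<in>UNIV. (crs u v $ i * frechet_derivative (H i) (at x) e + \<i> * (crs u v $ i * frechet_derivative (H i) (at x) (\<i> *s e))) / 2)"
      by (simp only: sum_distrib_left sum.distrib[symmetric] sum_divide_distrib)
    also have "\<dots> = (\<Sum>i\<in>UNIV. crs u v $ i * dbv (H i) x e)"
      by (intro sum.cong refl) (simp add: dbv_def field_simps)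
    finally show ?thesis unfolding dbar_dir_eq_dbv ex .
  qed
  define l where "l u v x e = (\<Sum>i\<in>UNIV. crs u v $ i * dbv (H i) x e)" for u v x e
  have lcl: "l u v x (c *s e + d *s e') = cnj c * l u v x e + cnj d * l u v x e'" for u v x c d e e'
    unfolding l_def by (simp add: dbv_linear[OF Hd] sum_distrib_left sum.distrib[symmetric] algebra_simps)
  have lcr: "l (\<gamma> *s u + \<delta> *s v) (\<epsilon> *s u + \<zeta> *s v) x e = (\<gamma> * \<zeta> - \<delta> * \<epsilon>) * l u v x e" for \<gamma> \<delta> \<epsilon> \<zeta> u v x e
    unfolding l_def crs_lincomb vector_smult_component sum_distrib_left by (simp only: mult.assoc)
  let ?\<omega> = "\<lambda>x. wedge 1 3 \<phi> (dbar \<eta>) x (unitary_frame X x)"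
  have chart: "?\<omega> (p z) * of_real (volume_density p z) =
      4 * (\<phi> (p z) [frechet_derivative p (at z) (axis 1 1)] * l (frechet_derivative p (at z) (axis 1 1)) (frechet_derivative p (at z) (axis 2 1)) (p z) (frechet_derivative p (at z) (axis 2 1))
         - \<phi> (p z) [frechet_derivative p (at z) (axis 2 1)] * l (frechet_derivative p (at z) (axis 1 1)) (frechet_derivative p (at z) (axis 2 1)) (p z) (frechet_derivative p (at z) (axis 1 1)))"
    if p: "holo_param X W p" "p ` W \<subseteq> Reg" "z \<in> W" for W p z
  proof (rule wedge_1_3_frame[OF p(1,3)])
    have xU: "p z \<in> U" using p(2,3) Reg_U by blast
    let ?A = "frechet_derivative p (at z) (axis 1 1)" and ?B = "frechet_derivative p (at z) (axis 2 1)"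
    show "\<phi> (p z) [\<alpha> *s ?A + \<beta> *s ?B] = cnj \<alpha> * \<phi> (p z) [?A] + cnj \<beta> * \<phi> (p z) [?B]" for \<alpha> \<beta>
      by (rule \<phi>_conj_linear[OF xU])
    show "dbar \<eta> (p z) [\<alpha> *s ?A + \<beta> *s ?B, \<gamma> *s ?A + \<delta> *s ?B, \<epsilon> *s ?A + \<zeta> *s ?B] =
      (cnj \<alpha> * l ?A ?B (p z) ?A + cnj \<beta> * l ?A ?B (p z) ?B) * (\<gamma> * \<zeta> - \<delta> * \<epsilon>)
      - (cnj \<gamma> * l ?A ?B (p z) ?A + cnj \<delta> * l ?A ?B (p z) ?B) * (\<alpha> * \<zeta> - \<beta> * \<epsilon>)
      + (cnj \<epsilon> * l ?A ?B (p z) ?A + cnj \<zeta> * l ?A ?B (p z) ?B) * (\<alpha> * \<delta> - \<beta> * \<gamma>)" for \<alpha> \<beta> \<gamma> \<delta> \<epsilon> \<zeta>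
      unfolding dbar_list3 dd l_def[symmetric] lcr lcl by (simp add: algebra_simps)
  qed
  have cp: "continuous_on W (\<lambda>z. l (u z) (v z) (p z) (e z))"
    if "continuous_on W u" "continuous_on W v" "continuous_on W p" "continuous_on W e"
    for W and u v p e :: "complex^2 \<Rightarrow> complex^3"
  proof -
    have c: "continuous_on W (\<lambda>z. crs (u z) (v z) $ i)" for i
    proof -
      have "\<forall>i. continuous_on W (\<lambda>z. crs (u z) (v z) $ i)"
        unfolding forall_3 crs_nth using that by (intro conjI continuous_intros)
      then show ?thesis by blast
    qed
    have L: "linear (frechet_derivative (H i) (at y))" for i y using Hd linear_frechet_derivative by blast
    have cD: "continuous_on W (\<lambda>z. frechet_derivative (H i) (at (p z)) (e' z))" if e': "continuous_on W e'" for i e'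
      by (rule continuous_on_linear_apply[OF L _ e'])
         (rule continuous_on_compose2[OF Hc \<open>continuous_on W p\<close> subset_UNIV])
    have ie: "continuous_on W (\<lambda>z. \<i> *s e z)"
      unfolding vector_scalar_mult_def using that by (intro continuous_intros)
    show ?thesis unfolding l_def dbv_def by (intro continuous_intros c cD that ie) auto
  qed
  \<comment> \<open>Up to the factor x, the pulled-back test form is k dy \<and> dz. The function is
    smooth also at the origin and vanishes there, since \<open>cvec\<close> does.\<close>
  define k where "k v = (\<Sum>i\<in>UNIV. cvec v $ i * H i (G v))" for v
  have kCk: "Ck_on n V k" for n
    unfolding k_def [abs_def]
    by (intro Ck_on_sum Ck_on_mult V(1) holo_fun_Ck_on holo_fun_cvec Ck_on_compose[OF V(1) Ck holomorphic_map_Ck_on[OF V(1) G(1)]]) auto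
  have kd: "(k has_derivative frechet_derivative k (at v)) (at v)" if "v \<in> V" for v
    using Ck_on_has_derivative[of 0 V k v] kCk[of "Suc 0"] that by simp
  have kc: "continuous_on V (\<lambda>v. frechet_derivative k (at v) e)" for e using kCk[of 1] by simp
  have kl: "linear (frechet_derivative k (at v))" if "v \<in> V" for v using kd[OF that] has_derivative_linear by blast
  have dbk: "dbv k v e = (\<Sum>i\<in>UNIV. cvec v $ i * dbv (H i) (G v) (frechet_derivative G (at v) e))" if "v \<in> V" for v e
    unfolding k_def [abs_def] by (rule dbv_sum_holo(2)[OF holo_fun_cvec G(1) that Hd])
  \<comment> \<open>The flow leaves \<open>V\<close>, so k and its derivative are continued by 0
    outside the ball. On the hypersurface this causes no jump, by the support condition on the test
    form.\<close>
  define k0 where "k0 v = indicator (ball 0 r) v *\<^sub>R k v" for v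
  define \<kappa> where "\<kappa> c v = indicator (ball 0 r) v *\<^sub>R frechet_derivative k (at v) (c *s Rt v)" for c v
  have bV: "ball 0 r \<subseteq> V" using r by (auto simp: subset_iff)
  have k0m: "k0 \<in> borel_measurable borel"
    unfolding k0_def [abs_def]
    by (rule borel_measurable_vanishing_extension[OF Ck_on_imp_continuous_on[OF kCk[of 0]] _ bV]) auto
  have cRt: "continuous_on S (\<lambda>v. c *s Rt v)" for S c
    unfolding continuous_on_vec_iff[where f="\<lambda>v. c *s Rt v"] forall_3 by (auto intro!: continuous_intros)
  have \<kappa>m: "\<kappa> c \<in> borel_measurable borel" for c
    unfolding \<kappa>_def [abs_def]
    by (rule borel_measurable_vanishing_extension[OF continuous_on_linear_apply[OF kl kc cRt] _ bV]) auto
  obtain K where K: "K > 0" "\<And>v u. v \<in> cball 0 r \<Longrightarrow> norm (frechet_derivative k (at v) u) \<le> K * norm u"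
    by (rule linear_family_bound[of "cball 0 r" "\<lambda>v. frechet_derivative k (at v)"])
       (use kl r continuous_on_subset[OF kc r(2)] in auto)
  have k00: "k 0 = 0" by (simp add: k_def cvec_0)
  have kb: "norm (k v) \<le> K * norm v" if "v \<in> cball 0 r" for v
  proof -
    have "norm (k v - k 0) \<le> K * norm (v - 0)"
    proof (rule differentiable_bound[OF convex_cball _ _ that])
      show "(k has_derivative frechet_derivative k (at x)) (at x within cball 0 r)" if "x \<in> cball 0 r" for x
        using kd r(2) that has_derivative_at_withinI by blast
      show "onorm (frechet_derivative k (at x)) \<le> K" if "x \<in> cball 0 r" for x
        by (rule onorm_le) (use K(2)[OF that] in auto)
    qed (use r in auto)
    then show ?thesis using k00 by simp
  qed
  define C where "C = K * (1 + real h + real a + real b)"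
  have C: "C \<ge> 0" "K \<le> C" using K(1) by (auto simp: C_def)
  have nRt: "norm (Rt v) \<le> (real h + real a + real b) * norm v" for v
  proof -
    have e: "Rt v = (of_nat h / 2 * v$1) *s axis 1 1 + ((of_nat a * v$2) *s axis 2 1 + (of_nat b * v$3) *s axis 3 1)"
      by (simp add: vec_eq_iff forall_3 axis_def)
    have "norm (Rt v) \<le> norm ((of_nat h / 2 * v$1) *s axis 1 1 :: complex^3) + (norm ((of_nat a * v$2) *s axis 2 1 :: complex^3) + norm ((of_nat b * v$3) *s axis 3 1 :: complex^3))"
      unfolding e by (intro order.trans[OF norm_triangle_ineq] add_left_mono norm_triangle_ineq)
    also have "\<dots> = real h / 2 * cmod (v$1) + (real a * cmod (v$2) + real b * cmod (v$3))"
      by (simp add: norm_vector_scalar_mult norm_mult norm_axis_1 norm_divide)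
    also have "\<dots> \<le> real h * norm v + (real a * norm v + real b * norm v)"
      by (intro add_mono mult_mono) (auto intro: Finite_Cartesian_Product.norm_nth_le)
    finally show ?thesis by (simp add: algebra_simps)
  qed
  have k0b: "cmod (k0 v) \<le> C * norm v" for v
  proof (cases "v \<in> ball 0 r")
    case True
    then have "cmod (k0 v) \<le> K * norm v" using kb[of v] by (simp add: k0_def)
    also have "\<dots> \<le> C * norm v" using C by (intro mult_right_mono) auto
    finally show ?thesis .
  qed (use C in \<open>simp add: k0_def\<close>)
  have \<kappa>b: "cmod (\<kappa> c v) \<le> C * norm v" if "cmod c = 1" for c v
  proof (cases "v \<in> ball 0 r")
    case True
    then have "cmod (\<kappa> c v) \<le> K * norm (c *s Rt v)" using K(2)[of v] by (simp add: \<kappa>_def)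
    also have "\<dots> \<le> K * ((real h + real a + real b) * norm v)"
      using K(1) nRt[of v] that by (simp add: norm_vector_scalar_mult)
    also have "\<dots> \<le> C * norm v" using K(1) by (simp add: C_def algebra_simps)
    finally show ?thesis .
  qed (use C in \<open>simp add: \<kappa>_def\<close>)
  obtain Ks where Ks: "compact Ks" "Ks \<subseteq> Reg" "\<And>x vs. x \<in> X - Ks \<Longrightarrow> length vs = 2 \<Longrightarrow> \<eta> x vs = 0"
    using \<eta> unfolding test_form_def by auto
  \<comment> \<open>Compactness of the support leaves a gap below r: on the hypersurface k vanishes
    already for norms between r' and r.\<close>
  obtain r' where r': "r' < r" "\<And>x. x \<in> Ks \<Longrightarrow> norm (F x) \<le> r'"
  proof (cases "Ks = {}")
    case True
    then show ?thesis using that[of "r - 1"] by auto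
  next
    case False
    have "continuous_on Ks (\<lambda>x. norm (F x))"
      by (intro continuous_intros continuous_on_subset[OF continuous_on_F]) (use Ks(2) Reg_U in blast)
    from continuous_attains_sup[OF Ks(1) False this] obtain x0 where "x0 \<in> Ks" "\<And>x. x \<in> Ks \<Longrightarrow> norm (F x) \<le> norm (F x0)" by blast
    then show ?thesis using that[of "norm (F x0)"] Ks(2) by (auto simp: Reg_def)
  qed
  have kz: "k v = 0" if "f v = 0" "norm v < r" "norm v > r'" for v
  proof -
    have vV: "v \<in> V" using that(2) bV by (auto simp: subset_iff)
    have "G v \<in> X" using GY that(1) vV by blast
    moreover have "G v \<notin> Ks" using r'(2)[of "G v"] FG[OF that(1) vV] that(3) by auto
    ultimately have "H i (G v) = 0" for i using Ks(3)[of "G v"] len by (simp add: H_def)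
    then show ?thesis by (simp add: k_def)
  qed
  have der: "((\<lambda>t. k0 (Fl (c * of_real t) v)) has_vector_derivative \<kappa> c (Fl (c * of_real t) v)) (at t)" if "f v = 0" for c v t
  proof -
    let ?\<gamma> = "\<lambda>t. Fl (c * of_real t) v"
    have \<gamma>': "(?\<gamma> has_vector_derivative c *s Rt (?\<gamma> t)) (at t)" for t by (rule Fl_has_vector_derivative)
    have \<gamma>c: "continuous_on UNIV ?\<gamma>"
      using \<gamma>' by (auto intro!: continuous_at_imp_continuous_on has_vector_derivative_continuous)
    have f\<gamma>: "f (?\<gamma> t) = 0" for t using that by (simp add: f_Fl)
    show ?thesis
    proof (cases "norm (?\<gamma> t) < r")
      case True
      let ?S = "{t. norm (?\<gamma> t) < r}"
      have "open ?S" by (intro open_Collect_less continuous_intros \<gamma>c)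
      have V\<gamma>: "?\<gamma> t \<in> V" using True bV by (auto simp: subset_iff)
      have "((\<lambda>t. k (?\<gamma> t)) has_derivative (\<lambda>x. frechet_derivative k (at (?\<gamma> t)) (x *\<^sub>R (c *s Rt (?\<gamma> t))))) (at t)"
        by (rule has_derivative_compose[OF \<gamma>'[unfolded has_vector_derivative_def] kd[OF V\<gamma>]])
      then have "((\<lambda>t. k (?\<gamma> t)) has_vector_derivative frechet_derivative k (at (?\<gamma> t)) (c *s Rt (?\<gamma> t))) (at t)"
        unfolding has_vector_derivative_def by (simp only: linear_cmul[OF kl[OF V\<gamma>]])
      then have "((\<lambda>t. k0 (?\<gamma> t)) has_vector_derivative frechet_derivative k (at (?\<gamma> t)) (c *s Rt (?\<gamma> t))) (at t)"
        by (rule has_vector_derivative_transform_within_open[OF _ \<open>open ?S\<close>]) (use True in \<open>auto simp: k0_def\<close>)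
      then show ?thesis using True by (simp add: \<kappa>_def)
    next
      case False
      let ?S = "{t. r' < norm (?\<gamma> t)}"
      have "open ?S" by (intro open_Collect_less continuous_intros \<gamma>c)
      moreover have "k0 (?\<gamma> t') = 0" if "t' \<in> ?S" for t'
        using kz[OF f\<gamma>, of t'] that by (cases "norm (?\<gamma> t') < r") (auto simp: k0_def)
      ultimately have "((\<lambda>t. k0 (?\<gamma> t)) has_vector_derivative 0) (at t)"
        by (intro has_vector_derivative_transform_within_open[OF has_vector_derivative_const[of 0], of ?S]) (use False r' in auto)
      then show ?thesis using False by (simp add: \<kappa>_def)
    qed
  qed
  have k0z: "k0 v = 0" and \<kappa>z: "\<kappa> c v = 0" if "norm v \<ge> r" for c v
    using that by (simp_all add: k0_def \<kappa>_def)
  have flow: "s = 1 \<or> s = -1 \<Longrightarrow> integrable lborel (\<lambda>w. mw w *\<^sub>R \<kappa> c (pt s w))"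
    "(\<integral>w. mw w *\<^sub>R \<kappa> c (pt 1 w) \<partial>lborel) + (\<integral>w. mw w *\<^sub>R \<kappa> c (pt (-1) w) \<partial>lborel) = 0" if c: "cmod c = 1" for c s
    using flow_derivative_integral[where k=k0 and \<kappa>="\<kappa> c" and C=C and r=r and c=c, OF k0m k0b k0z \<kappa>m \<kappa>b[OF c] \<kappa>z C(1) r(1) der]
    by blast+
  \<comment> \<open>The conjugate-linear part is half the sum of the derivative along the field and
    \<i> times the derivative along \<i> times the field; -4 times it gives these two
    coefficients.\<close>
  define w where "w s z = (-2) * (mw z *\<^sub>R \<kappa> 1 (pt s z)) + (-2 * \<i>) * (mw z *\<^sub>R \<kappa> \<i> (pt s z))" for s z
  have wint: "integrable lborel (w s)" if "s = 1 \<or> s = -1" for s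
    unfolding w_def [abs_def]
    by (intro Bochner_Integration.integrable_add integrable_mult_right flow(1) that) simp_all
  have off: "w s z = 0" if "s = 1 \<or> s = -1" "z \<in> slit" "z \<notin> Dm" for s z
  proof -
    have "norm (pt s z) = norm (pt 1 z)" by (rule norm_pt) (use that(1) in auto)
    then show ?thesis using that by (simp add: w_def \<kappa>_def Dm_def)
  qed
  have wDm: "(LINT z:Dm|lborel. w s z) = (\<integral>z. w s z \<partial>lborel)" if s: "s = 1 \<or> s = -1" for s
    unfolding set_lebesgue_integral_def
  proof (rule integral_cong_AE)
    have "- slit \<in> null_sets lborel" using null_slit_complement by (intro null_setsI) auto
    from AE_not_in[OF this] show "AE z in lborel. indicator Dm z *\<^sub>R w s z = w s z"
      by eventually_elim (use off[OF s] in \<open>auto simp: indicator_def\<close>)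
    show "w s \<in> borel_measurable lborel" using wint[OF s] by (rule borel_measurable_integrable)
    then show "(\<lambda>z. indicator Dm z *\<^sub>R w s z) \<in> borel_measurable lborel"
      using open_Dm by (intro borel_measurable_scaleR) auto
  qed
  have "integral_form X Reg (wedge 1 3 \<phi> (dbar \<eta>)) = (LINT x:Reg - {0}|\<mu>. ?\<omega> x)"
    by (simp add: integral_form_def)
  also have "\<dots> = (LINT z:Dm|lborel. w 1 z) + (LINT z:Dm|lborel. w (-1) z)"
  proof (rule region_integral)
    fix W p assume p: "holo_param X W p" "p ` W \<subseteq> Reg"
    note c = holo_param_deriv_continuous_on[OF p(1)] holo_paramD(5)[OF p(1)]
    show "\<exists>w. continuous_on W w \<and> (\<forall>z\<in>W. ?\<omega> (p z) * of_real (volume_density p z) = w z)"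
    proof (intro exI conjI ballI)
      show "?\<omega> (p z) * of_real (volume_density p z) =
      4 * (\<phi> (p z) [frechet_derivative p (at z) (axis 1 1)] * l (frechet_derivative p (at z) (axis 1 1)) (frechet_derivative p (at z) (axis 2 1)) (p z) (frechet_derivative p (at z) (axis 2 1))
         - \<phi> (p z) [frechet_derivative p (at z) (axis 2 1)] * l (frechet_derivative p (at z) (axis 1 1)) (frechet_derivative p (at z) (axis 2 1)) (p z) (frechet_derivative p (at z) (axis 1 1)))"
        if "z \<in> W" for z by (rule chart[OF p that])
      show "continuous_on W (\<lambda>z. 4 * (\<phi> (p z) [frechet_derivative p (at z) (axis 1 1)] * l (frechet_derivative p (at z) (axis 1 1)) (frechet_derivative p (at z) (axis 2 1)) (p z) (frechet_derivative p (at z) (axis 2 1))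
         - \<phi> (p z) [frechet_derivative p (at z) (axis 2 1)] * l (frechet_derivative p (at z) (axis 1 1)) (frechet_derivative p (at z) (axis 2 1)) (p z) (frechet_derivative p (at z) (axis 1 1))))"
        by (intro continuous_intros \<phi>_chart_continuous_on[OF p] cp c)
    qed
  next
    fix s :: complex and z assume s: "s = 1 \<or> s = -1" and z: "z \<in> Dm"
    let ?A = "frechet_derivative (sheet s) (at z) (axis 1 1)" and ?B = "frechet_derivative (sheet s) (at z) (axis 2 1)"
    let ?v = "pt s z"
    have sR: "sheet s ` Dm \<subseteq> Reg" using sheet_props(5)[OF s] by blast
    have vV: "?v \<in> V" and vb: "?v \<in> ball 0 r" using sheet_props(1,2)[OF s z] by auto
    have "?\<omega> (sheet s z) * of_real (volume_density (sheet s) z) = 4 * (\<phi> (sheet s z) [?A] * l ?A ?B (sheet s z) ?B - \<phi> (sheet s z) [?B] * l ?A ?B (sheet s z) ?A)"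
      by (rule chart[OF holo_param_sheet[OF s] sR z])
    also have "\<dots> = 4 * - (s * sqg z * of_real (mw z) * l ?A ?B (sheet s z) (frechet_derivative G (at ?v) (Rt ?v)))"
      by (subst \<phi>_wedge_sheet[OF s z lcl]) simp
    also have "\<dots> = - 4 * of_real (mw z) * (\<Sum>i\<in>UNIV. ((s * sqg z) *s crs ?A ?B) $ i * dbv (H i) (G ?v) (frechet_derivative G (at ?v) (Rt ?v)))"
      unfolding l_def sheet_def by (simp add: sum_3 algebra_simps)
    also have "\<dots> = - 4 * of_real (mw z) * dbv k ?v (Rt ?v)"
      unfolding cvec_sheet[OF s z] dbk[OF vV] ..
    also have "\<dots> = w s z"
      using vb by (simp add: w_def \<kappa>_def dbv_def scaleR_conv_of_real field_simps)
    finally show "?\<omega> (sheet s z) * of_real (volume_density (sheet s) z) = w s z" .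
  next
    fix s :: complex assume s: "s = 1 \<or> s = -1"
    show "set_integrable lborel Dm (w s)"
      using integrable_mult_indicator[OF _ wint[OF s], of Dm] open_Dm by (simp add: set_integrable_def)
  qed
  also have "\<dots> = (\<integral>z. w 1 z \<partial>lborel) + (\<integral>z. w (-1) z \<partial>lborel)" by (simp add: wDm)
  also have "\<dots> = (-2) * ((\<integral>z. mw z *\<^sub>R \<kappa> 1 (pt 1 z) \<partial>lborel) + (\<integral>z. mw z *\<^sub>R \<kappa> 1 (pt (-1) z) \<partial>lborel))
     + (-2 * \<i>) * ((\<integral>z. mw z *\<^sub>R \<kappa> \<i> (pt 1 z) \<partial>lborel) + (\<integral>z. mw z *\<^sub>R \<kappa> \<i> (pt (-1) z) \<partial>lborel))"
  proof -
    have "(\<integral>z. w s z \<partial>lborel) = (-2) * (\<integral>z. mw z *\<^sub>R \<kappa> 1 (pt s z) \<partial>lborel) + (-2 * \<i>) * (\<integral>z. mw z *\<^sub>R \<kappa> \<i> (pt s z) \<partial>lborel)"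
      if s: "s = 1 \<or> s = -1" for s
      unfolding w_def
      by (subst Bochner_Integration.integral_add) (simp_all only: integrable_mult_right flow(1) s norm_one norm_ii integral_mult_right_zero)
    from this[OF disjI1[OF refl]] this[OF disjI2[OF refl]] show ?thesis
      by (simp only: distrib_left add_ac)
  qed
  also have "\<dots> = 0" using flow(2)[of 1] flow(2)[of \<i>] by simp
  finally show ?thesis .
qed

lemma \<phi>_dbar_w: "dbar_w X Reg 1 \<phi> (\<lambda>x vs. 0)"
  unfolding dbar_w_def
proof (intro conjI allI impI \<phi>_L2)
  show "L2_form X Reg (1 + 1) (\<lambda>x vs. 0)"
    by (simp add: L2_form_def form_at_def form_norm_sq_def)
  fix s \<eta> assume s: "1 + 1 + s = 2 \<and> test_form X Reg 2 s \<eta>"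
  then have "s = 0" "test_form X Reg 2 0 \<eta>" by auto
  then show "integral_form X Reg (wedge (1 + 1) (2 + s) (\<lambda>x vs. 0) \<eta>) =
       (-1) ^ (1 + 1) * integral_form X Reg (wedge 1 (2 + s + 1) \<phi> (dbar \<eta>))"
    using \<phi>_closed[of \<eta>] by (simp add: integral_form_def wedge_def numeral_3_eq_3 set_lebesgue_integral_def)
qed

end

section \<open>Symmetry of the second derivative\<close>

text \<open>The increment of f in direction v is an integral of the v-derivative. Differentiating it
  first in direction w under the integral sign and then in s at 0 yields the mixed derivatives in
  both orders.\<close>

lemma frechet_derivative_symmetric:
  fixes f :: "'a::real_normed_vector \<Rightarrow> 'b::banach"
  assumes S: "open S" "x \<in> S" and f: "Ck_on 2 S f"
  shows "frechet_derivative (\<lambda>y. frechet_derivative f (at y) v) (at x) w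
    = frechet_derivative (\<lambda>y. frechet_derivative f (at y) w) (at x) v"
proof -
  define p where "p u y = frechet_derivative f (at y) u" for u y
  have f1: "Ck_on (Suc 0) S f" by (rule Ck_on_le[OF f]) simp
  have p1: "Ck_on (Suc 0) S (p u)" for u using f by (simp add: p_def [abs_def] numeral_2_eq_2)
  have fd: "(f has_derivative (\<lambda>u. p u y)) (at y)" if "y \<in> S" for y
    unfolding p_def by (rule Ck_on_has_derivative[OF f1 that])
  note pd = Ck_on_has_derivative[OF p1]
  have pc: "continuous_on S (p u)" for u using p1 Ck_on_imp_continuous_on by blast
  have qc: "continuous_on S (\<lambda>y. frechet_derivative (p u) (at y) u')" for u u' using p1[of u] by simp
  have "continuous_on UNIV (\<lambda>(t, s). x + s *\<^sub>R v + t *\<^sub>R w)"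
    unfolding case_prod_unfold by (intro continuous_intros)
  from open_vimage[OF S(1) this]
  have "open {ts. (\<lambda>(t, s). x + s *\<^sub>R v + t *\<^sub>R w) ts \<in> S}" by (simp add: vimage_def)
  then obtain A B where AB: "open A" "open B" "(0::real, 0::real) \<in> A \<times> B" "A \<times> B \<subseteq> {ts. (\<lambda>(t, s). x + s *\<^sub>R v + t *\<^sub>R w) ts \<in> S}"
    by (rule open_prod_elim) (use S(2) in auto)
  obtain e1 e2 where "e1 > 0" "cball 0 e1 \<subseteq> A" "e2 > 0" "cball 0 e2 \<subseteq> B"
    using AB(1-3) by (metis SigmaE Pair_inject open_contains_cball)
  then obtain e where e: "e > 0" "{-e..e} \<subseteq> A" "{-e..e} \<subseteq> B"
    by (intro that[of "min e1 e2"]) (auto simp: subset_iff dist_real_def)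
  have inS: "x + s *\<^sub>R v + t *\<^sub>R w \<in> S" if "s \<in> {-e..e}" "t \<in> {-e..e}" for s t
    using AB(4) e that by (auto simp: subset_iff)
  have dline: "((\<lambda>t. k (y + t *\<^sub>R u)) has_vector_derivative D u) (at t within T)"
    if "(k has_derivative D) (at (y + t *\<^sub>R u))" for k :: "'a \<Rightarrow> 'b" and D y u t T
  proof -
    have "((\<lambda>t. y + t *\<^sub>R u) has_derivative (\<lambda>t. t *\<^sub>R u)) (at t within T)"
      by (auto intro!: derivative_eq_intros)
    from has_derivative_compose[OF this that] show ?thesis
      unfolding has_vector_derivative_def by (simp only: linear_cmul[OF has_derivative_linear[OF that]])
  qed
  have int: "p w (x + s *\<^sub>R v) - p w x = integral {0..s} (\<lambda>\<sigma>. frechet_derivative (p v) (at (x + \<sigma> *\<^sub>R v)) w)" if s: "s \<in> {0..e}" for s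
  proof -
    have sub: "\<sigma> \<in> {-e..e}" if "\<sigma> \<in> {0..s}" for \<sigma> using that s by auto
    have ftc: "((\<lambda>\<sigma>. p v (x + \<sigma> *\<^sub>R v + t *\<^sub>R w)) has_integral f (x + s *\<^sub>R v + t *\<^sub>R w) - f (x + t *\<^sub>R w)) {0..s}" if t: "t \<in> {-e..e}" for t
    proof -
      have d: "((\<lambda>\<sigma>. f (x + \<sigma> *\<^sub>R v + t *\<^sub>R w)) has_vector_derivative p v (x + \<sigma> *\<^sub>R v + t *\<^sub>R w)) (at \<sigma> within {0..s})" if "\<sigma> \<in> {0..s}" for \<sigma>
        using dline[of f "\<lambda>u. p u (x + \<sigma> *\<^sub>R v + t *\<^sub>R w)" "x + t *\<^sub>R w" \<sigma> v "{0..s}"] fd[OF inS[OF sub[OF that] t]]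
        by (simp add: add_ac)
      show ?thesis using fundamental_theorem_of_calculus[OF _ d] s by simp
    qed
    have L: "((\<lambda>t. integral (cbox 0 s) (\<lambda>\<sigma>. p v (x + \<sigma> *\<^sub>R v + t *\<^sub>R w))) has_vector_derivative
        integral (cbox 0 s) (\<lambda>\<sigma>. frechet_derivative (p v) (at (x + \<sigma> *\<^sub>R v + 0 *\<^sub>R w)) w)) (at 0 within {-e..e})"
    proof (rule leibniz_rule_vector_derivative)
      show "((\<lambda>t. p v (x + \<sigma> *\<^sub>R v + t *\<^sub>R w)) has_vector_derivative frechet_derivative (p v) (at (x + \<sigma> *\<^sub>R v + t *\<^sub>R w)) w) (at t within {-e..e})"
        if "t \<in> {-e..e}" "\<sigma> \<in> cbox 0 s" for t \<sigma>
        by (rule dline[OF pd[OF inS]]) (use that sub in auto)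
      show "(\<lambda>\<sigma>. p v (x + \<sigma> *\<^sub>R v + t *\<^sub>R w)) integrable_on cbox 0 s" if "t \<in> {-e..e}" for t
        using ftc[OF that] by auto
      show "continuous_on ({-e..e} \<times> cbox 0 s) (\<lambda>(t, \<sigma>). frechet_derivative (p v) (at (x + \<sigma> *\<^sub>R v + t *\<^sub>R w)) w)"
        unfolding case_prod_unfold
        by (rule continuous_on_compose2[OF qc]) (use inS sub in \<open>auto intro!: continuous_intros\<close>)
    qed (use e in auto)
    have "((\<lambda>t. f (x + s *\<^sub>R v + t *\<^sub>R w) - f (x + t *\<^sub>R w)) has_vector_derivative p w (x + s *\<^sub>R v + 0 *\<^sub>R w) - p w (x + 0 *\<^sub>R w)) (at 0 within {-e..e})"
      by (intro has_vector_derivative_diff dline fd) (use inS[of s 0] inS[of 0 0] s e in auto)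
    moreover have "((\<lambda>t. f (x + s *\<^sub>R v + t *\<^sub>R w) - f (x + t *\<^sub>R w)) has_vector_derivative
        integral (cbox 0 s) (\<lambda>\<sigma>. frechet_derivative (p v) (at (x + \<sigma> *\<^sub>R v + 0 *\<^sub>R w)) w)) (at 0 within {-e..e})"
    proof (rule has_vector_derivative_transform[OF _ _ L])
      show "f (x + s *\<^sub>R v + t *\<^sub>R w) - f (x + t *\<^sub>R w) = integral (cbox 0 s) (\<lambda>\<sigma>. p v (x + \<sigma> *\<^sub>R v + t *\<^sub>R w))" if "t \<in> {-e..e}" for t
        using integral_unique[OF ftc[OF that]] by simp
    qed (use e in auto)
    ultimately have "p w (x + s *\<^sub>R v + 0 *\<^sub>R w) - p w (x + 0 *\<^sub>R w) = integral (cbox 0 s) (\<lambda>\<sigma>. frechet_derivative (p v) (at (x + \<sigma> *\<^sub>R v + 0 *\<^sub>R w)) w)"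
      by (rule vector_derivative_unique_within_closed_interval[rotated 2, where a="-e" and b=e and x=0, unfolded box_real]) (use e in auto)
    then show ?thesis by simp
  qed
  have "((\<lambda>s. integral {0..s} (\<lambda>\<sigma>. frechet_derivative (p v) (at (x + \<sigma> *\<^sub>R v)) w)) has_vector_derivative
      frechet_derivative (p v) (at (x + 0 *\<^sub>R v)) w) (at 0 within {0..e})"
  proof (rule integral_has_vector_derivative)
    show "continuous_on {0..e} (\<lambda>\<sigma>. frechet_derivative (p v) (at (x + \<sigma> *\<^sub>R v)) w)"
      by (rule continuous_on_compose2[OF qc]) (use inS[of _ 0] e in \<open>auto intro!: continuous_intros\<close>)
  qed (use e in auto)
  then have "((\<lambda>s. p w (x + s *\<^sub>R v) - p w x) has_vector_derivative frechet_derivative (p v) (at (x + 0 *\<^sub>R v)) w) (at 0 within {0..e})"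
    by (rule has_vector_derivative_transform[rotated 2]) (use e int in auto)
  moreover have "((\<lambda>s. p w (x + s *\<^sub>R v) - p w x) has_vector_derivative frechet_derivative (p w) (at (x + 0 *\<^sub>R v)) v - 0) (at 0 within {0..e})"
    by (intro has_vector_derivative_diff dline pd has_vector_derivative_const) (use S in auto)
  ultimately have "frechet_derivative (p v) (at (x + 0 *\<^sub>R v)) w = frechet_derivative (p w) (at (x + 0 *\<^sub>R v)) v - 0"
    by (rule vector_derivative_unique_within_closed_interval[rotated 2, where a=0 and b=e and x=0, unfolded box_real]) (use e in auto)
  then show ?thesis by (simp add: p_def [abs_def])
qed

section \<open>Calculus of the conjugate-linear derivative\<close>

text \<open>Real differentiability packaged with its conjugate-linear part, so that sum, product and
  chain rules can be composed without naming the full derivative.\<close>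

definition has_dbar :: "(complex^'n \<Rightarrow> complex) \<Rightarrow> (complex^'n \<Rightarrow> complex) \<Rightarrow> complex^'n \<Rightarrow> bool" where
  "has_dbar f L x \<longleftrightarrow> (\<exists>D. (f has_derivative D) (at x) \<and> (\<forall>v. (D v + \<i> * D (\<i> *s v)) / 2 = L v))"

lemma has_dbar_dbv: "has_dbar f L x \<Longrightarrow> dbv f x v = L v"
  unfolding has_dbar_def by (elim exE conjE) (simp add: dbv_eqI)

lemma has_dbar_const: "has_dbar (\<lambda>y. c) (\<lambda>v. 0) x"
  unfolding has_dbar_def by (rule exI[of _ "\<lambda>_. 0"]) simp

lemma has_dbar_add: "has_dbar f L x \<Longrightarrow> has_dbar k M x \<Longrightarrow> has_dbar (\<lambda>y. f y + k y) (\<lambda>v. L v + M v) x"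
  and has_dbar_diff: "has_dbar f L x \<Longrightarrow> has_dbar k M x \<Longrightarrow> has_dbar (\<lambda>y. f y - k y) (\<lambda>v. L v - M v) x"
  and has_dbar_mult: "has_dbar f L x \<Longrightarrow> has_dbar k M x \<Longrightarrow> has_dbar (\<lambda>y. f y * k y) (\<lambda>v. f x * M v + L v * k x) x"
proof -
  assume "has_dbar f L x" "has_dbar k M x"
  then obtain D E where D: "(f has_derivative D) (at x)" "\<And>v. L v = (D v + \<i> * D (\<i> *s v)) / 2"
    and E: "(k has_derivative E) (at x)" "\<And>v. M v = (E v + \<i> * E (\<i> *s v)) / 2"
    unfolding has_dbar_def by metis
  show "has_dbar (\<lambda>y. f y + k y) (\<lambda>v. L v + M v) x"
    unfolding has_dbar_def
    by (intro exI conjI allI, rule has_derivative_add[OF D(1) E(1)]) (simp add: D(2) E(2) field_simps)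
  show "has_dbar (\<lambda>y. f y - k y) (\<lambda>v. L v - M v) x"
    unfolding has_dbar_def
    by (intro exI conjI allI, rule has_derivative_diff[OF D(1) E(1)]) (simp add: D(2) E(2) field_simps)
  show "has_dbar (\<lambda>y. f y * k y) (\<lambda>v. f x * M v + L v * k x) x"
    unfolding has_dbar_def
    by (intro exI conjI allI, rule has_derivative_mult[OF D(1) E(1)]) (simp add: D(2) E(2) field_simps)
qed

lemma has_dbar_sum:
  "(\<And>i. i \<in> I \<Longrightarrow> has_dbar (f i) (L i) x) \<Longrightarrow> has_dbar (\<lambda>y. \<Sum>i\<in>I. f i y) (\<lambda>v. \<Sum>i\<in>I. L i v) x"
  by (induction I rule: infinite_finite_induct) (auto intro: has_dbar_add has_dbar_const)

lemma has_dbar_holo: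
  assumes "holo_fun f S" "x \<in> S"
  shows "has_dbar f (\<lambda>v. 0) x" "has_dbar (\<lambda>y. cnj (f y)) (\<lambda>v. cnj (frechet_derivative f (at x) v)) x"
proof -
  note d = holo_funD(1)[OF assms]
  have ii: "\<i> * (\<i> * x) = - x" for x by (simp add: mult.assoc[symmetric])
  show "has_dbar f (\<lambda>v. 0) x"
    unfolding has_dbar_def by (intro exI conjI allI, rule d) (simp add: holo_funD(2)[OF assms] ii)
  show "has_dbar (\<lambda>y. cnj (f y)) (\<lambda>v. cnj (frechet_derivative f (at x) v)) x"
    unfolding has_dbar_def
    by (intro exI conjI allI, rule bounded_linear.has_derivative[OF bounded_linear_cnj d])
       (simp add: holo_funD(2)[OF assms] ii)
qed

lemma has_dbar_real_compose:
  assumes "has_dbar (\<lambda>y. complex_of_real (f y)) L x" "(\<theta> has_real_derivative c) (at (f x))"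
  shows "has_dbar (\<lambda>y. complex_of_real (\<theta> (f y))) (\<lambda>v. of_real c * L v) x"
proof -
  obtain D where D: "((\<lambda>y. complex_of_real (f y)) has_derivative D) (at x)" "\<And>v. L v = (D v + \<i> * D (\<i> *s v)) / 2"
    using assms(1) unfolding has_dbar_def by metis
  from bounded_linear.has_derivative[OF bounded_linear_Re D(1)]
  have f: "(f has_derivative (\<lambda>v. Re (D v))) (at x)" by simp
  from bounded_linear.has_derivative[OF bounded_linear_of_real this]
  have "((\<lambda>y. complex_of_real (f y)) has_derivative (\<lambda>v. of_real (Re (D v)))) (at x)" .
  then have re: "D v = of_real (Re (D v))" for v using has_derivative_unique[OF D(1)] by metis
  have "((\<lambda>y. \<theta> (f y)) has_derivative (\<lambda>v. c * Re (D v))) (at x)"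
    using has_derivative_compose[OF f assms(2)[unfolded has_field_derivative_def]] .
  from bounded_linear.has_derivative[OF bounded_linear_of_real this]
  have "((\<lambda>y. complex_of_real (\<theta> (f y))) has_derivative (\<lambda>v. of_real (c * Re (D v)))) (at x)" .
  moreover have "(of_real (c * Re (D v)) + \<i> * of_real (c * Re (D (\<i> *s v)))) / 2 = of_real c * L v" for v
    unfolding D(2) by (subst (3 4) re) (simp add: field_simps)
  ultimately show ?thesis unfolding has_dbar_def by blast
qed

text \<open>The cross product of two vectors annihilated by n is a multiple of n; this produces the
  value of the residue form on a pair of tangent vectors.\<close>

lemma crs_parallel:
  assumes "n \<noteq> 0" "(\<Sum>i\<in>UNIV. n $ i * a $ i) = 0" "(\<Sum>i\<in>UNIV. n $ i * b $ i) = 0"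
  shows "\<exists>c. crs a b = c *s n"
proof -
  let ?m = "crs a b"
  have "n $ 1 * ?m $ 2 = n $ 2 * ?m $ 1" "n $ 1 * ?m $ 3 = n $ 3 * ?m $ 1" "n $ 2 * ?m $ 3 = n $ 3 * ?m $ 2"
    unfolding crs_nth using assms(2,3) unfolding sum_3 by algebra+
  then have par: "n $ i * ?m $ j = n $ j * ?m $ i" for i j
  proof -
    have "\<forall>i j. n $ i * ?m $ j = n $ j * ?m $ i"
      using \<open>n $ 1 * ?m $ 2 = n $ 2 * ?m $ 1\<close> \<open>n $ 1 * ?m $ 3 = n $ 3 * ?m $ 1\<close> \<open>n $ 2 * ?m $ 3 = n $ 3 * ?m $ 2\<close>
      unfolding forall_3 by (simp del: crs_nth)
    then show ?thesis by blast
  qed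
  obtain j where j: "n $ j \<noteq> 0" using assms(1) by (auto simp: vec_eq_iff)
  have "\<forall>i. ?m $ i = (?m $ j / n $ j) * n $ i" using par[of _ j] j by (simp add: field_simps del: crs_nth)
  then have "?m = (?m $ j / n $ j) *s n" unfolding vec_eq_iff vector_smult_component .
  then show ?thesis by blast
qed

context germ
begin

section \<open>The closed test form built from the gradient of the equation\<close>

definition nrm :: "complex^3 \<Rightarrow> complex^3" where
  "nrm v = vector [2 * v$1, g1 (v$2) (v$3), g2 (v$2) (v$3)]"

lemma nrm_nth [simp]: "nrm v $ 1 = 2 * v$1" "nrm v $ 2 = g1 (v$2) (v$3)" "nrm v $ 3 = g2 (v$2) (v$3)"
  by (simp_all add: nrm_def)

definition dnrm :: "complex^3 \<Rightarrow> complex^3 \<Rightarrow> complex^3" where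
  "dnrm v u = vector [2 * u$1, g11 (v$2) (v$3) * u$2 + g12 (v$2) (v$3) * u$3, g12 (v$2) (v$3) * u$2 + g22 (v$2) (v$3) * u$3]"

definition N :: "3 \<Rightarrow> complex^3 \<Rightarrow> complex" where "N i x = nrm (F x) $ i"

lemma nrm_has_derivative: "(nrm has_derivative dnrm v) (at v)"
  unfolding has_derivative_vec_iff[where f=nrm] forall_3
  by (simp add: dnrm_def has_derivative_mult_right has_derivative_coord)
     (intro conjI g1_has_derivative g2_has_derivative has_derivative_coord)

lemma holomorphic_map_nrm: "holomorphic_map nrm S"
  unfolding holomorphic_map_def
  by (intro ballI exI conjI, rule nrm_has_derivative) (simp add: dnrm_def vec_eq_iff forall_3 algebra_simps)

lemma holomorphic_map_nrm_F: "holomorphic_map (\<lambda>x. nrm (F x)) U"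
  by (rule holomorphic_map_compose[OF holomorphic_map_nrm[of UNIV] F(1)]) simp

lemma holo_fun_N: "holo_fun (N i) U"
  unfolding N_def [abs_def] by (rule holomorphic_map_nth[OF holomorphic_map_nrm_F])

lemma N_derivative:
  assumes "x \<in> U"
  shows "frechet_derivative (N i) (at x) v = dnrm (F x) (frechet_derivative F (at x) v) $ i"
proof -
  have "((\<lambda>x. nrm (F x)) has_derivative (\<lambda>v. dnrm (F x) (frechet_derivative F (at x) v))) (at x)"
    by (rule has_derivative_compose[OF holomorphic_mapD(1)[OF F(1) assms] nrm_has_derivative])
  from frechet_derivative_eqI[OF has_derivative_vec_nth[OF this, of i]] show ?thesis by (simp add: N_def [abs_def])
qed

definition S :: "complex^3 \<Rightarrow> real" where "S x = (norm (nrm (F x)))\<^sup>2"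

definition A :: "complex^3 \<Rightarrow> complex^3 \<Rightarrow> complex" where
  "A x v = (\<Sum>i\<in>UNIV. N i x * cnj (frechet_derivative (N i) (at x) v))"

text \<open>The residue form \<Omega> is defined by crs = \<Omega> times the gradient on tangent
  vectors. Contracting with the conjugate gradient gives an expression that makes sense for all
  ambient vectors and equals \<open>S\<close> \<Omega> on tangent ones.\<close>

definition W2 :: "complex^3 \<Rightarrow> complex^3 \<Rightarrow> complex^3 \<Rightarrow> complex" where
  "W2 x u v = (\<Sum>i\<in>UNIV. cnj (N i x) * crs (frechet_derivative F (at x) u) (frechet_derivative F (at x) v) $ i)"

lemma S_eq: "complex_of_real (S x) = (\<Sum>i\<in>UNIV. N i x * cnj (N i x))"
proof -
  have "S x = (\<Sum>i\<in>UNIV. (cmod (N i x))\<^sup>2)"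
    by (simp add: S_def N_def norm_vec_def L2_set_def sum_nonneg)
  then show ?thesis by (simp only: of_real_sum complex_norm_square)
qed

lemma A_linear:
  assumes "x \<in> U"
  shows "A x (u + v) = A x u + A x v" "A x (c *s v) = cnj c * A x v"
proof -
  note d = holo_funD[OF holo_fun_N assms]
  have l: "linear (frechet_derivative (N i) (at x))" for i using d(1) has_derivative_linear by blast
  show "A x (u + v) = A x u + A x v" "A x (c *s v) = cnj c * A x v"
    unfolding A_def by (simp_all add: linear_add[OF l] d(2) sum_distrib_left sum.distrib algebra_simps)
qed

lemma W2_linear:
  assumes "x \<in> U"
  shows "W2 x (u + u') v = W2 x u v + W2 x u' v" "W2 x v (u + u') = W2 x v u + W2 x v u'"
    "W2 x (c *s u) v = c * W2 x u v" "W2 x u (c *s v) = c * W2 x u v" "W2 x u u = 0"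
  unfolding W2_def linear_add[OF F_deriv(1)[OF assms]] F_deriv(2)[OF assms]
  by (simp_all add: sum_3 algebra_simps)

lemma W2_lincomb:
  assumes "x \<in> U"
  shows "W2 x (\<gamma> *s u + \<delta> *s v) (\<epsilon> *s u + \<zeta> *s v) = (\<gamma> * \<zeta> - \<delta> * \<epsilon>) * W2 x u v"
  unfolding W2_def linear_add[OF F_deriv(1)[OF assms]] F_deriv(2)[OF assms] crs_lincomb
  by (simp add: sum_distrib_left algebra_simps)

lemma nrm_F_nonzero:
  assumes "x \<in> X \<inter> U" "x \<noteq> 0"
  shows "nrm (F x) \<noteq> 0" "S x > 0"
proof -
  have "g1 (F x $ 2) (F x $ 3) \<noteq> 0 \<or> g2 (F x $ 2) (F x $ 3) \<noteq> 0"
    using isolated' F_coords_nonzero[OF assms] by blast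
  then show "nrm (F x) \<noteq> 0" by (auto simp: vec_eq_iff forall_3)
  then show "S x > 0" by (simp add: S_def)
qed

lemma crs_tangent:
  assumes x: "x \<in> Reg - {0}" and u: "u \<in> tangent X x" "v \<in> tangent X x"
  obtains c where "\<And>i. crs (frechet_derivative F (at x) u) (frechet_derivative F (at x) v) $ i = c * N i x"
    "W2 x u v = c * of_real (S x)"
proof -
  obtain W p z where p: "holo_param X W p" "p ` W \<subseteq> Reg" "z \<in> W" "x = p z"
  proof -
    obtain W p where Wp: "\<And>n::nat. holo_param X (W n) (p n)" "\<And>n. p n ` W n \<subseteq> Reg" "Reg - {0} = (\<Union>n. p n ` W n)"
      using Reg_cover by blast
    from x obtain n z where "z \<in> W n" "x = p n z" unfolding Wp(3) by blast
    then show ?thesis using that Wp(1,2) by blast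
  qed
  obtain u' v' where u': "u = frechet_derivative p (at z) u'" "v = frechet_derivative p (at z) v'"
    using u unfolding p(4) tangent_eq_range[OF p(1,3)] by blast
  have "nrm (F x) \<noteq> 0" using nrm_F_nonzero x Reg_U by blast
  moreover have "(\<Sum>i\<in>UNIV. nrm (F x) $ i * frechet_derivative F (at x) u $ i) = 0" "(\<Sum>i\<in>UNIV. nrm (F x) $ i * frechet_derivative F (at x) v $ i) = 0"
    using chart_F(4)[OF p(1,2,3) chart_F(2)[OF p(1,2,3), of u']] chart_F(4)[OF p(1,2,3) chart_F(2)[OF p(1,2,3), of v']]
    unfolding u' p(4) sum_3 nrm_nth by simp_all
  ultimately obtain c where c: "crs (frechet_derivative F (at x) u) (frechet_derivative F (at x) v) = c *s nrm (F x)"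
    using crs_parallel by blast
  show ?thesis
  proof (rule that)
    show "crs (frechet_derivative F (at x) u) (frechet_derivative F (at x) v) $ i = c * N i x" for i
      by (simp only: c vector_smult_component N_def)
    then show "W2 x u v = c * of_real (S x)"
      unfolding W2_def S_eq by (simp add: sum_distrib_left mult_ac)
  qed
qed

lemma has_dbar_S: "x \<in> U \<Longrightarrow> has_dbar (\<lambda>y. complex_of_real (S y)) (A x) x"
proof -
  assume x: "x \<in> U"
  have "has_dbar (\<lambda>y. \<Sum>i\<in>UNIV. N i y * cnj (N i y)) (\<lambda>v. \<Sum>i\<in>UNIV. N i x * cnj (frechet_derivative (N i) (at x) v) + 0 * cnj (N i x)) x"
    by (intro has_dbar_sum has_dbar_mult has_dbar_holo[OF holo_fun_N x])
  then show ?thesis by (simp add: S_eq A_def [abs_def])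
qed

text \<open>The conjugate-linear derivative of \<open>A\<close>; its symmetry, which comes from the
  mixed second derivatives of holomorphic functions, expresses that dbar of dbar S is 0.\<close>

definition A2 :: "complex^3 \<Rightarrow> complex^3 \<Rightarrow> complex^3 \<Rightarrow> complex" where
  "A2 x w v = (\<Sum>i\<in>UNIV. N i x * cnj (frechet_derivative (\<lambda>y. frechet_derivative (N i) (at y) v) (at x) w))"

lemma A2_symmetric: "x \<in> U \<Longrightarrow> A2 x v w = A2 x w v"
  unfolding A2_def using frechet_derivative_symmetric[OF U(1) _ holo_fun_Ck_on[OF U(1) holo_fun_N]] by simp

lemma has_dbar_A: "x \<in> U \<Longrightarrow> has_dbar (\<lambda>y. A y v) (\<lambda>w. A2 x w v) x"
proof -
  assume x: "x \<in> U"
  have "has_dbar (\<lambda>y. \<Sum>i\<in>UNIV. N i y * cnj (frechet_derivative (N i) (at y) v))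
    (\<lambda>w. \<Sum>i\<in>UNIV. N i x * cnj (frechet_derivative (\<lambda>y. frechet_derivative (N i) (at y) v) (at x) w) + 0 * cnj (frechet_derivative (N i) (at x) v)) x"
    by (intro has_dbar_sum has_dbar_mult has_dbar_holo(1)[OF holo_fun_N x] has_dbar_holo(2)[OF holo_fun_deriv[OF holo_fun_N U(1)] x])
  then show ?thesis by (simp add: A_def [abs_def] A2_def [abs_def])
qed

lemma holo_fun_crs_F: "holo_fun (\<lambda>y. crs (frechet_derivative F (at y) u) (frechet_derivative F (at y) v) $ i) U"
proof -
  have E: "holo_fun (\<lambda>y. frechet_derivative F (at y) e $ j) U" for e j
    by (rule holomorphic_map_nth[OF holomorphic_map_deriv[OF F(1) U(1)]])
  have "\<forall>i. holo_fun (\<lambda>y. crs (frechet_derivative F (at y) u) (frechet_derivative F (at y) v) $ i) U"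
    unfolding forall_3 crs_nth by (intro conjI holo_fun_diff holo_fun_mult E)
  then show ?thesis by blast
qed

text \<open>Only the conjugate gradient contributes to dbar. Replacing the cross product by c times
  the gradient turns its derivative into c times dbar S, as expected for \<open>S\<close> times a
  holomorphic form.\<close>

lemma has_dbar_W2:
  assumes x: "x \<in> Reg - {0}" and u: "u \<in> tangent X x" "v \<in> tangent X x"
  obtains c where "W2 x u v = c * of_real (S x)" "has_dbar (\<lambda>y. W2 y u v) (\<lambda>w. c * A x w) x"
proof -
  have xU: "x \<in> U" using x Reg_U by blast
  obtain c where c: "\<And>i. crs (frechet_derivative F (at x) u) (frechet_derivative F (at x) v) $ i = c * N i x"
    "W2 x u v = c * of_real (S x)" using crs_tangent[OF x u] by blast
  have "has_dbar (\<lambda>y. W2 y u v) (\<lambda>w. \<Sum>i\<in>UNIV. cnj (N i x) * 0 + cnj (frechet_derivative (N i) (at x) w) * crs (frechet_derivative F (at x) u) (frechet_derivative F (at x) v) $ i) x"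
    unfolding W2_def by (intro has_dbar_sum has_dbar_mult has_dbar_holo[OF holo_fun_N xU] has_dbar_holo(1)[OF holo_fun_crs_F xU])
  also have "(\<lambda>w. \<Sum>i\<in>UNIV. cnj (N i x) * 0 + cnj (frechet_derivative (N i) (at x) w) * crs (frechet_derivative F (at x) u) (frechet_derivative F (at x) v) $ i) = (\<lambda>w. c * A x w)"
    unfolding c A_def by (simp add: sum_distrib_left mult_ac)
  finally show ?thesis using that c(2) by blast
qed

definition tst :: "(real \<Rightarrow> real) \<Rightarrow> form" where
  "tst \<theta> y vs = of_real (\<theta> (S y)) * (A y (vs!0) * W2 y (vs!1) (vs!2) - A y (vs!1) * W2 y (vs!0) (vs!2) + A y (vs!2) * W2 y (vs!0) (vs!1))"

text \<open>On the regular part, \<open>W2 = S \<Omega>\<close> for a holomorphic 2-form \<open>\<Omega>\<close>, so \<open>tst \<theta>\<close> is \<open>\<theta>(S) S (dbar S) \<and> \<Omega>\<close>.\<close>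

lemma dbar_tst:
  assumes x: "x \<in> Reg - {0}" and vs: "set vs \<subseteq> tangent X x" "length vs = 4"
    and \<theta>: "(\<theta> has_real_derivative \<theta>') (at (S x))"
  shows "dbar (tst \<theta>) x vs = 0"
proof -
  have xU: "x \<in> U" using x Reg_U by blast
  obtain v0 v1 v2 v3 where v: "vs = [v0, v1, v2, v3]"
    using vs(2) by (auto simp: numeral_eq_Suc length_Suc_conv)
  then have t: "v0 \<in> tangent X x" "v1 \<in> tangent X x" "v2 \<in> tangent X x" "v3 \<in> tangent X x" using vs(1) by auto
  \<comment> \<open>The number \<open>c u v\<close> is the value of the residue form at x; it is
    chosen once so that all directional derivatives below use the same constants.\<close>
  have "\<exists>c. \<forall>u\<in>tangent X x. \<forall>v\<in>tangent X x. W2 x u v = c u v * of_real (S x) \<and> has_dbar (\<lambda>y. W2 y u v) (\<lambda>w. c u v * A x w) x"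
    using has_dbar_W2[OF x] by (subst bchoice_iff [symmetric], subst bchoice_iff[symmetric]) metis
  then obtain c where c: "\<And>u v. u \<in> tangent X x \<Longrightarrow> v \<in> tangent X x \<Longrightarrow> W2 x u v = c u v * of_real (S x)"
    "\<And>u v. u \<in> tangent X x \<Longrightarrow> v \<in> tangent X x \<Longrightarrow> has_dbar (\<lambda>y. W2 y u v) (\<lambda>w. c u v * A x w) x" by metis
  let ?q = "complex_of_real (\<theta> (S x))" and ?q' = "complex_of_real \<theta>'" and ?s = "complex_of_real (S x)"
  have d: "dbar_dir (\<lambda>y. tst \<theta> y [u1, u2, u3]) x w =
    ?q * ((A x u1 * (c u2 u3 * A x w) + A2 x w u1 * (c u2 u3 * ?s)) - (A x u2 * (c u1 u3 * A x w) + A2 x w u2 * (c u1 u3 * ?s))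
      + (A x u3 * (c u1 u2 * A x w) + A2 x w u3 * (c u1 u2 * ?s)))
    + ?q' * A x w * (A x u1 * (c u2 u3 * ?s) - A x u2 * (c u1 u3 * ?s) + A x u3 * (c u1 u2 * ?s))"
    if "u1 \<in> tangent X x" "u2 \<in> tangent X x" "u3 \<in> tangent X x" for u1 u2 u3 w
  proof -
    have "has_dbar (\<lambda>y. of_real (\<theta> (S y)) * (A y u1 * W2 y u2 u3 - A y u2 * W2 y u1 u3 + A y u3 * W2 y u1 u2))
      (\<lambda>w. ?q * ((A x u1 * (c u2 u3 * A x w) + A2 x w u1 * W2 x u2 u3) - (A x u2 * (c u1 u3 * A x w) + A2 x w u2 * W2 x u1 u3)
        + (A x u3 * (c u1 u2 * A x w) + A2 x w u3 * W2 x u1 u2))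
      + ?q' * A x w * (A x u1 * W2 x u2 u3 - A x u2 * W2 x u1 u3 + A x u3 * W2 x u1 u2)) x"
      by (intro has_dbar_mult has_dbar_add has_dbar_diff has_dbar_real_compose[OF has_dbar_S[OF xU] \<theta>] has_dbar_A[OF xU] c(2) that)
    from has_dbar_dbv[OF this, of w] show ?thesis
      using c(1) that by (simp add: dbar_dir_eq_dbv tst_def)
  qed
  \<comment> \<open>After antisymmetrization the second derivatives cancel by symmetry, and the
    terms with a product of two values of \<open>A\<close> cancel in pairs. This includes those with
    the derivative of \<theta>.\<close>
  have sym: "A2 x v1 v0 = A2 x v0 v1" "A2 x v2 v0 = A2 x v0 v2" "A2 x v3 v0 = A2 x v0 v3"
    "A2 x v2 v1 = A2 x v1 v2" "A2 x v3 v1 = A2 x v1 v3" "A2 x v3 v2 = A2 x v2 v3" using A2_symmetric[OF xU] by auto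
  have "{..<length vs} = {0, 1, 2, 3}" using v by auto
  then have "dbar (tst \<theta>) x vs = dbar_dir (\<lambda>y. tst \<theta> y [v1, v2, v3]) x v0 - dbar_dir (\<lambda>y. tst \<theta> y [v0, v2, v3]) x v1
    + dbar_dir (\<lambda>y. tst \<theta> y [v0, v1, v3]) x v2 - dbar_dir (\<lambda>y. tst \<theta> y [v0, v1, v2]) x v3"
    unfolding dbar_def by (simp add: v numeral_2_eq_2 numeral_3_eq_3)
  also have "\<dots> = 0"
    by (simp add: d t sym algebra_simps)
  finally show ?thesis .
qed

end

section \<open>The obstruction\<close>

lemma dbar_cong_open:
  assumes "open T" "x \<in> T" "\<And>y vs. y \<in> T \<Longrightarrow> \<eta> y vs = \<eta>' y vs"
  shows "dbar \<eta> x vs = dbar \<eta>' x vs"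
proof -
  have "frechet_derivative (\<lambda>y. \<eta> y us) (at x) = frechet_derivative (\<lambda>y. \<eta>' y us) (at x)" for us
    by (rule frechet_derivative_cong_open[OF assms(1,2)]) (rule assms(3))
  then show ?thesis unfolding dbar_def dbar_dir_def by simp
qed

lemma dbar_zero: "dbar (\<lambda>y vs. 0) x vs = 0"
  by (simp add: dbar_def dbar_dir_def frechet_derivative_const)

lemma unitary_frame_tangent:
  assumes "surface_regular_off_0 X" "x \<in> X - {0}"
  shows "set (unitary_frame X x) \<subseteq> tangent X x" "length (unitary_frame X x) = 4"
proof -
  obtain W p z where p: "holo_param X W p" "z \<in> W" "x = p z"
    using assms unfolding surface_regular_off_0_def by blast
  obtain \<alpha> \<beta> \<gamma> \<delta> where e: "unitary_frame X (p z) =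
      [\<alpha> *s frechet_derivative p (at z) (axis 1 1) + \<beta> *s frechet_derivative p (at z) (axis 2 1),
       \<i> *s (\<alpha> *s frechet_derivative p (at z) (axis 1 1) + \<beta> *s frechet_derivative p (at z) (axis 2 1)),
       \<gamma> *s frechet_derivative p (at z) (axis 1 1) + \<delta> *s frechet_derivative p (at z) (axis 2 1),
       \<i> *s (\<gamma> *s frechet_derivative p (at z) (axis 1 1) + \<delta> *s frechet_derivative p (at z) (axis 2 1))]"
    using unitary_frame_chart[OF p(1,2)] by metis
  have i: "\<i> *s (\<alpha> *s u + \<beta> *s v) = (\<i> * \<alpha>) *s u + (\<i> * \<beta>) *s v" for \<alpha> \<beta> and u v :: "complex^3"
    by (simp add: vec_eq_iff algebra_simps)
  show "set (unitary_frame X x) \<subseteq> tangent X x"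
    unfolding p(3) e holo_param_basis(3)[OF p(1,2)] i by auto
  show "length (unitary_frame X x) = 4" unfolding p(3) e by simp
qed

lemma wedge_zero_right:
  assumes "\<And>us. set us \<subseteq> set vs \<Longrightarrow> length us = l \<Longrightarrow> \<beta> x us = 0" "length vs = k + l"
  shows "wedge k l \<alpha> \<beta> x vs = 0"
proof -
  have "\<beta> x (map (\<lambda>i. vs ! \<sigma> i) [k..<k + l]) = 0" if "\<sigma> permutes {..<k + l}" for \<sigma>
  proof (rule assms(1))
    have "vs ! \<sigma> i \<in> set vs" if "i < k + l" for i
      using permutes_in_image[OF \<open>\<sigma> permutes {..<k + l}\<close>, of i] that assms(2) by simp
    then show "set (map (\<lambda>i. vs ! \<sigma> i) [k..<k + l]) \<subseteq> set vs" by auto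
  qed simp
  then show ?thesis by (simp add: wedge_def)
qed

lemma open_pos_measure:
  fixes T :: "'a::euclidean_space set"
  assumes "open T" "T \<noteq> {}"
  shows "T \<notin> null_sets lborel"
  using open_not_negligible[OF assms] null_sets_completionI[of T lborel] by (auto simp: negligible_iff_null_sets)

context germ
begin

text \<open>Test forms must be smooth on the whole ambient space, whereas \<open>tst\<close> lives
  where \<open>F\<close> is defined. The distance cutoff achieves the extension.\<close>

definition cut :: "real \<Rightarrow> (real \<Rightarrow> real) \<Rightarrow> form" where
  "cut \<rho> \<theta> y vs = (if y \<in> U then of_real (smooth_step (y \<bullet> y / \<rho>\<^sup>2)) * tst \<theta> y vs else 0)"

lemma cut_far:
  assumes "\<rho> > 0" "y \<bullet> y \<ge> 2 * \<rho>\<^sup>2"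
  shows "cut \<rho> \<theta> y vs = 0"
proof -
  have "y \<bullet> y / \<rho>\<^sup>2 \<ge> 2" using assms by (simp add: field_simps)
  then show ?thesis by (simp add: cut_def smooth_step)
qed

section \<open>Smoothness, support and closedness of the cut-off form\<close>

lemma Ck_on_S: "Ck_on k U S"
proof -
  have "Ck_on k U (\<lambda>x. Re (\<Sum>i\<in>UNIV. N i x * cnj (N i x)))"
    by (intro Ck_on_bounded_linear_comp[OF U(1) bounded_linear_Re] Ck_on_sum Ck_on_mult U(1)
      Ck_on_bounded_linear_comp[OF U(1) bounded_linear_cnj] holo_fun_Ck_on holo_fun_N)
  then show ?thesis unfolding S_eq[symmetric] by simp
qed

lemma Ck_on_tst:
  assumes "\<And>k. Ck_on k UNIV \<theta>"
  shows "Ck_on k U (\<lambda>y. tst \<theta> y vs)"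
proof -
  have A: "Ck_on k U (\<lambda>y. A y v)" for v
    unfolding A_def
    by (intro Ck_on_sum Ck_on_mult U(1) Ck_on_bounded_linear_comp[OF U(1) bounded_linear_cnj] holo_fun_Ck_on holo_fun_N
      holo_fun_deriv[OF holo_fun_N U(1)])
  have W: "Ck_on k U (\<lambda>y. W2 y u v)" for u v
    unfolding W2_def
    by (intro Ck_on_sum Ck_on_mult U(1) Ck_on_bounded_linear_comp[OF U(1) bounded_linear_cnj] holo_fun_Ck_on holo_fun_N holo_fun_crs_F)
  show ?thesis unfolding tst_def
    by (intro Ck_on_mult Ck_on_add Ck_on_diff U(1) A W Ck_on_bounded_linear_comp[OF U(1) bounded_linear_of_real]
      Ck_on_compose[OF U(1) assms Ck_on_S]) simp
qed

lemma form_at_tst: "y \<in> U \<Longrightarrow> form_at UNIV 2 1 (tst \<theta> y)"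
proof -
  assume y: "y \<in> U"
  note A = A_linear[OF y] and W = W2_linear[OF y]
  have sc: "A y (t *\<^sub>R v) = of_real t * A y v" "W2 y (t *\<^sub>R v) w = of_real t * W2 y v w" "W2 y w (t *\<^sub>R v) = of_real t * W2 y w v" for t v w
    using A(2)[of "of_real t" v] W(3)[of "of_real t" v w] W(4)[of w "of_real t" v] by (simp_all add: vector_scalar_mult_of_real)
  have anti: "W2 y v u = - W2 y u v" for u v
    by (simp add: W2_def sum_3 algebra_simps)
  define t where "t u v w = tst \<theta> y [u, v, w]" for u v w
  have t: "t u v w = of_real (\<theta> (S y)) * (A y u * W2 y v w - A y v * W2 y u w + A y w * W2 y u v)" for u v w
    by (simp add: t_def tst_def)
  have add: "t (u + u') v w = t u v w + t u' v w" "t v (u + u') w = t v u w + t v u' w" "t v w (u + u') = t v w u + t v w u'" for u u' v w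
    unfolding t A W by (simp_all add: algebra_simps)
  have scale: "t (r *\<^sub>R u) v w = r *\<^sub>R t u v w" "t v (r *\<^sub>R u) w = r *\<^sub>R t v u w" "t v w (r *\<^sub>R u) = r *\<^sub>R t v w u" for r u v w
    unfolding t sc scaleR_conv_of_real[where 'a=complex] by (simp_all add: algebra_simps)
  have alt: "t u u w = 0" "t w u u = 0" "t u w u = 0" for u w
    unfolding t W(5) anti[of w u] by simp_all
  have "t (c *s u) (c *s v) (c *s w) = c\<^sup>2 * cnj c * t u v w" for c u v w
    unfolding t A W by (simp add: power2_eq_square algebra_simps)
  then show ?thesis
    using add scale alt unfolding t_def form_at_def
    by (auto simp: numeral_eq_Suc length_Suc_conv less_Suc_eq)
qed

text \<open>\<open>U\<close> and the open set of points with squared norm above 2 \<rho>^2 cover the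
  space. The form is smooth on the first and zero on the second.\<close>

lemma test_form_cut:
  assumes \<theta>: "\<And>k. Ck_on k UNIV \<theta>" and \<rho>: "\<rho> > 0" "cball 0 (2 * \<rho>) \<subseteq> U"
    and K: "compact (X \<inter> cball 0 (2 * \<rho>))" "X \<inter> cball 0 (2 * \<rho>) \<subseteq> V0"
  shows "test_form X V0 2 1 (cut \<rho> \<theta>)"
  unfolding test_form_def
proof (intro conjI allI impI)
  show "form_at UNIV 2 1 (cut \<rho> \<theta> x)" for x
  proof (cases "x \<in> U")
    case True
    show ?thesis
      using form_at_tst[OF True, of \<theta>] True
      unfolding form_at_def cut_def by (simp add: algebra_simps)
  qed (simp add: form_at_def cut_def)
next
  fix vs k
  have far: "y \<bullet> y > 2 * \<rho>\<^sup>2" if "norm y > 2 * \<rho>" for y :: "complex^3"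
  proof -
    have "(2 * \<rho>)\<^sup>2 < (norm y)\<^sup>2" using that \<rho>(1) by (intro power_strict_mono) auto
    moreover have "(2 * \<rho>)\<^sup>2 \<ge> 2 * \<rho>\<^sup>2" by (simp add: power_mult_distrib)
    ultimately show ?thesis unfolding power2_norm_eq_inner by linarith
  qed
  let ?T = "{y :: complex^3. y \<bullet> y > 2 * \<rho>\<^sup>2}"
  have T: "open ?T" by (intro open_Collect_less continuous_intros)
  have "Ck_on k U (\<lambda>y. of_real (smooth_step (y \<bullet> y / \<rho>\<^sup>2)) * tst \<theta> y vs)"
    unfolding divide_inverse
    by (intro Ck_on_mult U(1) Ck_on_tst \<theta> Ck_on_bounded_linear_comp[OF U(1) bounded_linear_of_real]
      Ck_on_compose[OF U(1) Ck_on_smooth_step] Ck_on_inner Ck_on_id Ck_on_const) simp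
  then have 1: "Ck_on k U (\<lambda>y. cut \<rho> \<theta> y vs)"
    by (subst Ck_on_cong[OF U(1)]) (auto simp: cut_def)
  have 2: "Ck_on k ?T (\<lambda>y. cut \<rho> \<theta> y vs)"
    by (rule Ck_on_cong[OF T, THEN iffD2, OF _ Ck_on_const[OF T, of k 0]]) (use cut_far[OF \<rho>(1)] in auto)
  have "U \<union> ?T = UNIV"
  proof (intro set_eqI iffI UNIV_I)
    fix y show "y \<in> U \<union> ?T" using far[of y] \<rho>(2) by (cases "norm y \<le> 2 * \<rho>") auto
  qed
  with Ck_on_Un[OF 1 2 U(1) T] show "C_k k (\<lambda>y. cut \<rho> \<theta> y vs)" by (simp add: C_k_eq_Ck_on)
  show "\<exists>K. compact K \<and> K \<subseteq> V0 \<and> (\<forall>x\<in>X - K. \<forall>vs. length vs = 2 + 1 \<longrightarrow> cut \<rho> \<theta> x vs = 0)"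
  proof (rule exI[of _ "X \<inter> cball 0 (2 * \<rho>)"], intro conjI ballI allI impI K)
    fix x vs assume "x \<in> X - X \<inter> cball 0 (2 * \<rho>)"
    then show "cut \<rho> \<theta> x vs = 0" using cut_far[OF \<rho>(1)] far[of x] by auto
  qed
qed

text \<open>Where the distance cutoff equals 1 the form is \<open>tst\<close>, which is closed.
  Elsewhere the form vanishes on an ambient neighbourhood of x, either because x is far away or
  because \<open>S\<close> exceeds \<delta> near x.\<close>

lemma dbar_cut:
  assumes \<theta>: "\<And>t. \<exists>c. (\<theta> has_real_derivative c) (at t)" "\<And>t. t \<ge> \<delta> \<Longrightarrow> \<theta> t = 0"
    and \<rho>: "\<rho> > 0" and \<delta>: "\<And>x. x \<in> X \<Longrightarrow> \<rho> \<le> norm x \<Longrightarrow> norm x \<le> 2 * \<rho> \<Longrightarrow> S x > \<delta>"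
    and x: "x \<in> Reg - {0}" and vs: "set vs \<subseteq> tangent X x" "length vs = 4"
  shows "dbar (cut \<rho> \<theta>) x vs = 0"
proof (cases "norm x < \<rho>")
  case True
  let ?T = "ball 0 \<rho> \<inter> U"
  have "dbar (cut \<rho> \<theta>) x vs = dbar (tst \<theta>) x vs"
  proof (rule dbar_cong_open[of ?T])
    fix y vs assume y: "y \<in> ?T"
    then have "(norm y)\<^sup>2 \<le> \<rho>\<^sup>2" by (intro power_mono) auto
    then have "y \<bullet> y / \<rho>\<^sup>2 \<le> 1" using \<rho> by (simp add: power2_norm_eq_inner)
    then show "cut \<rho> \<theta> y vs = tst \<theta> y vs" using y by (simp add: cut_def smooth_step)
  qed (use True x Reg_U U in auto)
  moreover obtain c where "(\<theta> has_real_derivative c) (at (S x))" using \<theta>(1) by blast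
  ultimately show ?thesis using dbar_tst[OF x vs] by simp
next
  case False
  have Sc: "continuous_on U S" using Ck_on_imp_continuous_on[OF Ck_on_S[of 0]] .
  let ?T = "{y :: complex^3. y \<bullet> y > 2 * \<rho>\<^sup>2} \<union> (U \<inter> S -` {\<delta><..})"
  have "open ?T"
    by (intro open_Un open_Collect_less continuous_intros continuous_open_preimage[OF Sc U(1)] open_greaterThan)
  moreover have "x \<in> ?T"
  proof (cases "norm x \<le> 2 * \<rho>")
    case True
    then show ?thesis using \<delta>[of x] False x Reg_U[of x] by auto
  next
    case f: False
    have "(2 * \<rho>)\<^sup>2 < (norm x)\<^sup>2" using f \<rho> by (intro power_strict_mono) auto
    moreover have "(2 * \<rho>)\<^sup>2 \<ge> 2 * \<rho>\<^sup>2" by (simp add: power_mult_distrib)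
    ultimately have "x \<bullet> x > 2 * \<rho>\<^sup>2" unfolding power2_norm_eq_inner by linarith
    then show ?thesis by simp
  qed
  moreover have "cut \<rho> \<theta> y vs = 0" if "y \<in> ?T" for y vs
    using that
  proof
    assume "y \<in> U \<inter> S -` {\<delta><..}"
    then show ?thesis using \<theta>(2)[of "S y"] by (simp add: cut_def tst_def)
  qed (simp add: cut_far[OF \<rho>])
  ultimately have "dbar (cut \<rho> \<theta>) x vs = dbar (\<lambda>y vs. 0) x vs" by (rule dbar_cong_open)
  then show ?thesis by (simp add: dbar_zero)
qed

text \<open>The value of dbar S on the Euler field: each component of the gradient counts with its
  weighted degree. Positivity of all three degrees makes the pairing with \<phi> definite.\<close>

definition E :: "complex^3 \<Rightarrow> real" where
  "E v = real h / 2 * (cmod (nrm v $ 1))\<^sup>2 + real (h - a) * (cmod (nrm v $ 2))\<^sup>2 + real (h - b) * (cmod (nrm v $ 3))\<^sup>2"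

lemma E_ge: "E v \<ge> (norm (nrm v))\<^sup>2 / 2"
proof -
  have "h \<ge> 1" "h - a \<ge> 1" "h - b \<ge> 1" using ha hb by auto
  then have c: "real h / 2 \<ge> 1 / 2" "real (h - a) \<ge> 1 / 2" "real (h - b) \<ge> 1 / 2" by auto
  have "(norm (nrm v))\<^sup>2 = (cmod (nrm v $ 1))\<^sup>2 + (cmod (nrm v $ 2))\<^sup>2 + (cmod (nrm v $ 3))\<^sup>2"
    by (simp add: norm_vec_def L2_set_def sum_nonneg sum_3)
  then have "(norm (nrm v))\<^sup>2 / 2 = 1 / 2 * (cmod (nrm v $ 1))\<^sup>2 + 1 / 2 * (cmod (nrm v $ 2))\<^sup>2 + 1 / 2 * (cmod (nrm v $ 3))\<^sup>2"
    by (simp del: nrm_nth)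
  also have "\<dots> \<le> E v" unfolding E_def by (intro add_mono mult_right_mono c) auto
  finally show ?thesis .
qed

lemma dnrm_Rt:
  "dnrm v (Rt v) $ 1 = of_real (real h / 2) * nrm v $ 1" "dnrm v (Rt v) $ 2 = of_real (real (h - a)) * nrm v $ 2"
  "dnrm v (Rt v) $ 3 = of_real (real (h - b)) * nrm v $ 3"
  using euler1[of "v$2" "v$3"] euler2[of "v$2" "v$3"] by (simp_all add: dnrm_def)

lemma A_sheet:
  assumes s: "s = 1 \<or> s = -1" and w: "w \<in> Dm"
  shows "A (sheet s w) (frechet_derivative G (at (pt s w)) (Rt (pt s w))) = of_real (E (pt s w))"
proof -
  have xU: "sheet s w \<in> U" using sheet_props(5)[OF s w] Reg_U by blast
  have "frechet_derivative G (at (pt s w)) (Rt (pt s w)) = frechet_derivative (sheet s) (at w) (vector [of_nat a * w$1, of_nat b * w$2])"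
    using sheet_Rt[OF s w] holo_param_basis(1)[OF holo_param_sheet[OF s] w, of "vector [of_nat a * w$1, of_nat b * w$2]"] by simp
  then have "frechet_derivative F (at (sheet s w)) (frechet_derivative G (at (pt s w)) (Rt (pt s w))) = Rt (pt s w)"
    using Dpt_sheet[OF s w] dpt_Rt[OF s w] by simp
  then have "A (sheet s w) (frechet_derivative G (at (pt s w)) (Rt (pt s w))) = (\<Sum>i\<in>UNIV. nrm (pt s w) $ i * cnj (dnrm (pt s w) (Rt (pt s w)) $ i))"
    unfolding A_def N_derivative[OF xU] N_def sheet_props(4)[OF s w] by simp
  also have "\<dots> = of_real (E (pt s w))"
    unfolding sum_3 dnrm_Rt E_def complex_cnj_mult complex_cnj_complex_of_real of_real_add of_real_mult complex_norm_square
    by (simp only: mult_ac)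
  finally show ?thesis .
qed

text \<open>In the coordinates y, z of a sheet the residue form is dy \<and> dz / (2x), so x times
  it has the value 1/2.\<close>

lemma W2_sheet:
  assumes s: "s = 1 \<or> s = -1" and w: "w \<in> Dm"
  shows "s * sqg w * W2 (sheet s w) (frechet_derivative (sheet s) (at w) (axis 1 1)) (frechet_derivative (sheet s) (at w) (axis 2 1))
    = of_real ((norm (nrm (pt s w)))\<^sup>2 / 2)"
proof -
  have q0: "sqg w \<noteq> 0" using Re_sqg_pos[OF sheet_props(7)[OF s w]] by auto
  have ss: "s * s = 1" using s by auto
  have c: "s * sqg w * crs (dpt s w (axis 1 1)) (dpt s w (axis 2 1)) $ i = nrm (pt s w) $ i / 2" for i
  proof -
    have "\<forall>i. s * sqg w * crs (dpt s w (axis 1 1)) (dpt s w (axis 2 1)) $ i = nrm (pt s w) $ i / 2"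
      unfolding forall_3 crs_nth nrm_nth using q0 s by (auto simp: dpt_def pt_def axis_def)
    then show ?thesis by blast
  qed
  have "s * sqg w * W2 (sheet s w) (frechet_derivative (sheet s) (at w) (axis 1 1)) (frechet_derivative (sheet s) (at w) (axis 2 1))
    = (\<Sum>i\<in>UNIV. cnj (nrm (pt s w) $ i) * (s * sqg w * crs (dpt s w (axis 1 1)) (dpt s w (axis 2 1)) $ i))"
    unfolding W2_def Dpt_sheet[OF s w] N_def sheet_props(4)[OF s w] sum_distrib_left by (simp only: mult_ac)
  also have "\<dots> = of_real (S (sheet s w)) / 2"
    unfolding c S_eq N_def sheet_props(4)[OF s w] sum_divide_distrib by (simp only: mult_ac times_divide_eq_right)
  finally show ?thesis by (simp add: S_def sheet_props(4)[OF s w])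
qed

text \<open>The factors of \<open>mw\<close> may vanish on the coordinate axes. The branch cut and
  the sets where a coordinate has real part 0 are null sets and cannot fill a neighbourhood of the
  origin.\<close>

lemma sheet_near_origin:
  assumes "\<epsilon> > 0"
  obtains w where "w \<in> Dm" "norm (pt 1 w) < \<epsilon>" "mw w > 0"
proof -
  let ?n = "\<lambda>w. cmod (g (w$1) (w$2)) + (cmod (w$1))\<^sup>2 + (cmod (w$2))\<^sup>2"
  define e where "e = min \<epsilon> r"
  have e: "e > 0" "e \<le> \<epsilon>" "e \<le> r" using assms r by (auto simp: e_def)
  define T where "T = {w :: complex^2. ?n w < e\<^sup>2}"
  have n: "(norm (pt 1 w))\<^sup>2 = ?n w" for w
  proof -
    have "(cmod (sqg w))\<^sup>2 = cmod (g (w$1) (w$2))" using sqg_square[of w] by (metis norm_minus_cancel norm_power)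
    then show ?thesis by (simp add: pt_def norm_vec3)
  qed
  have "open T"
    unfolding T_def by (intro open_Collect_less continuous_intros holo_fun_continuous_on[OF holo_fun_g(1)])
  moreover have "0 \<in> T" using e(1) euler[of 0 0] ha by (simp add: T_def)
  ultimately have T: "T \<notin> null_sets lborel" using open_pos_measure by blast
  have coord: "{w \<in> UNIV. Re (w $ i) = 0} \<in> null_sets (lborel :: (complex^2) measure)" for i
  proof -
    have "\<exists>v. frechet_derivative (\<lambda>w::complex^2. w $ i) (at w) v \<noteq> 0" for w
      unfolding frechet_derivative_eqI[OF has_derivative_coord] by (rule exI[of _ "axis i 1"]) simp
    from null_level_set[OF open_UNIV holo_fun_coord this] show ?thesis by (intro null_setsI) auto
  qed
  have "- slit \<in> null_sets lborel" using null_slit_complement by (intro null_setsI) auto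
  from null_sets.Un[OF this null_sets.Un[OF coord[of 1] coord[of 2]]]
  have "- slit \<union> ({w \<in> UNIV. Re (w $ 1) = 0} \<union> {w \<in> UNIV. Re (w $ 2) = 0}) \<in> null_sets lborel" .
  moreover have "T \<in> sets lborel" using \<open>open T\<close> by simp
  ultimately have "\<not> T \<subseteq> - slit \<union> ({w \<in> UNIV. Re (w $ 1) = 0} \<union> {w \<in> UNIV. Re (w $ 2) = 0})"
    using T null_sets_subset by blast
  then obtain w where w: "w \<in> T" "w \<in> slit" "Re (w $ 1) \<noteq> 0" "Re (w $ 2) \<noteq> 0" by auto
  then have w0: "w $ 1 \<noteq> 0" "w $ 2 \<noteq> 0" "w \<noteq> 0" by auto
  have "(norm (pt 1 w))\<^sup>2 < e\<^sup>2" using w(1) n by (simp add: T_def)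
  then have "norm (pt 1 w) < e" using e(1) by (simp add: power2_less_imp_less)
  then have "norm (pt 1 w) < \<epsilon>" "w \<in> Dm" using e w(2) by (auto simp: Dm_def)
  moreover have "mw w > 0"
    unfolding mw_def using w0 Nw_pos[of w] by (intro divide_pos_pos mult_pos_pos zero_less_power) auto
  ultimately show ?thesis using that by blast
qed

lemma nrm_0: "nrm 0 = 0"
  by (simp add: vec_eq_iff forall_3 gradient_0)

text \<open>The surface is only locally closed, so the radius is chosen inside an open set in which
  it is closed. The shell between \<rho> and 2 \<rho> is then compact, and \<open>S\<close> has a
  positive lower bound on it.\<close>

lemma cutoff_radius:
  assumes V0: "openin (top_of_set X) V0" "0 \<in> V0"
  obtains \<rho> \<delta> where "\<rho> > 0" "\<delta> > 0" "cball 0 (2 * \<rho>) \<subseteq> U" "compact (X \<inter> cball 0 (2 * \<rho>))" "X \<inter> cball 0 (2 * \<rho>) \<subseteq> V0"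
    "\<And>x. x \<in> X \<Longrightarrow> \<rho> \<le> norm x \<Longrightarrow> norm x \<le> 2 * \<rho> \<Longrightarrow> S x > \<delta>"
proof -
  obtain T0 where T0: "open T0" "closedin (top_of_set T0) X" using X unfolding surface_regular_off_0_def by blast
  then obtain C where C: "closed C" "X = T0 \<inter> C" by (auto simp: closedin_closed)
  obtain T1 where T1: "open T1" "V0 = X \<inter> T1" using V0(1) by (auto simp: openin_open)
  have "open (U \<inter> T0 \<inter> T1)" "0 \<in> U \<inter> T0 \<inter> T1" using U T0 T1 V0(2) C(2) by auto
  then obtain e where e: "e > 0" "cball 0 e \<subseteq> U \<inter> T0 \<inter> T1" using open_contains_cball by blast
  define \<rho> where "\<rho> = e / 2"
  have \<rho>: "\<rho> > 0" "2 * \<rho> = e" using e by (auto simp: \<rho>_def)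
  have "X \<inter> cball 0 e = C \<inter> cball 0 e" using e(2) C(2) by auto
  then have K: "compact (X \<inter> cball 0 (2 * \<rho>))" using C(1) by (simp add: \<rho>(2) closed_Int_compact)
  let ?R = "(X \<inter> cball 0 (2 * \<rho>)) \<inter> {x. \<rho> \<le> norm x}"
  have R: "compact ?R" by (intro compact_Int_closed K closed_Collect_le continuous_intros)
  have Sp: "S x > 0" if "x \<in> ?R" for x
  proof -
    have "x \<noteq> 0" using that \<rho>(1) by auto
    then show ?thesis using nrm_F_nonzero(2)[of x] that e(2) \<rho>(2) by (auto simp: subset_iff)
  qed
  have "\<exists>\<delta>>0. \<forall>x\<in>?R. S x > \<delta>"
  proof (cases "?R = {}")
    case True
    then show ?thesis by (intro exI[of _ 1]) auto
  next
    case False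
    have "continuous_on ?R S"
      by (rule continuous_on_subset[OF Ck_on_imp_continuous_on[OF Ck_on_S[of 0]]]) (use e(2) \<rho> in auto)
    from continuous_attains_inf[OF R False this] obtain x0 where "x0 \<in> ?R" "\<And>x. x \<in> ?R \<Longrightarrow> S x0 \<le> S x" by blast
    then show ?thesis using Sp[of x0] by (intro exI[of _ "S x0 / 2"]) force
  qed
  then obtain \<delta> where "\<delta> > 0" "\<And>x. x \<in> ?R \<Longrightarrow> S x > \<delta>" by blast
  then show ?thesis using that[of \<rho> \<delta>] \<rho> K e(2) T1(2) by auto
qed

text \<open>Puts the cut-off form into the shape l \<and> dz1 \<and> dz2 that
  \<open>wedge_1_3_frame\<close> asks for, with l a multiple of \<open>A x\<close>.\<close>

lemma tst_chart:
  assumes xU: "x \<in> U"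
  shows "cut \<rho> \<theta> x [\<alpha> *s u + \<beta> *s v, \<gamma> *s u + \<delta> *s v, \<epsilon> *s u + \<zeta> *s v] =
    (cnj \<alpha> * (of_real (smooth_step (x \<bullet> x / \<rho>\<^sup>2) * \<theta> (S x)) * A x u * W2 x u v) + cnj \<beta> * (of_real (smooth_step (x \<bullet> x / \<rho>\<^sup>2) * \<theta> (S x)) * A x v * W2 x u v)) * (\<gamma> * \<zeta> - \<delta> * \<epsilon>)
    - (cnj \<gamma> * (of_real (smooth_step (x \<bullet> x / \<rho>\<^sup>2) * \<theta> (S x)) * A x u * W2 x u v) + cnj \<delta> * (of_real (smooth_step (x \<bullet> x / \<rho>\<^sup>2) * \<theta> (S x)) * A x v * W2 x u v)) * (\<alpha> * \<zeta> - \<beta> * \<epsilon>)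
    + (cnj \<epsilon> * (of_real (smooth_step (x \<bullet> x / \<rho>\<^sup>2) * \<theta> (S x)) * A x u * W2 x u v) + cnj \<zeta> * (of_real (smooth_step (x \<bullet> x / \<rho>\<^sup>2) * \<theta> (S x)) * A x v * W2 x u v)) * (\<alpha> * \<delta> - \<beta> * \<gamma>)"
proof -
  have c: "cut \<rho> \<theta> x [p, q, s] = of_real (smooth_step (x \<bullet> x / \<rho>\<^sup>2) * \<theta> (S x)) * (A x p * W2 x q s - A x q * W2 x p s + A x s * W2 x p q)" for p q s
    using xU by (simp add: cut_def tst_def)
  show ?thesis
    unfolding c W2_lincomb[OF xU] A_linear[OF xU] by (simp add: algebra_simps)
qed

lemma A_chart_continuous_on:
  assumes "continuous_on W p" "p ` W \<subseteq> U" "continuous_on W e"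
  shows "continuous_on W (\<lambda>z. A (p z) (e z))"
proof -
  have "continuous_on W (\<lambda>z. frechet_derivative (N i) (at (p z)) (e z))" for i
  proof (rule continuous_on_linear_apply[OF _ _ assms(3)])
    show "linear (frechet_derivative (N i) (at (p z)))" if "z \<in> W" for z
      using holo_funD(1)[OF holo_fun_N, of "p z"] assms(2) that has_derivative_linear by blast
    show "continuous_on W (\<lambda>z. frechet_derivative (N i) (at (p z)) e)" for e
      by (rule continuous_on_compose2[OF holo_fun_continuous_on[OF holo_fun_deriv[OF holo_fun_N U(1)]] assms(1,2)])
  qed
  moreover have "continuous_on W (\<lambda>z. N i (p z))" for i
    by (rule continuous_on_compose2[OF holo_fun_continuous_on[OF holo_fun_N] assms(1,2)])
  ultimately show ?thesis unfolding A_def by (intro continuous_intros) auto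
qed

lemma W2_chart_continuous_on:
  assumes "continuous_on W p" "p ` W \<subseteq> U" "continuous_on W e" "continuous_on W e'"
  shows "continuous_on W (\<lambda>z. W2 (p z) (e z) (e' z))"
proof -
  have D: "continuous_on W (\<lambda>z. frechet_derivative F (at (p z)) (k z))" if "continuous_on W k" for k
  proof (rule continuous_on_linear_apply[OF _ _ that])
    show "linear (frechet_derivative F (at (p z)))" if "z \<in> W" for z
      using F_deriv(1)[of "p z"] assms(2) that by blast
    show "continuous_on W (\<lambda>z. frechet_derivative F (at (p z)) e)" for e
      by (rule continuous_on_compose2[OF holomorphic_map_continuous_on[OF holomorphic_map_deriv[OF F(1) U(1)]] assms(1,2)])
  qed
  have "\<forall>i. continuous_on W (\<lambda>z. crs (frechet_derivative F (at (p z)) (e z)) (frechet_derivative F (at (p z)) (e' z)) $ i)"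
    unfolding forall_3 crs_nth by (intro conjI continuous_intros D assms)
  moreover have "continuous_on W (\<lambda>z. N i (p z))" for i
    by (rule continuous_on_compose2[OF holo_fun_continuous_on[OF holo_fun_N] assms(1,2)])
  ultimately show ?thesis unfolding W2_def by (intro continuous_on_sum continuous_on_mult continuous_on_cnj) auto
qed

text \<open>A solution would make the pairing of \<phi> with the closed test form zero. On the
  sheets the pairing is -2 times the integral of \<open>mw * k\<close>, with k nonnegative and
  positive somewhere.\<close>

theorem \<phi>_not_solvable:
  assumes V0: "openin (top_of_set X) V0" "0 \<in> V0" "V0 \<subseteq> Reg"
  shows "\<not> dbar_w X V0 0 u \<phi>"
proof
  assume sol: "dbar_w X V0 0 u \<phi>"
  obtain \<rho> \<delta> where \<rho>: "\<rho> > 0" and \<delta>: "\<delta> > 0" and K: "cball 0 (2 * \<rho>) \<subseteq> U" "compact (X \<inter> cball 0 (2 * \<rho>))" "X \<inter> cball 0 (2 * \<rho>) \<subseteq> V0"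
    and S\<delta>: "\<And>x. x \<in> X \<Longrightarrow> \<rho> \<le> norm x \<Longrightarrow> norm x \<le> 2 * \<rho> \<Longrightarrow> S x > \<delta>"
    using cutoff_radius[OF V0(1,2)] by blast
  have cn: "continuous_on T nrm" for T by (rule holomorphic_map_continuous_on[OF holomorphic_map_nrm])
  obtain w0 where w0: "w0 \<in> Dm" "mw w0 > 0" "norm (sheet 1 w0) < \<rho>" "(norm (nrm (pt 1 w0)))\<^sup>2 < \<delta>"
  proof -
    have "open (V \<inter> G -` ball 0 \<rho>)" by (rule continuous_open_preimage[OF continuous_on_G V(1)]) simp
    moreover have "open {v. (norm (nrm v))\<^sup>2 < \<delta>}" by (intro open_Collect_less continuous_intros cn)
    ultimately have "open (V \<inter> G -` ball 0 \<rho> \<inter> {v. (norm (nrm v))\<^sup>2 < \<delta>})" by (rule open_Int)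
    moreover have "0 \<in> V \<inter> G -` ball 0 \<rho> \<inter> {v. (norm (nrm v))\<^sup>2 < \<delta>}" using V G \<rho> \<delta> nrm_0 by simp
    ultimately obtain e where e: "e > 0" "ball 0 e \<subseteq> V \<inter> G -` ball 0 \<rho> \<inter> {v. (norm (nrm v))\<^sup>2 < \<delta>}"
      using open_contains_ball by blast
    obtain w where w: "w \<in> Dm" "norm (pt 1 w) < e" "mw w > 0" using sheet_near_origin[OF e(1)] by blast
    then have "pt 1 w \<in> V \<inter> G -` ball 0 \<rho> \<inter> {v. (norm (nrm v))\<^sup>2 < \<delta>}" using e(2) by (auto simp: subset_iff)
    then show ?thesis using that[of w] w by (simp add: sheet_def)
  qed
  define S0 where "S0 = (norm (nrm (pt 1 w0)))\<^sup>2"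
  have S0: "S0 > 0" "S0 < \<delta>"
    using nrm_F_nonzero(1)[of "sheet 1 w0"] sheet_props(4,5,6)[of 1 w0] w0 Reg_U by (auto simp: S0_def)
  \<comment> \<open>The upper end \<delta> makes the test form vanish on the shell of the distance
    cutoff. The lower end keeps its support away from the origin, and \<open>S0\<close> lies between
    them because \<open>w0\<close> was chosen close to 0.\<close>
  define \<theta> where "\<theta> = smooth_bump (S0 / 2) \<delta>"
  have \<theta>: "\<theta> t \<ge> 0" "t \<ge> \<delta> \<Longrightarrow> \<theta> t = 0" "t \<le> S0 / 2 \<Longrightarrow> \<theta> t = 0" "\<theta> S0 > 0" for t
    using S0 by (auto simp: \<theta>_def smooth_bump)
  have \<theta>C: "Ck_on k UNIV \<theta>" for k unfolding \<theta>_def by (rule Ck_on_smooth_bump)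
  have \<theta>D: "\<exists>c. (\<theta> has_real_derivative c) (at t)" for t
    using \<theta>C[of 1] by (simp add: real_differentiable_def[symmetric])
  let ?\<eta> = "cut \<rho> \<theta>"
  have dz: "dbar ?\<eta> x vs = 0" if "x \<in> Reg - {0}" "set vs \<subseteq> tangent X x" "length vs = 4" for x vs
    by (rule dbar_cut[OF \<theta>D \<theta>(2) \<rho> S\<delta> that])
  let ?\<omega> = "\<lambda>x. wedge 1 3 \<phi> ?\<eta> x (unitary_frame X x)"
  have "test_form X V0 2 1 ?\<eta>" by (rule test_form_cut[OF \<theta>C \<rho> K])
  then have "integral_form X V0 (wedge (0 + 1) (2 + 1) \<phi> ?\<eta>) = (-1) ^ (0 + 1) * integral_form X V0 (wedge 0 (2 + 1 + 1) u (dbar ?\<eta>))"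
    using sol unfolding dbar_w_def by force
  moreover have "integral_form X V0 (wedge 0 4 u (dbar ?\<eta>)) = 0"
  proof -
    have "wedge 0 4 u (dbar ?\<eta>) x (unitary_frame X x) = 0" if "x \<in> V0 - {0}" for x
    proof (rule wedge_zero_right)
      have x: "x \<in> Reg - {0}" "x \<in> X - {0}" using that V0(3) Reg_U by auto
      show "length (unitary_frame X x) = 0 + 4" using unitary_frame_tangent(2)[OF X x(2)] by simp
      show "dbar ?\<eta> x us = 0" if "set us \<subseteq> set (unitary_frame X x)" "length us = 4" for us
        using dz[OF x(1)] unitary_frame_tangent(1)[OF X x(2)] that by blast
    qed
    then have "(\<lambda>x. indicator (V0 - {0}) x *\<^sub>R wedge 0 4 u (dbar ?\<eta>) x (unitary_frame X x)) = (\<lambda>x. 0)"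
      by (auto simp: fun_eq_iff indicator_def)
    then show ?thesis unfolding integral_form_def set_lebesgue_integral_def by simp
  qed
  ultimately have "integral_form X V0 (wedge 1 3 \<phi> ?\<eta>) = 0" by simp
  moreover have "integral_form X V0 (wedge 1 3 \<phi> ?\<eta>) = (LINT x:Reg - {0}|\<mu>. ?\<omega> x)"
  proof -
    have "?\<omega> x = 0" if x: "x \<in> Reg - {0}" "x \<notin> V0" for x
    proof (rule wedge_zero_right)
      have "x \<in> X" using x(1) Reg_U by blast
      then have "x \<notin> cball 0 (2 * \<rho>)" using x(2) K(3) by blast
      then have "norm x > 2 * \<rho>" by simp
      then have "(2 * \<rho>)\<^sup>2 < (norm x)\<^sup>2" using \<rho> by (intro power_strict_mono) auto
      moreover have "(2 * \<rho>)\<^sup>2 \<ge> 2 * \<rho>\<^sup>2" by (simp add: power_mult_distrib)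
      ultimately have "2 * \<rho>\<^sup>2 \<le> x \<bullet> x" unfolding power2_norm_eq_inner by linarith
      then show "?\<eta> x us = 0" for us using cut_far[OF \<rho>] by blast
      show "length (unitary_frame X x) = 1 + 3" using unitary_frame_tangent(2)[OF X] x(1) Reg_U by auto
    qed
    then have "(\<lambda>x. indicator (V0 - {0}) x *\<^sub>R ?\<omega> x) = (\<lambda>x. indicator (Reg - {0}) x *\<^sub>R ?\<omega> x)"
      using V0(3) by (auto simp: fun_eq_iff indicator_def)
    then show ?thesis unfolding integral_form_def set_lebesgue_integral_def by simp
  qed
  ultimately have I0: "(LINT x:Reg - {0}|\<mu>. ?\<omega> x) = 0" by simp
  define k where "k v = smooth_step (G v \<bullet> G v / \<rho>\<^sup>2) * \<theta> ((norm (nrm v))\<^sup>2) * (E v * (norm (nrm v))\<^sup>2)" for v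
  have ck: "continuous_on V k"
    unfolding k_def E_def divide_inverse
    by (intro continuous_intros continuous_on_G cn
      continuous_on_compose2[OF Ck_on_imp_continuous_on[OF Ck_on_smooth_step[of 0]] _ subset_UNIV]
      continuous_on_compose2[OF Ck_on_imp_continuous_on[OF \<theta>C[of 0]] _ subset_UNIV])
  have E0: "E v \<ge> 0" for v using E_ge[of v] by (rule order.trans[rotated]) simp
  \<comment> \<open>The distance cutoff equals 1 near the origin and 0 far out; in between the
    factor \<theta> vanishes, so the sign of the cutoff does not matter there.\<close>
  have k_nonneg: "k (pt s z) \<ge> 0" if s: "s = 1 \<or> s = -1" and z: "z \<in> Dm" for s z
  proof -
    let ?x = "sheet s z"
    have x: "?x \<in> X" using sheet_props(5)[OF s z] Reg_U by blast
    have Sx: "S ?x = (norm (nrm (pt s z)))\<^sup>2" by (simp add: S_def sheet_props(4)[OF s z])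
    have Gx: "G (pt s z) = ?x" by (simp add: sheet_def)
    consider "norm ?x < \<rho>" | "\<rho> \<le> norm ?x" "norm ?x \<le> 2 * \<rho>" | "norm ?x > 2 * \<rho>" by linarith
    then have "smooth_step (?x \<bullet> ?x / \<rho>\<^sup>2) * \<theta> (S ?x) \<ge> 0"
    proof cases
      case 1
      then have "(norm ?x)\<^sup>2 \<le> \<rho>\<^sup>2" by (intro power_mono) auto
      then show ?thesis using \<rho> \<theta>(1) by (simp add: power2_norm_eq_inner smooth_step)
    next
      case 2
      then show ?thesis using \<theta>(2)[of "S ?x"] S\<delta>[OF x] by simp
    next
      case 3
      then have "(2 * \<rho>)\<^sup>2 < (norm ?x)\<^sup>2" using \<rho> by (intro power_strict_mono) auto
      moreover have "(2 * \<rho>)\<^sup>2 \<ge> 2 * \<rho>\<^sup>2" by (simp add: power_mult_distrib)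
      ultimately have "2 * \<rho>\<^sup>2 \<le> ?x \<bullet> ?x" unfolding power2_norm_eq_inner by linarith
      then have "?x \<bullet> ?x / \<rho>\<^sup>2 \<ge> 2" using \<rho> by (simp add: field_simps)
      then show ?thesis by (simp add: smooth_step)
    qed
    then show ?thesis unfolding k_def Gx Sx[symmetric] by (rule mult_nonneg_nonneg) (use E0 Sx in simp)
  qed
  have k_pos: "k (pt 1 w0) > 0"
  proof -
    have "(norm (sheet 1 w0))\<^sup>2 \<le> \<rho>\<^sup>2" using w0(3) by (intro power_mono) auto
    then have "smooth_step (G (pt 1 w0) \<bullet> G (pt 1 w0) / \<rho>\<^sup>2) = 1"
      using \<rho> by (intro smooth_step) (simp add: power2_norm_eq_inner sheet_def)
    moreover have "E (pt 1 w0) > 0"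
      by (rule order.strict_trans2[OF _ E_ge]) (use S0(1) in \<open>simp add: S0_def\<close>)
    ultimately show ?thesis unfolding k_def using S0(1) \<theta>(4) by (simp add: S0_def)
  qed
  define \<kappa> where "\<kappa> v = complex_of_real (indicator (ball 0 r) v *\<^sub>R k v)" for v
  have bV: "ball 0 r \<subseteq> V" using r by (auto simp: subset_iff)
  have \<kappa>m: "\<kappa> \<in> borel_measurable borel"
    unfolding \<kappa>_def [abs_def]
    by (rule measurable_compose[OF borel_measurable_vanishing_extension[OF ck _ bV] borel_measurable_continuous_onI])
       (simp_all add: linear_continuous_on[OF bounded_linear_of_real])
  obtain B where B: "B > 0" "\<And>v. v \<in> cball 0 r \<Longrightarrow> \<bar>k v\<bar> \<le> B"
    using compact_imp_bounded[OF compact_continuous_image[OF continuous_on_subset[OF ck r(2)] compact_cball]]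
    by (auto simp: bounded_pos)
  \<comment> \<open>Near the origin the squared gradient is below \<open>S0 / 2\<close>, so the
    density vanishes. Away from it a constant bound is also a linear one, which is the form required
    for integrability.\<close>
  have "open {v. (norm (nrm v))\<^sup>2 < S0 / 2}" by (intro open_Collect_less continuous_intros cn)
  moreover have "0 \<in> {v. (norm (nrm v))\<^sup>2 < S0 / 2}" using S0 nrm_0 by simp
  ultimately obtain e where e: "e > 0" "ball 0 e \<subseteq> {v. (norm (nrm v))\<^sup>2 < S0 / 2}"
    using open_contains_ball by blast
  have \<kappa>b: "cmod (\<kappa> v) \<le> B / e * norm v" for v
  proof (cases "v \<in> ball 0 r \<and> norm v \<ge> e")
    case True
    then have "cmod (\<kappa> v) \<le> B" using B(2)[of v] by (simp add: \<kappa>_def)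
    also have "\<dots> \<le> B * (norm v / e)" using mult_left_mono[of 1 "norm v / e" B] True B(1) e(1) by simp
    finally show ?thesis by simp
  next
    case False
    have "\<kappa> v = 0"
    proof (cases "v \<in> ball 0 r")
      case True
      then have "v \<in> ball 0 e" using False by simp
      then have "(norm (nrm v))\<^sup>2 < S0 / 2" using e(2) by blast
      then show ?thesis using \<theta>(3) by (simp add: \<kappa>_def k_def)
    qed (simp add: \<kappa>_def)
    then show ?thesis using B e by simp
  qed
  have \<kappa>i: "integrable lborel (\<lambda>z. mw z *\<^sub>R \<kappa> (pt s z))" if s: "s = 1 \<or> s = -1" for s
    by (rule integrable_linear_bound[OF \<kappa>m _ r(1) _ \<kappa>b]) (use s B e in \<open>auto simp: \<kappa>_def\<close>)
  define m where "m s z = indicator Dm z * (mw z * k (pt s z))" for s z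
  have m_eq: "complex_of_real (m s z) = indicator Dm z *\<^sub>R (mw z *\<^sub>R \<kappa> (pt s z))" if "s = 1 \<or> s = -1" for s z
    using sheet_props(1)[OF that, of z] by (cases "z \<in> Dm") (auto simp: m_def \<kappa>_def scaleR_conv_of_real)
  have mi': "integrable lborel (\<lambda>z. complex_of_real (m s z))" if s: "s = 1 \<or> s = -1" for s
    unfolding m_eq[OF s] by (rule integrable_mult_indicator[OF _ \<kappa>i[OF s]]) (use open_Dm in auto)
  have mi: "integrable lborel (m s)" if s: "s = 1 \<or> s = -1" for s
    using mi'[OF s] by (simp add: complex_of_real_integrable_eq)
  have m0: "m s z \<ge> 0" if "s = 1 \<or> s = -1" for s z
    using k_nonneg[OF that, of z] mw_nonneg[of z] by (cases "z \<in> Dm") (auto simp: m_def)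
  define w where "w s z = (-2) * complex_of_real (mw z * k (pt s z))" for s z
  have wm: "indicator Dm z *\<^sub>R w s z = (-2) * complex_of_real (m s z)" for s z
    by (simp add: w_def m_def scaleR_conv_of_real)
  have wI: "(LINT z:Dm|lborel. w s z) = (-2) * complex_of_real (\<integral>z. m s z \<partial>lborel)" for s
    unfolding set_lebesgue_integral_def wm integral_mult_right_zero integral_complex_of_real ..
  have "(LINT x:Reg - {0}|\<mu>. ?\<omega> x) = (LINT z:Dm|lborel. w 1 z) + (LINT z:Dm|lborel. w (-1) z)"
  proof (rule region_integral)
    define l where "l x a b e = of_real (smooth_step (x \<bullet> x / \<rho>\<^sup>2) * \<theta> (S x)) * A x e * W2 x a b" for x a b e
    have chart: "?\<omega> (p z) * of_real (volume_density p z) =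
      4 * (\<phi> (p z) [frechet_derivative p (at z) (axis 1 1)] * l (p z) (frechet_derivative p (at z) (axis 1 1)) (frechet_derivative p (at z) (axis 2 1)) (frechet_derivative p (at z) (axis 2 1))
         - \<phi> (p z) [frechet_derivative p (at z) (axis 2 1)] * l (p z) (frechet_derivative p (at z) (axis 1 1)) (frechet_derivative p (at z) (axis 2 1)) (frechet_derivative p (at z) (axis 1 1)))"
      if p: "holo_param X W p" "p ` W \<subseteq> Reg" "z \<in> W" for W p z
    proof (rule wedge_1_3_frame[OF p(1,3)])
      have xU: "p z \<in> U" using p(2,3) Reg_U by blast
      note * = \<phi>_conj_linear[OF xU] tst_chart[OF xU]
      let ?A = "frechet_derivative p (at z) (axis 1 1)" and ?B = "frechet_derivative p (at z) (axis 2 1)"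
      show "\<phi> (p z) [\<alpha> *s ?A + \<beta> *s ?B] = cnj \<alpha> * \<phi> (p z) [?A] + cnj \<beta> * \<phi> (p z) [?B]" for \<alpha> \<beta> by (rule *(1))
      show "?\<eta> (p z) [\<alpha> *s ?A + \<beta> *s ?B, \<gamma> *s ?A + \<delta> *s ?B, \<epsilon> *s ?A + \<zeta> *s ?B] =
        (cnj \<alpha> * l (p z) ?A ?B ?A + cnj \<beta> * l (p z) ?A ?B ?B) * (\<gamma> * \<zeta> - \<delta> * \<epsilon>)
        - (cnj \<gamma> * l (p z) ?A ?B ?A + cnj \<delta> * l (p z) ?A ?B ?B) * (\<alpha> * \<zeta> - \<beta> * \<epsilon>)
        + (cnj \<epsilon> * l (p z) ?A ?B ?A + cnj \<zeta> * l (p z) ?A ?B ?B) * (\<alpha> * \<delta> - \<beta> * \<gamma>)" for \<alpha> \<beta> \<gamma> \<delta> \<epsilon> \<zeta>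
        unfolding l_def by (rule *(2))
    qed
    show "\<exists>w. continuous_on W w \<and> (\<forall>z\<in>W. ?\<omega> (p z) * of_real (volume_density p z) = w z)"
      if p: "holo_param X W p" "p ` W \<subseteq> Reg" for W p
    proof (intro exI conjI ballI)
      note c = holo_param_deriv_continuous_on[OF p(1)] holo_paramD(5)[OF p(1)]
      have pU: "p ` W \<subseteq> U" using p(2) Reg_U by blast
      show "?\<omega> (p z) * of_real (volume_density p z) =
      4 * (\<phi> (p z) [frechet_derivative p (at z) (axis 1 1)] * l (p z) (frechet_derivative p (at z) (axis 1 1)) (frechet_derivative p (at z) (axis 2 1)) (frechet_derivative p (at z) (axis 2 1))
         - \<phi> (p z) [frechet_derivative p (at z) (axis 2 1)] * l (p z) (frechet_derivative p (at z) (axis 1 1)) (frechet_derivative p (at z) (axis 2 1)) (frechet_derivative p (at z) (axis 1 1)))"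
        if "z \<in> W" for z by (rule chart[OF p that])
      have cS: "continuous_on W (\<lambda>z. S (p z))"
        by (rule continuous_on_compose2[OF Ck_on_imp_continuous_on[OF Ck_on_S[of 0]] c(2) pU])
      show "continuous_on W (\<lambda>z. 4 * (\<phi> (p z) [frechet_derivative p (at z) (axis 1 1)] * l (p z) (frechet_derivative p (at z) (axis 1 1)) (frechet_derivative p (at z) (axis 2 1)) (frechet_derivative p (at z) (axis 2 1))
         - \<phi> (p z) [frechet_derivative p (at z) (axis 2 1)] * l (p z) (frechet_derivative p (at z) (axis 1 1)) (frechet_derivative p (at z) (axis 2 1)) (frechet_derivative p (at z) (axis 1 1))))"
        unfolding l_def divide_inverse
        by (intro continuous_intros \<phi>_chart_continuous_on[OF p] A_chart_continuous_on W2_chart_continuous_on c pU cS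
          continuous_on_compose2[OF Ck_on_imp_continuous_on[OF Ck_on_smooth_step[of 0]] _ subset_UNIV]
          continuous_on_compose2[OF Ck_on_imp_continuous_on[OF \<theta>C[of 0]] _ subset_UNIV])
    qed
    fix s :: complex assume s: "s = 1 \<or> s = -1"
    show "set_integrable lborel Dm (w s)"
      unfolding set_integrable_def wm by (rule integrable_mult_right[OF mi'[OF s]])
    fix z assume z: "z \<in> Dm"
    let ?A = "frechet_derivative (sheet s) (at z) (axis 1 1)" and ?B = "frechet_derivative (sheet s) (at z) (axis 2 1)"
    let ?v = "pt s z" and ?x = "sheet s z"
    have sR: "sheet s ` Dm \<subseteq> Reg" using sheet_props(5)[OF s] by blast
    have xU: "?x \<in> U" using sheet_props(5)[OF s z] Reg_U by blast
    have ll: "l ?x ?A ?B (c *s ?A + d *s ?B) = cnj c * l ?x ?A ?B ?A + cnj d * l ?x ?A ?B ?B" for c d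
      by (simp add: l_def A_linear[OF xU] algebra_simps)
    have "?\<omega> ?x * of_real (volume_density (sheet s) z) = 4 * (\<phi> ?x [?A] * l ?x ?A ?B ?B - \<phi> ?x [?B] * l ?x ?A ?B ?A)"
      by (rule chart[OF holo_param_sheet[OF s] sR z])
    also have "\<dots> = 4 * - (s * sqg z * of_real (mw z) * l ?x ?A ?B (frechet_derivative G (at ?v) (Rt ?v)))"
      by (subst \<phi>_wedge_sheet[OF s z ll]) simp
    also have "\<dots> = - 4 * of_real (mw z) * of_real (smooth_step (?x \<bullet> ?x / \<rho>\<^sup>2) * \<theta> (S ?x)) * of_real (E ?v) * (s * sqg z * W2 ?x ?A ?B)"
      unfolding l_def A_sheet[OF s z] by (simp add: algebra_simps)
    also have "\<dots> = w s z"
      unfolding W2_sheet[OF s z] w_def k_def by (simp add: S_def sheet_props(4)[OF s z]) (simp add: sheet_def)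
    finally show "?\<omega> ?x * of_real (volume_density (sheet s) z) = w s z" .
  qed
  also have "\<dots> = complex_of_real (-2 * ((\<integral>z. m 1 z \<partial>lborel) + (\<integral>z. m (-1) z \<partial>lborel)))"
    unfolding wI by simp
  finally have "complex_of_real (-2 * ((\<integral>z. m 1 z \<partial>lborel) + (\<integral>z. m (-1) z \<partial>lborel))) = 0"
    unfolding I0 by (rule sym)
  then have "(\<integral>z. m 1 z \<partial>lborel) + (\<integral>z. m (-1) z \<partial>lborel) = 0"
    by (simp only: of_real_eq_0_iff) simp
  moreover have "(\<integral>z. m 1 z \<partial>lborel) \<ge> 0" "(\<integral>z. m (-1) z \<partial>lborel) \<ge> 0"
    by (intro integral_nonneg_AE AE_I2 m0; simp)+
  ultimately have "(\<integral>z. m 1 z \<partial>lborel) = 0" by linarith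
  then have ae: "AE z in lborel. m 1 z = 0"
    using integral_nonneg_eq_0_iff_AE[OF mi] m0 by simp
  \<comment> \<open>The integrand is continuous and positive at \<open>w0\<close>, hence positive on
    a nonempty open set, which cannot be null.\<close>
  let ?P = "Dm \<inter> (\<lambda>z. mw z * k (pt 1 z)) -` {0<..}"
  have "Dm \<subseteq> - {0}"
  proof
    fix z assume "z \<in> Dm"
    then have "g (z$1) (z$2) \<noteq> 0" using g_0_iff_nonslit by (auto simp: Dm_def)
    then show "z \<in> - {0}" using euler[of 0 0] ha by auto
  qed
  moreover have "continuous_on Dm (pt 1)"
    by (rule continuous_on_subset[OF holomorphic_map_continuous_on[OF holomorphic_map_pt]]) (auto simp: Dm_def)
  ultimately have "continuous_on Dm (\<lambda>z. mw z * k (pt 1 z))"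
    by (intro continuous_intros continuous_on_subset[OF mw_continuous_on] continuous_on_compose2[OF ck])
       (use sheet_props(2) in auto)
  from continuous_open_preimage[OF this open_Dm open_greaterThan] have "open ?P" .
  moreover have "w0 \<in> ?P" using w0 k_pos by simp
  ultimately have "?P \<notin> null_sets lborel" using open_pos_measure by blast
  moreover have "?P \<in> null_sets lborel"
  proof (rule AE_iff_null_sets[THEN iffD2])
    show "?P \<in> sets lborel" using \<open>open ?P\<close> by simp
    show "AE z in lborel. z \<notin> ?P" using ae by eventually_elim (auto simp: m_def)
  qed
  ultimately show False by blast
qed

end

section \<open>The types D and E\<close>

lemma weighted_poly_pair:
  assumes "(i, j) \<noteq> (k, l)" "a * i + b * j = h" "a * k + b * l = h" "a > 0" "b > 0" "2 * a < h" "2 * b < h"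
    and "\<And>y z. of_nat i * y ^ (i - 1) * z ^ j + of_nat k * y ^ (k - 1) * z ^ l = (0::complex) \<Longrightarrow>
      of_nat j * y ^ i * z ^ (j - 1) + of_nat l * y ^ k * z ^ (l - 1) = 0 \<Longrightarrow> y = 0 \<and> z = 0"
  shows "weighted_poly {(i, j), (k, l)} a b h"
proof
  show "a * i' + b * j' = h" if "(i', j') \<in> {(i, j), (k, l)}" for i' j'
    using that assms(2,3) by auto
  fix y z :: complex
  assume 1: "wpoly {(i, j), (k, l)} (\<lambda>k. of_nat (fst k)) (\<lambda>k. fst k - 1) snd y z = 0"
    and 2: "wpoly {(i, j), (k, l)} (\<lambda>k. of_nat (snd k)) fst (\<lambda>k. snd k - 1) y z = 0"
  have e: "wpoly {(i, j), (k, l)} c d m y z = c (i, j) * y ^ d (i, j) * z ^ m (i, j) + c (k, l) * y ^ d (k, l) * z ^ m (k, l)" for c d m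
    unfolding wpoly_def by (subst sum.insert) (use assms(1) in auto)
  show "y = 0 \<and> z = 0" using assms(8) 1 2 unfolding e fst_conv snd_conv .
qed (simp_all add: assms(4-7))

lemma du_val_weighted:
  assumes "admissible_type T"
  obtains M a b h where "weighted_poly M a b h"
    "\<And>v. du_val_poly T v = (v$1)\<^sup>2 + wpoly M (\<lambda>_. 1) fst snd (v$2) (v$3)"
proof (cases T)
  case (D_type n)
  then have n: "n \<ge> 4" using assms by simp
  \<comment> \<open>Both monomials have degree 2 (n - 1) for these weights. The condition on twice
    the second weight, 4 < 2 (n - 1), is n >= 4.\<close>
  have "weighted_poly {(2, 1), (0, n - 1)} (n - 2) 2 (2 * (n - 1))"
  proof (rule weighted_poly_pair)
    fix y z :: complex
    assume "of_nat 2 * y ^ (2 - 1) * z ^ 1 + of_nat 0 * y ^ (0 - 1) * z ^ (n - 1) = 0"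
      "of_nat 1 * y ^ 2 * z ^ (1 - 1) + of_nat (n - 1) * y ^ 0 * z ^ (n - 1 - 1) = 0"
    then have yz: "y = 0 \<or> z = 0" "y\<^sup>2 + of_nat (n - 1) * z ^ (n - 2) = 0" by (simp_all add: numeral_2_eq_2)
    have "n - 2 > 0" "n - 1 > 0" using n by auto
    then have nz: "(of_nat (n - 1) :: complex) \<noteq> 0" "n - 2 > 0" using of_nat_0_neq by auto
    show "y = 0 \<and> z = 0" using yz nz by (auto simp: zero_power)
  qed (use n in \<open>auto simp: algebra_simps\<close>)
  moreover have "du_val_poly T v = (v$1)\<^sup>2 + wpoly {(2, 1), (0, n - 1)} (\<lambda>_. 1) fst snd (v$2) (v$3)" for v
    by (simp add: D_type wpoly_def)
  ultimately show ?thesis by (rule that)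
next
  case E6_type
  have "weighted_poly {(3, 0), (0, 4)} 4 3 12" by (rule weighted_poly_pair) auto
  moreover have "du_val_poly T v = (v$1)\<^sup>2 + wpoly {(3, 0), (0, 4)} (\<lambda>_. 1) fst snd (v$2) (v$3)" for v
    by (simp add: E6_type wpoly_def)
  ultimately show ?thesis by (rule that)
next
  case E7_type
  \<comment> \<open>The weights solve 3 a = a + 3 b = 9. The degree is odd here, so x has the
    half-integral weight 9/2.\<close>
  have "weighted_poly {(3, 0), (1, 3)} 3 2 9" by (rule weighted_poly_pair) auto
  moreover have "du_val_poly T v = (v$1)\<^sup>2 + wpoly {(3, 0), (1, 3)} (\<lambda>_. 1) fst snd (v$2) (v$3)" for v
    by (simp add: E7_type wpoly_def)
  ultimately show ?thesis by (rule that)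
next
  case E8_type
  have "weighted_poly {(3, 0), (0, 5)} 5 3 15" by (rule weighted_poly_pair) auto
  moreover have "du_val_poly T v = (v$1)\<^sup>2 + wpoly {(3, 0), (0, 5)} (\<lambda>_. 1) fst snd (v$2) (v$3)" for v
    by (simp add: E8_type wpoly_def)
  ultimately show ?thesis by (rule that)
qed

theorem theorem5p6:
  fixes X :: "(complex^3) set" and T :: du_val
  assumes "admissible_type T"
    and "has_singularity_of_type X T"
  shows "\<exists>U \<phi>. openin (top_of_set X) U \<and> 0 \<in> U \<and> dbar_w X U 1 \<phi> (\<lambda>x vs. 0) \<and>
           \<not> (\<exists>V u. openin (top_of_set X) V \<and> 0 \<in> V \<and> V \<subseteq> U \<and> dbar_w X V 0 u \<phi>)"
proof -
  obtain M a b h where M: "weighted_poly M a b h"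
    "\<And>v. du_val_poly T v = (v$1)\<^sup>2 + wpoly M (\<lambda>_. 1) fst snd (v$2) (v$3)"
    using du_val_weighted[OF assms(1)] by blast
  interpret weighted_poly M a b h by (rule M)
  have f: "{v. du_val_poly T v = 0} = {v. f v = 0}" by (simp add: M(2) f_def g_def)
  obtain U V F G where FG: "open U" "0 \<in> U" "open V" "0 \<in> V" "holomorphic_map F U" "holomorphic_map G V" "F 0 = 0" "G 0 = 0"
    "F ` (X \<inter> U) = {v. f v = 0} \<inter> V" "G ` ({v. f v = 0} \<inter> V) = X \<inter> U"
    "\<forall>x\<in>X \<inter> U. G (F x) = x" "\<forall>y\<in>{v. f v = 0} \<inter> V. F (G y) = y"
    using assms(2) unfolding has_singularity_of_type_def germ_biholomorphic_def f
    by (elim exE conjE) (rule that, assumption+)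
  obtain r where r: "r > 0" "cball 0 r \<subseteq> V" using FG(3,4) open_contains_cball by blast
  interpret germ M a b h X U V F G r
    by unfold_locales (use assms(2) FG r in \<open>auto simp: has_singularity_of_type_def\<close>)
  show ?thesis
  proof (intro exI conjI notI)
    \<comment> \<open>One neighbourhood serves for all attempts at a solution: smaller
      neighbourhoods only shrink the support of the test form.\<close>
    show "openin (top_of_set X) Reg" "0 \<in> Reg" by (rule Reg_openin)+
    show "dbar_w X Reg 1 \<phi> (\<lambda>x vs. 0)" by (rule \<phi>_dbar_w)
    assume "\<exists>V u. openin (top_of_set X) V \<and> 0 \<in> V \<and> V \<subseteq> Reg \<and> dbar_w X V 0 u \<phi>"
    then show False using \<phi>_not_solvable by blast
  qed
qed

end
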